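(* Assume $\ln n\ll d\ll n$ as $n\to\infty$. Then $$ F_{[-1,1]}=\big[(4\pi+o(1))\ln(n/d)\big]^{\frac{d-1}{2}}. $$
   Context: Asymptotic setting: $\mathbb{N}\ni n\to\infty$ and $d=d(n)\in\{2,\ldots,n-1\}$ is a function of $n$ which is either constant or tends to infinity. The notation $f\ll g$ means $f(n)/g(n)\to0$, and $o(1)$ is a sequence tending to $0$ as $n\to\infty$. Let $X_1,\ldots,X_n$ be i.i.d. random vectors uniformly distributed on the unit sphere $\mathbb{S}^{d-1}\subset\mathbb{R}^d$, and let $P_{n,d}=[X_1,\ldots,X_n]$ be their convex hull. $F_{[-1,1]}$ denotes the expected number of facets ($(d-1)$-dimensional faces) of $P_{n,d}$. *)

theory Defs
  imports "HOL-Probability.Probability" "HOL-Library.Function_Algebras"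
begin

text \<open>
  The dimension \<open>d\<close> varies with \<open>n\<close>, so it cannot be a type. The space \<open>\<real>\<^sup>d\<close> is realised as the
  subspace of those \<open>x :: nat \<Rightarrow> real\<close> that vanish outside \<open>{..<d}\<close>. With the pointwise
  vector space structure, \<^const>\<open>convex\<close>, \<^const>\<open>hull\<close>, \<^const>\<open>affine_dependent\<close> and
  \<^const>\<open>face_of\<close> apply to this type as they stand; none of them depends on the ambient space.
  The Borel sets of \<open>nat \<Rightarrow> real\<close> are those of the product topology, which induces the
  Euclidean topology on each of these subspaces.
\<close>

instantiation "fun" :: (type, real_vector) real_vector
begin

definition scaleR_fun :: "real \<Rightarrow> ('a \<Rightarrow> 'b) \<Rightarrow> 'a \<Rightarrow> 'b"
  where "scaleR_fun c f = (\<lambda>x. c *\<^sub>R f x)"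

instance
  by standard (simp_all add: scaleR_fun_def plus_fun_def scaleR_add_right scaleR_add_left)

end

definition lborel_dim :: "nat \<Rightarrow> (nat \<Rightarrow> real) measure"
  where "lborel_dim d = distr (\<Pi>\<^sub>M i\<in>{..<d}. lborel) borel (\<lambda>x i. if i < d then x i else 0)"

definition unit_ball_dim :: "nat \<Rightarrow> (nat \<Rightarrow> real) set"
  where "unit_ball_dim d = {x. (\<forall>i\<ge>d. x i = 0) \<and> L2_set x {..<d} \<le> 1}"

definition unit_sphere_dim :: "nat \<Rightarrow> (nat \<Rightarrow> real) set"
  where "unit_sphere_dim d = {x. (\<forall>i\<ge>d. x i = 0) \<and> L2_set x {..<d} = 1}"

text \<open>
  The normalised surface measure on the unit sphere, via polar coordinates: the mass of a set \<open>A\<close>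
  of directions is the proportion of the volume of the unit ball taken up by the cone
  \<open>{r *\<^sub>R u | r u. 0 < r \<and> r \<le> 1 \<and> u \<in> A}\<close>. The centre of the ball, where the radial
  projection is not meaningful, is a null set if \<open>d \<ge> 1\<close>.
\<close>

definition uniform_sphere :: "nat \<Rightarrow> (nat \<Rightarrow> real) measure"
  where "uniform_sphere d =
    distr (uniform_measure (lborel_dim d) (unit_ball_dim d)) borel (\<lambda>x. x /\<^sub>R L2_set x {..<d})"

text \<open>
  The affine dimension \<^const>\<open>aff_dim\<close> is only available in type class
  \<^class>\<open>euclidean_space\<close>; the following is its definition for dimension \<open>k\<close>. For \<open>k \<ge> 0\<close>
  the set \<open>B\<close> is finite, since its cardinality is positive.
\<close>

definition has_aff_dim :: "'a::real_vector set \<Rightarrow> int \<Rightarrow> bool"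
  where "has_aff_dim V k \<longleftrightarrow>
    (\<exists>B. affine hull B = affine hull V \<and> \<not> affine_dependent B \<and> of_nat (card B) = k + 1)"

definition facets :: "nat \<Rightarrow> (nat \<Rightarrow> real) set \<Rightarrow> (nat \<Rightarrow> real) set set"
  where "facets d P = {F. F face_of P \<and> has_aff_dim F (int d - 1)}"

definition expected_facets ::
    "nat \<Rightarrow> nat \<Rightarrow> 'w measure \<Rightarrow> (nat \<Rightarrow> 'w \<Rightarrow> (nat \<Rightarrow> real)) \<Rightarrow> real"
  where "expected_facets n d M X =
    (\<integral>\<omega>. real (card (facets d (convex hull ((\<lambda>i. X i \<omega>) ` {1..n})))) \<partial>M)"

lemma measurable_fun_borel:
  fixes f :: "'a \<Rightarrow> nat \<Rightarrow> real"
  assumes "\<And>i. (\<lambda>x. f x i) \<in> borel_measurable M"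
  shows "f \<in> borel_measurable M"
  using assms by (rule measurable_coordinatewise_then_product)

lemma measurable_coord [measurable]: "(\<lambda>x :: nat \<Rightarrow> real. x i) \<in> borel_measurable borel"
  by (rule measurable_product_coordinates)

lemma measurable_L2_set [measurable]:
  "(\<lambda>x :: nat \<Rightarrow> real. L2_set x {..<d}) \<in> borel_measurable borel"
  unfolding L2_set_def by measurable

lemma measurable_embed:
  fixes d :: nat
  shows "(\<lambda>x i. if i < d then x i else 0) \<in> borel_measurable (\<Pi>\<^sub>M i\<in>{..<d}. (lborel :: real measure))"
proof (rule measurable_fun_borel)
  fix i
  show "(\<lambda>x. if i < d then x i else 0) \<in> borel_measurable (\<Pi>\<^sub>M i\<in>{..<d}. (lborel :: real measure))"
  proof (cases "i < d")
    case True
    then have "(\<lambda>x. x i) \<in> measurable (\<Pi>\<^sub>M i\<in>{..<d}. (lborel :: real measure)) lborel"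
      by (intro measurable_component_singleton) auto
    then show ?thesis using True by simp
  qed simp
qed

lemma measurable_normalise:
  "(\<lambda>x :: nat \<Rightarrow> real. x /\<^sub>R L2_set x {..<d}) \<in> borel_measurable borel"
  by (rule measurable_fun_borel) (simp add: scaleR_fun_def)

lemma sets_unit_ball_dim [measurable]: "unit_ball_dim d \<in> sets borel"
proof -
  have "{x \<in> space borel. (\<forall>i. d \<le> i \<longrightarrow> x i = 0) \<and> L2_set x {..<d} \<le> 1} \<in> sets borel"
    by measurable
  then show ?thesis by (simp add: unit_ball_dim_def)
qed

lemma emeasure_lborel_dim:
  assumes "A \<in> sets borel"
  shows "emeasure (lborel_dim d) A =
    emeasure (\<Pi>\<^sub>M i\<in>{..<d}. lborel)
      {x \<in> extensional {..<d}. (\<lambda>i. if i < d then x i else 0) \<in> A}"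
  unfolding lborel_dim_def using assms measurable_embed
  by (subst emeasure_distr) (auto intro!: arg_cong2[where f = emeasure] simp: space_PiM PiE_def)

interpretation lborel_product: product_sigma_finite "\<lambda>i :: nat. lborel :: real measure"
  by standard

lemma emeasure_unit_ball_dim:
  "emeasure (lborel_dim d) (unit_ball_dim d) \<noteq> 0"
  "emeasure (lborel_dim d) (unit_ball_dim d) \<noteq> \<infinity>"
proof -
  let ?P = "\<Pi>\<^sub>M i\<in>{..<d}. (lborel :: real measure)"
  let ?B = "{x \<in> extensional {..<d}. (\<lambda>i. if i < d then x i else 0) \<in> unit_ball_dim d}"
  let ?e = "1 / real (Suc d)"
  let ?I = "\<lambda>e. \<Pi>\<^sub>E i\<in>{..<d}. {- e..e :: real}"
  have I: "emeasure ?P (?I e) = ennreal ((2 * e) ^ d)" if "e \<ge> 0" for e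
    using that by (simp add: lborel_product.emeasure_PiM ennreal_power)
  have L2: "L2_set (\<lambda>i. if i < d then x i else 0) {..<d} = L2_set x {..<d}" for x :: "nat \<Rightarrow> real"
    by (rule L2_set_cong) auto
  have B: "?B = {x \<in> extensional {..<d}. L2_set x {..<d} \<le> 1}"
    by (auto simp: unit_ball_dim_def L2)
  have meas: "?B \<in> sets ?P"
  proof -
    have "?B = (\<lambda>x i. if i < d then x i else 0) -` unit_ball_dim d \<inter> space ?P"
      by (auto simp: space_PiM PiE_def)
    then show ?thesis using measurable_sets[OF measurable_embed sets_unit_ball_dim] by simp
  qed
  have "?B \<subseteq> ?I 1"
  proof
    fix x assume x: "x \<in> ?B"
    then have L: "L2_set x {..<d} \<le> 1" unfolding B by simp
    have "\<bar>x i\<bar> \<le> 1" if "i < d" for i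
    proof -
      have "\<bar>x i\<bar> \<le> L2_set (\<lambda>i. \<bar>x i\<bar>) {..<d}"
        using that by (intro member_le_L2_set) auto
      also have "\<dots> = L2_set x {..<d}" by (simp add: L2_set_def)
      finally show ?thesis using L by linarith
    qed
    then show "x \<in> ?I 1" using x by (auto simp: PiE_def abs_le_iff minus_le_iff)
  qed
  then have "emeasure ?P ?B \<le> emeasure ?P (?I 1)"
    by (rule emeasure_mono) (auto intro!: sets_PiM_I_finite)
  also have "\<dots> < \<infinity>" by (simp add: I)
  finally show "emeasure (lborel_dim d) (unit_ball_dim d) \<noteq> \<infinity>"
    by (simp add: emeasure_lborel_dim)
  have "?I ?e \<subseteq> ?B"
  proof
    fix x assume x: "x \<in> ?I ?e"
    have "L2_set x {..<d} \<le> (\<Sum>i<d. \<bar>x i\<bar>)" by (rule L2_set_le_sum_abs)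
    also have "\<dots> \<le> (\<Sum>i<d. ?e)"
      using x by (intro sum_mono) (force simp: PiE_def Pi_def abs_le_iff)
    also have "\<dots> \<le> 1" by (simp add: field_simps)
    finally show "x \<in> ?B" unfolding B using x by (auto simp: PiE_def)
  qed
  then have "emeasure ?P (?I ?e) \<le> emeasure ?P ?B"
    using meas by (rule emeasure_mono)
  moreover have "emeasure ?P (?I ?e) > 0" by (subst I) simp_all
  ultimately show "emeasure (lborel_dim d) (unit_ball_dim d) \<noteq> 0"
    by (simp add: emeasure_lborel_dim)
qed

lemma prob_space_uniform_sphere: "prob_space (uniform_sphere d)"
proof -
  interpret prob_space "uniform_measure (lborel_dim d) (unit_ball_dim d)"
    using emeasure_unit_ball_dim by (rule prob_space_uniform_measure)
  show ?thesis unfolding uniform_sphere_def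
    by (rule prob_space_distr) (use measurable_normalise in \<open>simp add: lborel_dim_def\<close>)
qed

lemma AE_uniform_sphere:
  assumes "d \<ge> 1"
  shows "AE x in uniform_sphere d. x \<in> unit_sphere_dim d"
proof -
  let ?P = "\<Pi>\<^sub>M i\<in>{..<d}. (lborel :: real measure)"
  have [measurable]: "{x. L2_set x {..<d} = 0} \<in> sets (borel :: (nat \<Rightarrow> real) measure)"
    using measurable_sets[OF measurable_L2_set, of "{0}" d] by (simp add: vimage_def)
  have "{x \<in> extensional {..<d}. L2_set (\<lambda>i. if i < d then x i else 0) {..<d} = (0::real)}
      = (\<Pi>\<^sub>E i\<in>{..<d}. {0})"
    by (auto simp: L2_set_eq_0_iff PiE_iff extensional_def fun_eq_iff)
  moreover have "emeasure ?P (\<Pi>\<^sub>E i\<in>{..<d}. {0}) = 0"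
    using assms by (subst lborel_product.emeasure_PiM) auto
  ultimately have "emeasure (lborel_dim d) {x. L2_set x {..<d} = 0} = 0"
    by (simp add: emeasure_lborel_dim)
  then have nz: "AE x in lborel_dim d. L2_set x {..<d} \<noteq> 0"
    by (intro AE_I[where N = "{x. L2_set x {..<d} = 0}"]) (auto simp: lborel_dim_def)
  have "AE x in uniform_measure (lborel_dim d) (unit_ball_dim d).
      x /\<^sub>R L2_set x {..<d} \<in> unit_sphere_dim d"
  proof (rule AE_uniform_measureI)
    show "unit_ball_dim d \<in> sets (lborel_dim d)" by (simp add: lborel_dim_def)
    show "AE x in lborel_dim d. x \<in> unit_ball_dim d \<longrightarrow>
        x /\<^sub>R L2_set x {..<d} \<in> unit_sphere_dim d"
      using nz
    proof eventually_elim
      case (elim x)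
      have "L2_set (x /\<^sub>R L2_set x {..<d}) {..<d} = inverse (L2_set x {..<d}) * L2_set x {..<d}"
        unfolding scaleR_fun_def by (simp add: L2_set_right_distrib)
      then show ?case using elim
        by (auto simp: unit_ball_dim_def unit_sphere_dim_def scaleR_fun_def)
    qed
  qed
  moreover have "{x \<in> space borel. x \<in> unit_sphere_dim d} \<in> sets borel"
  proof -
    have "{x \<in> space borel. (\<forall>i. d \<le> i \<longrightarrow> x i = 0) \<and> L2_set x {..<d} = 1} \<in> sets borel"
      by measurable
    then show ?thesis by (simp add: unit_sphere_dim_def)
  qed
  ultimately show ?thesis
    unfolding uniform_sphere_def using measurable_normalise
    by (subst AE_distr_iff) (auto simp: lborel_dim_def)
qed

end

theory Submission
  imports Defs "HOL-Real_Asymp.Real_Asymp"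
begin

text \<open>
  The expected number of facets is, up to a factor two, \<open>n choose d\<close> times the probability that the
  first \<open>d\<close> points span a facet. The event is invariant under reflections, so two of the \<open>d\<close> points may
  be assumed to differ only in the last coordinate. Projecting along that coordinate removes one of
  these points and one dimension, and turns the distribution of the others into one with density
  proportional to \<open>(1 - \<bar>x\<bar>\<^sup>2) powr a\<close> on the unit ball; such densities are preserved by further steps.
  After \<open>d - 1\<close> steps the probability has become the mean of \<open>(1 - c t) ^ (n - d)\<close> with respect to the
  weight \<open>(1 - t\<^sup>2) powr ((d - 1)\<^sup>2 / 2 - 1)\<close>, where \<open>c t\<close> is the proportion of the sphere in the cap at
  distance \<open>t\<close> from the centre.

  In terms of \<open>q = (1 - t\<^sup>2) powr ((d - 1) / 2)\<close> the integrand is about \<open>q ^ (d - 1) * exp (- n * A * q)\<close>,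
  and \<open>A\<close> is close to \<open>1 / sqrt (4 * pi * ln (n / d))\<close> near the maximum, where \<open>t\<^sup>2\<close> is about
  \<open>2 * ln (n / d) / d\<close>. The maximal value \<open>(d / (e * n * A)) ^ (d - 1)\<close> multiplied by
  \<open>n choose d\<close>, which is about \<open>(e * n / d) ^ d\<close>, leaves \<open>A powr (1 - d)\<close> and factors polynomial in \<open>n\<close>.
  These are absorbed by the error term because \<open>ln n\<close> is small compared with \<open>d\<close>.
\<close>

subsection \<open>Finite powers of a measure on an infinite product\<close>

text \<open>The normalising constants of the single elimination steps are never computed. Each step
  produces a factor that depends on the measures but not on the integrand, so the product of all
  factors is read off at the end from the integrand 1, whose mean is 1. General position is replaced
  by an enclosure: the number of facets lies between the counts of two events, one with weak
  inequalities, one with strict inequalities and affine independence. Both lead to the same integral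
  in dimension one up to a factor two. Orthogonal invariance enters through reflections alone,
  because two vectors of equal norm are exchanged by the reflection along their difference.
  Measurability is the remaining obstacle, as the events are existential statements about normals
  and coefficients. Once these parameters are confined to a compact cube, the events are projections
  of closed sets along a compact factor, or countable unions and Boolean combinations of such
  sets.\<close>

definition power_measure :: "nat set \<Rightarrow> 'a :: {second_countable_topology, zero} measure \<Rightarrow> (nat \<Rightarrow> 'a) measure"
  where "power_measure I N = distr (\<Pi>\<^sub>M i\<in>I. N) borel (\<lambda>x i. if i \<in> I then x i else 0)"

lemma measurable_coords:
  fixes f :: "'a \<Rightarrow> nat \<Rightarrow> 'b :: second_countable_topology"
  assumes "\<And>i. (\<lambda>x. f x i) \<in> borel_measurable M"
  shows "f \<in> borel_measurable M"
  using assms by (rule measurable_coordinatewise_then_product)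

lemma measurable_app:
  "(\<lambda>x :: nat \<Rightarrow> 'b :: second_countable_topology. x i) \<in> borel_measurable borel"
  by (rule measurable_product_coordinates)

lemma measurable_app2:
  fixes f :: "'a \<Rightarrow> nat \<Rightarrow> 'b :: second_countable_topology"
  assumes "f \<in> borel_measurable M"
  shows "(\<lambda>x. f x i) \<in> borel_measurable M"
  using measurable_compose[OF assms measurable_app] .

lemma measurable_upd:
  fixes f :: "'a \<Rightarrow> nat \<Rightarrow> 'b :: second_countable_topology"
  assumes "f \<in> borel_measurable M" "g \<in> borel_measurable M"
  shows "(\<lambda>x. (f x)(i := g x)) \<in> borel_measurable M"
proof (rule measurable_coords)
  fix j show "(\<lambda>x. ((f x)(i := g x)) j) \<in> borel_measurable M"
    by (cases "j = i") (simp_all only: fun_upd_same fun_upd_other assms(2) measurable_app2[OF assms(1)]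
      not_False_eq_True)
qed

lemma measurable_zext:
  fixes N :: "'b :: {second_countable_topology, zero} measure" and I :: "nat set"
  assumes "sets N = sets borel"
  shows "(\<lambda>x i. if i \<in> I then x i else 0) \<in> borel_measurable (\<Pi>\<^sub>M i\<in>I. N)"
proof (rule measurable_coords)
  fix i
  show "(\<lambda>x. if i \<in> I then x i else 0) \<in> borel_measurable (\<Pi>\<^sub>M i\<in>I. N)"
  proof (cases "i \<in> I")
    case True
    then have "(\<lambda>x. x i) \<in> measurable (\<Pi>\<^sub>M i\<in>I. N) N"
      by (intro measurable_component_singleton) auto
    then show ?thesis using True measurable_cong_sets[OF refl assms] by fastforce
  qed simp
qed

lemma sets_pm [simp, measurable_cong]: "sets (power_measure I N) = sets borel"
  by (simp add: power_measure_def)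

lemma space_pm [simp]: "space (power_measure I N) = UNIV"
  by (simp add: power_measure_def)

text \<open>One construction serves on two levels: with \<open>N = lborel\<close> it gives Lebesgue
  measure on vectors, with \<open>N\<close> a law of vectors it gives the law of a configuration of
  points. Padding by 0 keeps the index set out of the type, so that all configurations share one
  Borel space.\<close>

lemma lborel_dim_pm: "lborel_dim D = power_measure {..<D} lborel"
  by (simp add: lborel_dim_def power_measure_def)

lemma nn_integral_pm:
  assumes "sets N = sets borel" "f \<in> borel_measurable borel"
  shows "(\<integral>\<^sup>+x. f x \<partial>power_measure I N) = (\<integral>\<^sup>+x. f (\<lambda>i. if i \<in> I then x i else 0) \<partial>(\<Pi>\<^sub>M i\<in>I. N))"
  unfolding power_measure_def by (rule nn_integral_distr[OF measurable_zext[OF assms(1)]]) (simp add: assms(2))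

lemma sigma_finite_pm:
  assumes "sigma_finite_measure N" "sets N = sets borel" "finite I"
  shows "sigma_finite_measure (power_measure I N)"
proof -
  interpret sigma_finite_measure N by fact
  interpret P: product_sigma_finite "\<lambda>_ :: nat. N" by standard
  obtain A :: "nat \<Rightarrow> 'a set" where A: "range A \<subseteq> sets N" "(\<Union>i. A i) = space N"
    "\<And>i. emeasure N (A i) \<noteq> \<infinity>" "incseq A"
    using sigma_finite_incseq by metis
  have spN: "space N = UNIV" using sets_eq_imp_space_eq[OF assms(2)] by simp
  have [measurable]: "A k \<in> sets borel" for k using A(1) assms(2) by auto
  let ?B = "\<lambda>k. {x :: nat \<Rightarrow> 'a. \<forall>i\<in>I. x i \<in> A k}"
  have B[measurable]: "?B k \<in> sets borel" for k
  proof -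
    have "{x \<in> space borel. \<forall>i\<in>I. x i \<in> A k} \<in> sets (borel :: (nat \<Rightarrow> 'a) measure)"
      using assms(3) by measurable
    then show ?thesis by simp
  qed
  show ?thesis
  proof
    show "\<exists>A. countable A \<and> A \<subseteq> sets (power_measure I N) \<and> \<Union> A = space (power_measure I N) \<and>
        (\<forall>a\<in>A. emeasure (power_measure I N) a \<noteq> \<infinity>)"
    proof (intro exI conjI ballI)
      show "countable (range ?B)" by simp
      show "range ?B \<subseteq> sets (power_measure I N)" by auto
      have "x \<in> (\<Union>k. ?B k)" for x :: "nat \<Rightarrow> 'a"
      proof -
        have "\<forall>i. \<exists>k. x i \<in> A k" using A(2) spN by blast
        then obtain k where k: "\<And>i. x i \<in> A (k i)" by metis
        \<comment> \<open>Since \<open>A\<close> increases, the largest of the finitely many indices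
          works for all coordinates at once.\<close>
        have "x i \<in> A (Max (k ` I))" if "i \<in> I" for i
          using incseqD[OF A(4), of "k i" "Max (k ` I)"] k[of i] that assms(3) by auto
        then show ?thesis by auto
      qed
      then show "\<Union> (range ?B) = space (power_measure I N)" by auto
      fix a assume "a \<in> range ?B"
      then obtain k where a: "a = ?B k" by auto
      have "emeasure (power_measure I N) a = emeasure (\<Pi>\<^sub>M i\<in>I. N)
          ((\<lambda>x i. if i \<in> I then x i else 0) -` ?B k \<inter> space (\<Pi>\<^sub>M i\<in>I. N))"
        unfolding a power_measure_def by (rule emeasure_distr[OF measurable_zext[OF assms(2)] B])
      also have "(\<lambda>x i. if i \<in> I then x i else 0) -` ?B k \<inter> space (\<Pi>\<^sub>M i\<in>I. N) = (\<Pi>\<^sub>E i\<in>I. A k)"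
        by (auto simp: space_PiM spN PiE_def Pi_def)
      also have "emeasure (\<Pi>\<^sub>M i\<in>I. N) (\<Pi>\<^sub>E i\<in>I. A k) = emeasure N (A k) ^ card I"
        using A(1) assms(3) by (subst P.emeasure_PiM) auto
      also have "\<dots> \<noteq> \<infinity>" using A(3)[of k] by (simp add: power_eq_top_ennreal)
      finally show "emeasure (power_measure I N) a \<noteq> \<infinity>" .
    qed
  qed
qed

lemma nn_integral_pm_insert:
  assumes "sigma_finite_measure N" "sets N = sets borel" "finite I" "i \<notin> I"
    and f: "f \<in> borel_measurable borel"
  shows "(\<integral>\<^sup>+x. f x \<partial>power_measure (insert i I) N) = (\<integral>\<^sup>+x. \<integral>\<^sup>+y. f (x(i := y)) \<partial>N \<partial>power_measure I N)"
proof -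
  interpret sigma_finite_measure N by fact
  interpret P: product_sigma_finite "\<lambda>_ :: nat. N" by standard
  have [measurable]: "f \<in> borel_measurable borel" by fact
  have [measurable_cong]: "sets N = sets borel" by fact
  have m: "(\<lambda>(x, y). f (x(i := y))) \<in> borel_measurable (borel \<Otimes>\<^sub>M N)"
    unfolding split_beta
    by (rule measurable_compose[OF _ f], rule measurable_upd) measurable
  have m2: "(\<lambda>x. f (\<lambda>j. if j \<in> insert i I then x j else 0)) \<in> borel_measurable (\<Pi>\<^sub>M i\<in>insert i I. N)"
    by (rule measurable_compose[OF _ f], rule measurable_zext) fact
  have "(\<integral>\<^sup>+x. f x \<partial>power_measure (insert i I) N) =
    (\<integral>\<^sup>+x. \<integral>\<^sup>+y. f (\<lambda>j. if j \<in> insert i I then (x(i := y)) j else 0) \<partial>N \<partial>(\<Pi>\<^sub>M i\<in>I. N))"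
    by (subst nn_integral_pm[OF assms(2) f], rule P.product_nn_integral_insert[OF assms(3,4) m2])
  also have "\<dots> = (\<integral>\<^sup>+x. \<integral>\<^sup>+y. f ((\<lambda>j. if j \<in> I then x j else 0)(i := y)) \<partial>N \<partial>(\<Pi>\<^sub>M i\<in>I. N))"
    using assms(4) by (intro nn_integral_cong arg_cong[of _ _ f]) (auto simp: fun_eq_iff)
  also have "(\<integral>\<^sup>+x. \<integral>\<^sup>+y. f ((\<lambda>j. if j \<in> I then x j else 0)(i := y)) \<partial>N \<partial>(\<Pi>\<^sub>M i\<in>I. N)) =
    (\<integral>\<^sup>+x. \<integral>\<^sup>+y. f (x(i := y)) \<partial>N \<partial>power_measure I N)"
    by (rule nn_integral_pm[OF assms(2), symmetric]) (rule borel_measurable_nn_integral[OF m])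
  finally show ?thesis .
qed

lemma pm_empty: "f \<in> borel_measurable borel \<Longrightarrow> sets N = sets borel \<Longrightarrow> (\<integral>\<^sup>+x. f x \<partial>power_measure {} N) = f 0"
  by (subst nn_integral_pm) (auto simp: PiM_empty nn_integral_count_space_finite zero_fun_def)

lemma AE_pm_zero:
  assumes "sets N = sets borel"
  shows "AE x in power_measure I (N :: 'a :: {second_countable_topology, t1_space, zero} measure). \<forall>i. i \<notin> I \<longrightarrow> x i = 0"
proof -
  have "{x \<in> space borel. \<forall>i. i \<notin> I \<longrightarrow> x i = 0} \<in> sets (borel :: (nat \<Rightarrow> 'a) measure)"
    by measurable
  then show ?thesis unfolding power_measure_def
    by (subst AE_distr_iff[OF measurable_zext[OF assms]]) simp_all
qed

text \<open>Peeling off the last coordinate as the innermost integral is the induction step behind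
  translation and scaling in every dimension.\<close>

lemma lborel_dim_Suc:
  assumes "f \<in> borel_measurable borel"
  shows "(\<integral>\<^sup>+x. f x \<partial>lborel_dim (Suc D)) = (\<integral>\<^sup>+x. \<integral>\<^sup>+s. f (x(D := s)) \<partial>lborel \<partial>lborel_dim D)"
  unfolding lborel_dim_pm lessThan_Suc using assms
  by (intro nn_integral_pm_insert) (auto intro: lborel.sigma_finite_measure_axioms)

lemma lborel_dim_0: "f \<in> borel_measurable borel \<Longrightarrow> (\<integral>\<^sup>+x. f x \<partial>lborel_dim 0) = f 0"
  unfolding lborel_dim_pm by (simp add: pm_empty)

lemma sigma_finite_lborel_dim: "sigma_finite_measure (lborel_dim D)"
  unfolding lborel_dim_pm by (intro sigma_finite_pm) (auto intro: lborel.sigma_finite_measure_axioms)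

lemma sets_lborel_dim [simp, measurable_cong]: "sets (lborel_dim D) = sets borel"
  by (simp add: lborel_dim_pm)

lemma space_lborel_dim [simp]: "space (lborel_dim D) = UNIV"
  by (simp add: lborel_dim_pm)

section \<open>Lebesgue measure on \<open>Rn D\<close>: support, translations, scaling\<close>

definition Rn :: "nat \<Rightarrow> (nat \<Rightarrow> real) set"
  where "Rn D = {x. \<forall>i\<ge>D. x i = 0}"

text \<open>The measures live on all of \<open>nat \<Rightarrow> real\<close> but charge only
  \<open>Rn D\<close>. Identities that need vanishing coordinates, such as
  \<open>x(D := 0) = x\<close>, are therefore used almost everywhere.\<close>

lemma AE_lborel_dim: "AE x in lborel_dim D. x \<in> Rn D"
  unfolding lborel_dim_pm Rn_def using AE_pm_zero[of lborel "{..<D}"] by (simp add: not_less)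

lemma swap_lborel_dim:
  assumes "(\<lambda>(x, y). f x y) \<in> borel_measurable (lborel_dim D \<Otimes>\<^sub>M lborel_dim E)"
  shows "(\<integral>\<^sup>+x. \<integral>\<^sup>+y. f x y \<partial>lborel_dim E \<partial>lborel_dim D) =
    (\<integral>\<^sup>+y. \<integral>\<^sup>+x. f x y \<partial>lborel_dim D \<partial>lborel_dim E)"
  by (rule pair_sigma_finite.Fubini'[symmetric])
    (use assms sigma_finite_lborel_dim in \<open>auto simp: pair_sigma_finite_def\<close>)

lemma lborel_dim_translate:
  assumes "f \<in> borel_measurable borel" "a \<in> Rn D"
  shows "(\<integral>\<^sup>+x. f (x + a) \<partial>lborel_dim D) = (\<integral>\<^sup>+x. f x \<partial>lborel_dim D)"
  using assms
proof (induction D arbitrary: f a)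
  case 0
  then have "a = 0" by (auto simp: Rn_def fun_eq_iff)
  then show ?case by simp
next
  case (Suc D)
  note [measurable] = Suc.prems(1)
  have a: "a(D := 0) \<in> Rn D" using Suc.prems(2) by (auto simp: Rn_def)
  have [measurable]: "(\<lambda>x. x + a) \<in> borel_measurable (borel :: (nat \<Rightarrow> real) measure)" for a
    by (rule measurable_fun_borel) (simp add: plus_fun_def)
  have m: "(\<lambda>(x, s). f (x(D := s))) \<in> borel_measurable (borel \<Otimes>\<^sub>M lborel)"
    unfolding split_beta
    by (rule measurable_compose[OF _ Suc.prems(1)], rule measurable_upd) measurable
  have m1: "(\<lambda>s. f (x(D := s))) \<in> borel_measurable borel" for x
    by (rule measurable_compose[OF _ Suc.prems(1)], rule measurable_upd) auto
  have "(\<integral>\<^sup>+x. f (x + a) \<partial>lborel_dim (Suc D)) =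
      (\<integral>\<^sup>+x. \<integral>\<^sup>+s. f (x(D := s) + a) \<partial>lborel \<partial>lborel_dim D)"
    by (subst lborel_dim_Suc) auto
  \<comment> \<open>The factor 1 puts the shift into the form \<open>t + c * s\<close> of
    \<open>nn_integral_real_affine\<close>.\<close>
  also have "\<dots> = (\<integral>\<^sup>+x. \<integral>\<^sup>+s. f ((x + a(D := 0))(D := a D + 1 * s)) \<partial>lborel \<partial>lborel_dim D)"
    by (intro nn_integral_cong arg_cong[of _ _ f]) (auto simp: fun_eq_iff)
  also have "\<dots> = (\<integral>\<^sup>+x. \<integral>\<^sup>+s. f ((x + a(D := 0))(D := s)) \<partial>lborel \<partial>lborel_dim D)"
    using nn_integral_real_affine[OF m1, of 1] by (intro nn_integral_cong[where M = "lborel_dim D"]) auto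
  also have "\<dots> = (\<integral>\<^sup>+x. \<integral>\<^sup>+s. f (x(D := s)) \<partial>lborel \<partial>lborel_dim D)"
    by (rule Suc.IH[OF _ a], rule lborel.borel_measurable_nn_integral, rule m)
  also have "\<dots> = (\<integral>\<^sup>+x. f x \<partial>lborel_dim (Suc D))"
    by (subst lborel_dim_Suc) auto
  finally show ?case .
qed

lemma lborel_dim_scale:
  assumes "f \<in> borel_measurable borel" "r \<noteq> 0"
  shows "(\<integral>\<^sup>+x. f x \<partial>lborel_dim D) = ennreal (\<bar>r\<bar> ^ D) * (\<integral>\<^sup>+x. f (r *\<^sub>R x) \<partial>lborel_dim D)"
  using assms
proof (induction D arbitrary: f)
  case 0
  have "(\<lambda>x. f (r *\<^sub>R x)) \<in> borel_measurable borel"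
    by (rule measurable_compose[OF measurable_fun_borel 0(1)]) (simp add: scaleR_fun_def)
  then show ?case using 0 by (simp add: lborel_dim_0 scaleR_fun_def zero_fun_def)
next
  case (Suc D)
  note [measurable] = Suc.prems(1)
  have s[measurable]: "(\<lambda>x. r *\<^sub>R x) \<in> borel_measurable (borel :: (nat \<Rightarrow> real) measure)"
    by (rule measurable_fun_borel) (simp add: scaleR_fun_def)
  have m: "(\<lambda>(x, s). f (x(D := s))) \<in> borel_measurable (borel \<Otimes>\<^sub>M lborel)"
    unfolding split_beta
    by (rule measurable_compose[OF _ Suc.prems(1)], rule measurable_upd) measurable
  have m1: "(\<lambda>s. f (x(D := s))) \<in> borel_measurable borel" for x
    by (rule measurable_compose[OF _ Suc.prems(1)], rule measurable_upd) auto
  have m': "(\<lambda>(x, s). f (x(D := r * s))) \<in> borel_measurable (borel \<Otimes>\<^sub>M lborel)"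
    unfolding split_beta
    by (rule measurable_compose[OF _ Suc.prems(1)], rule measurable_upd) measurable
  have "(\<integral>\<^sup>+x. f x \<partial>lborel_dim (Suc D)) = (\<integral>\<^sup>+x. \<integral>\<^sup>+s. f (x(D := s)) \<partial>lborel \<partial>lborel_dim D)"
    by (subst lborel_dim_Suc) auto
  also have "\<dots> = (\<integral>\<^sup>+x. ennreal \<bar>r\<bar> * \<integral>\<^sup>+s. f (x(D := r * s)) \<partial>lborel \<partial>lborel_dim D)"
    by (intro nn_integral_cong) (subst nn_integral_real_affine[OF m1 Suc.prems(2), where t = 0], auto)
  also have "\<dots> = ennreal \<bar>r\<bar> * (\<integral>\<^sup>+x. \<integral>\<^sup>+s. f (x(D := r * s)) \<partial>lborel \<partial>lborel_dim D)"
    using lborel.borel_measurable_nn_integral[OF m'] by (intro nn_integral_cmult) simp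
  also have "(\<integral>\<^sup>+x. \<integral>\<^sup>+s. f (x(D := r * s)) \<partial>lborel \<partial>lborel_dim D) = ennreal (\<bar>r\<bar> ^ D) *
      (\<integral>\<^sup>+x. \<integral>\<^sup>+s. f ((r *\<^sub>R x)(D := r * s)) \<partial>lborel \<partial>lborel_dim D)"
    by (rule Suc.IH[OF _ Suc.prems(2)], rule lborel.borel_measurable_nn_integral, rule m')
  also have "(\<integral>\<^sup>+x. \<integral>\<^sup>+s. f ((r *\<^sub>R x)(D := r * s)) \<partial>lborel \<partial>lborel_dim D) =
      (\<integral>\<^sup>+x. \<integral>\<^sup>+s. f (r *\<^sub>R (x(D := s))) \<partial>lborel \<partial>lborel_dim D)"
    by (intro nn_integral_cong arg_cong[of _ _ f]) (auto simp: fun_eq_iff scaleR_fun_def)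
  also have "\<dots> = (\<integral>\<^sup>+x. f (r *\<^sub>R x) \<partial>lborel_dim (Suc D))"
    by (subst lborel_dim_Suc) auto
  finally show ?case by (simp add: ennreal_mult mult_ac)
qed

lemma measurable_lborel_dim: "f \<in> borel_measurable borel \<Longrightarrow> f \<in> borel_measurable (lborel_dim D)"
  by (simp add: measurable_def)

subsection \<open>Reflections\<close>

definition ip :: "nat \<Rightarrow> (nat \<Rightarrow> real) \<Rightarrow> (nat \<Rightarrow> real) \<Rightarrow> real"
  where "ip D x y = (\<Sum>i<D. x i * y i)"

text \<open>The reflection in the hyperplane orthogonal to \<open>a\<close>. When
  \<open>ip D a a = 0\<close>, division by zero yields the identity, so that isometry and involution
  hold for every \<open>a\<close>.\<close>

definition reflect :: "nat \<Rightarrow> (nat \<Rightarrow> real) \<Rightarrow> (nat \<Rightarrow> real) \<Rightarrow> nat \<Rightarrow> real"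
  where "reflect D a x = x - (2 * ip D a x / ip D a a) *\<^sub>R a"

lemma ip_commute: "ip D x y = ip D y x"
  by (simp add: ip_def mult.commute)

lemma ip_simps:
  "ip D (x + y) z = ip D x z + ip D y z" "ip D z (x + y) = ip D z x + ip D z y"
  "ip D (x - y) z = ip D x z - ip D y z" "ip D z (x - y) = ip D z x - ip D z y"
  "ip D (c *\<^sub>R x) z = c * ip D x z" "ip D z (c *\<^sub>R x) = c * ip D z x"
  "ip D 0 z = 0" "ip D z 0 = 0" "ip D (- x) z = - ip D x z" "ip D z (- x) = - ip D z x"
  by (simp_all add: ip_def plus_fun_def fun_diff_def scaleR_fun_def fun_Compl_def zero_fun_def algebra_simps
      sum.distrib sum_subtractf sum_distrib_left sum_negf)

lemma ip_nonneg [simp]: "ip D x x \<ge> 0"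
  by (simp add: ip_def sum_nonneg)

lemma L2_ip: "L2_set x {..<D} = sqrt (ip D x x)"
  by (simp add: L2_set_def ip_def power2_eq_square)

lemma ip_eq_0: "x \<in> Rn D \<Longrightarrow> ip D x x = 0 \<longleftrightarrow> x = 0"
  by (auto simp: ip_def sum_nonneg_eq_0_iff Rn_def fun_eq_iff) (metis lessThan_iff not_less)

lemma ip_reflect [simp]: "ip D (reflect D a x) (reflect D a y) = ip D x y"
proof (cases "ip D a a = 0")
  case False
  then show ?thesis
    by (simp add: reflect_def ip_simps ip_commute[of D x a] ip_commute[of D y a] field_simps)
qed (simp add: reflect_def)

lemma reflect_add: "reflect D a (x + y) = reflect D a x + reflect D a y"
  and reflect_diff: "reflect D a (x - y) = reflect D a x - reflect D a y"
  and reflect_scale: "reflect D a (c *\<^sub>R x) = c *\<^sub>R reflect D a x"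
  by (simp_all add: reflect_def ip_simps algebra_simps add_divide_distrib diff_divide_distrib)

lemma reflect_reflect [simp]: "reflect D a (reflect D a x) = x"
proof (cases "ip D a a = 0")
  case False
  then have "ip D a (reflect D a x) = - ip D a x" by (simp add: reflect_def ip_simps)
  then show ?thesis by (simp add: reflect_def)
qed (simp add: reflect_def)

lemma Rn_simps:
  "x \<in> Rn D \<Longrightarrow> y \<in> Rn D \<Longrightarrow> x + y \<in> Rn D"
  "x \<in> Rn D \<Longrightarrow> y \<in> Rn D \<Longrightarrow> x - y \<in> Rn D"
  "x \<in> Rn D \<Longrightarrow> c *\<^sub>R x \<in> Rn D" "x \<in> Rn D \<Longrightarrow> - x \<in> Rn D" "0 \<in> Rn D"
  by (simp_all add: Rn_def scaleR_fun_def)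

lemma reflect_Rn: "a \<in> Rn D \<Longrightarrow> x \<in> Rn D \<Longrightarrow> reflect D a x \<in> Rn D"
  by (simp add: reflect_def Rn_simps)

text \<open>For equal norms, \<open>2 * ip D (x - y) x = ip D (x - y) (x - y)\<close>. This makes
  reflections transitive on spheres and lets them replace the orthogonal group.\<close>

lemma reflect_swap:
  assumes "x \<in> Rn D" "y \<in> Rn D" "ip D x x = ip D y y"
  shows "reflect D (x - y) x = y"
proof (cases "ip D (x - y) (x - y) = 0")
  case True
  then have "x - y = 0" using ip_eq_0[of "x - y" D] assms by (simp add: Rn_simps)
  then show ?thesis by (simp add: reflect_def)
next
  case False
  then have "2 * ip D (x - y) x / ip D (x - y) (x - y) = 1"
    using assms(3) by (simp add: ip_simps ip_commute[of D y x])
  then show ?thesis by (simp add: reflect_def)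
qed

lemma measurable_ip [measurable]: "(\<lambda>x. ip D x a) \<in> borel_measurable borel" "ip D a \<in> borel_measurable borel"
  unfolding ip_def by measurable

lemma measurable_ip_self [measurable]: "(\<lambda>x. ip D x x) \<in> borel_measurable borel"
  unfolding ip_def by measurable

lemma measurable_comp:
  assumes "f \<in> borel_measurable borel" "g \<in> borel_measurable M"
  shows "(\<lambda>x. f (g x)) \<in> borel_measurable M"
  using measurable_compose[OF assms(2,1)] .

lemma measurable_vadd:
  fixes f :: "'a \<Rightarrow> nat \<Rightarrow> real"
  assumes "f \<in> borel_measurable M" "g \<in> borel_measurable M"
  shows "(\<lambda>x. f x + g x) \<in> borel_measurable M"
  unfolding plus_fun_def
  by (rule measurable_coords, rule borel_measurable_add) (rule measurable_app2, fact)+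

lemma measurable_vdiff:
  fixes f :: "'a \<Rightarrow> nat \<Rightarrow> real"
  assumes "f \<in> borel_measurable M" "g \<in> borel_measurable M"
  shows "(\<lambda>x. f x - g x) \<in> borel_measurable M"
  unfolding fun_diff_def
  by (rule measurable_coords, rule borel_measurable_diff) (rule measurable_app2, fact)+

lemma measurable_vscale:
  fixes f :: "'a \<Rightarrow> nat \<Rightarrow> real"
  assumes "c \<in> borel_measurable M" "f \<in> borel_measurable M"
  shows "(\<lambda>x. c x *\<^sub>R f x) \<in> borel_measurable M"
  unfolding scaleR_fun_def
  by (rule measurable_coords, rule borel_measurable_scaleR, fact) (rule measurable_app2, fact)+

lemma measurable_vip:
  fixes f :: "'a \<Rightarrow> nat \<Rightarrow> real"
  assumes "f \<in> borel_measurable M" "g \<in> borel_measurable M"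
  shows "(\<lambda>x. ip D (f x) (g x)) \<in> borel_measurable M"
  unfolding ip_def
  by (intro borel_measurable_sum borel_measurable_times measurable_app2[OF assms(1)]
      measurable_app2[OF assms(2)])

lemma measurable_reflect:
  fixes f :: "'a \<Rightarrow> nat \<Rightarrow> real"
  assumes f: "f \<in> borel_measurable M"
  shows "(\<lambda>x. reflect D a (f x)) \<in> borel_measurable M"
  unfolding reflect_def
  by (intro measurable_vdiff measurable_vscale measurable_vip borel_measurable_times
      borel_measurable_divide borel_measurable_const f)

lemma unit_ball_ip: "x \<in> unit_ball_dim D \<longleftrightarrow> x \<in> Rn D \<and> ip D x x \<le> 1"
  by (auto simp: unit_ball_dim_def Rn_def L2_ip)

text \<open>
  Both the Lebesgue measure and its image under the reflection are translation invariant, so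
  comparing the two ways of integrating \<open>f (R x + y) g y\<close> shows that they agree up to a factor,
  which is \<open>1\<close> since the unit ball is preserved.
\<close>

lemma lborel_dim_reflect:
  assumes f: "f \<in> borel_measurable borel" and a: "a \<in> Rn D"
  shows "(\<integral>\<^sup>+x. f (reflect D a x) \<partial>lborel_dim D) = (\<integral>\<^sup>+x. f x \<partial>lborel_dim D)"
proof -
  let ?R = "reflect D a" and ?E = "lborel_dim D"
  define g :: "(nat \<Rightarrow> real) \<Rightarrow> ennreal" where "g = indicator (unit_ball_dim D)"
  have g: "g \<in> borel_measurable borel" unfolding g_def by measurable
  define k where "k = (\<integral>\<^sup>+x. g x \<partial>?E)"
  have k: "k \<noteq> 0" "k \<noteq> \<infinity>" using emeasure_unit_ball_dim[of D]
    unfolding k_def g_def by (subst nn_integral_indicator, simp_all)+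
  interpret sigma_finite_measure ?E by (rule sigma_finite_lborel_dim)
  interpret P: pair_sigma_finite ?E ?E by (simp add: pair_sigma_finite_def sigma_finite_lborel_dim)
  have [measurable_cong]: "sets ?E = sets borel" by simp
  have m1: "(\<lambda>x. f (?R x)) \<in> borel_measurable borel"
    by (intro measurable_comp[OF f] measurable_reflect) auto
  have m2: "(\<lambda>(x, y). f (?R x + y) * g y) \<in> borel_measurable (?E \<Otimes>\<^sub>M ?E)"
    unfolding split_beta
    by (intro borel_measurable_times_ennreal measurable_comp[OF f] measurable_comp[OF g] measurable_vadd measurable_vdiff measurable_reflect) auto
  have m3: "(\<lambda>(x, y). f y * g (y - ?R x)) \<in> borel_measurable (?E \<Otimes>\<^sub>M ?E)"
    unfolding split_beta
    by (intro borel_measurable_times_ennreal measurable_comp[OF f] measurable_comp[OF g] measurable_vadd measurable_vdiff measurable_reflect) auto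
  have m4: "(\<lambda>y. f y * g (y - ?R x)) \<in> borel_measurable borel" for x
    by (intro borel_measurable_times_ennreal measurable_comp[OF f] measurable_comp[OF g] measurable_vadd measurable_vdiff measurable_reflect) auto
  have m5: "(\<lambda>x. f (?R x + y)) \<in> borel_measurable borel" for y
    by (intro measurable_comp[OF f] measurable_vadd measurable_vdiff measurable_reflect) auto
  have m6: "(\<lambda>x. g (y - ?R x)) \<in> borel_measurable borel" for y
    by (intro measurable_comp[OF g] measurable_vadd measurable_vdiff measurable_reflect) auto
  \<comment> \<open>The reflection is a linear isometric involution and the ball is symmetric, so
    \<open>y - ?R x\<close> may be replaced by \<open>- ?R (y - ?R x) = x - ?R y\<close>. This turns
    the integral over \<open>x\<close> into one over a translate.\<close>
  have gR: "g (y - ?R x) = g (x + - ?R y)" if "x \<in> Rn D" "y \<in> Rn D" for x y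
  proof -
    have "ip D (y - ?R x) (y - ?R x) = ip D (?R (y - ?R x)) (?R (y - ?R x))" by simp
    also have "?R (y - ?R x) = - (x + - ?R y)" by (simp add: reflect_diff)
    also have "ip D (- (x + - ?R y)) (- (x + - ?R y)) = ip D (x + - ?R y) (x + - ?R y)"
      by (simp only: ip_simps minus_minus)
    finally have "ip D (y - ?R x) (y - ?R x) = ip D (x + - ?R y) (x + - ?R y)" .
    moreover have "y - ?R x \<in> Rn D" "x + - ?R y \<in> Rn D"
      using that a by (auto intro!: Rn_simps reflect_Rn simp del: add_uminus_conv_diff)
    ultimately show ?thesis
      unfolding g_def indicator_def unit_ball_ip by presburger
  qed
  have "k * (\<integral>\<^sup>+x. f (?R x) \<partial>?E) = (\<integral>\<^sup>+y. (\<integral>\<^sup>+x. f (?R x) \<partial>?E) * g y \<partial>?E)"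
    by (subst nn_integral_cmult[OF measurable_lborel_dim[OF g]]) (simp add: k_def mult.commute)
  also have "\<dots> = (\<integral>\<^sup>+y. (\<integral>\<^sup>+x. f (?R x + y) * g y \<partial>?E) \<partial>?E)"
  proof (rule nn_integral_cong_AE, use AE_lborel_dim[of D] in eventually_elim)
    case (elim y)
    have "(\<integral>\<^sup>+x. f (?R x) \<partial>?E) = (\<integral>\<^sup>+x. f (?R (x + ?R y)) \<partial>?E)"
      by (rule lborel_dim_translate[OF m1 reflect_Rn[OF a elim], symmetric])
    also have "\<dots> = (\<integral>\<^sup>+x. f (?R x + y) \<partial>?E)" by (simp add: reflect_add)
    finally show ?case by (subst nn_integral_multc[OF measurable_lborel_dim[OF m5]]) simp
  qed
  also have "\<dots> = (\<integral>\<^sup>+x. (\<integral>\<^sup>+y. f (?R x + y) * g y \<partial>?E) \<partial>?E)"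
    by (rule swap_lborel_dim[symmetric]) (rule m2)
  also have "\<dots> = (\<integral>\<^sup>+x. (\<integral>\<^sup>+y. f y * g (y - ?R x) \<partial>?E) \<partial>?E)"
  proof (rule nn_integral_cong_AE, use AE_lborel_dim[of D] in eventually_elim)
    case (elim x)
    have "(\<integral>\<^sup>+y. f y * g (y - ?R x) \<partial>?E) = (\<integral>\<^sup>+y. f (y + ?R x) * g (y + ?R x - ?R x) \<partial>?E)"
      by (rule lborel_dim_translate[OF m4 reflect_Rn[OF a elim], symmetric])
    then show ?case by (simp add: add.commute)
  qed
  also have "\<dots> = (\<integral>\<^sup>+y. (\<integral>\<^sup>+x. f y * g (y - ?R x) \<partial>?E) \<partial>?E)"
    by (rule swap_lborel_dim) (rule m3)
  also have "\<dots> = (\<integral>\<^sup>+y. f y * k \<partial>?E)"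
  proof (rule nn_integral_cong_AE, use AE_lborel_dim[of D] in eventually_elim)
    case (elim y)
    have "(\<integral>\<^sup>+x. g (y - ?R x) \<partial>?E) = (\<integral>\<^sup>+x. g (x + - ?R y) \<partial>?E)"
      by (rule nn_integral_cong_AE, use AE_lborel_dim[of D] in eventually_elim) (rule gR[OF _ elim])
    also have "\<dots> = k" unfolding k_def
      by (rule lborel_dim_translate[OF g Rn_simps(4)[OF reflect_Rn[OF a elim]]])
    finally show ?case by (subst nn_integral_cmult[OF measurable_lborel_dim[OF m6]]) simp
  qed
  also have "\<dots> = k * (\<integral>\<^sup>+y. f y \<partial>?E)"
    by (subst nn_integral_multc[OF measurable_lborel_dim[OF f]]) (rule mult.commute)
  finally show ?thesis using k by (subst (asm) ennreal_mult_cancel_left) auto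
qed

subsection \<open>Radial integrals and beta weights\<close>

lemma measurable_upd_D [measurable]:
  "(\<lambda>x :: nat \<Rightarrow> real. x(D := c)) \<in> borel_measurable borel"
  by (rule measurable_upd) auto

lemma ip_upd: "ip (Suc D) (x(D := s)) (y(D := t)) = ip D x y + s * t"
  by (simp add: ip_def)

lemma ip_upd': "ip D (x(D := s)) (y(D := t)) = ip D x y"
  by (simp add: ip_def)

text \<open>The closed unit ball has positive mass, and it is twice the ball of radius 1/2, which
  lies in the open unit ball. Scaling by 2 costs the factor \<open>2 ^ D\<close> only.\<close>

lemma ball_measure_pos: "0 < (\<integral>\<^sup>+x. indicator {x. ip D x x < 1} x \<partial>lborel_dim D)" (is ?A)
  and ball_measure_fin: "(\<integral>\<^sup>+x. indicator {x. ip D x x \<le> 1} x \<partial>lborel_dim D) < \<infinity>" (is ?B)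
proof -
  have [measurable]: "{x. ip D x x \<le> 1} \<in> sets borel" "{x. ip D x x < 1} \<in> sets borel"
    by measurable
  have "(\<integral>\<^sup>+x. indicator {x. ip D x x \<le> 1} x \<partial>lborel_dim D) =
      (\<integral>\<^sup>+x. indicator (unit_ball_dim D) x \<partial>lborel_dim D)"
    by (rule nn_integral_cong_AE, use AE_lborel_dim[of D] in eventually_elim)
      (simp add: indicator_def unit_ball_ip)
  then have e: "(\<integral>\<^sup>+x. indicator {x. ip D x x \<le> 1} x \<partial>lborel_dim D) = emeasure (lborel_dim D) (unit_ball_dim D)"
    by simp
  then show ?B using emeasure_unit_ball_dim(2)[of D] by (simp add: top.not_eq_extremum)
  have "(\<integral>\<^sup>+x. indicator {x. ip D x x \<le> 1} x \<partial>lborel_dim D) =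
      ennreal (\<bar>2\<bar> ^ D) * (\<integral>\<^sup>+x. indicator {x. ip D x x \<le> 1} (2 *\<^sub>R x) \<partial>lborel_dim D)"
    by (rule lborel_dim_scale) auto
  also have "\<dots> \<le> ennreal (\<bar>2\<bar> ^ D) * (\<integral>\<^sup>+x. indicator {x. ip D x x < 1} x \<partial>lborel_dim D)"
    by (intro mult_left_mono nn_integral_mono) (auto simp: indicator_def ip_simps)
  finally show ?A using e emeasure_unit_ball_dim(1)[of D]
    by (auto simp: zero_less_iff_neq_zero)
qed

lemma nn_integral_power_Ioo:
  assumes "0 \<le> r"
  shows "(\<integral>\<^sup>+x. ennreal (x ^ m) * indicator {0<..<r} x \<partial>lborel) = ennreal (r ^ Suc m / real (Suc m))"
proof -
  have "(\<integral>\<^sup>+x. ennreal (x ^ m) * indicator {0<..<r} x \<partial>lborel) =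
      (\<integral>\<^sup>+x. ennreal (x ^ m) * indicator {0..r} x \<partial>lborel)"
    by (rule nn_integral_cong_AE, use AE_lborel_singleton[of 0] AE_lborel_singleton[of r] in eventually_elim)
      (auto simp: indicator_def)
  also have "\<dots> = ennreal (r ^ Suc m / real (Suc m) - 0 ^ Suc m / real (Suc m))"
    using assms by (intro nn_integral_FTC_Icc) (auto intro!: derivative_eq_intros simp del: power_Suc of_nat_Suc)
  finally show ?thesis by simp
qed

text \<open>Polar coordinates for integrands that depend on the norm. Scaling determines the mass of
  every ball, hence the law of the norm. The constant is the dimension times the volume of the unit
  ball; its value is left open except that it is neither 0 nor infinite.\<close>

lemma radial:
  "\<exists>C. C \<noteq> 0 \<and> C \<noteq> \<infinity> \<and> (\<forall>k \<in> borel_measurable borel.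
    (\<integral>\<^sup>+z. k (sqrt (ip (Suc m) z z)) \<partial>lborel_dim (Suc m)) =
    C * (\<integral>\<^sup>+t. ennreal (t ^ m) * k t * indicator {0<..} t \<partial>lborel))"
proof -
  let ?D = "Suc m"
  let ?n = "\<lambda>z. sqrt (ip ?D z z)"
  define K where "K = (\<integral>\<^sup>+z. indicator {x. ip ?D x x < 1} z \<partial>lborel_dim ?D)"
  have Kfin: "K < \<infinity>"
    unfolding K_def by (rule le_less_trans[OF _ ball_measure_fin[of ?D]])
      (auto intro!: nn_integral_mono simp: indicator_def simp del: nn_integral_indicator)
  define C where "C = ennreal (real ?D) * K"
  let ?d = "\<lambda>t. C * ennreal (t ^ m) * indicator {0<..} t"
  \<comment> \<open>The sign turns balls into the rays \<open>{x<..}\<close> of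
    \<open>measure_eqI_lessThan\<close>, whose masses are then finite.\<close>
  define M where "M = distr (lborel_dim ?D) borel (\<lambda>z. - ?n z)"
  define N where "N = distr (density lborel ?d) borel (\<lambda>t :: real. - t)"
  have M: "emeasure M {x<..} = ennreal ((max 0 (- x)) ^ ?D) * K" for x
  proof -
    have "emeasure M {x<..} = emeasure (lborel_dim ?D) {z. ?n z < - x}"
      unfolding M_def by (subst emeasure_distr) (auto intro!: arg_cong2[where f = emeasure])
    also have "\<dots> = (\<integral>\<^sup>+z. indicator {z. ?n z < - x} z \<partial>lborel_dim ?D)"
      by (rule nn_integral_indicator[symmetric]) simp
    also have "\<dots> = ennreal ((max 0 (- x)) ^ ?D) * K"
    proof (cases "x < 0")
      case True
      have "(\<integral>\<^sup>+z. indicator {z. ?n z < - x} z \<partial>lborel_dim ?D) =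
          ennreal (\<bar>- x\<bar> ^ ?D) * (\<integral>\<^sup>+z. indicator {z. ?n z < - x} ((- x) *\<^sub>R z) \<partial>lborel_dim ?D)"
        using True by (intro lborel_dim_scale) auto
      also have "(\<integral>\<^sup>+z. indicator {z. ?n z < - x} ((- x) *\<^sub>R z) \<partial>lborel_dim ?D) = K"
        unfolding K_def using True
        by (intro nn_integral_cong) (auto simp: indicator_def ip_simps real_sqrt_mult mult.assoc[symmetric] simp del: scaleR_minus_left)
      finally show ?thesis using True by simp
    next
      case False
      have "\<not> ?n z < - x" for z using False by (smt (verit) ip_nonneg real_sqrt_ge_zero)
      then show ?thesis using False by simp
    qed
    finally show ?thesis .
  qed
  have N: "emeasure N {x<..} = ennreal ((max 0 (- x)) ^ ?D) * K" for x
  proof -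
    have "emeasure N {x<..} = emeasure (density lborel ?d) {..< - x}"
      unfolding N_def by (subst emeasure_distr) (auto intro!: arg_cong2[where f = emeasure])
    also have "\<dots> = (\<integral>\<^sup>+t. C * (ennreal (t ^ m) * indicator {0<..<max 0 (- x)} t) \<partial>lborel)"
      by (subst emeasure_density) (auto intro!: nn_integral_cong simp: indicator_def mult.assoc)
    also have "\<dots> = C * ennreal (max 0 (- x) ^ ?D / real ?D)"
      by (subst nn_integral_cmult) (simp_all add: nn_integral_power_Ioo del: power_Suc)
    also have "\<dots> = ennreal ((max 0 (- x)) ^ ?D) * K"
    proof -
      have "ennreal (real ?D) * ennreal (max 0 (- x) ^ ?D / real ?D) = ennreal ((max 0 (- x)) ^ ?D)"
        by (subst ennreal_mult[symmetric]) (simp_all del: power_Suc)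
      then show ?thesis unfolding C_def by (metis mult.assoc mult.commute)
    qed
    finally show ?thesis .
  qed
  have MN: "M = N"
  proof (rule measure_eqI_lessThan)
    show "emeasure M {x<..} < \<infinity>" for x
      unfolding M using Kfin by (simp add: ennreal_mult_less_top)
  qed (simp_all add: M N, simp_all add: M_def N_def)
  have "(\<integral>\<^sup>+z. k (?n z) \<partial>lborel_dim ?D) = C * (\<integral>\<^sup>+t. ennreal (t ^ m) * k t * indicator {0<..} t \<partial>lborel)"
    if [measurable]: "k \<in> borel_measurable borel" for k :: "real \<Rightarrow> ennreal"
  proof -
    have "(\<integral>\<^sup>+z. k (?n z) \<partial>lborel_dim ?D) = (\<integral>\<^sup>+t. k (- t) \<partial>M)"
      unfolding M_def by (subst nn_integral_distr) auto
    also have "\<dots> = (\<integral>\<^sup>+t. k t \<partial>density lborel ?d)"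
      unfolding MN N_def by (subst nn_integral_distr) auto
    also have "\<dots> = (\<integral>\<^sup>+t. C * (ennreal (t ^ m) * k t * indicator {0<..} t) \<partial>lborel)"
      by (subst nn_integral_density) (auto intro!: nn_integral_cong simp: mult_ac)
    also have "\<dots> = C * (\<integral>\<^sup>+t. ennreal (t ^ m) * k t * indicator {0<..} t \<partial>lborel)"
      by (rule nn_integral_cmult) simp
    finally show ?thesis .
  qed
  moreover have "C \<noteq> 0" "C \<noteq> \<infinity>"
    using ball_measure_pos[of ?D] Kfin
    by (auto simp: C_def K_def ennreal_mult_eq_top_iff simp del: nn_integral_indicator)
  ultimately show ?thesis by blast
qed

text \<open>Apply \<open>radial\<close> to the indicator of 0: its right-hand side runs over
  positive radii only.\<close>

lemma AE_lborel_dim_nonzero: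
  assumes "D > 0"
  shows "AE x in lborel_dim D. ip D x x > 0"
proof -
  obtain m where D: "D = Suc m" using assms by (cases D) auto
  obtain C where C: "\<forall>k \<in> borel_measurable borel.
    (\<integral>\<^sup>+z. k (sqrt (ip D z z)) \<partial>lborel_dim D) =
    C * (\<integral>\<^sup>+t. ennreal (t ^ m) * k t * indicator {0<..} t \<partial>lborel)"
    using radial[of m] unfolding D by blast
  have "(\<integral>\<^sup>+z. indicator {0} (sqrt (ip D z z)) \<partial>lborel_dim D) =
      C * (\<integral>\<^sup>+t. ennreal (t ^ m) * indicator {0} t * indicator {0<..} t \<partial>lborel)"
    using C by simp
  also have "(\<integral>\<^sup>+t. ennreal (t ^ m) * indicator {0} t * indicator {0<..} t \<partial>lborel) = (\<integral>\<^sup>+t. 0 \<partial>(lborel :: real measure))"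
    by (intro nn_integral_cong) (simp add: indicator_def)
  finally have "(\<integral>\<^sup>+z. indicator {0} (sqrt (ip D z z)) \<partial>lborel_dim D) = 0" by simp
  then have "AE z in lborel_dim D. indicator {0} (sqrt (ip D z z)) = (0 :: ennreal)"
    by (subst (asm) nn_integral_0_iff_AE) auto
  then show ?thesis
    by eventually_elim (auto simp: indicator_def less_le split: if_splits)
qed

text \<open>The argument \<open>q\<close> is a squared norm, so one weight serves all dimensions.
  The explicit case makes the weight vanish from the unit sphere outwards for negative exponents
  too.\<close>

definition beta_weight :: "real \<Rightarrow> real \<Rightarrow> real"
  where "beta_weight a q = (if q < 1 then (1 - q) powr a else 0)"

lemma bw_nonneg [simp]: "beta_weight a q \<ge> 0"
  by (simp add: beta_weight_def)

lemma measurable_bw [measurable]: "beta_weight a \<in> borel_measurable borel"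
  unfolding beta_weight_def by measurable

text \<open>\<open>1 - (q + (1 - q) * u) = (1 - q) * (1 - u)\<close>. This factorisation is what
  keeps the beta family closed under projections and under the elimination of points.\<close>

lemma bw_scale: "0 \<le> q \<Longrightarrow> q < 1 \<Longrightarrow> beta_weight a (q + (1 - q) * u) = (1 - q) powr a * beta_weight a u"
proof -
  assume q: "0 \<le> q" "q < 1"
  have e: "1 - (q + (1 - q) * u) = (1 - q) * (1 - u)" by (simp add: algebra_simps)
  have "q + (1 - q) * u < 1 \<longleftrightarrow> u < 1" using q e by (smt (verit) zero_less_mult_iff)
  then show ?thesis using q unfolding beta_weight_def e by (auto simp: powr_mult)
qed

lemma bw_0: "0 \<le> u \<Longrightarrow> q \<ge> 1 \<Longrightarrow> beta_weight a (q + u) = 0"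
  by (simp add: beta_weight_def)

text \<open>Total mass in dimension one, and also the factor split off at each projection along one
  coordinate, see \<open>Nb_project\<close>.\<close>

definition beta_mass :: "real \<Rightarrow> ennreal"
  where "beta_mass a = (\<integral>\<^sup>+s. beta_weight a (s\<^sup>2) \<partial>lborel)"

text \<open>On the line over a point of squared norm \<open>q\<close>, substitute
  \<open>s = sqrt (1 - q) * s'\<close>. By \<open>bw_scale\<close> the power \<open>a\<close> is
  pulled out, and the Jacobian adds 1/2 to the exponent.\<close>

lemma bw_marginal:
  assumes "q \<ge> 0"
  shows "(\<integral>\<^sup>+s. beta_weight a (q + s\<^sup>2) \<partial>lborel) = beta_mass a * ennreal (beta_weight (a + 1 / 2) q)"
proof (cases "q < 1")
  case True
  define r where "r = sqrt (1 - q)"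
  have r: "r > 0" "r\<^sup>2 = 1 - q" using True by (simp_all add: r_def)
  have "(\<integral>\<^sup>+s. beta_weight a (q + s\<^sup>2) \<partial>lborel) = ennreal \<bar>r\<bar> * (\<integral>\<^sup>+s. beta_weight a (q + (0 + r * s)\<^sup>2) \<partial>lborel)"
    using r by (intro nn_integral_real_affine) auto
  also have "(\<integral>\<^sup>+s. beta_weight a (q + (0 + r * s)\<^sup>2) \<partial>lborel) = (\<integral>\<^sup>+s. ennreal ((1 - q) powr a) * beta_weight a (s\<^sup>2) \<partial>lborel)"
    using True assms by (intro nn_integral_cong)
      (simp add: power_mult_distrib r(2) bw_scale ennreal_mult)
  also have "\<dots> = ennreal ((1 - q) powr a) * beta_mass a"
    unfolding beta_mass_def by (rule nn_integral_cmult) simp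
  finally have "(\<integral>\<^sup>+s. beta_weight a (q + s\<^sup>2) \<partial>lborel) = beta_mass a * (ennreal \<bar>r\<bar> * ennreal ((1 - q) powr a))"
    by (simp add: mult_ac)
  also have "ennreal \<bar>r\<bar> * ennreal ((1 - q) powr a) = ennreal (beta_weight (a + 1 / 2) q)"
    using True r by (subst ennreal_mult[symmetric]) (simp_all add: beta_weight_def powr_add r_def powr_half_sqrt)
  finally show ?thesis .
next
  case False
  then show ?thesis by (simp add: bw_0) (simp add: beta_weight_def)
qed

text \<open>Left unnormalised; all masses end up in the constant of
  \<open>reduction\<close>.\<close>

definition beta_measure :: "nat \<Rightarrow> real \<Rightarrow> (nat \<Rightarrow> real) measure"
  where "beta_measure D a = density (lborel_dim D) (\<lambda>x. ennreal (beta_weight a (ip D x x)))"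

lemma sets_Nb [simp, measurable_cong]: "sets (beta_measure D a) = sets borel"
  by (simp add: beta_measure_def)

lemma space_Nb [simp]: "space (beta_measure D a) = UNIV"
  by (simp add: beta_measure_def)

lemma sigma_finite_Nb: "sigma_finite_measure (beta_measure D a)"
  unfolding beta_measure_def
  by (rule sigma_finite_measure.sigma_finite_iff_density_finite[THEN iffD2])
    (simp_all add: sigma_finite_lborel_dim)

lemma nn_integral_Nb:
  fixes f :: "(nat \<Rightarrow> real) \<Rightarrow> ennreal"
  shows "f \<in> borel_measurable borel \<Longrightarrow> (\<integral>\<^sup>+x. f x \<partial>beta_measure D a) = (\<integral>\<^sup>+x. beta_weight a (ip D x x) * f x \<partial>lborel_dim D)"
  unfolding beta_measure_def by (subst nn_integral_density) auto

lemma Nb_reflect: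
  assumes f: "f \<in> borel_measurable borel" and a: "v \<in> Rn D"
  shows "(\<integral>\<^sup>+x. f (reflect D v x) \<partial>beta_measure D a) = (\<integral>\<^sup>+x. f x \<partial>beta_measure D a)"
proof -
  have [measurable]: "(\<lambda>x. f (reflect D v x)) \<in> borel_measurable borel"
    by (rule measurable_comp[OF f], rule measurable_reflect) simp
  have "(\<integral>\<^sup>+x. beta_weight a (ip D (reflect D v x) (reflect D v x)) * f (reflect D v x) \<partial>lborel_dim D) =
      (\<integral>\<^sup>+x. beta_weight a (ip D x x) * f x \<partial>lborel_dim D)"
    using f a by (intro lborel_dim_reflect) auto
  then show ?thesis using f by (simp add: nn_integral_Nb)
qed

lemma Nb_project:
  assumes [measurable]: "f \<in> borel_measurable borel"
  shows "(\<integral>\<^sup>+x. f (x(D := 0)) \<partial>beta_measure (Suc D) a) = beta_mass a * (\<integral>\<^sup>+x. f x \<partial>beta_measure D (a + 1 / 2))"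
proof -
  have m: "(\<lambda>x. f (x(D := 0))) \<in> borel_measurable borel"
    by (rule measurable_compose[OF measurable_upd_D assms])
  have "(\<integral>\<^sup>+x. f (x(D := 0)) \<partial>beta_measure (Suc D) a) =
      (\<integral>\<^sup>+x. \<integral>\<^sup>+s. beta_weight a (ip D x x + s\<^sup>2) * f (x(D := 0)) \<partial>lborel \<partial>lborel_dim D)"
    using m by (simp add: nn_integral_Nb, subst lborel_dim_Suc) (simp_all add: ip_upd power2_eq_square)
  also have "\<dots> = (\<integral>\<^sup>+x. beta_mass a * (beta_weight (a + 1 / 2) (ip D x x) * f x) \<partial>lborel_dim D)"
  proof (rule nn_integral_cong_AE, use AE_lborel_dim[of D] in eventually_elim)
    case (elim x)
    then have "x(D := 0) = x" by (auto simp: Rn_def)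
    then show ?case by (simp only:) (subst nn_integral_multc, simp_all add: bw_marginal mult_ac)
  qed
  also have "\<dots> = beta_mass a * (\<integral>\<^sup>+x. f x \<partial>beta_measure D (a + 1 / 2))"
    by (subst nn_integral_cmult) (simp_all add: nn_integral_Nb)
  finally show ?thesis .
qed

subsection \<open>The uniform distribution on the sphere\<close>

lemma sets_S [simp, measurable_cong]: "sets (uniform_sphere d) = sets borel"
  by (simp add: uniform_sphere_def)

lemma space_S [simp]: "space (uniform_sphere d) = UNIV"
  by (simp add: uniform_sphere_def)

lemma sigma_finite_S: "sigma_finite_measure (uniform_sphere d)"
proof -
  interpret prob_space "uniform_sphere d" by (rule prob_space_uniform_sphere)
  show ?thesis by standard
qed

lemma AE_S:
  assumes "d \<ge> 1"
  shows "AE x in uniform_sphere d. x \<in> Rn d \<and> ip d x x = 1"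
  using AE_uniform_sphere[OF assms] by eventually_elim (auto simp: unit_sphere_dim_def Rn_def L2_ip)

lemma nn_integral_S:
  fixes f :: "(nat \<Rightarrow> real) \<Rightarrow> ennreal"
  assumes f: "f \<in> borel_measurable borel"
  shows "(\<integral>\<^sup>+x. f x \<partial>uniform_sphere d) =
    (\<integral>\<^sup>+x. f (x /\<^sub>R sqrt (ip d x x)) * indicator {x. ip d x x \<le> 1} x \<partial>lborel_dim d) /
      emeasure (lborel_dim d) (unit_ball_dim d)"
proof -
  have n: "(\<lambda>x. x /\<^sub>R sqrt (ip d x x)) \<in> borel_measurable borel"
    using measurable_normalise[of d] by (simp add: L2_ip)
  have fn: "(\<lambda>x. f (x /\<^sub>R sqrt (ip d x x))) \<in> borel_measurable (lborel_dim d)"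
    by (rule measurable_lborel_dim, rule measurable_comp[OF f n])
  have nu: "(\<lambda>x. x /\<^sub>R sqrt (ip d x x)) \<in> borel_measurable (uniform_measure (lborel_dim d) (unit_ball_dim d))"
    using n by (simp add: measurable_def)
  have "(\<integral>\<^sup>+x. f x \<partial>uniform_sphere d) = (\<integral>\<^sup>+x. f (x /\<^sub>R sqrt (ip d x x)) \<partial>uniform_measure (lborel_dim d) (unit_ball_dim d))"
    unfolding uniform_sphere_def L2_ip by (rule nn_integral_distr[OF nu]) (simp add: f)
  also have "\<dots> = (\<integral>\<^sup>+x. f (x /\<^sub>R sqrt (ip d x x)) * indicator (unit_ball_dim d) x \<partial>lborel_dim d) /
      emeasure (lborel_dim d) (unit_ball_dim d)"
    by (rule nn_integral_uniform_measure[OF fn]) simp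
  also have "(\<integral>\<^sup>+x. f (x /\<^sub>R sqrt (ip d x x)) * indicator (unit_ball_dim d) x \<partial>lborel_dim d) =
      (\<integral>\<^sup>+x. f (x /\<^sub>R sqrt (ip d x x)) * indicator {x. ip d x x \<le> 1} x \<partial>lborel_dim d)"
    by (rule nn_integral_cong_AE, use AE_lborel_dim[of d] in eventually_elim)
      (simp add: indicator_def unit_ball_ip)
  finally show ?thesis .
qed

lemma S_reflect:
  fixes f :: "(nat \<Rightarrow> real) \<Rightarrow> ennreal"
  assumes f: "f \<in> borel_measurable borel" and v: "v \<in> Rn d"
  shows "(\<integral>\<^sup>+x. f (reflect d v x) \<partial>uniform_sphere d) = (\<integral>\<^sup>+x. f x \<partial>uniform_sphere d)"
proof -
  have n: "(\<lambda>x. x /\<^sub>R sqrt (ip d x x)) \<in> borel_measurable borel"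
    using measurable_normalise[of d] by (simp add: L2_ip)
  have fr: "(\<lambda>x. f (reflect d v x)) \<in> borel_measurable borel"
    by (rule measurable_comp[OF f], rule measurable_reflect) simp
  have m: "(\<lambda>x. f (x /\<^sub>R sqrt (ip d x x)) * indicator {x. ip d x x \<le> 1} x) \<in> borel_measurable borel"
    by (rule borel_measurable_times_ennreal, rule measurable_comp[OF f n]) measurable
  have "(\<integral>\<^sup>+x. f (reflect d v (x /\<^sub>R sqrt (ip d x x))) * indicator {x. ip d x x \<le> 1} x \<partial>lborel_dim d) =
    (\<integral>\<^sup>+x. f (reflect d v x /\<^sub>R sqrt (ip d (reflect d v x) (reflect d v x))) *
        indicator {x. ip d x x \<le> 1} (reflect d v x) \<partial>lborel_dim d)"
    by (intro nn_integral_cong) (simp add: reflect_scale indicator_def)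
  also have "\<dots> = (\<integral>\<^sup>+x. f (x /\<^sub>R sqrt (ip d x x)) * indicator {x. ip d x x \<le> 1} x \<partial>lborel_dim d)"
    by (rule lborel_dim_reflect[OF m v])
  finally show ?thesis unfolding nn_integral_S[OF f] nn_integral_S[OF fr] by simp
qed

text \<open>For fixed \<open>z\<close>, integrate over the norm \<open>R\<close> of \<open>(z, s)\<close> instead of over \<open>s\<close>.\<close>

lemma norm_substitution:
  fixes f :: "real \<Rightarrow> ennreal"
  assumes f[measurable]: "f \<in> borel_measurable borel" and a: "a > 0"
  shows "(\<integral>\<^sup>+s. f (sqrt (a\<^sup>2 + s\<^sup>2)) * indicator {..1} (sqrt (a\<^sup>2 + s\<^sup>2)) \<partial>lborel) =
    2 * (\<integral>\<^sup>+R. f R * ennreal (R / sqrt (R\<^sup>2 - a\<^sup>2)) * indicator {a<..1} R \<partial>lborel)"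
proof -
  let ?g = "\<lambda>s. sqrt (a\<^sup>2 + s\<^sup>2)" and ?g' = "\<lambda>s. s / sqrt (a\<^sup>2 + s\<^sup>2)"
  let ?h = "\<lambda>s. f (?g s) * indicator {..1} (?g s)"
  let ?F = "\<lambda>R. f R * ennreal (R / sqrt (R\<^sup>2 - a\<^sup>2)) * indicator {a<..1} R"
  have pos: "a\<^sup>2 + s\<^sup>2 > 0" for s using a by (simp add: add_pos_nonneg)
  have h: "?h \<in> borel_measurable borel" by measurable
  have dg: "(?g has_real_derivative ?g' s) (at s)" for s
  proof -
    have "((\<lambda>s. a\<^sup>2 + s\<^sup>2) has_real_derivative 2 * s) (at s)"
      by (auto intro!: derivative_eq_intros)
    from DERIV_chain2[OF DERIV_real_sqrt[OF pos] this]
    moreover have "inverse (sqrt (a\<^sup>2 + s\<^sup>2)) / 2 * (2 * s) = ?g' s"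
      by (simp add: field_simps)
    ultimately show ?thesis by (simp only:)
  qed
  have sg: "sqrt (a\<^sup>2 + s\<^sup>2) \<noteq> 0" for s using pos[of s] by (metis less_irrefl real_sqrt_eq_zero_cancel_iff)
  have "(\<integral>\<^sup>+s. ?h s \<partial>lborel) = (\<integral>\<^sup>+s. ?h s * indicator {0<..} s + ?h s * indicator {..0} s \<partial>lborel)"
    by (intro nn_integral_cong) (auto simp: indicator_def)
  also have "\<dots> = (\<integral>\<^sup>+s. ?h s * indicator {0<..} s \<partial>lborel) + (\<integral>\<^sup>+s. ?h s * indicator {..0} s \<partial>lborel)"
    by (rule nn_integral_add; rule borel_measurable_times_ennreal) (use h in simp_all)
  also have "(\<integral>\<^sup>+s. ?h s * indicator {..0} s \<partial>lborel) =
      ennreal \<bar>-1\<bar> * (\<integral>\<^sup>+s. ?h (0 + -1 * s) * indicator {..0} (0 + -1 * s) \<partial>lborel)"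
    by (rule nn_integral_real_affine) auto
  also have "\<dots> = (\<integral>\<^sup>+s. ?h s * indicator {0<..} s \<partial>lborel)"
    by (simp, rule nn_integral_cong_AE, use AE_lborel_singleton[of 0] in eventually_elim)
      (auto simp: indicator_def)
  finally have 1: "(\<integral>\<^sup>+s. ?h s \<partial>lborel) = 2 * (\<integral>\<^sup>+s. ?h s * indicator {0<..} s \<partial>lborel)"
    by (simp add: mult_2)
  \<comment> \<open>Norms up to 1 force \<open>s \<le> 1\<close>, which confines the substitution to
    a compact interval. For \<open>R = ?g s\<close> one has
    \<open>sqrt (R\<^sup>2 - a\<^sup>2) = s\<close>, so the extra factor in \<open>?F\<close>
    cancels the derivative \<open>?g'\<close>.\<close>
  have "(\<integral>\<^sup>+s. ?h s * indicator {0<..} s \<partial>lborel) =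
      (\<integral>\<^sup>+s. ?F (?g s) * ennreal (?g' s) * indicator {0..1} s \<partial>lborel)"
  proof (rule nn_integral_cong_AE, use AE_lborel_singleton[of 0] in eventually_elim)
    case (elim s)
    show ?case
    proof (cases "s > 0")
      case True
      have ga: "?g s > a" using a True by (intro real_less_rsqrt) simp
      have e: "(?g s)\<^sup>2 - a\<^sup>2 = s\<^sup>2" using pos[of s] by simp
      have "ennreal (?g s / sqrt ((?g s)\<^sup>2 - a\<^sup>2)) * ennreal (?g' s) = 1"
        unfolding e using True pos[of s] a by (subst ennreal_mult[symmetric]) (simp_all)
      moreover have "s \<le> 1" if "?g s \<le> 1"
      proof -
        have "s \<le> ?g s" using True by (intro real_le_rsqrt) simp
        then show ?thesis using that by linarith
      qed
      ultimately show ?thesis using True ga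
        by (cases "?g s \<le> 1") (simp_all add: indicator_def mult.assoc del: real_sqrt_le_1_iff)
    qed (use elim in \<open>auto simp: indicator_def\<close>)
  qed
  also have "\<dots> = (\<integral>\<^sup>+R. ?F R * indicator {?g 0..?g 1} R \<partial>lborel)"
  proof (rule nn_integral_substitution_aux[symmetric])
    show "continuous_on {0..1} ?g'"
      by (intro continuous_on_divide continuous_on_id continuous_intros) (use sg in blast)
    show "0 \<le> ?g' s" if "s \<in> {0..1}" for s using that by simp
  qed (simp_all add: dg)
  also have "\<dots> = (\<integral>\<^sup>+R. ?F R \<partial>lborel)"
  proof (intro nn_integral_cong)
    fix R
    have "1 \<le> ?g 1" by simp
    then have "R \<in> {?g 0..?g 1}" if "R \<in> {a<..1}"
    proof -
      have "?g 0 = a" using a by simp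
      moreover have "R \<le> ?g 1" using that \<open>1 \<le> ?g 1\<close> unfolding greaterThanAtMost_iff by linarith
      ultimately show ?thesis using that by (simp only: atLeastAtMost_iff greaterThanAtMost_iff less_imp_le)
    qed
    then show "?F R * indicator {?g 0..?g 1} R = ?F R" by (auto simp: indicator_def)
  qed
  finally show ?thesis using 1 by simp
qed

text \<open>The sphere is parametrised by the ball. For fixed \<open>z\<close> the last coordinate
  is traded for the norm \<open>R\<close> of the whole vector (\<open>norm_substitution\<close>).
  For fixed \<open>R\<close>, rescaling \<open>z\<close> by \<open>R\<close> leaves the weight
  \<open>(1 - ip m z z) powr (- 1 / 2)\<close> and a factor \<open>R ^ m\<close> that integrates to
  a constant. By \<open>m \<ge> 1\<close>, \<open>z\<close> is nonzero almost everywhere.\<close>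

lemma S_project:
  assumes "m \<ge> 1"
  shows "\<exists>C. \<forall>g \<in> (borel_measurable borel :: ((nat \<Rightarrow> real) \<Rightarrow> ennreal) set).
    (\<integral>\<^sup>+x. g (x(m := 0)) \<partial>uniform_sphere (Suc m)) = C * (\<integral>\<^sup>+x. g x \<partial>beta_measure m (- 1 / 2))"
proof -
  let ?k = "emeasure (lborel_dim (Suc m)) (unit_ball_dim (Suc m))"
  have m0: "m > 0" using assms by simp
  define C where "C = 2 * (\<integral>\<^sup>+R. ennreal (R ^ m) * indicator {0<..1} R \<partial>(lborel :: real measure)) / ?k"
  have "(\<integral>\<^sup>+x. g (x(m := 0)) \<partial>uniform_sphere (Suc m)) = C * (\<integral>\<^sup>+x. g x \<partial>beta_measure m (- 1 / 2))"
    if g: "g \<in> borel_measurable borel" for g :: "(nat \<Rightarrow> real) \<Rightarrow> ennreal"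
  proof -
    let ?n = "\<lambda>z. sqrt (ip m z z)"
    have g0: "(\<lambda>x. g (x(m := 0))) \<in> borel_measurable borel"
      by (rule measurable_compose[OF measurable_upd_D g])
    have n: "(\<lambda>x. x /\<^sub>R sqrt (ip (Suc m) x x)) \<in> borel_measurable borel"
      using measurable_normalise[of "Suc m"] by (simp add: L2_ip)
    have m1: "(\<lambda>x. g ((x /\<^sub>R sqrt (ip (Suc m) x x))(m := 0)) * indicator {x. ip (Suc m) x x \<le> 1} x) \<in> borel_measurable borel"
      by (rule borel_measurable_times_ennreal, rule measurable_comp[OF g0 n]) measurable
    have m2: "(\<lambda>(z, R). g (z /\<^sub>R R)) \<in> borel_measurable (lborel_dim m \<Otimes>\<^sub>M lborel)"
      unfolding split_beta by (rule measurable_comp[OF g], rule measurable_vscale) measurable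
    let ?W = "\<lambda>z R. g (z /\<^sub>R R) * ennreal (R / sqrt (R\<^sup>2 - (?n z)\<^sup>2)) * indicator {?n z<..1} R"
    have m3: "(\<lambda>(z, R). ?W z R) \<in> borel_measurable (lborel_dim m \<Otimes>\<^sub>M lborel)"
    proof -
      have "(\<lambda>p :: (nat \<Rightarrow> real) \<times> real. ennreal (snd p / sqrt ((snd p)\<^sup>2 - (?n (fst p))\<^sup>2)) *
          indicator {p. ?n (fst p) < snd p \<and> snd p \<le> 1} p) \<in> borel_measurable (lborel_dim m \<Otimes>\<^sub>M lborel)"
        by measurable
      then have "(\<lambda>p. g (fst p /\<^sub>R snd p) * (ennreal (snd p / sqrt ((snd p)\<^sup>2 - (?n (fst p))\<^sup>2)) *
          indicator {p. ?n (fst p) < snd p \<and> snd p \<le> 1} p)) \<in> borel_measurable (lborel_dim m \<Otimes>\<^sub>M lborel)"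
        by (rule borel_measurable_times_ennreal[OF m2[unfolded split_beta]])
      also have "(\<lambda>p. g (fst p /\<^sub>R snd p) * (ennreal (snd p / sqrt ((snd p)\<^sup>2 - (?n (fst p))\<^sup>2)) *
          indicator {p. ?n (fst p) < snd p \<and> snd p \<le> 1} p)) = (\<lambda>(z, R). ?W z R)"
        by (auto simp: fun_eq_iff indicator_def)
      finally show ?thesis .
    qed
    have m4: "(\<lambda>R. g (z /\<^sub>R R)) \<in> borel_measurable borel" for z
      by (rule measurable_comp[OF g], rule measurable_vscale) measurable
    have m5: "(\<lambda>z. ?W z R) \<in> borel_measurable borel" for R
    proof -
      have "(\<lambda>z. (z, R)) \<in> measurable (borel :: (nat \<Rightarrow> real) measure) (lborel_dim m \<Otimes>\<^sub>M lborel)"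
        by measurable
      from measurable_compose[OF this m3] show ?thesis by simp
    qed
    have "(\<integral>\<^sup>+x. g ((x /\<^sub>R sqrt (ip (Suc m) x x))(m := 0)) * indicator {x. ip (Suc m) x x \<le> 1} x \<partial>lborel_dim (Suc m)) =
      (\<integral>\<^sup>+z. \<integral>\<^sup>+s. g ((z(m := s) /\<^sub>R sqrt (ip (Suc m) (z(m := s)) (z(m := s))))(m := 0)) *
        indicator {x. ip (Suc m) x x \<le> 1} (z(m := s)) \<partial>lborel \<partial>lborel_dim m)"
      by (rule lborel_dim_Suc[OF m1])
    also have "\<dots> = (\<integral>\<^sup>+z. 2 * (\<integral>\<^sup>+R. ?W z R \<partial>lborel) \<partial>lborel_dim m)"
    proof (rule nn_integral_cong_AE, use AE_lborel_dim[of m] AE_lborel_dim_nonzero[OF m0] in eventually_elim)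
      case (elim z)
      then have n: "?n z > 0" using assms by simp
      have z: "(z(m := s) /\<^sub>R c)(m := 0) = z /\<^sub>R c" for s c
        using elim by (auto simp: fun_eq_iff scaleR_fun_def Rn_def)
      have "(\<integral>\<^sup>+s. g ((z(m := s) /\<^sub>R sqrt (ip (Suc m) (z(m := s)) (z(m := s))))(m := 0)) *
        indicator {x. ip (Suc m) x x \<le> 1} (z(m := s)) \<partial>lborel) =
        (\<integral>\<^sup>+s. g (z /\<^sub>R sqrt ((?n z)\<^sup>2 + s\<^sup>2)) * indicator {..1} (sqrt ((?n z)\<^sup>2 + s\<^sup>2)) \<partial>lborel)"
        unfolding z by (intro nn_integral_cong) (simp add: ip_upd power2_eq_square[symmetric] indicator_def)
      also have "\<dots> = 2 * (\<integral>\<^sup>+R. ?W z R \<partial>lborel)"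
        by (rule norm_substitution[OF m4 n])
      finally show ?case .
    qed
    also have "\<dots> = 2 * (\<integral>\<^sup>+z. \<integral>\<^sup>+R. ?W z R \<partial>lborel \<partial>lborel_dim m)"
      by (rule nn_integral_cmult, rule lborel.borel_measurable_nn_integral, rule m3)
    also have "(\<integral>\<^sup>+z. \<integral>\<^sup>+R. ?W z R \<partial>lborel \<partial>lborel_dim m) = (\<integral>\<^sup>+R. \<integral>\<^sup>+z. ?W z R \<partial>lborel_dim m \<partial>lborel)"
      by (rule pair_sigma_finite.Fubini'[symmetric])
        (use m3 sigma_finite_lborel_dim lborel.sigma_finite_measure_axioms in \<open>auto simp: pair_sigma_finite_def\<close>)
    also have "\<dots> = (\<integral>\<^sup>+R. ennreal (R ^ m) * indicator {0<..1} R * (\<integral>\<^sup>+x. g x \<partial>beta_measure m (- 1 / 2)) \<partial>lborel)"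
    proof (intro nn_integral_cong)
      fix R :: real
      show "(\<integral>\<^sup>+z. ?W z R \<partial>lborel_dim m) = ennreal (R ^ m) * indicator {0<..1} R * (\<integral>\<^sup>+x. g x \<partial>beta_measure m (- 1 / 2))"
      proof (cases "0 < R \<and> R \<le> 1")
        case True
        have "(\<integral>\<^sup>+z. ?W z R \<partial>lborel_dim m) = ennreal (\<bar>R\<bar> ^ m) * (\<integral>\<^sup>+z. ?W (R *\<^sub>R z) R \<partial>lborel_dim m)"
          using True by (intro lborel_dim_scale[OF m5]) simp
        also have "(\<integral>\<^sup>+z. ?W (R *\<^sub>R z) R \<partial>lborel_dim m) = (\<integral>\<^sup>+z. beta_weight (- 1 / 2) (ip m z z) * g z \<partial>lborel_dim m)"
        proof (intro nn_integral_cong)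
          fix z
          have nR: "?n (R *\<^sub>R z) = R * ?n z"
            using True by (simp add: ip_simps real_sqrt_mult mult.assoc[symmetric])
          have "R / sqrt (R\<^sup>2 - (R * ?n z)\<^sup>2) = beta_weight (- 1 / 2) (ip m z z)" if "?n z < 1"
          proof -
            have "R\<^sup>2 - (R * ?n z)\<^sup>2 = R\<^sup>2 * (1 - ip m z z)"
              by (simp add: power_mult_distrib algebra_simps)
            then show ?thesis using True that
              by (simp add: real_sqrt_mult beta_weight_def powr_minus_divide powr_half_sqrt)
          qed
          moreover have "beta_weight (- 1 / 2) (ip m z z) = 0" if "\<not> ?n z < 1"
            using that by (simp add: beta_weight_def)
          moreover have "R * ?n z < R \<longleftrightarrow> ?n z < 1" using True by simp
          ultimately show "?W (R *\<^sub>R z) R = beta_weight (- 1 / 2) (ip m z z) * g z"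
            unfolding nR using True by (cases "?n z < 1") (auto simp: indicator_def mult.commute)
        qed
        finally show ?thesis using True g by (simp add: nn_integral_Nb indicator_def)
      next
        case False
        have "?W z R = 0" for z
        proof -
          have "0 \<le> ?n z" by simp
          then have "R \<notin> {?n z<..1}" using False by (simp only: greaterThanAtMost_iff) linarith
          then show ?thesis by simp
        qed
        then have "(\<integral>\<^sup>+z. ?W z R \<partial>lborel_dim m) = (\<integral>\<^sup>+z. 0 \<partial>lborel_dim m)"
          by (intro nn_integral_cong)
        moreover have "indicator {0<..1} R = (0 :: ennreal)" using False by (auto simp: indicator_def)
        ultimately show ?thesis by simp
      qed
    qed
    also have "\<dots> = (\<integral>\<^sup>+R. ennreal (R ^ m) * indicator {0<..1} R \<partial>lborel) * (\<integral>\<^sup>+x. g x \<partial>beta_measure m (- 1 / 2))"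
      by (rule nn_integral_multc, rule borel_measurable_times_ennreal) simp_all
    finally have E: "(\<integral>\<^sup>+x. g ((x /\<^sub>R sqrt (ip (Suc m) x x))(m := 0)) * indicator {x. ip (Suc m) x x \<le> 1} x \<partial>lborel_dim (Suc m)) =
      2 * ((\<integral>\<^sup>+R. ennreal (R ^ m) * indicator {0<..1} R \<partial>lborel) * (\<integral>\<^sup>+x. g x \<partial>beta_measure m (- 1 / 2)))" .
    show ?thesis unfolding nn_integral_S[OF g0] E C_def
      by (simp only: divide_ennreal_def mult_ac)
  qed
  then show ?thesis by blast
qed

section \<open>Functions of two points that are invariant under reflections\<close>

definition pair_inv :: "nat \<Rightarrow> ((nat \<Rightarrow> real) \<Rightarrow> (nat \<Rightarrow> real) \<Rightarrow> ennreal) \<Rightarrow> bool"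
  where "pair_inv D F \<longleftrightarrow> (\<lambda>(x, y). F x y) \<in> borel_measurable borel \<and>
    (\<forall>v\<in>Rn D. \<forall>x y. F (reflect D v x) (reflect D v y) = F x y)"

lemma pair_inv_measurable:
  assumes "pair_inv D F"
  shows "f \<in> borel_measurable M \<Longrightarrow> g \<in> borel_measurable M \<Longrightarrow> (\<lambda>x. F (f x) (g x)) \<in> borel_measurable M"
proof -
  assume "f \<in> borel_measurable M" "g \<in> borel_measurable M"
  then have "(\<lambda>x. (f x, g x)) \<in> borel_measurable M" by (rule borel_measurable_Pair)
  moreover have "(\<lambda>(x, y). F x y) \<in> borel_measurable borel" using assms by (simp add: pair_inv_def)
  ultimately show ?thesis by (auto dest: measurable_compose)
qed

text \<open>A reflection takes \<open>x\<close> to \<open>y\<close> and \<open>x'\<close> to some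
  \<open>z\<close>. Since \<open>z\<close> and \<open>y'\<close> have equal inner products with
  \<open>y\<close>, the reflection along \<open>z - y'\<close> fixes \<open>y\<close>, and it takes
  \<open>z\<close> to \<open>y'\<close>. Hence an invariant function of two points depends on their
  inner products alone.\<close>

lemma pair_inv_eq:
  assumes F: "pair_inv D F" and R: "x \<in> Rn D" "x' \<in> Rn D" "y \<in> Rn D" "y' \<in> Rn D"
    and eq: "ip D x x = ip D y y" "ip D x' x' = ip D y' y'" "ip D x x' = ip D y y'"
  shows "F x x' = F y y'"
proof -
  define z where "z = reflect D (x - y) x'"
  have xy: "reflect D (x - y) x = y" by (rule reflect_swap) (use R eq in auto)
  have v: "x - y \<in> Rn D" using R by (simp add: Rn_simps)
  have z: "z \<in> Rn D" unfolding z_def using R v by (intro reflect_Rn)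
  have "ip D y z = ip D y y'" using ip_reflect[of D "x - y" x x'] eq(3) by (simp add: z_def xy)
  then have y: "reflect D (z - y') y = y" by (simp add: reflect_def ip_simps ip_commute[of D _ y])
  have zy: "reflect D (z - y') z = y'" by (rule reflect_swap) (use R z eq in \<open>auto simp: z_def\<close>)
  have "F x x' = F y z" using F v xy unfolding pair_inv_def z_def by metis
  also have "\<dots> = F y y'" using F z R y zy Rn_simps(2) unfolding pair_inv_def by metis
  finally show ?thesis .
qed

subsection \<open>Eliminating one point from the sphere\<close>

lemma Nb1_coord:
  fixes g :: "real \<Rightarrow> ennreal"
  assumes [measurable]: "g \<in> borel_measurable borel"
  shows "(\<integral>\<^sup>+x. g (x 0) \<partial>beta_measure 1 a) = (\<integral>\<^sup>+t. beta_weight a (t\<^sup>2) * g t \<partial>lborel)"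
  by (simp add: nn_integral_Nb, subst lborel_dim_Suc, simp)
    (subst lborel_dim_0, simp_all add: ip_def power2_eq_square fun_upd_def)

text \<open>Each of the \<open>j\<close> coordinates projected away adds 1/2 to the
  exponent.\<close>

lemma Nb_coord0:
  "\<exists>C. \<forall>g \<in> (borel_measurable borel :: (real \<Rightarrow> ennreal) set).
    (\<integral>\<^sup>+x. g (x 0) \<partial>beta_measure (Suc j) a) = C * (\<integral>\<^sup>+t. beta_weight (a + j / 2) (t\<^sup>2) * g t \<partial>lborel)"
proof (induction j arbitrary: a)
  case 0
  have "(\<integral>\<^sup>+x. g (x 0) \<partial>beta_measure (Suc 0) a) = 1 * (\<integral>\<^sup>+t. beta_weight a (t\<^sup>2) * g t \<partial>lborel)"
    if "g \<in> borel_measurable borel" for g :: "real \<Rightarrow> ennreal"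
    using Nb1_coord[OF that, of a] by simp
  then show ?case by (intro exI[of _ 1]) simp
next
  case (Suc j)
  obtain C where C: "\<And>g :: real \<Rightarrow> ennreal. g \<in> borel_measurable borel \<Longrightarrow> (\<integral>\<^sup>+x. g (x 0) \<partial>beta_measure (Suc j) (a + 1 / 2)) =
      C * (\<integral>\<^sup>+t. beta_weight (a + 1 / 2 + j / 2) (t\<^sup>2) * g t \<partial>lborel)"
    using Suc.IH by blast
  have "(\<integral>\<^sup>+x. g (x 0) \<partial>beta_measure (Suc (Suc j)) a) =
      (beta_mass a * C) * (\<integral>\<^sup>+t. beta_weight (a + Suc j / 2) (t\<^sup>2) * g t \<partial>lborel)"
    if [measurable]: "g \<in> borel_measurable borel" for g :: "real \<Rightarrow> ennreal"
  proof -
    have "(\<integral>\<^sup>+x. g (x 0) \<partial>beta_measure (Suc (Suc j)) a) = (\<integral>\<^sup>+x. g ((x(Suc j := 0)) 0) \<partial>beta_measure (Suc (Suc j)) a)"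
      by simp
    also have "\<dots> = beta_mass a * (\<integral>\<^sup>+x. g (x 0) \<partial>beta_measure (Suc j) (a + 1 / 2))"
      by (rule Nb_project) measurable
    finally show ?thesis by (simp add: C mult.assoc add_divide_distrib algebra_simps)
  qed
  then show ?case by blast
qed

text \<open>Here \<open>t\<close> is the inner product of two unit vectors and
  \<open>r = sqrt ((1 + t) / 2)\<close> the norm of their midpoint. With
  \<open>t = 2 * r\<^sup>2 - 1\<close> one has
  \<open>1 - t\<^sup>2 = 4 * r\<^sup>2 * (1 - r\<^sup>2)\<close>, and the power of \<open>r\<close>
  combines with the derivative \<open>4 * r\<close> to the radial density
  \<open>r ^ (m - 1)\<close>.\<close>

lemma chord_substitution:
  fixes f :: "real \<Rightarrow> ennreal"
  assumes [measurable]: "f \<in> borel_measurable borel" and "m \<ge> 1"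
  shows "(\<integral>\<^sup>+t. beta_weight ((real m - 2) / 2) (t\<^sup>2) * f (sqrt ((1 + t) / 2)) \<partial>lborel) =
    ennreal (4 powr (m / 2)) * (\<integral>\<^sup>+r. ennreal (r ^ (m - 1)) * (beta_weight ((real m - 2) / 2) (r\<^sup>2) * f r) * indicator {0<..} r \<partial>lborel)"
proof -
  define a where "a = (real m - 2) / 2"
  let ?F = "\<lambda>t. beta_weight a (t\<^sup>2) * f (sqrt ((1 + t) / 2))"
  let ?g = "\<lambda>r. 2 * r\<^sup>2 - 1 :: real"
  have sq: "t \<in> {-1<..<1}" if "t\<^sup>2 < 1" for t :: real using that by (auto simp: abs_square_less_1)
  have "(\<integral>\<^sup>+t. ?F t \<partial>lborel) = (\<integral>\<^sup>+t. ?F t * indicator {?g 0..?g 1} t \<partial>lborel)"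
    by (intro nn_integral_cong) (auto simp: indicator_def beta_weight_def dest!: sq)
  also have "\<dots> = (\<integral>\<^sup>+r. ?F (?g r) * ennreal (4 * r) * indicator {0..1} r \<partial>lborel)"
    by (rule nn_integral_substitution_aux) (auto intro!: derivative_eq_intros continuous_intros)
  also have "\<dots> = (\<integral>\<^sup>+r. ennreal (4 powr (m / 2)) *
      (ennreal (r ^ (m - 1)) * (beta_weight a (r\<^sup>2) * f r) * indicator {0<..} r) \<partial>lborel)"
  proof (rule nn_integral_cong_AE, use AE_lborel_singleton[of 0] AE_lborel_singleton[of 1] in eventually_elim)
    case (elim r)
    show ?case
    proof (cases "0 < r \<and> r < 1")
      case True
      have r2: "r\<^sup>2 < 1" using True by (simp add: power_less_one_iff)
      have e: "1 - (2 * r\<^sup>2 - 1)\<^sup>2 = 4 * (r\<^sup>2 * (1 - r\<^sup>2))" by (simp add: power2_eq_square algebra_simps)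
      have "4 * (r\<^sup>2 * (1 - r\<^sup>2)) > 0" using True r2 by simp
      then have l: "(2 * r\<^sup>2 - 1)\<^sup>2 < 1" using e by linarith
      have rr: "(r\<^sup>2) powr a * r = r ^ (m - 1)"
      proof -
        have r2: "r\<^sup>2 = r powr 2" and r1: "r powr 1 = r" using True by simp_all
        have "(r\<^sup>2) powr a * r powr 1 = r powr (2 * a + 1)" by (simp only: r2 powr_powr powr_add)
        also have "2 * a + 1 = real (m - 1)" using assms(2) by (simp add: a_def of_nat_diff field_simps)
        finally show ?thesis using True by (simp only: r1 powr_realpow)
      qed
      have f4: "(4 :: real) powr a * 4 = 4 powr (m / 2)"
      proof -
        have "(4 :: real) powr a * 4 powr 1 = 4 powr (m / 2)" by (simp only: powr_add[symmetric] a_def) (simp add: field_simps)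
        then show ?thesis by simp
      qed
      have "beta_weight a ((2 * r\<^sup>2 - 1)\<^sup>2) * (4 * r) = 4 powr a * 4 * ((r\<^sup>2) powr a * r) * (1 - r\<^sup>2) powr a"
        using l r2 unfolding beta_weight_def e by (simp add: powr_mult)
      then have main: "beta_weight a ((2 * r\<^sup>2 - 1)\<^sup>2) * (4 * r) = 4 powr (m / 2) * r ^ (m - 1) * beta_weight a (r\<^sup>2)"
        unfolding rr f4 using r2 by (simp add: beta_weight_def)
      have "?F (?g r) * ennreal (4 * r) = ennreal (beta_weight a ((2 * r\<^sup>2 - 1)\<^sup>2)) * ennreal (4 * r) * f r"
        using True by (simp add: mult_ac)
      also have "ennreal (beta_weight a ((2 * r\<^sup>2 - 1)\<^sup>2)) * ennreal (4 * r) = ennreal (4 powr (m / 2)) * ennreal (r ^ (m - 1)) * beta_weight a (r\<^sup>2)"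
        using True main by (simp add: ennreal_mult[symmetric])
      finally show ?thesis using True by (simp add: mult_ac)
    next
      case False
      then have "r < 0 \<or> r > 1" using elim by auto
      moreover have "r > 1 \<Longrightarrow> beta_weight a (r\<^sup>2) = 0" using one_le_power[of r 2] by (simp add: beta_weight_def not_less)
      ultimately show ?thesis by (auto simp: indicator_def)
    qed
  qed
  also have "\<dots> = ennreal (4 powr (m / 2)) * (\<integral>\<^sup>+r. ennreal (r ^ (m - 1)) * (beta_weight a (r\<^sup>2) * f r) * indicator {0<..} r \<partial>lborel)"
    by (rule nn_integral_cmult, (rule borel_measurable_times_ennreal)+) simp_all
  finally show ?thesis by (simp add: a_def)
qed

text \<open>By invariance the first point is fixed at \<open>e\<close>, and \<open>F\<close> becomes
  a function of the inner product \<open>t\<close>, whose law is a one-dimensional beta law with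
  exponent \<open>(real m - 2) / 2\<close>. Each value of \<open>t\<close> is realised by a vertical
  chord with midpoint \<open>c\<close>, and \<open>chord_substitution\<close> turns the law of
  \<open>t\<close> into the law of the norm of \<open>c\<close> under the beta measure with the same
  exponent.\<close>

lemma sphere_pair:
  assumes m: "m \<ge> 1"
  shows "\<exists>C. \<forall>F. pair_inv (Suc m) F \<longrightarrow> (\<integral>\<^sup>+x. \<integral>\<^sup>+y. F x y \<partial>uniform_sphere (Suc m) \<partial>uniform_sphere (Suc m)) =
    C * (\<integral>\<^sup>+c. F (c(m := sqrt (1 - ip m c c))) (c(m := - sqrt (1 - ip m c c))) \<partial>beta_measure m ((real m - 2) / 2))"
proof -
  obtain j where j: "m = Suc j" using m by (cases m) auto
  obtain C1 where C1: "\<And>g :: (nat \<Rightarrow> real) \<Rightarrow> ennreal. g \<in> borel_measurable borel \<Longrightarrow>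
    (\<integral>\<^sup>+x. g (x(m := 0)) \<partial>uniform_sphere (Suc m)) = C1 * (\<integral>\<^sup>+x. g x \<partial>beta_measure m (- 1 / 2))"
    using S_project[OF m] by blast
  obtain C2 where C2: "\<And>g :: real \<Rightarrow> ennreal. g \<in> borel_measurable borel \<Longrightarrow> (\<integral>\<^sup>+x. g (x 0) \<partial>beta_measure m (- 1 / 2)) =
      C2 * (\<integral>\<^sup>+t. beta_weight (- 1 / 2 + j / 2) (t\<^sup>2) * g t \<partial>lborel)"
    using Nb_coord0[of j "- 1 / 2"] j by blast
  obtain C3 where C3: "C3 \<noteq> 0" "C3 \<noteq> \<infinity>" "\<And>k. k \<in> borel_measurable borel \<Longrightarrow>
    (\<integral>\<^sup>+z. k (sqrt (ip m z z)) \<partial>lborel_dim m) = C3 * (\<integral>\<^sup>+t. ennreal (t ^ (m - 1)) * k t * indicator {0<..} t \<partial>lborel)"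
    using radial[of j] j by auto
  have exp: "- 1 / 2 + real j / 2 = (real m - 2) / 2" by (simp add: j field_simps)
  define C where "C = C1 * C2 * ennreal (4 powr (m / 2)) / C3"
  let ?d = "Suc m"
  have "(\<integral>\<^sup>+x. \<integral>\<^sup>+y. F x y \<partial>uniform_sphere ?d \<partial>uniform_sphere ?d) =
    C * (\<integral>\<^sup>+c. F (c(m := sqrt (1 - ip m c c))) (c(m := - sqrt (1 - ip m c c))) \<partial>beta_measure m ((real m - 2) / 2))"
    if F: "pair_inv ?d F" for F
  proof -
    interpret prob_space "uniform_sphere ?d" by (rule prob_space_uniform_sphere)
    note mF = pair_inv_measurable[OF F]
    have AES: "AE x in uniform_sphere ?d. x \<in> Rn ?d \<and> ip ?d x x = 1" by (rule AE_S) simp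
    let ?z = "0 :: nat \<Rightarrow> real"
    define e where "e = ?z(0 := 1)"
    \<comment> \<open>The reference chord whose midpoint has norm \<open>r\<close>; every pair of
      unit vectors is congruent to one of these.\<close>
    define f where "f r = F (?z(0 := r, m := sqrt (1 - r\<^sup>2))) (?z(0 := r, m := - sqrt (1 - r\<^sup>2)))" for r
    have f: "f \<in> borel_measurable borel"
      unfolding f_def by (rule mF; intro measurable_upd) auto
    have e: "e \<in> Rn ?d" "ip ?d e e = 1" "ip ?d x e = x 0" for x
      unfolding e_def ip_def by (auto simp: Rn_def sum.delta' fun_upd_def if_distrib cong: if_cong)
    have ipf: "ip ?d (?z(0 := r, m := s)) (?z(0 := r', m := s')) = r * r' + s * s'" for r s r' s'
    proof -
      have "ip m (?z(0 := r)) (?z(0 := r')) = r * r'"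
        using m unfolding ip_def by (subst sum.remove[of _ 0]) auto
      then show ?thesis by (simp add: ip_upd)
    qed
    have R: "?z(0 := r, m := s) \<in> Rn ?d" for r s by (auto simp: Rn_def)
    have "(\<integral>\<^sup>+x. \<integral>\<^sup>+y. F x y \<partial>uniform_sphere ?d \<partial>uniform_sphere ?d) = (\<integral>\<^sup>+x. (\<integral>\<^sup>+y. F e y \<partial>uniform_sphere ?d) \<partial>uniform_sphere ?d)"
    proof (rule nn_integral_cong_AE, use AES in eventually_elim)
      case (elim x)
      have v: "x - e \<in> Rn ?d" using elim e by (simp add: Rn_simps)
      have "reflect ?d (x - e) x = e" using elim e by (intro reflect_swap) auto
      then have FE: "F x y = F e (reflect ?d (x - e) y)" for y
        using F v unfolding pair_inv_def by metis
      show ?case unfolding FE by (rule S_reflect[OF _ v], rule mF) auto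
    qed
    also have "\<dots> = (\<integral>\<^sup>+y. F e y \<partial>uniform_sphere ?d)" using emeasure_space_1 by simp
    also have "\<dots> = (\<integral>\<^sup>+y. f (sqrt ((1 + (y(m := 0)) 0) / 2)) \<partial>uniform_sphere ?d)"
    proof (rule nn_integral_cong_AE, use AES in eventually_elim)
      case (elim y)
      have "(y 0)\<^sup>2 \<le> 1"
        using elim member_le_sum[of 0 "{..<?d}" "\<lambda>i. y i * y i"] by (simp add: ip_def power2_eq_square)
      then have y0: "\<bar>y 0\<bar> \<le> 1" by (simp add: abs_square_le_1)
      let ?r = "sqrt ((1 + y 0) / 2)"
      have r: "?r\<^sup>2 = (1 + y 0) / 2" "?r * ?r = (1 + y 0) / 2" using y0 by auto
      have q: "sqrt (1 - ?r\<^sup>2) * sqrt (1 - ?r\<^sup>2) = (1 - y 0) / 2" unfolding r using y0 by (simp add: field_simps)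
      let ?P = "?z(0 := ?r, m := sqrt (1 - ?r\<^sup>2))" and ?P' = "?z(0 := ?r, m := - sqrt (1 - ?r\<^sup>2))"
      have "ip ?d ?P ?P = 1" "ip ?d ?P' ?P' = 1" "ip ?d ?P ?P' = y 0"
        unfolding ipf mult_minus_left mult_minus_right minus_minus q r(2) by (simp_all add: field_simps)
      then have "F e y = f ?r" unfolding f_def
        using elim e(2,3) ip_commute[of ?d e y] by (intro pair_inv_eq[OF F e(1) _ R R]) metis+
      then show ?case using m by simp
    qed
    also have "\<dots> = C1 * (\<integral>\<^sup>+x. f (sqrt ((1 + x 0) / 2)) \<partial>beta_measure m (- 1 / 2))"
      by (rule C1) (rule measurable_comp[OF f], measurable)
    also have "(\<integral>\<^sup>+x. f (sqrt ((1 + x 0) / 2)) \<partial>beta_measure m (- 1 / 2)) =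
        C2 * (\<integral>\<^sup>+t. beta_weight ((real m - 2) / 2) (t\<^sup>2) * f (sqrt ((1 + t) / 2)) \<partial>lborel)"
      unfolding exp[symmetric] by (rule C2) (rule measurable_comp[OF f], measurable)
    also have "(\<integral>\<^sup>+t. beta_weight ((real m - 2) / 2) (t\<^sup>2) * f (sqrt ((1 + t) / 2)) \<partial>lborel) = ennreal (4 powr (m / 2)) *
      (\<integral>\<^sup>+r. ennreal (r ^ (m - 1)) * (beta_weight ((real m - 2) / 2) (r\<^sup>2) * f r) * indicator {0<..} r \<partial>lborel)"
      by (rule chord_substitution[OF f m])
    \<comment> \<open>Polar coordinates read backwards: the constant \<open>C3\<close> is cancelled,
      which is why \<open>radial\<close> records that it is neither 0 nor infinite.\<close>
    also have "(\<integral>\<^sup>+r. ennreal (r ^ (m - 1)) * (beta_weight ((real m - 2) / 2) (r\<^sup>2) * f r) * indicator {0<..} r \<partial>lborel) =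
      (\<integral>\<^sup>+c. beta_weight ((real m - 2) / 2) ((sqrt (ip m c c))\<^sup>2) * f (sqrt (ip m c c)) \<partial>lborel_dim m) / C3"
    proof -
      have k: "(\<lambda>r. beta_weight ((real m - 2) / 2) (r\<^sup>2) * f r) \<in> borel_measurable borel"
        by (rule borel_measurable_times_ennreal[OF _ f]) measurable
      show ?thesis unfolding C3(3)[OF k] using C3(1,2)
        by (subst mult.commute[of C3], subst ennreal_mult_divide_eq) simp_all
    qed
    also have "(\<integral>\<^sup>+c. beta_weight ((real m - 2) / 2) ((sqrt (ip m c c))\<^sup>2) * f (sqrt (ip m c c)) \<partial>lborel_dim m) =
      (\<integral>\<^sup>+c. beta_weight ((real m - 2) / 2) (ip m c c) *
        F (c(m := sqrt (1 - ip m c c))) (c(m := - sqrt (1 - ip m c c))) \<partial>lborel_dim m)"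
    proof (rule nn_integral_cong_AE, use AE_lborel_dim[of m] in eventually_elim)
      case (elim c)
      have "f (sqrt (ip m c c)) = F (c(m := sqrt (1 - ip m c c))) (c(m := - sqrt (1 - ip m c c)))"
        if "ip m c c < 1"
        unfolding f_def
      proof (rule pair_inv_eq[OF F R R])
        show "c(m := sqrt (1 - ip m c c)) \<in> Rn ?d" "c(m := - sqrt (1 - ip m c c)) \<in> Rn ?d"
          using elim by (auto simp: Rn_def)
      qed (unfold ipf, unfold ip_upd, simp_all)
      then show ?case by (auto simp: beta_weight_def)
    qed
    also have "\<dots> = (\<integral>\<^sup>+c. F (c(m := sqrt (1 - ip m c c))) (c(m := - sqrt (1 - ip m c c))) \<partial>beta_measure m ((real m - 2) / 2))"
      by (rule nn_integral_Nb[symmetric], rule mF; rule measurable_upd) simp_all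
    finally show ?thesis unfolding C_def
      by (simp only: divide_ennreal_def mult_ac)
  qed
  then show ?thesis by blast
qed

subsection \<open>Eliminating one point from a beta distribution\<close>

text \<open>Both \<open>t\<close> and \<open>s\<close> are scaled by \<open>sqrt (1 - q)\<close>.
  The weights contribute the powers \<open>a\<close> and \<open>b\<close>, the factor
  \<open>t ^ m\<close> contributes \<open>m / 2\<close>, and the two Jacobians contribute 1/2
  each.\<close>

lemma two_bw_scale:
  assumes "q \<ge> 0"
  shows "(\<integral>\<^sup>+t. \<integral>\<^sup>+s. ennreal (t ^ m) * indicator {0<..} t * (beta_weight a (q + s\<^sup>2) * beta_weight b (q + (t + s)\<^sup>2)) \<partial>lborel \<partial>lborel) =
    (\<integral>\<^sup>+t. \<integral>\<^sup>+s. ennreal (t ^ m) * indicator {0<..} t * (beta_weight a (s\<^sup>2) * beta_weight b ((t + s)\<^sup>2)) \<partial>lborel \<partial>lborel) *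
      beta_weight (a + b + 1 + m / 2) q"
proof (cases "q < 1")
  case True
  define r where "r = sqrt (1 - q)"
  have r: "r > 0" "r\<^sup>2 = 1 - q" using True by (simp_all add: r_def)
  let ?W = "\<lambda>q t s. ennreal (t ^ m) * indicator {0<..} t * (beta_weight a (q + s\<^sup>2) * beta_weight b (q + (t + s)\<^sup>2))"
  have m: "(\<lambda>(t, s). ?W q t s) \<in> borel_measurable (borel \<Otimes>\<^sub>M lborel)" for q
    by measurable
  have m1: "(\<lambda>t. \<integral>\<^sup>+s. ?W q t s \<partial>lborel) \<in> borel_measurable borel" for q
    by (rule lborel.borel_measurable_nn_integral) (rule m)
  have m2: "(\<lambda>s. ?W q t s) \<in> borel_measurable borel" for q t
    by measurable
  have e: "(1 - q) powr a * (1 - q) powr b * r ^ m * r * r = beta_weight (a + b + 1 + m / 2) q"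
  proof -
    have "r ^ m = (1 - q) powr (m / 2)"
      using True by (simp add: r_def powr_half_sqrt[symmetric] powr_powr powr_realpow[symmetric])
    moreover have "r * r = (1 - q) powr 1" using r True by (simp add: power2_eq_square)
    ultimately show ?thesis using True
      by (simp only: mult.assoc powr_add[symmetric] beta_weight_def if_True) (simp add: add_ac)
  qed
  have W: "?W q (r * t) (r * s) = ennreal ((1 - q) powr a * (1 - q) powr b * r ^ m) * ?W 0 t s" for t s
  proof -
    have "q + (r * s)\<^sup>2 = q + (1 - q) * s\<^sup>2" "q + (r * t + r * s)\<^sup>2 = q + (1 - q) * (t + s)\<^sup>2"
      by (simp_all add: r(2)[symmetric] power_mult_distrib[symmetric] distrib_left)
    then have "beta_weight a (q + (r * s)\<^sup>2) = (1 - q) powr a * beta_weight a (s\<^sup>2)"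
      "beta_weight b (q + (r * t + r * s)\<^sup>2) = (1 - q) powr b * beta_weight b ((t + s)\<^sup>2)"
      using assms True by (simp_all add: bw_scale)
    moreover have "0 < r * t \<longleftrightarrow> 0 < t" using r by (simp add: zero_less_mult_iff)
    ultimately show ?thesis using r
      by (cases "0 < t") (simp_all add: indicator_def ennreal_mult[symmetric] power_mult_distrib mult_ac)
  qed
  have "(\<integral>\<^sup>+t. \<integral>\<^sup>+s. ?W q t s \<partial>lborel \<partial>lborel) =
      ennreal \<bar>r\<bar> * (\<integral>\<^sup>+t. \<integral>\<^sup>+s. ?W q (0 + r * t) s \<partial>lborel \<partial>lborel)"
    using r by (intro nn_integral_real_affine[OF m1]) simp
  also have "(\<integral>\<^sup>+t. \<integral>\<^sup>+s. ?W q (0 + r * t) s \<partial>lborel \<partial>lborel) =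
      (\<integral>\<^sup>+t. ennreal ((1 - q) powr a * (1 - q) powr b * r ^ m * r) * (\<integral>\<^sup>+s. ?W 0 t s \<partial>lborel) \<partial>lborel)"
  proof (rule nn_integral_cong)
    fix t :: real
    have "(\<integral>\<^sup>+s. ?W q (0 + r * t) s \<partial>lborel) = ennreal \<bar>r\<bar> * (\<integral>\<^sup>+s. ?W q (0 + r * t) (0 + r * s) \<partial>lborel)"
      using r by (intro nn_integral_real_affine[OF m2]) simp
    also have "\<dots> = ennreal \<bar>r\<bar> * (\<integral>\<^sup>+s. ennreal ((1 - q) powr a * (1 - q) powr b * r ^ m) * ?W 0 t s \<partial>lborel)"
      unfolding add_0 W ..
    also have "\<dots> = ennreal \<bar>r\<bar> * (ennreal ((1 - q) powr a * (1 - q) powr b * r ^ m) * (\<integral>\<^sup>+s. ?W 0 t s \<partial>lborel))"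
      by (subst nn_integral_cmult) (use m2[of 0 t] in simp_all)
    also have "\<dots> = ennreal ((1 - q) powr a * (1 - q) powr b * r ^ m * r) * (\<integral>\<^sup>+s. ?W 0 t s \<partial>lborel)"
      using r by (simp add: ennreal_mult mult_ac)
    finally show "(\<integral>\<^sup>+s. ?W q (0 + r * t) s \<partial>lborel) =
      ennreal ((1 - q) powr a * (1 - q) powr b * r ^ m * r) * (\<integral>\<^sup>+s. ?W 0 t s \<partial>lborel)" .
  qed
  also have "\<dots> = ennreal ((1 - q) powr a * (1 - q) powr b * r ^ m * r) * (\<integral>\<^sup>+t. \<integral>\<^sup>+s. ?W 0 t s \<partial>lborel \<partial>lborel)"
    by (rule nn_integral_cmult) (use m1[of 0] in simp)
  finally have "(\<integral>\<^sup>+t. \<integral>\<^sup>+s. ?W q t s \<partial>lborel \<partial>lborel) =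
      (\<integral>\<^sup>+t. \<integral>\<^sup>+s. ?W 0 t s \<partial>lborel \<partial>lborel) *
      (ennreal ((1 - q) powr a * (1 - q) powr b * r ^ m * r) * ennreal \<bar>r\<bar>)"
    by (simp only: mult_ac)
  also have "ennreal ((1 - q) powr a * (1 - q) powr b * r ^ m * r) * ennreal \<bar>r\<bar> =
      ennreal (beta_weight (a + b + 1 + m / 2) q)"
    using r by (subst ennreal_mult[symmetric]) (simp_all add: e[symmetric])
  finally show ?thesis by (simp only: add_0)
next
  case False
  then have "beta_weight a (q + s\<^sup>2) = 0" for s by (simp add: bw_0)
  moreover have "beta_weight (a + b + 1 + m / 2) q = 0" using False by (simp add: beta_weight_def)
  ultimately show ?thesis by simp
qed

text \<open>The affine Blaschke-Petkantschin formula for lines, for invariant \<open>F\<close>. With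
  \<open>z = y - x\<close> turned to the last axis, polar coordinates give the density
  \<open>t ^ m\<close> of the distance. Both points then project to the same \<open>c\<close>, and
  integrating over their heights leaves a power of \<open>1 - ip m c c\<close> by
  \<open>two_bw_scale\<close>.\<close>

lemma beta_pair:
  "\<exists>C. \<forall>F F'. pair_inv (Suc m) F \<longrightarrow> F' \<in> borel_measurable borel \<longrightarrow>
    (\<forall>c s t. s \<noteq> t \<longrightarrow> F (c(m := s)) (c(m := t)) = F' c) \<longrightarrow>
    (\<integral>\<^sup>+x. \<integral>\<^sup>+y. F x y \<partial>beta_measure (Suc m) b \<partial>beta_measure (Suc m) a) =
    C * (\<integral>\<^sup>+c. F' c \<partial>beta_measure m (a + b + 1 + m / 2))"
proof -
  let ?D = "Suc m"
  let ?E = "lborel_dim ?D"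
  obtain C where C: "\<And>k :: real \<Rightarrow> ennreal. k \<in> borel_measurable borel \<Longrightarrow>
    (\<integral>\<^sup>+z. k (sqrt (ip ?D z z)) \<partial>?E) = C * (\<integral>\<^sup>+t. ennreal (t ^ m) * k t * indicator {0<..} t \<partial>lborel)"
    using radial[of m] by blast
  define T where "T = (\<integral>\<^sup>+t. \<integral>\<^sup>+s. ennreal (t ^ m) * indicator {0<..} t * (beta_weight a (s\<^sup>2) * beta_weight b ((t + s)\<^sup>2)) \<partial>lborel \<partial>lborel)"
  have "(\<integral>\<^sup>+x. \<integral>\<^sup>+y. F x y \<partial>beta_measure ?D b \<partial>beta_measure ?D a) = (C * T) * (\<integral>\<^sup>+c. F' c \<partial>beta_measure m (a + b + 1 + m / 2))"
    if F: "pair_inv ?D F" and F'[measurable]: "F' \<in> borel_measurable borel"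
      and FF': "\<And>c s t. s \<noteq> t \<Longrightarrow> F (c(m := s)) (c(m := t)) = F' c" for F F'
  proof -
    note mF = pair_inv_measurable[OF F]
    define H where "H x y = beta_weight a (ip ?D x x) * (beta_weight b (ip ?D y y) * F x y)" for x y
    have mH: "(\<lambda>p. H (f p) (g p)) \<in> borel_measurable M"
      if "f \<in> borel_measurable M" "g \<in> borel_measurable M" for f g and M :: "'q measure"
    proof -
      have [measurable]: "(\<lambda>p. ip ?D (f p) (f p)) \<in> borel_measurable M" "(\<lambda>p. ip ?D (g p) (g p)) \<in> borel_measurable M"
        "(\<lambda>p. F (f p) (g p)) \<in> borel_measurable M"
        using that by (auto intro: measurable_vip mF)
      show ?thesis unfolding H_def by measurable
    qed
    have H: "H (reflect ?D v x) (reflect ?D v y) = H x y" if "v \<in> Rn ?D" for v x y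
      using F that by (simp add: H_def pair_inv_def)
    have sH: "(\<integral>\<^sup>+y. F x y \<partial>beta_measure ?D b) = (\<integral>\<^sup>+y. beta_weight b (ip ?D y y) * F x y \<partial>?E)" for x
      by (rule nn_integral_Nb, rule mF) simp_all
    have m1: "(\<lambda>x. \<integral>\<^sup>+y. F x y \<partial>beta_measure ?D b) \<in> borel_measurable borel"
      by (rule sigma_finite_measure.borel_measurable_nn_integral[OF sigma_finite_Nb])
        (unfold split_beta, rule mF; simp)
    have "(\<integral>\<^sup>+x. \<integral>\<^sup>+y. F x y \<partial>beta_measure ?D b \<partial>beta_measure ?D a) = (\<integral>\<^sup>+x. beta_weight a (ip ?D x x) * (\<integral>\<^sup>+y. F x y \<partial>beta_measure ?D b) \<partial>?E)"
      by (rule nn_integral_Nb[OF m1])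
    also have "\<dots> = (\<integral>\<^sup>+x. (\<integral>\<^sup>+y. H x y \<partial>?E) \<partial>?E)"
    proof (rule nn_integral_cong)
      fix x
      have "(\<lambda>y. beta_weight b (ip ?D y y) * F x y) \<in> borel_measurable ?E"
        by (rule borel_measurable_times_ennreal, measurable, rule mF) simp_all
      then show "beta_weight a (ip ?D x x) * (\<integral>\<^sup>+y. F x y \<partial>beta_measure ?D b) = (\<integral>\<^sup>+y. H x y \<partial>?E)"
        unfolding sH H_def by (rule nn_integral_cmult[symmetric])
    qed
    also have "\<dots> = (\<integral>\<^sup>+x. (\<integral>\<^sup>+z. H x (z + x) \<partial>?E) \<partial>?E)"
      by (rule nn_integral_cong_AE, use AE_lborel_dim[of ?D] in eventually_elim)
        (rule lborel_dim_translate[symmetric], rule mH, simp_all)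
    also have "\<dots> = (\<integral>\<^sup>+z. (\<integral>\<^sup>+x. H x (z + x) \<partial>?E) \<partial>?E)"
      by (rule swap_lborel_dim, unfold split_beta, rule mH) (simp_all add: measurable_vadd)
    also have "\<dots> = (\<integral>\<^sup>+z. (\<lambda>t. \<integral>\<^sup>+x. H x ((0 :: nat \<Rightarrow> real)(m := t) + x) \<partial>?E) (sqrt (ip ?D z z)) \<partial>?E)"
    proof (rule nn_integral_cong_AE, use AE_lborel_dim[of ?D] in eventually_elim)
      case (elim z)
      define e where "e = (0 :: nat \<Rightarrow> real)(m := sqrt (ip ?D z z))"
      have e: "e \<in> Rn ?D" "ip ?D e e = ip ?D z z"
        by (simp_all add: e_def Rn_def ip_upd) (simp add: ip_def)
      have v: "z - e \<in> Rn ?D" using e elim by (simp add: Rn_simps)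
      have ze: "reflect ?D (z - e) z = e" by (rule reflect_swap) (use e elim in auto)
      have mz: "(\<lambda>x. H x (z + x)) \<in> borel_measurable borel"
        by (rule mH) (simp_all add: measurable_vadd)
      have "(\<integral>\<^sup>+x. H x (z + x) \<partial>?E) = (\<integral>\<^sup>+x. H (reflect ?D (z - e) x) (z + reflect ?D (z - e) x) \<partial>?E)"
        by (rule lborel_dim_reflect[OF mz v, symmetric])
      also have "\<dots> = (\<integral>\<^sup>+x. H x (e + x) \<partial>?E)"
      proof (rule nn_integral_cong)
        fix x
        have "z + reflect ?D (z - e) x = reflect ?D (z - e) (e + x)"
          unfolding reflect_add by (metis ze reflect_reflect)
        then show "H (reflect ?D (z - e) x) (z + reflect ?D (z - e) x) = H x (e + x)"
          using H[OF v] by simp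
      qed
      finally show ?case by (simp only: e_def)
    qed
    also have "\<dots> = C * (\<integral>\<^sup>+t. ennreal (t ^ m) * (\<integral>\<^sup>+x. H x ((0 :: nat \<Rightarrow> real)(m := t) + x) \<partial>?E) * indicator {0<..} t \<partial>lborel)"
      by (rule C, rule sigma_finite_measure.borel_measurable_nn_integral[OF sigma_finite_lborel_dim],
          unfold split_beta, rule mH, simp, rule measurable_vadd, rule measurable_upd) simp_all
    also have "(\<integral>\<^sup>+t. ennreal (t ^ m) * (\<integral>\<^sup>+x. H x ((0 :: nat \<Rightarrow> real)(m := t) + x) \<partial>?E) * indicator {0<..} t \<partial>lborel) =
      (\<integral>\<^sup>+t. (\<integral>\<^sup>+c. F' c * (\<integral>\<^sup>+s. ennreal (t ^ m) * indicator {0<..} t *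
        (beta_weight a (ip m c c + s\<^sup>2) * beta_weight b (ip m c c + (t + s)\<^sup>2)) \<partial>lborel) \<partial>lborel_dim m) \<partial>lborel)"
    proof (rule nn_integral_cong)
      fix t :: real
      have mt: "(\<lambda>x. H x ((0 :: nat \<Rightarrow> real)(m := t) + x)) \<in> borel_measurable borel"
        by (rule mH, simp, rule measurable_vadd) simp_all
      show "ennreal (t ^ m) * (\<integral>\<^sup>+x. H x ((0 :: nat \<Rightarrow> real)(m := t) + x) \<partial>?E) * indicator {0<..} t =
        (\<integral>\<^sup>+c. F' c * (\<integral>\<^sup>+s. ennreal (t ^ m) * indicator {0<..} t *
        (beta_weight a (ip m c c + s\<^sup>2) * beta_weight b (ip m c c + (t + s)\<^sup>2)) \<partial>lborel) \<partial>lborel_dim m)"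
      proof (cases "t > 0")
        case True
        let ?w = "\<lambda>c s. ennreal (beta_weight a (ip m c c + s\<^sup>2) * beta_weight b (ip m c c + (t + s)\<^sup>2))"
        have add: "(0 :: nat \<Rightarrow> real)(m := t) + c(m := s) = c(m := t + s)" for c s by (auto simp: fun_eq_iff)
        have "H (c(m := s)) ((0 :: nat \<Rightarrow> real)(m := t) + c(m := s)) = F' c * ?w c s" for c s
          using FF'[of s "t + s" c] True
          by (simp add: add H_def ip_upd power2_eq_square ennreal_mult mult_ac)
        then have "(\<integral>\<^sup>+x. H x ((0 :: nat \<Rightarrow> real)(m := t) + x) \<partial>?E) = (\<integral>\<^sup>+c. \<integral>\<^sup>+s. F' c * ?w c s \<partial>lborel \<partial>lborel_dim m)"
          by (subst lborel_dim_Suc[OF mt]) simp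
        also have "\<dots> = (\<integral>\<^sup>+c. F' c * (\<integral>\<^sup>+s. ?w c s \<partial>lborel) \<partial>lborel_dim m)"
          by (rule nn_integral_cong, rule nn_integral_cmult) simp
        finally have "(\<integral>\<^sup>+x. H x ((0 :: nat \<Rightarrow> real)(m := t) + x) \<partial>?E) =
          (\<integral>\<^sup>+c. F' c * (\<integral>\<^sup>+s. ?w c s \<partial>lborel) \<partial>lborel_dim m)" .
        then have "ennreal (t ^ m) * (\<integral>\<^sup>+x. H x ((0 :: nat \<Rightarrow> real)(m := t) + x) \<partial>?E) * indicator {0<..} t =
          ennreal (t ^ m) * (\<integral>\<^sup>+c. F' c * (\<integral>\<^sup>+s. ?w c s \<partial>lborel) \<partial>lborel_dim m)"
          using True by simp
        also have "\<dots> = (\<integral>\<^sup>+c. ennreal (t ^ m) * (F' c * (\<integral>\<^sup>+s. ?w c s \<partial>lborel)) \<partial>lborel_dim m)"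
          by (rule nn_integral_cmult[symmetric]) measurable
        also have "\<dots> = (\<integral>\<^sup>+c. F' c * (\<integral>\<^sup>+s. ennreal (t ^ m) * ?w c s \<partial>lborel) \<partial>lborel_dim m)"
          by (rule nn_integral_cong, subst nn_integral_cmult) (simp_all add: mult_ac)
        finally show ?thesis using True by (simp add: mult_ac)
      qed simp
    qed
    also have "\<dots> = (\<integral>\<^sup>+c. (\<integral>\<^sup>+t. F' c * (\<integral>\<^sup>+s. ennreal (t ^ m) * indicator {0<..} t *
        (beta_weight a (ip m c c + s\<^sup>2) * beta_weight b (ip m c c + (t + s)\<^sup>2)) \<partial>lborel) \<partial>lborel) \<partial>lborel_dim m)"
      by (rule pair_sigma_finite.Fubini', simp add: pair_sigma_finite_def sigma_finite_lborel_dim lborel.sigma_finite_measure_axioms)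
        measurable
    also have "\<dots> = (\<integral>\<^sup>+c. T * (beta_weight (a + b + 1 + m / 2) (ip m c c) * F' c) \<partial>lborel_dim m)"
    proof (rule nn_integral_cong)
      fix c
      have "(\<lambda>t. \<integral>\<^sup>+s. ennreal (t ^ m) * indicator {0<..} t *
          (beta_weight a (ip m c c + s\<^sup>2) * beta_weight b (ip m c c + (t + s)\<^sup>2)) \<partial>lborel) \<in> borel_measurable lborel"
        by measurable
      then show "(\<integral>\<^sup>+t. F' c * (\<integral>\<^sup>+s. ennreal (t ^ m) * indicator {0<..} t *
          (beta_weight a (ip m c c + s\<^sup>2) * beta_weight b (ip m c c + (t + s)\<^sup>2)) \<partial>lborel) \<partial>lborel) =
        T * (beta_weight (a + b + 1 + m / 2) (ip m c c) * F' c)"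
        by (subst nn_integral_cmult, simp, subst two_bw_scale) (simp_all add: T_def mult_ac)
    qed
    also have "\<dots> = T * (\<integral>\<^sup>+c. F' c \<partial>beta_measure m (a + b + 1 + m / 2))"
      by (subst nn_integral_cmult) (simp_all add: nn_integral_Nb)
    finally show ?thesis by (simp only: mult.assoc)
  qed
  then show ?thesis by blast
qed

subsection \<open>Reduction of the dimension\<close>

lemma pm_box:
  assumes "sigma_finite_measure N" "sets N = sets borel" "finite I" and A: "A \<in> sets borel"
  shows "emeasure (power_measure I N) {x. \<forall>i\<in>I. x i \<in> A} = emeasure N A ^ card I"
proof -
  interpret sigma_finite_measure N by fact
  interpret P: product_sigma_finite "\<lambda>_ :: nat. N" by standard
  have spN: "space N = UNIV" using sets_eq_imp_space_eq[OF assms(2)] by simp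
  note [measurable] = A
  have B: "{x :: nat \<Rightarrow> 'a. \<forall>i\<in>I. x i \<in> A} \<in> sets borel"
  proof -
    have [measurable]: "(\<lambda>x :: nat \<Rightarrow> 'a. x i) \<in> borel_measurable borel" for i
      by (rule measurable_app)
    have "{x \<in> space borel. \<forall>i\<in>I. x i \<in> A} \<in> sets (borel :: (nat \<Rightarrow> 'a) measure)"
      using assms(3) by measurable
    then show ?thesis by simp
  qed
  have "emeasure (power_measure I N) {x. \<forall>i\<in>I. x i \<in> A} = emeasure (\<Pi>\<^sub>M i\<in>I. N)
      ((\<lambda>x i. if i \<in> I then x i else 0) -` {x. \<forall>i\<in>I. x i \<in> A} \<inter> space (\<Pi>\<^sub>M i\<in>I. N))"
    unfolding power_measure_def by (rule emeasure_distr[OF measurable_zext[OF assms(2)] B])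
  also have "(\<lambda>x i. if i \<in> I then x i else 0) -` {x. \<forall>i\<in>I. x i \<in> A} \<inter> space (\<Pi>\<^sub>M i\<in>I. N) = (\<Pi>\<^sub>E i\<in>I. A)"
    by (auto simp: space_PiM spN PiE_def Pi_def)
  also have "emeasure (\<Pi>\<^sub>M i\<in>I. N) (\<Pi>\<^sub>E i\<in>I. A) = emeasure N A ^ card I"
    using A assms(2,3) by (subst P.emeasure_PiM) auto
  finally show ?thesis .
qed

lemma measurable_map_coords:
  fixes T :: "'a :: second_countable_topology \<Rightarrow> 'b :: second_countable_topology"
  assumes T: "T \<in> borel_measurable borel"
  shows "(\<lambda>z :: nat \<Rightarrow> 'a. \<lambda>i. T (z i)) \<in> borel_measurable borel"
  by (rule measurable_coords, rule measurable_compose[OF measurable_app T])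

text \<open>Independent coordinates are transformed one at a time, each contributing a factor
  \<open>B\<close>. The condition \<open>T 0 = 0\<close> keeps the padding outside \<open>R\<close>
  fixed. The map \<open>T\<close> is a reflection in one application and a projection in the
  other.\<close>

lemma pm_map:
  fixes N N' :: "'a :: {second_countable_topology, zero} measure"
  assumes N: "sigma_finite_measure N" "sets N = sets borel"
    and N': "sigma_finite_measure N'" "sets N' = sets borel"
    and T: "T \<in> borel_measurable borel" "T 0 = 0"
    and step: "\<And>f :: 'a \<Rightarrow> ennreal. f \<in> borel_measurable borel \<Longrightarrow> (\<integral>\<^sup>+x. f (T x) \<partial>N) = B * (\<integral>\<^sup>+x. f x \<partial>N')"
    and R: "finite R" and f: "f \<in> borel_measurable borel"
  shows "(\<integral>\<^sup>+z. f (\<lambda>i. T (z i)) \<partial>power_measure R N) = B ^ card R * (\<integral>\<^sup>+z. f z \<partial>power_measure R N')"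
  using R f
proof (induction R arbitrary: f)
  case empty
  have "(\<lambda>z. f (\<lambda>i. T (z i))) \<in> borel_measurable borel"
    by (rule measurable_comp[OF empty measurable_map_coords[OF T(1)]])
  then show ?case using empty by (simp add: pm_empty N N' T(2) zero_fun_def)
next
  case (insert i R)
  note f = insert.prems
  let ?g = "\<lambda>z. \<integral>\<^sup>+x. f (z(i := x)) \<partial>N'"
  have mT: "(\<lambda>z. f (\<lambda>i. T (z i))) \<in> borel_measurable borel"
    by (rule measurable_comp[OF f measurable_map_coords[OF T(1)]])
  have mu: "(\<lambda>x. f (z(i := x))) \<in> borel_measurable borel" for z
    by (rule measurable_comp[OF f], rule measurable_upd) simp_all
  have g: "?g \<in> borel_measurable borel"
  proof (rule sigma_finite_measure.borel_measurable_nn_integral[OF N'(1)])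
    have [measurable_cong]: "sets N' = sets borel" by fact
    show "(\<lambda>(z, x). f (z(i := x))) \<in> borel_measurable (borel \<Otimes>\<^sub>M N')"
      unfolding split_beta by (rule measurable_comp[OF f], rule measurable_upd) measurable
  qed
  have "(\<integral>\<^sup>+z. f (\<lambda>i. T (z i)) \<partial>power_measure (insert i R) N) =
      (\<integral>\<^sup>+z. \<integral>\<^sup>+x. f ((\<lambda>j. T ((z(i := x)) j))) \<partial>N \<partial>power_measure R N)"
    by (rule nn_integral_pm_insert[OF N insert.hyps mT])
  also have "\<dots> = (\<integral>\<^sup>+z. \<integral>\<^sup>+x. f ((\<lambda>j. T (z j))(i := T x)) \<partial>N \<partial>power_measure R N)"
    by (intro nn_integral_cong arg_cong[of _ _ f]) (auto simp: fun_eq_iff)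
  also have "\<dots> = (\<integral>\<^sup>+z. B * ?g (\<lambda>j. T (z j)) \<partial>power_measure R N)"
    by (rule nn_integral_cong, rule step, rule mu)
  also have "\<dots> = B * (\<integral>\<^sup>+z. ?g (\<lambda>j. T (z j)) \<partial>power_measure R N)"
    by (rule nn_integral_cmult) (use measurable_comp[OF g measurable_map_coords[OF T(1)]] in \<open>simp add: measurable_def\<close>)
  also have "(\<integral>\<^sup>+z. ?g (\<lambda>j. T (z j)) \<partial>power_measure R N) = B ^ card R * (\<integral>\<^sup>+z. ?g z \<partial>power_measure R N')"
    by (rule insert.IH[OF g])
  also have "(\<integral>\<^sup>+z. ?g z \<partial>power_measure R N') = (\<integral>\<^sup>+z. f z \<partial>power_measure (insert i R) N')"
    by (rule nn_integral_pm_insert[OF N' insert.hyps f, symmetric])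
  finally show ?case using insert.hyps by (simp add: mult.assoc)
qed

section \<open>Invariant functions of configurations and their reduction\<close>

definition cfg_inv :: "nat \<Rightarrow> ((nat \<Rightarrow> nat \<Rightarrow> real) \<Rightarrow> ennreal) \<Rightarrow> bool"
  where "cfg_inv D \<Phi> \<longleftrightarrow> \<Phi> \<in> borel_measurable borel \<and>
    (\<forall>v\<in>Rn D. \<forall>z. \<Phi> (\<lambda>i. reflect D v (z i)) = \<Phi> z)"

text \<open>
  If the points \<open>0\<close> and \<open>m\<close> of a configuration have the same projection \<open>c\<close> along coordinate \<open>m\<close>,
  then the configuration may be projected along that coordinate, merging the two points.
\<close>

definition cfg_reduce :: "nat \<Rightarrow> ((nat \<Rightarrow> nat \<Rightarrow> real) \<Rightarrow> ennreal) \<Rightarrow> ((nat \<Rightarrow> nat \<Rightarrow> real) \<Rightarrow> ennreal) \<Rightarrow> bool"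
  where "cfg_reduce m \<Phi> \<Phi>' \<longleftrightarrow> (\<forall>z c s t. s \<noteq> t \<longrightarrow>
    \<Phi> (z(0 := c(m := s), m := c(m := t))) = \<Phi>' ((\<lambda>i. (z i)(m := 0))(0 := c)))"

definition reflect_inv :: "nat \<Rightarrow> (nat \<Rightarrow> real) measure \<Rightarrow> bool"
  where "reflect_inv D N \<longleftrightarrow> sigma_finite_measure N \<and> sets N = sets borel \<and>
    (\<forall>v\<in>Rn D. \<forall>f \<in> (borel_measurable borel :: ((nat \<Rightarrow> real) \<Rightarrow> ennreal) set).
      (\<integral>\<^sup>+x. f (reflect D v x) \<partial>N) = (\<integral>\<^sup>+x. f x \<partial>N))"

lemma reflect_inv_Nb: "reflect_inv D (beta_measure D a)"
  by (simp add: reflect_inv_def sigma_finite_Nb Nb_reflect)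

lemma reflect_inv_S: "reflect_inv D (uniform_sphere D)"
  by (simp add: reflect_inv_def sigma_finite_S S_reflect)

lemma measurable_pm_integral:
  assumes N: "sigma_finite_measure N" "sets N = sets borel" "finite R"
    and f: "f \<in> borel_measurable borel" and g: "(\<lambda>(p, z). g p z) \<in> borel_measurable (M \<Otimes>\<^sub>M borel)"
  shows "(\<lambda>p. \<integral>\<^sup>+z. f (g p z) \<partial>power_measure R N) \<in> borel_measurable M"
proof (rule sigma_finite_measure.borel_measurable_nn_integral[OF sigma_finite_pm[OF N]])
  have "(\<lambda>(p, z). g p z) \<in> borel_measurable (M \<Otimes>\<^sub>M power_measure R N)"
    using g by (simp cong: measurable_cong_sets sets_pair_measure_cong)
  from measurable_compose[OF this, of f] f
  show "(\<lambda>(p, z). f (g p z)) \<in> borel_measurable (M \<Otimes>\<^sub>M power_measure R N)" by (simp add: split_beta)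
qed

text \<open>With the remaining points integrated out, a common reflection of the points 0 and
  \<open>m\<close> can be extended to all points, since the law of the others is invariant.\<close>

lemma pair_inv_config:
  assumes N: "reflect_inv D N" and R: "finite R" and \<Phi>: "cfg_inv D \<Phi>"
  shows "pair_inv D (\<lambda>x y. \<integral>\<^sup>+z. \<Phi> (z(0 := x, m := y)) \<partial>power_measure R N)"
  unfolding pair_inv_def
proof (intro conjI ballI allI)
  have sf: "sigma_finite_measure N" "sets N = sets borel" using N by (auto simp: reflect_inv_def)
  have mP: "\<Phi> \<in> borel_measurable borel" using \<Phi> by (simp add: cfg_inv_def)
  have "(\<lambda>p. \<integral>\<^sup>+z. \<Phi> (z(0 := fst p, m := snd p)) \<partial>power_measure R N) \<in> borel_measurable (borel :: ((nat \<Rightarrow> real) \<times> (nat \<Rightarrow> real)) measure)"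
  proof (rule measurable_pm_integral[OF sf R mP])
    have [measurable]: "(fst :: (nat \<Rightarrow> real) \<times> (nat \<Rightarrow> real) \<Rightarrow> _) \<in> borel_measurable borel"
      "(snd :: (nat \<Rightarrow> real) \<times> (nat \<Rightarrow> real) \<Rightarrow> _) \<in> borel_measurable borel"
      by (simp_all add: borel_prod[symmetric])
    show "(\<lambda>(p :: (nat \<Rightarrow> real) \<times> (nat \<Rightarrow> real), z). z(0 := fst p, m := snd p)) \<in> borel_measurable (borel \<Otimes>\<^sub>M borel)"
      unfolding split_beta by (intro measurable_upd) measurable
  qed
  then show "(\<lambda>(x, y). \<integral>\<^sup>+z. \<Phi> (z(0 := x, m := y)) \<partial>power_measure R N) \<in> borel_measurable borel"
    by (simp add: split_beta)
  fix v x y assume v: "v \<in> Rn D"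
  let ?R = "reflect D v"
  have mR: "?R \<in> borel_measurable borel" by (rule measurable_reflect) simp
  have R0: "?R 0 = 0" by (simp add: reflect_def ip_simps)
  have mf: "(\<lambda>z. \<Phi> (z(0 := ?R x, m := ?R y))) \<in> borel_measurable borel"
    by (rule measurable_comp[OF mP], intro measurable_upd) simp_all
  have step: "\<And>f :: (nat \<Rightarrow> real) \<Rightarrow> ennreal. f \<in> borel_measurable borel \<Longrightarrow>
      (\<integral>\<^sup>+x. f (?R x) \<partial>N) = 1 * (\<integral>\<^sup>+x. f x \<partial>N)"
    using N v by (simp add: reflect_inv_def)
  have "(\<integral>\<^sup>+z. \<Phi> (z(0 := ?R x, m := ?R y)) \<partial>power_measure R N) =
      (\<integral>\<^sup>+z. \<Phi> ((\<lambda>i. ?R (z i))(0 := ?R x, m := ?R y)) \<partial>power_measure R N)"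
    using pm_map[OF sf sf mR R0 step R mf] by simp
  also have "\<dots> = (\<integral>\<^sup>+z. \<Phi> (\<lambda>i. ?R ((z(0 := x, m := y)) i)) \<partial>power_measure R N)"
    by (intro nn_integral_cong arg_cong[of _ _ \<Phi>]) (auto simp: fun_eq_iff)
  also have "\<dots> = (\<integral>\<^sup>+z. \<Phi> (z(0 := x, m := y)) \<partial>power_measure R N)"
    using \<Phi> v by (simp only: cfg_inv_def)
  finally show "(\<integral>\<^sup>+z. \<Phi> (z(0 := ?R x, m := ?R y)) \<partial>power_measure R N) = (\<integral>\<^sup>+z. \<Phi> (z(0 := x, m := y)) \<partial>power_measure R N)" .
qed

lemma pm_insert_swap:
  assumes N: "sigma_finite_measure N" "sets N = sets borel" "finite R" "i \<notin> R"
    and f: "f \<in> borel_measurable borel"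
  shows "(\<integral>\<^sup>+z. f z \<partial>power_measure (insert i R) N) = (\<integral>\<^sup>+y. \<integral>\<^sup>+z. f (z(i := y)) \<partial>power_measure R N \<partial>N)"
proof -
  have "(\<lambda>(z, y). f (z(i := y))) \<in> borel_measurable (power_measure R N \<Otimes>\<^sub>M N)"
  proof -
    have [measurable_cong]: "sets N = sets borel" by fact
    show ?thesis
      unfolding split_beta by (rule measurable_comp[OF f], rule measurable_upd) measurable
  qed
  then show ?thesis
    by (subst nn_integral_pm_insert[OF N f], intro pair_sigma_finite.Fubini'[symmetric])
      (simp_all add: pair_sigma_finite_def sigma_finite_pm N)
qed

lemma reduce_tail:
  assumes R: "finite R" and N: "sigma_finite_measure N" "sets N = sets borel"
    and \<Phi>': "\<Phi>' \<in> borel_measurable borel"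
    and step: "\<And>f :: (nat \<Rightarrow> real) \<Rightarrow> ennreal. f \<in> borel_measurable borel \<Longrightarrow>
      (\<integral>\<^sup>+x. f (x(m := 0)) \<partial>N) = B * (\<integral>\<^sup>+x. f x \<partial>beta_measure m b)"
  shows "(\<integral>\<^sup>+z. \<Phi>' ((\<lambda>i. (z i)(m := 0))(0 := c)) \<partial>power_measure R N) =
    B ^ card R * (\<integral>\<^sup>+z. \<Phi>' (z(0 := c)) \<partial>power_measure R (beta_measure m b))"
proof (rule pm_map[where f = "\<lambda>z. \<Phi>' (z(0 := c))" and T = "\<lambda>x. x(m := 0)"])
  show "(\<lambda>z. \<Phi>' (z(0 := c))) \<in> borel_measurable borel"
    by (rule measurable_comp[OF \<Phi>'], rule measurable_upd) simp_all
qed (use assms in \<open>auto simp: sigma_finite_Nb\<close>)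

lemma measurable_pm_upd0:
  assumes "\<Phi> \<in> borel_measurable borel" "finite R" "sigma_finite_measure N" "sets N = sets borel"
  shows "(\<lambda>c. \<integral>\<^sup>+z. \<Phi> (z(0 := c)) \<partial>power_measure R N) \<in> borel_measurable borel"
  by (rule measurable_pm_integral[OF assms(3,4,2,1)]) (unfold split_beta, rule measurable_upd; simp)

text \<open>The number \<open>m\<close> plays two roles: it is the coordinate that is projected away
  and the index of the point that is merged into point 0. Point 0 carries its own exponent
  \<open>a\<close>, because it has already absorbed other points.\<close>

lemma step_beta:
  assumes R: "finite R" "m \<notin> R" and m: "m \<ge> 1"
  shows "\<exists>C. \<forall>\<Phi> \<Phi>'. cfg_inv (Suc m) \<Phi> \<longrightarrow> \<Phi>' \<in> borel_measurable borel \<longrightarrow> cfg_reduce m \<Phi> \<Phi>' \<longrightarrow>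
    (\<integral>\<^sup>+x. \<integral>\<^sup>+z. \<Phi> (z(0 := x)) \<partial>power_measure (insert m R) (beta_measure (Suc m) b) \<partial>beta_measure (Suc m) a) =
    C * (\<integral>\<^sup>+c. \<integral>\<^sup>+z. \<Phi>' (z(0 := c)) \<partial>power_measure R (beta_measure m (b + 1 / 2)) \<partial>beta_measure m (a + b + 1 + m / 2))"
proof -
  obtain C where C: "\<And>F F'. pair_inv (Suc m) F \<Longrightarrow> F' \<in> borel_measurable borel \<Longrightarrow>
    (\<And>c s t. s \<noteq> t \<Longrightarrow> F (c(m := s)) (c(m := t)) = F' c) \<Longrightarrow>
    (\<integral>\<^sup>+x. \<integral>\<^sup>+y. F x y \<partial>beta_measure (Suc m) b \<partial>beta_measure (Suc m) a) =
    C * (\<integral>\<^sup>+c. F' c \<partial>beta_measure m (a + b + 1 + m / 2))"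
    using beta_pair[of m a b] by blast
  have "(\<integral>\<^sup>+x. \<integral>\<^sup>+z. \<Phi> (z(0 := x)) \<partial>power_measure (insert m R) (beta_measure (Suc m) b) \<partial>beta_measure (Suc m) a) =
    (C * beta_mass b ^ card R) * (\<integral>\<^sup>+c. \<integral>\<^sup>+z. \<Phi>' (z(0 := c)) \<partial>power_measure R (beta_measure m (b + 1 / 2)) \<partial>beta_measure m (a + b + 1 + m / 2))"
    if \<Phi>: "cfg_inv (Suc m) \<Phi>" and \<Phi>': "\<Phi>' \<in> borel_measurable borel" and red: "cfg_reduce m \<Phi> \<Phi>'" for \<Phi> \<Phi>'
  proof -
    let ?F = "\<lambda>x y. \<integral>\<^sup>+z. \<Phi> (z(0 := x, m := y)) \<partial>power_measure R (beta_measure (Suc m) b)"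
    let ?F' = "\<lambda>c. beta_mass b ^ card R * (\<integral>\<^sup>+z. \<Phi>' (z(0 := c)) \<partial>power_measure R (beta_measure m (b + 1 / 2)))"
    have mP: "\<Phi> \<in> borel_measurable borel" using \<Phi> by (simp add: cfg_inv_def)
    have mF': "(\<lambda>c. \<integral>\<^sup>+z. \<Phi>' (z(0 := c)) \<partial>power_measure R (beta_measure m (b + 1 / 2))) \<in> borel_measurable borel"
      by (rule measurable_pm_upd0[OF \<Phi>' R(1) sigma_finite_Nb sets_Nb])
    have "(\<integral>\<^sup>+x. \<integral>\<^sup>+z. \<Phi> (z(0 := x)) \<partial>power_measure (insert m R) (beta_measure (Suc m) b) \<partial>beta_measure (Suc m) a) =
        (\<integral>\<^sup>+x. \<integral>\<^sup>+y. \<integral>\<^sup>+z. \<Phi> ((z(m := y))(0 := x)) \<partial>power_measure R (beta_measure (Suc m) b) \<partial>beta_measure (Suc m) b \<partial>beta_measure (Suc m) a)"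
      by (rule nn_integral_cong, rule pm_insert_swap[OF sigma_finite_Nb sets_Nb R],
          rule measurable_comp[OF mP], rule measurable_upd) simp_all
    also have "\<dots> = (\<integral>\<^sup>+x. \<integral>\<^sup>+y. ?F x y \<partial>beta_measure (Suc m) b \<partial>beta_measure (Suc m) a)"
      using m by (simp only: fun_upd_twist[of m 0])
    also have "\<dots> = C * (\<integral>\<^sup>+c. ?F' c \<partial>beta_measure m (a + b + 1 + m / 2))"
    proof (rule C[OF pair_inv_config[OF reflect_inv_Nb R(1) \<Phi>]])
      show "?F' \<in> borel_measurable borel" using mF' by simp
      fix c :: "nat \<Rightarrow> real" and s t :: real assume "s \<noteq> t"
      then have "?F (c(m := s)) (c(m := t)) = (\<integral>\<^sup>+z. \<Phi>' ((\<lambda>i. (z i)(m := 0))(0 := c)) \<partial>power_measure R (beta_measure (Suc m) b))"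
        using red unfolding cfg_reduce_def by simp
      also have "\<dots> = ?F' c"
        by (rule reduce_tail[OF R(1) sigma_finite_Nb sets_Nb \<Phi>' Nb_project])
      finally show "?F (c(m := s)) (c(m := t)) = ?F' c" .
    qed
    also have "(\<integral>\<^sup>+c. ?F' c \<partial>beta_measure m (a + b + 1 + m / 2)) =
      beta_mass b ^ card R * (\<integral>\<^sup>+c. \<integral>\<^sup>+z. \<Phi>' (z(0 := c)) \<partial>power_measure R (beta_measure m (b + 1 / 2)) \<partial>beta_measure m (a + b + 1 + m / 2))"
      by (rule nn_integral_cmult) (use mF' in \<open>simp add: measurable_def\<close>)
    finally show ?thesis by (simp only: mult.assoc)
  qed
  then show ?thesis by blast
qed

lemma step_sphere:
  assumes R: "finite R" "m \<notin> R" "0 \<notin> R" and m: "m \<ge> 1"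
  shows "\<exists>C. \<forall>\<Phi> \<Phi>'. cfg_inv (Suc m) \<Phi> \<longrightarrow> \<Phi>' \<in> borel_measurable borel \<longrightarrow> cfg_reduce m \<Phi> \<Phi>' \<longrightarrow>
    (\<integral>\<^sup>+z. \<Phi> z \<partial>power_measure (insert 0 (insert m R)) (uniform_sphere (Suc m))) =
    C * (\<integral>\<^sup>+c. \<integral>\<^sup>+z. \<Phi>' (z(0 := c)) \<partial>power_measure R (beta_measure m (- 1 / 2)) \<partial>beta_measure m ((real m - 2) / 2))"
proof -
  obtain C where C: "\<And>F. pair_inv (Suc m) F \<Longrightarrow> (\<integral>\<^sup>+x. \<integral>\<^sup>+y. F x y \<partial>uniform_sphere (Suc m) \<partial>uniform_sphere (Suc m)) =
    C * (\<integral>\<^sup>+c. F (c(m := sqrt (1 - ip m c c))) (c(m := - sqrt (1 - ip m c c))) \<partial>beta_measure m ((real m - 2) / 2))"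
    using sphere_pair[OF m] by blast
  obtain B where B: "\<And>g :: (nat \<Rightarrow> real) \<Rightarrow> ennreal. g \<in> borel_measurable borel \<Longrightarrow>
    (\<integral>\<^sup>+x. g (x(m := 0)) \<partial>uniform_sphere (Suc m)) = B * (\<integral>\<^sup>+x. g x \<partial>beta_measure m (- 1 / 2))"
    using S_project[OF m] by blast
  have "(\<integral>\<^sup>+z. \<Phi> z \<partial>power_measure (insert 0 (insert m R)) (uniform_sphere (Suc m))) =
    (C * B ^ card R) * (\<integral>\<^sup>+c. \<integral>\<^sup>+z. \<Phi>' (z(0 := c)) \<partial>power_measure R (beta_measure m (- 1 / 2)) \<partial>beta_measure m ((real m - 2) / 2))"
    if \<Phi>: "cfg_inv (Suc m) \<Phi>" and \<Phi>': "\<Phi>' \<in> borel_measurable borel" and red: "cfg_reduce m \<Phi> \<Phi>'" for \<Phi> \<Phi>'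
  proof -
    let ?F = "\<lambda>x y. \<integral>\<^sup>+z. \<Phi> (z(0 := x, m := y)) \<partial>power_measure R (uniform_sphere (Suc m))"
    let ?G = "\<lambda>c. \<integral>\<^sup>+z. \<Phi>' (z(0 := c)) \<partial>power_measure R (beta_measure m (- 1 / 2))"
    have mP: "\<Phi> \<in> borel_measurable borel" using \<Phi> by (simp add: cfg_inv_def)
    have G: "?G \<in> borel_measurable borel"
      by (rule measurable_pm_upd0[OF \<Phi>' R(1) sigma_finite_Nb sets_Nb])
    have pF: "pair_inv (Suc m) ?F" by (rule pair_inv_config[OF reflect_inv_S R(1) \<Phi>])
    have "(\<integral>\<^sup>+z. \<Phi> z \<partial>power_measure (insert 0 (insert m R)) (uniform_sphere (Suc m))) =
        (\<integral>\<^sup>+x. \<integral>\<^sup>+z. \<Phi> (z(0 := x)) \<partial>power_measure (insert m R) (uniform_sphere (Suc m)) \<partial>uniform_sphere (Suc m))"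
      by (rule pm_insert_swap[OF sigma_finite_S sets_S _ _ mP]) (use R m in auto)
    also have "\<dots> = (\<integral>\<^sup>+x. \<integral>\<^sup>+y. \<integral>\<^sup>+z. \<Phi> ((z(m := y))(0 := x)) \<partial>power_measure R (uniform_sphere (Suc m)) \<partial>uniform_sphere (Suc m) \<partial>uniform_sphere (Suc m))"
      by (rule nn_integral_cong, rule pm_insert_swap[OF sigma_finite_S sets_S R(1,2)],
          rule measurable_comp[OF mP], rule measurable_upd) simp_all
    also have "\<dots> = (\<integral>\<^sup>+x. \<integral>\<^sup>+y. ?F x y \<partial>uniform_sphere (Suc m) \<partial>uniform_sphere (Suc m))"
      using m by (simp only: fun_upd_twist[of m 0])
    also have "\<dots> = C * (\<integral>\<^sup>+c. ?F (c(m := sqrt (1 - ip m c c))) (c(m := - sqrt (1 - ip m c c))) \<partial>beta_measure m ((real m - 2) / 2))"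
      by (rule C[OF pF])
    also have "(\<integral>\<^sup>+c. ?F (c(m := sqrt (1 - ip m c c))) (c(m := - sqrt (1 - ip m c c))) \<partial>beta_measure m ((real m - 2) / 2)) =
      (\<integral>\<^sup>+c. beta_weight ((real m - 2) / 2) (ip m c c) * ?F (c(m := sqrt (1 - ip m c c))) (c(m := - sqrt (1 - ip m c c))) \<partial>lborel_dim m)"
      by (rule nn_integral_Nb, rule pair_inv_measurable[OF pF]; rule measurable_upd) simp_all
    also have "\<dots> = (\<integral>\<^sup>+c. beta_weight ((real m - 2) / 2) (ip m c c) * (B ^ card R * ?G c) \<partial>lborel_dim m)"
    proof (rule nn_integral_cong)
      fix c
      \<comment> \<open>\<open>cfg_reduce\<close> asks for distinct heights, which
        \<open>ip m c c < 1\<close> provides; elsewhere the weight vanishes.\<close>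
      have "?F (c(m := sqrt (1 - ip m c c))) (c(m := - sqrt (1 - ip m c c))) = B ^ card R * ?G c" if "ip m c c < 1"
      proof -
        have "?F (c(m := sqrt (1 - ip m c c))) (c(m := - sqrt (1 - ip m c c))) =
            (\<integral>\<^sup>+z. \<Phi>' ((\<lambda>i. (z i)(m := 0))(0 := c)) \<partial>power_measure R (uniform_sphere (Suc m)))"
          using red that unfolding cfg_reduce_def by simp
        also have "\<dots> = B ^ card R * ?G c"
          by (rule reduce_tail[OF R(1) sigma_finite_S sets_S \<Phi>' B])
        finally show ?thesis .
      qed
      then show "beta_weight ((real m - 2) / 2) (ip m c c) * ?F (c(m := sqrt (1 - ip m c c))) (c(m := - sqrt (1 - ip m c c))) =
        beta_weight ((real m - 2) / 2) (ip m c c) * (B ^ card R * ?G c)"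
        by (cases "ip m c c < 1") (simp_all add: beta_weight_def)
    qed
    also have "\<dots> = (\<integral>\<^sup>+c. B ^ card R * ?G c \<partial>beta_measure m ((real m - 2) / 2))"
      by (rule nn_integral_Nb[symmetric]) (use G in simp)
    also have "\<dots> = B ^ card R * (\<integral>\<^sup>+c. ?G c \<partial>beta_measure m ((real m - 2) / 2))"
      by (rule nn_integral_cmult) (use G in \<open>simp add: measurable_def\<close>)
    finally show ?thesis by (simp only: mult.assoc)
  qed
  then show ?thesis by blast
qed

definition cfg_family :: "nat \<Rightarrow> (nat \<Rightarrow> (nat \<Rightarrow> nat \<Rightarrow> real) \<Rightarrow> ennreal) \<Rightarrow> bool"
  where "cfg_family d \<Phi> \<longleftrightarrow> (\<forall>D\<in>{1..d}. cfg_inv D (\<Phi> D)) \<and>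
    (\<forall>D\<in>{1..<d}. cfg_reduce D (\<Phi> (Suc D)) (\<Phi> D))"

text \<open>The constant is quantified before the family, so a single family determines it for all.
  The induction descends in \<open>D\<close>: at level \<open>D\<close> the points 0 to
  \<open>D - 1\<close> of the first block are left, and the points in \<open>L\<close> are only
  projected, never merged.\<close>

theorem reduction:
  assumes d: "d \<ge> 2" and L: "finite L" "L \<inter> {..<d} = {}"
  shows "\<exists>C. \<forall>\<Phi>. cfg_family d \<Phi> \<longrightarrow> (\<integral>\<^sup>+z. \<Phi> d z \<partial>power_measure ({..<d} \<union> L) (uniform_sphere d)) =
    C * (\<integral>\<^sup>+x. \<integral>\<^sup>+z. \<Phi> 1 (z(0 := x)) \<partial>power_measure L (beta_measure 1 ((real d - 3) / 2)) \<partial>beta_measure 1 ((real d - 1)\<^sup>2 / 2 - 1))"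
proof -
  obtain m where m: "d = Suc m" "m \<ge> 1" using d by (cases d) auto
  \<comment> \<open>Closed forms of the recursions in \<open>step_beta\<close>: each projection adds
    1/2 to \<open>b\<close>, each merging takes \<open>a\<close> to
    \<open>a + b + 1 + D / 2\<close>, starting from -1/2 and \<open>(real m - 2) / 2\<close> at
    \<open>D = m\<close>.\<close>
  let ?b = "\<lambda>D. (real d - real D) / 2 - 1" and ?a = "\<lambda>D. (real d - real D) * (real d - 1) / 2 - 1"
  have "\<exists>C. \<forall>\<Phi>. cfg_family d \<Phi> \<longrightarrow> (\<integral>\<^sup>+z. \<Phi> d z \<partial>power_measure ({..<d} \<union> L) (uniform_sphere d)) =
    C * (\<integral>\<^sup>+x. \<integral>\<^sup>+z. \<Phi> D (z(0 := x)) \<partial>power_measure ({1..<D} \<union> L) (beta_measure D (?b D)) \<partial>beta_measure D (?a D))"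
    if "1 \<le> D" "D \<le> m" for D
    using that(2,1)
  proof (induction rule: inc_induct)
    case base
    let ?R = "{1..<m} \<union> L"
    have R: "{..<d} \<union> L = insert 0 (insert m ?R)" using m by auto
    have "\<exists>C. \<forall>\<Phi> \<Phi>'. cfg_inv (Suc m) \<Phi> \<longrightarrow> \<Phi>' \<in> borel_measurable borel \<longrightarrow> cfg_reduce m \<Phi> \<Phi>' \<longrightarrow>
      (\<integral>\<^sup>+z. \<Phi> z \<partial>power_measure (insert 0 (insert m ?R)) (uniform_sphere (Suc m))) =
      C * (\<integral>\<^sup>+c. \<integral>\<^sup>+z. \<Phi>' (z(0 := c)) \<partial>power_measure ?R (beta_measure m (- 1 / 2)) \<partial>beta_measure m ((real m - 2) / 2))"
      by (rule step_sphere) (use L m in auto)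
    then obtain C where C: "\<And>\<Phi> \<Phi>'. cfg_inv (Suc m) \<Phi> \<Longrightarrow> \<Phi>' \<in> borel_measurable borel \<Longrightarrow> cfg_reduce m \<Phi> \<Phi>' \<Longrightarrow>
      (\<integral>\<^sup>+z. \<Phi> z \<partial>power_measure (insert 0 (insert m ?R)) (uniform_sphere (Suc m))) =
      C * (\<integral>\<^sup>+c. \<integral>\<^sup>+z. \<Phi>' (z(0 := c)) \<partial>power_measure ?R (beta_measure m (- 1 / 2)) \<partial>beta_measure m ((real m - 2) / 2))"
      by blast
    have e: "?b m = - 1 / 2" "?a m = (real m - 2) / 2" using m by (simp_all add: field_simps)
    have "(\<integral>\<^sup>+z. \<Phi> d z \<partial>power_measure ({..<d} \<union> L) (uniform_sphere d)) =
      C * (\<integral>\<^sup>+x. \<integral>\<^sup>+z. \<Phi> m (z(0 := x)) \<partial>power_measure ?R (beta_measure m (?b m)) \<partial>beta_measure m (?a m))" if "cfg_family d \<Phi>" for \<Phi>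
      unfolding e R using that m C[of "\<Phi> d" "\<Phi> m"] by (auto simp: cfg_family_def cfg_inv_def)
    then show ?case by blast
  next
    case (step D)
    have D1: "1 \<le> Suc D" by simp
    from step.IH[OF D1] obtain C where C: "\<And>\<Phi>. cfg_family d \<Phi> \<Longrightarrow> (\<integral>\<^sup>+z. \<Phi> d z \<partial>power_measure ({..<d} \<union> L) (uniform_sphere d)) =
      C * (\<integral>\<^sup>+x. \<integral>\<^sup>+z. \<Phi> (Suc D) (z(0 := x)) \<partial>power_measure ({1..<Suc D} \<union> L) (beta_measure (Suc D) (?b (Suc D))) \<partial>beta_measure (Suc D) (?a (Suc D)))"
      by blast
    let ?R = "{1..<D} \<union> L"
    have R: "{1..<Suc D} \<union> L = insert D ?R" using step.prems by auto
    have "\<exists>C. \<forall>\<Phi> \<Phi>'. cfg_inv (Suc D) \<Phi> \<longrightarrow> \<Phi>' \<in> borel_measurable borel \<longrightarrow> cfg_reduce D \<Phi> \<Phi>' \<longrightarrow>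
      (\<integral>\<^sup>+x. \<integral>\<^sup>+z. \<Phi> (z(0 := x)) \<partial>power_measure (insert D ?R) (beta_measure (Suc D) (?b (Suc D))) \<partial>beta_measure (Suc D) (?a (Suc D))) =
      C * (\<integral>\<^sup>+c. \<integral>\<^sup>+z. \<Phi>' (z(0 := c)) \<partial>power_measure ?R (beta_measure D (?b (Suc D) + 1 / 2)) \<partial>beta_measure D (?a (Suc D) + ?b (Suc D) + 1 + D / 2))"
      by (rule step_beta) (use L m step.prems step.hyps in auto)
    then obtain C' where C': "\<And>\<Phi> \<Phi>'. cfg_inv (Suc D) \<Phi> \<Longrightarrow> \<Phi>' \<in> borel_measurable borel \<Longrightarrow> cfg_reduce D \<Phi> \<Phi>' \<Longrightarrow>
      (\<integral>\<^sup>+x. \<integral>\<^sup>+z. \<Phi> (z(0 := x)) \<partial>power_measure (insert D ?R) (beta_measure (Suc D) (?b (Suc D))) \<partial>beta_measure (Suc D) (?a (Suc D))) =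
      C' * (\<integral>\<^sup>+c. \<integral>\<^sup>+z. \<Phi>' (z(0 := c)) \<partial>power_measure ?R (beta_measure D (?b (Suc D) + 1 / 2)) \<partial>beta_measure D (?a (Suc D) + ?b (Suc D) + 1 + D / 2))"
      by blast
    have e: "?b (Suc D) + 1 / 2 = ?b D" "?a (Suc D) + ?b (Suc D) + 1 + D / 2 = ?a D"
      by (simp_all add: field_simps)
    have "(\<integral>\<^sup>+z. \<Phi> d z \<partial>power_measure ({..<d} \<union> L) (uniform_sphere d)) =
      (C * C') * (\<integral>\<^sup>+x. \<integral>\<^sup>+z. \<Phi> D (z(0 := x)) \<partial>power_measure ?R (beta_measure D (?b D)) \<partial>beta_measure D (?a D))" if F: "cfg_family d \<Phi>" for \<Phi>
    proof -
      have "cfg_inv (Suc D) (\<Phi> (Suc D))" "\<Phi> D \<in> borel_measurable borel" "cfg_reduce D (\<Phi> (Suc D)) (\<Phi> D)"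
        using F m step.prems step.hyps by (auto simp: cfg_family_def cfg_inv_def)
      from C'[OF this] show ?thesis unfolding C[OF F] R e by (simp only: mult.assoc)
    qed
    then show ?case by blast
  qed
  from this[of 1] m obtain C where C: "\<And>\<Phi>. cfg_family d \<Phi> \<Longrightarrow> (\<integral>\<^sup>+z. \<Phi> d z \<partial>power_measure ({..<d} \<union> L) (uniform_sphere d)) =
    C * (\<integral>\<^sup>+x. \<integral>\<^sup>+z. \<Phi> 1 (z(0 := x)) \<partial>power_measure ({1..<1} \<union> L) (beta_measure 1 (?b 1)) \<partial>beta_measure 1 (?a 1))" by auto
  have L0: "{1..<1} \<union> L = L" by simp
  have e: "?b 1 = (real d - 3) / 2" "?a 1 = (real d - 1)\<^sup>2 / 2 - 1" by (simp_all add: field_simps power2_eq_square)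
  from C[unfolded e L0] show ?thesis by blast
qed

subsection \<open>Measurability by compactness\<close>

definition pbox :: "real \<Rightarrow> (nat \<Rightarrow> real) set"
  where "pbox N = {p. \<forall>i. \<bar>p i\<bar> \<le> N}"

lemma compact_pbox: "compact (pbox N)"
proof -
  have "pbox N = PiE UNIV (\<lambda>_. {- N..N})"
    by (auto simp: pbox_def abs_le_iff PiE_def Pi_def minus_le_iff)
  moreover have "compactin (product_topology (\<lambda>_ :: nat. euclidean :: real topology) UNIV) (PiE UNIV (\<lambda>_. {- N..N}))"
    by (subst compactin_PiE) simp
  ultimately show ?thesis by (simp add: euclidean_product_topology)
qed

text \<open>Projection along a compact factor is a closed map, so existential quantifiers over
  normalised parameters preserve closedness.\<close>

lemma closed_ex_pbox:
  assumes "closed {x :: (nat \<Rightarrow> real) \<times> 'a :: topological_space. P (snd x) (fst x)}"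
  shows "closed {z. \<exists>p\<in>pbox N. P z p}"
proof -
  have c: "compact_space (top_of_set (pbox N))"
    by (simp add: compact_space_subtopology compact_pbox)
  have "closed_map (prod_topology (top_of_set (pbox N)) (euclidean :: 'a topology)) euclidean snd"
    by (rule closed_map_snd[OF c])
  moreover have "closedin (prod_topology (top_of_set (pbox N)) euclidean)
      ((pbox N \<times> UNIV) \<inter> {x :: (nat \<Rightarrow> real) \<times> 'a. P (snd x) (fst x)})"
  proof -
    have "prod_topology (top_of_set (pbox N)) (euclidean :: 'a topology) = top_of_set (pbox N \<times> UNIV)"
      by (simp add: prod_topology_subtopology)
    then show ?thesis using assms by (auto intro: closedin_closed_Int)
  qed
  ultimately have "closedin euclidean (snd ` ((pbox N \<times> UNIV) \<inter> {x :: (nat \<Rightarrow> real) \<times> 'a. P (snd x) (fst x)}))"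
    by (simp add: closed_map_def)
  moreover have "snd ` ((pbox N \<times> UNIV) \<inter> {x :: (nat \<Rightarrow> real) \<times> 'a. P (snd x) (fst x)}) = {z. \<exists>p\<in>pbox N. P z p}"
    by force
  ultimately show ?thesis by simp
qed

lemma closed_ball_Collect: "(\<And>i. i \<in> A \<Longrightarrow> closed {x. Q i x}) \<Longrightarrow> closed {x. \<forall>i\<in>A. Q i x}"
  using closed_INT[of A "\<lambda>i. {x. Q i x}"] by (simp add: Collect_ball_eq)

lemma closed_bex_Collect: "finite A \<Longrightarrow> (\<And>i. i \<in> A \<Longrightarrow> closed {x. Q i x}) \<Longrightarrow> closed {x. \<exists>i\<in>A. Q i x}"
  using closed_UN[of A "\<lambda>i. {x. Q i x}"] by (simp add: Collect_bex_eq)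

lemma continuous_param [continuous_intros]:
  "continuous_on UNIV (\<lambda>x :: (nat \<Rightarrow> real) \<times> (nat \<Rightarrow> nat \<Rightarrow> real). fst x i)"
  by (rule continuous_on_compose2[OF continuous_on_product_coordinates]) (auto intro: continuous_intros)

lemma continuous_config [continuous_intros]:
  "continuous_on UNIV (\<lambda>x :: (nat \<Rightarrow> real) \<times> (nat \<Rightarrow> nat \<Rightarrow> real). snd x i k)"
  by (rule continuous_on_compose2[OF continuous_on_product_coordinates],
      rule continuous_on_compose2[OF continuous_on_product_coordinates]) (auto intro: continuous_intros)

text \<open>Affine dependence of the family \<open>z\<close> over the index set \<open>I\<close>, as
  far as the coordinates in \<open>K\<close> can tell. It is a property of the family, so repeated
  points count as dependent.\<close>

definition dep :: "nat set \<Rightarrow> nat set \<Rightarrow> (nat \<Rightarrow> nat \<Rightarrow> real) \<Rightarrow> bool"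
  where "dep I K z \<longleftrightarrow> (\<exists>p. (\<exists>i\<in>I. p i \<noteq> 0) \<and> (\<Sum>i\<in>I. p i) = 0 \<and> (\<forall>k\<in>K. (\<Sum>i\<in>I. p i * z i k) = 0))"

text \<open>Dividing by the largest coefficient confines \<open>p\<close> to a compact cube and
  turns the open condition of not vanishing into the closed condition that some coefficient has
  absolute value 1.\<close>

lemma dep_pbox:
  assumes I: "finite I"
  shows "dep I K z \<longleftrightarrow> (\<exists>p\<in>pbox 1. (\<exists>i\<in>I. \<bar>p i\<bar> = 1) \<and> (\<Sum>i\<in>I. p i) = 0 \<and> (\<forall>k\<in>K. (\<Sum>i\<in>I. p i * z i k) = 0))"
    (is "_ \<longleftrightarrow> ?R")
proof
  assume "dep I K z"
  then obtain p where p: "\<exists>i\<in>I. p i \<noteq> 0" "(\<Sum>i\<in>I. p i) = 0" "\<And>k. k \<in> K \<Longrightarrow> (\<Sum>i\<in>I. p i * z i k) = 0"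
    by (auto simp: dep_def)
  define M where "M = Max ((\<lambda>i. \<bar>p i\<bar>) ` I)"
  have ne: "finite ((\<lambda>i. \<bar>p i\<bar>) ` I)" "(\<lambda>i. \<bar>p i\<bar>) ` I \<noteq> {}" using I p(1) by auto
  have M: "\<bar>p i\<bar> \<le> M" if "i \<in> I" for i unfolding M_def using that I by (intro Max_ge) auto
  have "M \<in> (\<lambda>i. \<bar>p i\<bar>) ` I" unfolding M_def by (rule Max_in[OF ne])
  then obtain j where j: "j \<in> I" "\<bar>p j\<bar> = M" by auto
  have M0: "M > 0" using p(1) M by force
  define q where "q i = (if i \<in> I then p i / M else 0)" for i
  have "q \<in> pbox 1" using M M0 by (auto simp: pbox_def q_def divide_le_eq_1)
  moreover have "\<bar>q j\<bar> = 1" using j M0 by (auto simp: q_def)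
  moreover have "(\<Sum>i\<in>I. q i) = (\<Sum>i\<in>I. p i) / M" by (simp add: q_def sum_divide_distrib)
  moreover have "(\<Sum>i\<in>I. q i * z i k) = (\<Sum>i\<in>I. p i * z i k) / M" for k by (simp add: q_def sum_divide_distrib)
  ultimately have "(\<exists>i\<in>I. \<bar>q i\<bar> = 1) \<and> (\<Sum>i\<in>I. q i) = 0 \<and> (\<forall>k\<in>K. (\<Sum>i\<in>I. q i * z i k) = 0)"
    using p(2,3) j(1) by auto
  with \<open>q \<in> pbox 1\<close> show ?R by blast
next
  assume ?R
  then obtain p i where "i \<in> I" "\<bar>p i\<bar> = 1" "(\<Sum>i\<in>I. p i) = 0" "\<forall>k\<in>K. (\<Sum>i\<in>I. p i * z i k) = 0"
    by blast
  moreover from this have "p i \<noteq> 0" by auto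
  ultimately show "dep I K z" unfolding dep_def by (intro exI[of _ p]) blast
qed

lemma closed_dep:
  assumes "finite I"
  shows "closed {z. dep I K z}"
  unfolding dep_pbox[OF assms]
  by (rule closed_ex_pbox) (intro closed_Collect_conj closed_bex_Collect closed_ball_Collect closed_Collect_eq
      continuous_intros assms)

lemma sets_dep: "finite I \<Longrightarrow> {z. dep I K z} \<in> sets borel"
  by (rule borel_closed[OF closed_dep])

text \<open>
  The points in \<open>{..<D}\<close> lie on a hyperplane that has the points in \<open>L\<close> on one side, at distance at
  least \<open>e\<close>. The distance makes the condition closed, so that its strict version is an \<open>F\<^sub>\<sigma>\<close> set.
\<close>

definition supp :: "nat \<Rightarrow> nat set \<Rightarrow> real \<Rightarrow> (nat \<Rightarrow> nat \<Rightarrow> real) \<Rightarrow> bool"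
  where "supp D L e z \<longleftrightarrow> (\<exists>u. ip D u u = 1 \<and> (\<forall>i\<in>{..<D}. ip D u (z i) = ip D u (z 0)) \<and>
    (\<forall>l\<in>L. ip D u (z l) \<le> ip D u (z 0) - e))"

definition ssupp :: "nat \<Rightarrow> nat set \<Rightarrow> (nat \<Rightarrow> nat \<Rightarrow> real) \<Rightarrow> bool"
  where "ssupp D L z \<longleftrightarrow> (\<exists>u. ip D u u = 1 \<and> (\<forall>i\<in>{..<D}. ip D u (z i) = ip D u (z 0)) \<and>
    (\<forall>l\<in>L. ip D u (z l) < ip D u (z 0)))"

lemma supp_pbox:
  "supp D L e z \<longleftrightarrow> (\<exists>u\<in>pbox 1. ip D u u = 1 \<and> (\<forall>i\<in>{..<D}. ip D u (z i) = ip D u (z 0)) \<and>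
    (\<forall>l\<in>L. ip D u (z l) \<le> ip D u (z 0) - e))" (is "_ \<longleftrightarrow> ?R")
proof
  assume "supp D L e z"
  then obtain u where u: "ip D u u = 1" "\<forall>i\<in>{..<D}. ip D u (z i) = ip D u (z 0)"
    "\<forall>l\<in>L. ip D u (z l) \<le> ip D u (z 0) - e" by (auto simp: supp_def)
  define v where "v i = (if i < D then u i else 0)" for i
  have v: "ip D v w = ip D u w" for w by (simp add: ip_def v_def)
  have "\<bar>v i\<bar> \<le> 1" for i
  proof (cases "i < D")
    case True
    then have "u i * u i \<le> ip D u u" unfolding ip_def by (intro member_le_sum) auto
    then show ?thesis using True u(1) by (simp add: v_def abs_square_le_1[symmetric] power2_eq_square)
  qed (simp add: v_def)
  then have "v \<in> pbox 1" by (simp add: pbox_def)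
  moreover have "ip D u v = 1" using u(1) v[of u] by (simp only: ip_commute[of D u v])
  then have "ip D v v = 1 \<and> (\<forall>i\<in>{..<D}. ip D v (z i) = ip D v (z 0)) \<and>
      (\<forall>l\<in>L. ip D v (z l) \<le> ip D v (z 0) - e)"
    using u(2,3) unfolding v by blast
  ultimately show ?R by blast
qed (auto simp: supp_def)

lemma closed_supp: "closed {z. supp D L e z}"
  unfolding supp_pbox ip_def
  by (rule closed_ex_pbox) (intro closed_Collect_conj closed_ball_Collect closed_Collect_eq closed_Collect_le
      continuous_intros)

lemma ssupp_supp:
  assumes "finite L"
  shows "ssupp D L z \<longleftrightarrow> (\<exists>n. supp D L (1 / real (Suc n)) z)"
proof
  assume "ssupp D L z"
  then obtain u where u: "ip D u u = 1" "\<forall>i\<in>{..<D}. ip D u (z i) = ip D u (z 0)"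
    "\<forall>l\<in>L. ip D u (z l) < ip D u (z 0)" by (auto simp: ssupp_def)
  have "\<exists>e>0. \<forall>l\<in>L. ip D u (z l) \<le> ip D u (z 0) - e"
  proof (cases "L = {}")
    case False
    define M where "M = Max ((\<lambda>l. ip D u (z l)) ` L)"
    have "M < ip D u (z 0)" unfolding M_def using u(3) assms False by (subst Max_less_iff) auto
    moreover have "ip D u (z l) \<le> M" if "l \<in> L" for l
      unfolding M_def using that assms by (intro Max_ge) auto
    ultimately show ?thesis by (intro exI[of _ "ip D u (z 0) - M"]) auto
  qed (auto intro: exI[of _ 1])
  then obtain e where e: "e > 0" "\<And>l. l \<in> L \<Longrightarrow> ip D u (z l) \<le> ip D u (z 0) - e" by auto
  obtain n where "inverse (real (Suc n)) < e" using reals_Archimedean[OF e(1)] by auto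
  then have "1 / real (Suc n) \<le> e" by (simp add: inverse_eq_divide)
  then have "supp D L (1 / real (Suc n)) z"
    unfolding supp_def using u e by (intro exI[of _ u]) force
  then show "\<exists>n. supp D L (1 / real (Suc n)) z" ..
next
  assume "\<exists>n. supp D L (1 / real (Suc n)) z"
  then obtain n u where "ip D u u = 1" "\<forall>i\<in>{..<D}. ip D u (z i) = ip D u (z 0)"
    "\<forall>l\<in>L. ip D u (z l) \<le> ip D u (z 0) - 1 / real (Suc n)" by (auto simp: supp_def)
  moreover have "ip D u (z 0) - 1 / real (Suc n) < ip D u (z 0)" by simp
  ultimately show "ssupp D L z" unfolding ssupp_def by (blast intro: le_less_trans)
qed

lemma sets_ssupp:
  assumes "finite L"
  shows "{z. ssupp D L z} \<in> sets borel"
proof -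
  have "{z. ssupp D L z} = (\<Union>n. {z. supp D L (1 / real (Suc n)) z})"
    using ssupp_supp[OF assms] by auto
  moreover have "(\<Union>n. {z. supp D L (1 / real (Suc n)) z}) \<in> sets borel"
    by (rule sets.countable_nat_UN) (blast intro: borel_closed closed_supp)
  ultimately show ?thesis by simp
qed

subsection \<open>The two events\<close>

text \<open>The two events enclose the event that the first \<open>D\<close> points span a facet:
  weak inequalities are necessary for it, strict ones with affine independence are sufficient. The
  gap is closed in dimension one, where both lead to the same integral up to a factor two.\<close>

definition upper_event :: "nat set \<Rightarrow> nat \<Rightarrow> (nat \<Rightarrow> nat \<Rightarrow> real) \<Rightarrow> ennreal"
  where "upper_event L D = indicator {z. supp D L 0 z}"

definition lower_event :: "nat set \<Rightarrow> nat \<Rightarrow> (nat \<Rightarrow> nat \<Rightarrow> real) \<Rightarrow> ennreal"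
  where "lower_event L D = indicator {z. \<not> dep {..<D} {..<D} z \<and> ssupp D L z}"

lemma supp_reflect:
  assumes "supp D L e z"
  shows "supp D L e (\<lambda>i. reflect D v (z i))"
proof -
  obtain u where "ip D u u = 1" "\<forall>i\<in>{..<D}. ip D u (z i) = ip D u (z 0)"
    "\<forall>l\<in>L. ip D u (z l) \<le> ip D u (z 0) - e" using assms by (auto simp: supp_def)
  then show ?thesis unfolding supp_def by (intro exI[of _ "reflect D v u"], unfold ip_reflect, blast)
qed

lemma ssupp_reflect:
  assumes "ssupp D L z"
  shows "ssupp D L (\<lambda>i. reflect D v (z i))"
proof -
  obtain u where "ip D u u = 1" "\<forall>i\<in>{..<D}. ip D u (z i) = ip D u (z 0)"
    "\<forall>l\<in>L. ip D u (z l) < ip D u (z 0)" using assms by (auto simp: ssupp_def)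
  then show ?thesis unfolding ssupp_def by (intro exI[of _ "reflect D v u"], unfold ip_reflect, blast)
qed

lemma dep_reflect:
  assumes "dep I {..<D} z"
  shows "dep I {..<D} (\<lambda>i. reflect D v (z i))"
proof -
  obtain p where p: "\<exists>i\<in>I. p i \<noteq> 0" "(\<Sum>i\<in>I. p i) = 0" "\<And>k. k < D \<Longrightarrow> (\<Sum>i\<in>I. p i * z i k) = 0"
    using assms by (auto simp: dep_def)
  have v: "(\<Sum>i\<in>I. p i * ip D v (z i)) = 0"
  proof -
    have "(\<Sum>i\<in>I. p i * ip D v (z i)) = (\<Sum>k<D. v k * (\<Sum>i\<in>I. p i * z i k))"
      unfolding ip_def sum_distrib_left by (subst sum.swap) (simp add: mult_ac)
    then show ?thesis using p(3) by simp
  qed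
  have "(\<Sum>i\<in>I. p i * reflect D v (z i) k) = 0" if "k < D" for k
  proof -
    have "(\<Sum>i\<in>I. p i * reflect D v (z i) k) =
        (\<Sum>i\<in>I. p i * z i k - 2 * v k / ip D v v * (p i * ip D v (z i)))"
      by (intro sum.cong) (simp_all add: reflect_def scaleR_fun_def algebra_simps)
    also have "\<dots> = (\<Sum>i\<in>I. p i * z i k) - 2 * v k / ip D v v * (\<Sum>i\<in>I. p i * ip D v (z i))"
      by (simp add: sum_subtractf sum_distrib_left)
    finally show ?thesis using p(3)[OF that] v by simp
  qed
  with p(1,2) show ?thesis unfolding dep_def by (intro exI[of _ p]) auto
qed

lemma reflect_iff:
  assumes "\<And>z. P z \<Longrightarrow> P (\<lambda>i. reflect D v (z i))"
  shows "P (\<lambda>i. reflect D v (z i)) \<longleftrightarrow> P z"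
  using assms[of z] assms[of "\<lambda>i. reflect D v (z i)"] by auto

lemma ip_Suc: "ip (Suc m) x y = ip m x y + x m * y m"
  by (simp add: ip_def)

text \<open>The points 0 and \<open>m\<close> differ only in coordinate \<open>m\<close>, so a
  normal that takes the same value on both has \<open>u m = 0\<close> and is a normal for the
  projections. Conversely, a normal downstairs is extended by 0. The relation \<open>R\<close>
  stands for the weak or the strict inequality, to serve both events.\<close>

lemma supp_reduce_aux:
  assumes m: "m \<ge> 1" "L \<inter> {..<Suc m} = {}" and st: "s \<noteq> (t :: real)"
    and w: "w = z(0 := c(m := s), m := c(m := t))" and w': "w' = (\<lambda>i. (z i)(m := 0))(0 := c)"
    and R: "\<And>x y d. R (x :: real) y \<longleftrightarrow> R (x + d) (y + d)"
  shows "(\<exists>u. ip (Suc m) u u = 1 \<and> (\<forall>i\<in>{..<Suc m}. ip (Suc m) u (w i) = ip (Suc m) u (w 0)) \<and>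
      (\<forall>l\<in>L. R (ip (Suc m) u (w l)) (ip (Suc m) u (w 0)))) \<longleftrightarrow>
    (\<exists>u. ip m u u = 1 \<and> (\<forall>i\<in>{..<m}. ip m u (w' i) = ip m u (w' 0)) \<and>
      (\<forall>l\<in>L. R (ip m u (w' l)) (ip m u (w' 0))))" (is "?A \<longleftrightarrow> ?B")
proof
  have w0: "w 0 = c(m := s)" "w m = c(m := t)" "w' 0 = c" using m by (simp_all add: w w')
  have wi: "w i = z i" "w' i = (z i)(m := 0)" if "i \<noteq> 0" "i \<noteq> m" for i using that by (simp_all add: w w')
  have L: "l \<noteq> 0" "l \<noteq> m" if "l \<in> L" for l using that m by auto
  have ipm: "ip m u (x(m := r)) = ip m u x" for u x r by (simp add: ip_def)
  {
    assume ?A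
    then obtain u where u: "ip (Suc m) u u = 1" "\<forall>i\<in>{..<Suc m}. ip (Suc m) u (w i) = ip (Suc m) u (w 0)"
      "\<forall>l\<in>L. R (ip (Suc m) u (w l)) (ip (Suc m) u (w 0))" by blast
    have "ip (Suc m) u (w m) = ip (Suc m) u (w 0)" using u(2) by blast
    then have "u m * (t - s) = 0" by (simp add: w0 ip_Suc ipm algebra_simps)
    then have um: "u m = 0" using st by simp
    have e: "ip (Suc m) u x = ip m u x" for x by (simp add: ip_Suc um)
    have ww: "ip m u (w' i) = ip m u (w i)" if "i \<noteq> m" for i
      using that wi[of i] w0 by (cases "i = 0") (simp_all add: ipm)
    have m0: "0 \<noteq> m" using m by simp
    show ?B
    proof (intro exI[of _ u] conjI ballI)
      show "ip m u u = 1" using u(1) by (simp only: e)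
      show "ip m u (w' i) = ip m u (w' 0)" if "i \<in> {..<m}" for i
      proof -
        have "i \<in> {..<Suc m}" "i \<noteq> m" using that by auto
        then show ?thesis using u(2) ww m0 unfolding e by metis
      qed
      show "R (ip m u (w' l)) (ip m u (w' 0))" if "l \<in> L" for l
        using u(3) that by (simp only: e ww[OF m0] ww[OF L(2)[OF that]])
    qed
  next
    assume ?B
    then obtain u where u: "ip m u u = 1" "\<forall>i\<in>{..<m}. ip m u (w' i) = ip m u (w' 0)"
      "\<forall>l\<in>L. R (ip m u (w' l)) (ip m u (w' 0))" by blast
    define v where "v = u(m := 0)"
    have e: "ip (Suc m) v x = ip m u x" for x by (simp add: ip_def v_def)
    have vv: "ip (Suc m) v v = 1" using u(1) by (simp add: ip_Suc v_def ip_upd')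
    have ww: "ip m u (w' i) = ip m u (w i)" if "i \<noteq> m" for i
      using that wi[of i] w0 by (cases "i = 0") (simp_all add: ipm)
    have "ip m u (w m) = ip m u (w 0)" by (simp add: w0 ipm)
    moreover have "ip m u (w i) = ip m u (w 0)" if "i < m" for i
    proof -
      have "i \<in> {..<m}" "i \<noteq> m" "0 \<noteq> m" using that by auto
      then show ?thesis using u(2) ww by metis
    qed
    ultimately have all: "\<forall>i\<in>{..<Suc m}. ip m u (w i) = ip m u (w 0)"
      unfolding lessThan_Suc by blast
    have "R (ip m u (w l)) (ip m u (w 0))" if "l \<in> L" for l
    proof -
      have "0 \<noteq> m" using m by simp
      then show ?thesis using u(3) that ww L(2)[OF that] by metis
    qed
    then have "\<forall>l\<in>L. R (ip m u (w l)) (ip m u (w 0))" by blast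
    with all vv have "ip (Suc m) v v = 1 \<and> (\<forall>i\<in>{..<Suc m}. ip (Suc m) v (w i) = ip (Suc m) v (w 0)) \<and>
      (\<forall>l\<in>L. R (ip (Suc m) v (w l)) (ip (Suc m) v (w 0)))"
      unfolding e by blast
    then show ?A by blast
  }
qed

text \<open>Downwards, the coefficients of the merged points 0 and \<open>m\<close> are added.
  Upwards, the coefficient of the merged point is split so that the equation for coordinate
  \<open>m\<close> holds as well, which is possible because \<open>s \<noteq> t\<close>.\<close>

lemma dep_reduce:
  assumes m: "m \<ge> 1" and st: "s \<noteq> (t :: real)"
    and w: "w = z(0 := c(m := s), m := c(m := t))" and w': "w' = (\<lambda>i. (z i)(m := 0))(0 := c)"
  shows "dep {..<Suc m} {..<Suc m} w \<longleftrightarrow> dep {..<m} {..<m} w'"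
proof
  have w0: "w 0 = c(m := s)" "w m = c(m := t)" "w' 0 = c" using m by (simp_all add: w w')
  have wi: "w i = z i" "w' i = (z i)(m := 0)" if "i \<noteq> 0" "i \<noteq> m" for i using that by (simp_all add: w w')
  have split: "(\<Sum>i<Suc m. f i) = f 0 + f m + (\<Sum>i\<in>{1..<m}. f i)" "(\<Sum>i<m. f i) = f 0 + (\<Sum>i\<in>{1..<m}. f i)" for f :: "nat \<Rightarrow> real"
  proof -
    have "{..<m} = insert 0 {1..<m}" using m by auto
    then show 2: "(\<Sum>i<m. f i) = f 0 + (\<Sum>i\<in>{1..<m}. f i)" by simp
    show "(\<Sum>i<Suc m. f i) = f 0 + f m + (\<Sum>i\<in>{1..<m}. f i)" by (simp add: 2)
  qed
  have rest: "(\<Sum>i\<in>{1..<m}. p i * w i k) = (\<Sum>i\<in>{1..<m}. p i * w' i k)" if "k < m" for k p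
    using that by (intro sum.cong) (auto simp: wi)
  {
    assume "dep {..<Suc m} {..<Suc m} w"
    then obtain p where p: "\<exists>i\<in>{..<Suc m}. p i \<noteq> 0" "(\<Sum>i<Suc m. p i) = 0"
      "\<And>k. k < Suc m \<Longrightarrow> (\<Sum>i<Suc m. p i * w i k) = 0" by (auto simp: dep_def)
    define q where "q = p(0 := p 0 + p m)"
    have q: "(\<Sum>i\<in>{1..<m}. q i * f i) = (\<Sum>i\<in>{1..<m}. p i * f i)" for f
      by (intro sum.cong) (auto simp: q_def)
    have "(\<Sum>i<m. q i) = 0" using p(2) q[of "\<lambda>_. 1"] unfolding split by (simp add: q_def)
    moreover have "(\<Sum>i<m. q i * w' i k) = 0" if "k < m" for k
      using p(3)[of k] that rest[of k p] unfolding split q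
      by (simp add: w0 q_def algebra_simps)
    \<comment> \<open>The two added coefficients may cancel. Coordinate \<open>m\<close>, where the
      two points differ, rules out that nothing else is left.\<close>
    moreover have "\<exists>i\<in>{..<m}. q i \<noteq> 0"
    proof (rule ccontr)
      assume n: "\<not> (\<exists>i\<in>{..<m}. q i \<noteq> 0)"
      then have q0: "p i = 0" if "i \<in> {1..<m}" for i using that unfolding q_def by force
      have "0 \<in> {..<m}" using m by simp
      with n have "q 0 = 0" by blast
      then have power_measure: "p 0 = - p m" by (simp add: q_def)
      have "(\<Sum>i\<in>{1..<m}. p i * w i m) = 0" using q0 by simp
      with p(3)[of m] have "p m * (t - s) = 0" unfolding split by (simp add: w0 power_measure algebra_simps)
      then have "p m = 0" using st by simp
      then have "p 0 = 0" using power_measure by simp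
      have "p i = 0" if "i < Suc m" for i
      proof -
        have "i = 0 \<or> i = m \<or> i \<in> {1..<m}" using that unfolding atLeastLessThan_iff by linarith
        then show ?thesis using \<open>p 0 = 0\<close> \<open>p m = 0\<close> q0 by blast
      qed
      with p(1) show False by blast
    qed
    ultimately show "dep {..<m} {..<m} w'" by (auto simp: dep_def)
  next
    assume "dep {..<m} {..<m} w'"
    then obtain q where q: "\<exists>i\<in>{..<m}. q i \<noteq> 0" "(\<Sum>i<m. q i) = 0"
      "\<And>k. k < m \<Longrightarrow> (\<Sum>i<m. q i * w' i k) = 0" by (auto simp: dep_def)
    \<comment> \<open>The share of point \<open>m\<close>, solved from the equation for coordinate
      \<open>m\<close>: moving \<open>r\<close> from height \<open>s\<close> to height
      \<open>t\<close> must cancel the sum obtained with all of \<open>q 0\<close> at height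
      \<open>s\<close>.\<close>
    define r where "r = - ((\<Sum>i\<in>{1..<m}. q i * w i m) + q 0 * s) / (t - s)"
    define p where "p = q(0 := q 0 - r, m := r)"
    have p: "(\<Sum>i\<in>{1..<m}. p i * f i) = (\<Sum>i\<in>{1..<m}. q i * f i)" for f
      by (intro sum.cong) (auto simp: p_def)
    have p0: "p 0 = q 0 - r" "p m = r" using m by (auto simp: p_def)
    have "(\<Sum>i<Suc m. p i) = 0" using q(2) p[of "\<lambda>_. 1"] unfolding split by (simp add: p0)
    moreover have "(\<Sum>i<Suc m. p i * w i k) = 0" if "k < Suc m" for k
    proof (cases "k = m")
      case True
      have "r * (t - s) = - ((\<Sum>i\<in>{1..<m}. q i * w i m) + q 0 * s)" using st by (simp add: r_def)
      then show ?thesis unfolding split p True by (simp add: w0 p0 algebra_simps)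
    next
      case False
      then have "k < m" using that by simp
      then show ?thesis using q(3)[of k] rest[of k q] unfolding split p by (simp add: w0 p0 algebra_simps)
    qed
    \<comment> \<open>A witness other than index 0 is required, as \<open>p 0 = q 0 - r\<close> may
      vanish. It exists because the coefficients \<open>q\<close> sum to 0.\<close>
    moreover have "\<exists>i\<in>{1..<m}. q i \<noteq> 0"
    proof (rule ccontr)
      assume n: "\<not> (\<exists>i\<in>{1..<m}. q i \<noteq> 0)"
      then have "q 0 = 0" using q(2) unfolding split by simp
      have "q i = 0" if "i < m" for i using n \<open>q 0 = 0\<close> that by (cases "i = 0") auto
      with q(1) show False by auto
    qed
    then obtain i where i: "i \<in> {1..<m}" "q i \<noteq> 0" by blast
    then have "p i \<noteq> 0" "i \<in> {..<Suc m}" by (auto simp: p_def)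
    then have "\<exists>i\<in>{..<Suc m}. p i \<noteq> 0" by blast
    ultimately show "dep {..<Suc m} {..<Suc m} w" by (auto simp: dep_def)
  }
qed

lemma upper_family:
  assumes L: "finite L" "L \<inter> {..<d} = {}"
  shows "cfg_family d (upper_event L)"
  unfolding cfg_family_def
proof (intro conjI ballI)
  fix D
  have "{z. supp D L 0 z} \<in> sets borel" by (rule borel_closed[OF closed_supp])
  moreover have "supp D L 0 (\<lambda>i. reflect D v (z i)) \<longleftrightarrow> supp D L 0 z" for v z
    by (rule reflect_iff[where P = "supp D L 0", OF supp_reflect])
  ultimately show "cfg_inv D (upper_event L D)"
    unfolding cfg_inv_def upper_event_def
    by (intro conjI ballI allI borel_measurable_indicator) (simp_all add: indicator_def)
next
  fix D assume D: "D \<in> {1..<d}"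
  have "supp (Suc D) L 0 (z(0 := c(D := s), D := c(D := t))) \<longleftrightarrow> supp D L 0 ((\<lambda>i. (z i)(D := 0))(0 := c))"
    if "s \<noteq> t" for z c s t
    unfolding supp_def
    by (rule supp_reduce_aux[where R = "\<lambda>x y. x \<le> y - 0", OF _ _ that refl refl]) (use D L in auto)
  then show "cfg_reduce D (upper_event L (Suc D)) (upper_event L D)"
    by (simp add: cfg_reduce_def upper_event_def indicator_def)
qed

lemma lower_family:
  assumes L: "finite L" "L \<inter> {..<d} = {}"
  shows "cfg_family d (lower_event L)"
  unfolding cfg_family_def
proof (intro conjI ballI)
  fix D
  have "{z. \<not> dep {..<D} {..<D} z \<and> ssupp D L z} = {z. ssupp D L z} - {z. dep {..<D} {..<D} z}" by auto
  then have "{z. \<not> dep {..<D} {..<D} z \<and> ssupp D L z} \<in> sets borel"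
    using sets_ssupp[OF L(1)] sets_dep by auto
  moreover have "ssupp D L (\<lambda>i. reflect D v (z i)) \<longleftrightarrow> ssupp D L z" for v z
    by (rule reflect_iff[where P = "ssupp D L", OF ssupp_reflect])
  moreover have "dep {..<D} {..<D} (\<lambda>i. reflect D v (z i)) \<longleftrightarrow> dep {..<D} {..<D} z" for v z
    by (rule reflect_iff[where P = "dep {..<D} {..<D}", OF dep_reflect])
  ultimately show "cfg_inv D (lower_event L D)"
    unfolding cfg_inv_def lower_event_def
    by (intro conjI ballI allI borel_measurable_indicator) (simp_all add: indicator_def)
next
  fix D assume D: "D \<in> {1..<d}"
  have "ssupp (Suc D) L (z(0 := c(D := s), D := c(D := t))) \<longleftrightarrow> ssupp D L ((\<lambda>i. (z i)(D := 0))(0 := c))"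
    if "s \<noteq> t" for z c s t
    unfolding ssupp_def
    by (rule supp_reduce_aux[where R = "\<lambda>x y. x < y", OF _ _ that refl refl]) (use D L in auto)
  moreover have "dep {..<Suc D} {..<Suc D} (z(0 := c(D := s), D := c(D := t))) \<longleftrightarrow>
      dep {..<D} {..<D} ((\<lambda>i. (z i)(D := 0))(0 := c))" if "s \<noteq> t" for z c s t
    by (rule dep_reduce[OF _ that refl refl]) (use D in simp)
  ultimately show "cfg_reduce D (lower_event L (Suc D)) (lower_event L D)"
    by (simp add: cfg_reduce_def lower_event_def indicator_def)
qed

text \<open>Its integral is the total mass 1, which determines the constant of
  \<open>reduction\<close> in \<open>event_bounds\<close>.\<close>

lemma const_family: "cfg_family d (\<lambda>_ _. 1)"
  by (simp add: cfg_family_def cfg_inv_def cfg_reduce_def)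

subsection \<open>The probabilities in dimension one\<close>

definition beta_below :: "real \<Rightarrow> real \<Rightarrow> ennreal"
  where "beta_below a t = (\<integral>\<^sup>+y. ennreal (beta_weight a (y\<^sup>2)) * indicator {..t} y \<partial>lborel)"

lemma lw_strict: "(\<integral>\<^sup>+y. ennreal (beta_weight a (y\<^sup>2)) * indicator {..<t} y \<partial>lborel) = beta_below a t"
  unfolding beta_below_def
  by (rule nn_integral_cong_AE, use AE_lborel_singleton[of t] in eventually_elim) (auto simp: indicator_def)

lemma lw_ge: "(\<integral>\<^sup>+y. ennreal (beta_weight a (y\<^sup>2)) * indicator {t..} y \<partial>lborel) = beta_below a (- t)"
proof -
  have "(\<integral>\<^sup>+y. ennreal (beta_weight a (y\<^sup>2)) * indicator {t..} y \<partial>lborel) =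
      ennreal \<bar>-1\<bar> * (\<integral>\<^sup>+y. ennreal (beta_weight a ((0 + -1 * y)\<^sup>2)) * indicator {t..} (0 + -1 * y) \<partial>lborel)"
    by (rule nn_integral_real_affine) auto
  also have "\<dots> = beta_below a (- t)" unfolding beta_below_def by (auto intro!: nn_integral_cong simp: indicator_def)
  finally show ?thesis .
qed

lemma lw_add: "beta_below a t + beta_below a (- t) = beta_mass a"
proof -
  have "beta_below a t + beta_below a (- t) = (\<integral>\<^sup>+y. ennreal (beta_weight a (y\<^sup>2)) * indicator {..<t} y + ennreal (beta_weight a (y\<^sup>2)) * indicator {t..} y \<partial>lborel)"
    unfolding lw_strict[symmetric, of a t] lw_ge[symmetric] by (rule nn_integral_add[symmetric]) auto
  also have "\<dots> = beta_mass a" unfolding beta_mass_def by (intro nn_integral_cong) (auto simp: indicator_def)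
  finally show ?thesis .
qed

lemma measurable_lw [measurable]: "beta_below a \<in> borel_measurable borel"
proof -
  have "beta_below a = (\<lambda>t. \<integral>\<^sup>+y. ennreal (beta_weight a (y\<^sup>2)) * (if y \<le> t then 1 else 0) \<partial>lborel)"
    by (auto simp: beta_below_def fun_eq_iff indicator_def intro!: nn_integral_cong)
  also have "\<dots> \<in> borel_measurable borel" by measurable
  finally show ?thesis .
qed

lemma bw_le_1: "a \<ge> 0 \<Longrightarrow> q \<ge> 0 \<Longrightarrow> beta_weight a q \<le> 1"
  by (auto simp: beta_weight_def intro: powr_le1)

lemma bw_sq_0: "t \<notin> {-1<..<1} \<Longrightarrow> beta_weight a (t\<^sup>2) = 0"
  using abs_square_less_1[of t] by (auto simp: beta_weight_def)

lemma Bt_le: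
  assumes "a \<ge> 0"
  shows "beta_mass a \<le> 2"
proof -
  have "beta_mass a \<le> (\<integral>\<^sup>+t. indicator {-1..1} t \<partial>(lborel :: real measure))"
    unfolding beta_mass_def
  proof (rule nn_integral_mono)
    fix t :: real
    show "ennreal (beta_weight a (t\<^sup>2)) \<le> indicator {-1..1} t"
      using bw_le_1[OF assms, of "t\<^sup>2"] bw_sq_0[of t a] by (auto simp: indicator_def)
  qed
  then show ?thesis by simp
qed

lemma Bt_ge:
  assumes "a \<ge> 0" "0 < r" "r < 1"
  shows "ennreal (r * (1 - r\<^sup>2) powr a) \<le> beta_mass a"
proof -
  have "ennreal (r * (1 - r\<^sup>2) powr a) = (\<integral>\<^sup>+t. ennreal ((1 - r\<^sup>2) powr a) * indicator {0..r} t \<partial>lborel)"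
    using assms by (subst nn_integral_cmult_indicator) (simp_all add: ennreal_mult[symmetric] mult.commute)
  also have "\<dots> \<le> beta_mass a" unfolding beta_mass_def
  proof (rule nn_integral_mono)
    fix t :: real
    have "beta_weight a (t\<^sup>2) \<ge> (1 - r\<^sup>2) powr a" if t: "t \<in> {0..r}"
    proof -
      have "t\<^sup>2 \<le> r\<^sup>2" "r\<^sup>2 < 1" using t assms by (auto intro: power_mono simp: power_less_one_iff)
      then show ?thesis using assms by (auto simp: beta_weight_def intro!: powr_mono2)
    qed
    then show "ennreal ((1 - r\<^sup>2) powr a) * indicator {0..r} t \<le> ennreal (beta_weight a (t\<^sup>2))"
      by (auto simp: indicator_def)
  qed
  finally show ?thesis .
qed

lemma Bt_finite_pos:
  assumes "a \<ge> 0"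
  shows "0 < beta_mass a" "beta_mass a < \<infinity>"
proof -
  have "0 < ennreal (1 / 2 * (1 - (1 / 2)\<^sup>2) powr a)" by (simp add: power2_eq_square)
  also have "\<dots> \<le> beta_mass a" by (rule Bt_ge) (use assms in auto)
  finally show "0 < beta_mass a" .
  show "beta_mass a < \<infinity>" using Bt_le[OF assms] by (rule le_less_trans) simp
qed

text \<open>The normalised mass beyond \<open>t\<close>: the proportion of the sphere in the cap at distance \<open>t\<close>.\<close>

definition cap :: "real \<Rightarrow> real \<Rightarrow> real"
  where "cap a t = enn2real (beta_below a (- t)) / enn2real (beta_mass a)"

lemma lw_cap:
  assumes "a \<ge> 0"
  shows "beta_below a t = ennreal (1 - cap a t) * beta_mass a" "0 \<le> cap a t" "cap a t \<le> 1"
    "beta_below a (- t) = ennreal (cap a t) * beta_mass a"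
proof -
  note B = Bt_finite_pos[OF assms]
  have l: "beta_below a (- t) \<le> beta_mass a" "beta_below a t \<le> beta_mass a" unfolding lw_add[of a t, symmetric] by simp_all
  have f: "beta_below a (- t) < \<infinity>" "beta_below a t < \<infinity>" using l B by (auto intro: le_less_trans)
  define x y b where "x = enn2real (beta_below a t)" and "y = enn2real (beta_below a (- t))" and "b = enn2real (beta_mass a)"
  have e: "beta_below a t = ennreal x" "beta_below a (- t) = ennreal y" "beta_mass a = ennreal b"
    using f B by (simp_all add: x_def y_def b_def ennreal_enn2real_if less_top)
  have nn: "x \<ge> 0" "y \<ge> 0" by (simp_all add: x_def y_def)
  have b: "b > 0" using B e(3) by simp
  have "x + y = b" using lw_add[of a t] nn b unfolding e by (simp flip: ennreal_plus)
  then have c: "cap a t = y / b" "1 - cap a t = x / b"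
    using b by (simp_all add: cap_def y_def[symmetric] b_def[symmetric] field_simps)
  show "0 \<le> cap a t" "cap a t \<le> 1" using c nn b \<open>x + y = b\<close> by auto
  show "beta_below a t = ennreal (1 - cap a t) * beta_mass a"
    unfolding e c(2) using nn b by (simp add: ennreal_mult[symmetric])
  show "beta_below a (- t) = ennreal (cap a t) * beta_mass a"
    unfolding e c(1) using nn b by (simp add: ennreal_mult[symmetric])
qed

lemma emeasure_Nb1:
  assumes "A \<in> sets borel"
  shows "emeasure (beta_measure 1 a) {x. x 0 \<in> A} = (\<integral>\<^sup>+t. ennreal (beta_weight a (t\<^sup>2)) * indicator A t \<partial>lborel)"
proof -
  have m: "{x :: nat \<Rightarrow> real. x 0 \<in> A} \<in> sets borel"
    using measurable_sets[OF measurable_coord[of 0] assms] by (simp add: vimage_def)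
  have "emeasure (beta_measure 1 a) {x. x 0 \<in> A} = (\<integral>\<^sup>+x. indicator {x. x 0 \<in> A} x \<partial>beta_measure 1 a)"
    using m by simp
  also have "\<dots> = (\<integral>\<^sup>+x. indicator A (x 0) \<partial>beta_measure 1 a)"
    by (intro nn_integral_cong) (simp add: indicator_def)
  also have "\<dots> = (\<integral>\<^sup>+t. ennreal (beta_weight a (t\<^sup>2)) * indicator A t \<partial>lborel)"
    using assms by (intro Nb1_coord) simp
  finally show ?thesis .
qed

lemma sets_box:
  assumes "finite L" "A \<in> sets borel"
  shows "{z :: nat \<Rightarrow> nat \<Rightarrow> real. \<forall>l\<in>L. z l 0 \<in> A} \<in> sets borel"
proof -
  have "{z :: nat \<Rightarrow> nat \<Rightarrow> real. z l 0 \<in> A} \<in> sets borel" for l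
    using measurable_sets[OF measurable_compose[OF measurable_app[of l] measurable_coord[of 0]] assms(2)]
    by (simp add: vimage_def)
  then have "{z \<in> space borel. \<forall>l\<in>L. z l 0 \<in> A} \<in> sets (borel :: (nat \<Rightarrow> nat \<Rightarrow> real) measure)"
    by (intro sets.sets_Collect_finite_All[OF _ assms(1)]) simp
  then show ?thesis by simp
qed

lemma pm_line:
  assumes "finite L" "A \<in> sets borel"
  shows "(\<integral>\<^sup>+z. indicator {z. \<forall>l\<in>L. z l 0 \<in> A} z \<partial>power_measure L (beta_measure 1 a)) =
    (\<integral>\<^sup>+t. ennreal (beta_weight a (t\<^sup>2)) * indicator A t \<partial>lborel) ^ card L"
proof -
  have m: "{x :: nat \<Rightarrow> real. x 0 \<in> A} \<in> sets borel"
    using measurable_sets[OF measurable_coord[of 0] assms(2)] by (simp add: vimage_def)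
  have "(\<integral>\<^sup>+z. indicator {z. \<forall>l\<in>L. z l 0 \<in> A} z \<partial>power_measure L (beta_measure 1 a)) = emeasure (power_measure L (beta_measure 1 a)) {z. \<forall>l\<in>L. z l \<in> {x. x 0 \<in> A}}"
    using sets_box[OF assms] by simp
  also have "\<dots> = emeasure (beta_measure 1 a) {x. x 0 \<in> A} ^ card L"
    by (rule pm_box[OF sigma_finite_Nb sets_Nb assms(1) m])
  finally show ?thesis unfolding emeasure_Nb1[OF assms(2)] .
qed

text \<open>A unit normal on the line is 1 or -1, so the other points lie all to the left or all to
  the right of \<open>x 0\<close>. The two cases are the source of the factor two.\<close>

lemma upper_1:
  assumes L: "finite L" "0 \<notin> L"
  shows "(\<integral>\<^sup>+z. upper_event L 1 (z(0 := x)) \<partial>power_measure L (beta_measure 1 a)) \<le> beta_below a (x 0) ^ card L + beta_below a (- x 0) ^ card L"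
proof -
  have "(\<integral>\<^sup>+z. upper_event L 1 (z(0 := x)) \<partial>power_measure L (beta_measure 1 a)) \<le>
    (\<integral>\<^sup>+z. indicator {z. \<forall>l\<in>L. z l 0 \<in> {..x 0}} z + indicator {z. \<forall>l\<in>L. z l 0 \<in> {x 0..}} z \<partial>power_measure L (beta_measure 1 a))"
  proof (rule nn_integral_mono)
    fix z
    have "(\<forall>l\<in>L. z l 0 \<in> {..x 0}) \<or> (\<forall>l\<in>L. z l 0 \<in> {x 0..})" if sp: "supp 1 L 0 (z(0 := x))"
    proof -
      obtain u where u': "ip 1 u u = 1" "\<forall>l\<in>L. ip 1 u ((z(0 := x)) l) \<le> ip 1 u ((z(0 := x)) 0) - 0"
        using sp unfolding supp_def by blast
      have u: "u 0 * u 0 = 1" "\<And>l. l \<in> L \<Longrightarrow> u 0 * z l 0 \<le> u 0 * x 0"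
        using u' L(2) by (auto simp: ip_def split: if_splits)
      then have "u 0 = 1 \<or> u 0 = -1" by (simp add: square_eq_1_iff)
      then show ?thesis using u(2) by force
    qed
    then show "upper_event L 1 (z(0 := x)) \<le>
      indicator {z. \<forall>l\<in>L. z l 0 \<in> {..x 0}} z + indicator {z. \<forall>l\<in>L. z l 0 \<in> {x 0..}} z"
      unfolding upper_event_def indicator_def by auto
  qed
  also have "\<dots> = (\<integral>\<^sup>+z. indicator {z. \<forall>l\<in>L. z l 0 \<in> {..x 0}} z \<partial>power_measure L (beta_measure 1 a)) +
      (\<integral>\<^sup>+z. indicator {z. \<forall>l\<in>L. z l 0 \<in> {x 0..}} z \<partial>power_measure L (beta_measure 1 a))"
    using sets_box[OF L(1), of "{..x 0}"] sets_box[OF L(1), of "{x 0..}"]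
    by (intro nn_integral_add borel_measurable_indicator) auto
  also have "\<dots> = beta_below a (x 0) ^ card L + beta_below a (- x 0) ^ card L"
    by (subst (1 2) pm_line[OF L(1)]) (auto simp: lw_ge beta_below_def[symmetric])
  finally show ?thesis .
qed

text \<open>One of the two normals suffices for a lower bound, and a single point is affinely
  independent.\<close>

lemma lower_1:
  assumes L: "finite L" "0 \<notin> L"
  shows "beta_below a (x 0) ^ card L \<le> (\<integral>\<^sup>+z. lower_event L 1 (z(0 := x)) \<partial>power_measure L (beta_measure 1 a))"
proof -
  have "beta_below a (x 0) ^ card L = (\<integral>\<^sup>+z. indicator {z. \<forall>l\<in>L. z l 0 \<in> {..<x 0}} z \<partial>power_measure L (beta_measure 1 a))"
    by (subst pm_line[OF L(1)]) (auto simp: lw_strict)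
  also have "\<dots> \<le> (\<integral>\<^sup>+z. lower_event L 1 (z(0 := x)) \<partial>power_measure L (beta_measure 1 a))"
  proof (rule nn_integral_mono)
    fix z :: "nat \<Rightarrow> nat \<Rightarrow> real"
    have "ssupp 1 L (z(0 := x))" if "\<forall>l\<in>L. z l 0 \<in> {..<x 0}"
      unfolding ssupp_def using that L by (intro exI[of _ "\<lambda>_. 1"]) (auto simp: ip_def intro: Nat.gr0I)
    moreover have "\<not> dep {..<1} {..<1} (z(0 := x))" by (auto simp: dep_def)
    ultimately show "indicator {z. \<forall>l\<in>L. z l 0 \<in> {..<x 0}} z \<le> lower_event L 1 (z(0 := x))"
      unfolding lower_event_def indicator_def by auto
  qed
  finally show ?thesis .
qed

lemma pm_prob:
  assumes "finite I" "prob_space N" "sets N = sets borel"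
  shows "prob_space (power_measure I N)"
proof -
  interpret prob_space N by fact
  have "emeasure (power_measure I N) {x. \<forall>i\<in>I. x i \<in> UNIV} = emeasure N UNIV ^ card I"
    by (rule pm_box) (use assms sigma_finite_measure_axioms in auto)
  then show ?thesis using sets_eq_imp_space_eq[OF assms(3)] emeasure_space_1
    by (intro prob_spaceI) simp
qed

lemma lw_half_bound:
  fixes \<alpha> a :: real
  shows "(\<integral>\<^sup>+t. beta_weight \<alpha> (t\<^sup>2) * (beta_below a t ^ N + beta_below a (- t) ^ N) \<partial>lborel) =
    2 * (\<integral>\<^sup>+t. beta_weight \<alpha> (t\<^sup>2) * beta_below a t ^ N \<partial>lborel)"
proof -
  have "(\<integral>\<^sup>+t. beta_weight \<alpha> (t\<^sup>2) * (beta_below a t ^ N + beta_below a (- t) ^ N) \<partial>lborel) =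
    (\<integral>\<^sup>+t. beta_weight \<alpha> (t\<^sup>2) * beta_below a t ^ N \<partial>lborel) + (\<integral>\<^sup>+t. beta_weight \<alpha> (t\<^sup>2) * beta_below a (- t) ^ N \<partial>lborel)"
    by (subst nn_integral_add[symmetric]) (auto simp: distrib_left)
  also have "(\<integral>\<^sup>+t. beta_weight \<alpha> (t\<^sup>2) * beta_below a (- t) ^ N \<partial>lborel) =
      ennreal \<bar>-1\<bar> * (\<integral>\<^sup>+t. beta_weight \<alpha> ((0 + -1 * t)\<^sup>2) * beta_below a (- (0 + -1 * t)) ^ N \<partial>lborel)"
    by (rule nn_integral_real_affine) auto
  finally show ?thesis by (simp add: mult_2)
qed

text \<open>Read probabilistically: \<open>N\<close> independent points stay below height
  \<open>t\<close>, averaged over \<open>t\<close> with the normalised one-dimensional beta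
  law.\<close>

definition facet_int :: "nat \<Rightarrow> nat \<Rightarrow> ennreal"
  where "facet_int d N = (\<integral>\<^sup>+t. beta_weight ((real d - 1)\<^sup>2 / 2 - 1) (t\<^sup>2) * ennreal ((1 - cap ((real d - 3) / 2) t) ^ N) \<partial>lborel) /
    beta_mass ((real d - 1)\<^sup>2 / 2 - 1)"

text \<open>\<open>reduction\<close> is applied to three families: the two events and the constant
  1, which eliminates the unknown constant. The condition \<open>d \<ge> 3\<close> makes both
  exponents nonnegative, so the masses are positive and finite.\<close>

theorem event_bounds:
  assumes d: "d \<ge> 3" "d \<le> n"
  defines "P \<equiv> power_measure {..<n} (uniform_sphere d)" and "L \<equiv> {d..<n}"
  shows "(\<integral>\<^sup>+z. upper_event L d z \<partial>P) \<le> 2 * facet_int d (n - d)"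
    and "facet_int d (n - d) \<le> (\<integral>\<^sup>+z. lower_event L d z \<partial>P)"
proof -
  let ?\<alpha> = "(real d - 1)\<^sup>2 / 2 - 1" and ?a = "(real d - 3) / 2" and ?N = "n - d"
  have a: "?a \<ge> 0" using d by simp
  have "(real d - 1)\<^sup>2 \<ge> 2\<^sup>2" using d by (intro power_mono) auto
  then have \<alpha>: "?\<alpha> \<ge> 0" by simp
  note B = Bt_finite_pos[OF a] and BA = Bt_finite_pos[OF \<alpha>]
  have L: "finite L" "L \<inter> {..<d} = {}" "0 \<notin> L" "card L = ?N" "{..<d} \<union> L = {..<n}"
    using d by (auto simp: L_def)
  obtain C where C: "\<And>\<Phi>. cfg_family d \<Phi> \<Longrightarrow> (\<integral>\<^sup>+z. \<Phi> d z \<partial>P) =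
    C * (\<integral>\<^sup>+x. \<integral>\<^sup>+z. \<Phi> 1 (z(0 := x)) \<partial>power_measure L (beta_measure 1 ?a) \<partial>beta_measure 1 ?\<alpha>)"
    using reduction[OF _ L(1,2)] d unfolding L(5) P_def by auto
  interpret P: prob_space P unfolding P_def
    by (rule pm_prob) (auto simp: prob_space_uniform_sphere)
  have tot: "emeasure (power_measure L (beta_measure 1 ?a)) UNIV = beta_mass ?a ^ ?N"
  proof -
    have "emeasure (power_measure L (beta_measure 1 ?a)) {z. \<forall>l\<in>L. z l \<in> UNIV} = emeasure (beta_measure 1 ?a) UNIV ^ card L"
      by (rule pm_box[OF sigma_finite_Nb sets_Nb L(1)]) simp
    moreover have "emeasure (beta_measure 1 ?a) UNIV = beta_mass ?a"
      using emeasure_Nb1[of UNIV ?a] by (simp add: beta_mass_def)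
    ultimately show ?thesis using L by simp
  qed
  have totA: "emeasure (beta_measure 1 ?\<alpha>) UNIV = beta_mass ?\<alpha>"
    using emeasure_Nb1[of UNIV ?\<alpha>] by (simp add: beta_mass_def)
  have "1 = (\<integral>\<^sup>+z. 1 \<partial>P)" using P.emeasure_space_1 by simp
  also have "\<dots> = C * (beta_mass ?\<alpha> * beta_mass ?a ^ ?N)"
    by (subst C[OF const_family]) (simp add: tot[simplified] totA[simplified] mult.commute)
  finally have C1: "C * (beta_mass ?\<alpha> * beta_mass ?a ^ ?N) = 1" ..
  have lwN: "beta_below ?a t ^ ?N = beta_mass ?a ^ ?N * ennreal ((1 - cap ?a t) ^ ?N)" for t
    using lw_cap[OF a, of t] by (simp add: power_mult_distrib ennreal_power mult.commute)
  have mcap: "(\<lambda>t. ennreal ((1 - cap ?a t) ^ ?N)) \<in> borel_measurable borel"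
    unfolding cap_def by measurable
  define J where "J = (\<integral>\<^sup>+t. beta_weight ?\<alpha> (t\<^sup>2) * ennreal ((1 - cap ?a t) ^ ?N) \<partial>lborel)"
  have J: "(\<integral>\<^sup>+t. beta_weight ?\<alpha> (t\<^sup>2) * beta_below ?a t ^ ?N \<partial>lborel) = beta_mass ?a ^ ?N * J"
    unfolding lwN J_def using mcap by (subst nn_integral_cmult[symmetric]) (auto simp: mult_ac)
  have CJ: "C * (beta_mass ?a ^ ?N * J) = facet_int d ?N"
  proof -
    have "facet_int d ?N = C * (beta_mass ?\<alpha> * beta_mass ?a ^ ?N) * J / beta_mass ?\<alpha>"
      unfolding facet_int_def J_def[symmetric] C1 by simp
    also have "\<dots> = (C * (beta_mass ?a ^ ?N * J)) * beta_mass ?\<alpha> / beta_mass ?\<alpha>" by (simp add: mult_ac)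
    also have "\<dots> = C * (beta_mass ?a ^ ?N * J)" using BA by (intro ennreal_mult_divide_eq) auto
    finally show ?thesis ..
  qed
  have "(\<integral>\<^sup>+z. upper_event L d z \<partial>P) =
    C * (\<integral>\<^sup>+x. \<integral>\<^sup>+z. upper_event L 1 (z(0 := x)) \<partial>power_measure L (beta_measure 1 ?a) \<partial>beta_measure 1 ?\<alpha>)"
    by (rule C[OF upper_family[OF L(1,2)]])
  also have "\<dots> \<le> C * (\<integral>\<^sup>+x. beta_below ?a (x 0) ^ ?N + beta_below ?a (- x 0) ^ ?N \<partial>beta_measure 1 ?\<alpha>)"
    using upper_1[OF L(1,3)] L(4) by (intro mult_left_mono nn_integral_mono) auto
  also have "(\<integral>\<^sup>+x. beta_below ?a (x 0) ^ ?N + beta_below ?a (- x 0) ^ ?N \<partial>beta_measure 1 ?\<alpha>) =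
      (\<integral>\<^sup>+t. beta_weight ?\<alpha> (t\<^sup>2) * (beta_below ?a t ^ ?N + beta_below ?a (- t) ^ ?N) \<partial>lborel)"
    by (rule Nb1_coord) measurable
  also have "C * \<dots> = 2 * (C * (beta_mass ?a ^ ?N * J))"
    unfolding lw_half_bound J by (simp only: mult_ac)
  finally show "(\<integral>\<^sup>+z. upper_event L d z \<partial>P) \<le> 2 * facet_int d (n - d)" unfolding CJ .
  have "facet_int d ?N = C * (\<integral>\<^sup>+t. beta_weight ?\<alpha> (t\<^sup>2) * beta_below ?a t ^ ?N \<partial>lborel)" unfolding J CJ ..
  also have "(\<integral>\<^sup>+t. beta_weight ?\<alpha> (t\<^sup>2) * beta_below ?a t ^ ?N \<partial>lborel) = (\<integral>\<^sup>+x. beta_below ?a (x 0) ^ ?N \<partial>beta_measure 1 ?\<alpha>)"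
    by (rule Nb1_coord[symmetric]) measurable
  also have "C * \<dots> \<le> C * (\<integral>\<^sup>+x. \<integral>\<^sup>+z. lower_event L 1 (z(0 := x)) \<partial>power_measure L (beta_measure 1 ?a) \<partial>beta_measure 1 ?\<alpha>)"
    using lower_1[OF L(1,3)] L(4) by (intro mult_left_mono nn_integral_mono) auto
  also have "\<dots> = (\<integral>\<^sup>+z. lower_event L d z \<partial>P)"
    by (rule C[OF lower_family[OF L(1,2)], symmetric])
  finally show "facet_int d (n - d) \<le> (\<integral>\<^sup>+z. lower_event L d z \<partial>P)" .
qed

subsection \<open>Facets and index sets\<close>

type_synonym vec = "nat \<Rightarrow> real"

lemma sum_fun_apply: "(\<Sum>i\<in>A. f i) k = (\<Sum>i\<in>A. f i k :: real)"
  by (induction A rule: infinite_finite_induct) (simp_all add: zero_fun_def plus_fun_def)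

lemma dep_UNIV: "dep I UNIV x \<longleftrightarrow> (\<exists>p. (\<exists>i\<in>I. p i \<noteq> 0) \<and> (\<Sum>i\<in>I. p i) = 0 \<and> (\<Sum>i\<in>I. p i *\<^sub>R x i) = 0)"
proof -
  have "(\<Sum>i\<in>I. p i *\<^sub>R x i) = 0 \<longleftrightarrow> (\<forall>k. (\<Sum>i\<in>I. p i * x i k) = 0)" for p
    by (simp add: fun_eq_iff sum_fun_apply scaleR_fun_def)
  then show ?thesis by (simp add: dep_def)
qed

text \<open>Coefficients are indexed by \<open>J\<close> rather than by points, which may coincide.
  One direction uses one representative index per point, the other sums the coefficients over each
  fibre.\<close>

lemma affine_hull_image:
  fixes x :: "nat \<Rightarrow> vec"
  assumes J: "finite J"
  shows "y \<in> affine hull (x ` J) \<longleftrightarrow> (\<exists>p. (\<Sum>j\<in>J. p j) = 1 \<and> (\<Sum>j\<in>J. p j *\<^sub>R x j) = y)"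
proof
  assume "y \<in> affine hull (x ` J)"
  then obtain u where u: "(\<Sum>v\<in>x ` J. u v) = 1" "(\<Sum>v\<in>x ` J. u v *\<^sub>R v) = y"
    using J by (auto simp: affine_hull_finite)
  obtain I where I: "I \<subseteq> J" "inj_on x I" "x ` J = x ` I"
    using subset_image_inj[of "x ` J" x J] by auto
  have [simp]: "J \<inter> I = I" "{j \<in> J. j \<in> I} = I" using I by auto
  let ?p = "\<lambda>j. if j \<in> I then u (x j) else 0"
  have "(\<Sum>j\<in>J. ?p j) = (\<Sum>j\<in>I. u (x j))"
    by (subst sum.inter_restrict[OF J, symmetric]) simp
  also have "\<dots> = 1" using u(1) unfolding I(3) by (simp add: sum.reindex[OF I(2)])
  finally have 1: "(\<Sum>j\<in>J. ?p j) = 1" .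
  have "(\<Sum>j\<in>J. ?p j *\<^sub>R x j) = (\<Sum>j\<in>J. if j \<in> I then u (x j) *\<^sub>R x j else 0)"
    by (intro sum.cong) auto
  also have "\<dots> = (\<Sum>j\<in>I. u (x j) *\<^sub>R x j)"
    by (subst sum.inter_restrict[OF J, symmetric]) simp
  also have "\<dots> = y" using u(2) unfolding I(3) by (simp add: sum.reindex[OF I(2)])
  finally show "\<exists>p. (\<Sum>j\<in>J. p j) = 1 \<and> (\<Sum>j\<in>J. p j *\<^sub>R x j) = y" using 1 by blast
next
  assume "\<exists>p. (\<Sum>j\<in>J. p j) = 1 \<and> (\<Sum>j\<in>J. p j *\<^sub>R x j) = y"
  then obtain p where p: "(\<Sum>j\<in>J. p j) = 1" "(\<Sum>j\<in>J. p j *\<^sub>R x j) = y" by blast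
  let ?u = "\<lambda>v. \<Sum>j | j \<in> J \<and> x j = v. p j"
  have "(\<Sum>v\<in>x ` J. ?u v) = 1" using sum.image_gen[OF J, of p x] p(1) by simp
  moreover have "(\<Sum>v\<in>x ` J. ?u v *\<^sub>R v) = y"
  proof -
    have "(\<Sum>v\<in>x ` J. ?u v *\<^sub>R v) = (\<Sum>v\<in>x ` J. \<Sum>j | j \<in> J \<and> x j = v. p j *\<^sub>R x j)"
      by (intro sum.cong refl) (simp add: scaleR_sum_left)
    then show ?thesis using sum.image_gen[OF J, of "\<lambda>j. p j *\<^sub>R x j" x] p(2) by simp
  qed
  ultimately show "y \<in> affine hull (x ` J)" using J by (auto simp: affine_hull_finite)
qed

lemma convex_hull_image:
  fixes x :: "nat \<Rightarrow> vec"
  assumes J: "finite J"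
  shows "y \<in> convex hull (x ` J) \<longleftrightarrow>
    (\<exists>p. (\<forall>j\<in>J. p j \<ge> 0) \<and> (\<Sum>j\<in>J. p j) = 1 \<and> (\<Sum>j\<in>J. p j *\<^sub>R x j) = y)"
proof
  assume "y \<in> convex hull (x ` J)"
  then obtain u where u: "(\<forall>v\<in>x ` J. 0 \<le> u v)" "(\<Sum>v\<in>x ` J. u v) = 1" "(\<Sum>v\<in>x ` J. u v *\<^sub>R v) = y"
    using J by (auto simp: convex_hull_finite)
  obtain I where I: "I \<subseteq> J" "inj_on x I" "x ` J = x ` I"
    using subset_image_inj[of "x ` J" x J] by auto
  have [simp]: "J \<inter> I = I" "{j \<in> J. j \<in> I} = I" using I by auto
  let ?p = "\<lambda>j. if j \<in> I then u (x j) else 0"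
  have "(\<Sum>j\<in>J. ?p j) = (\<Sum>j\<in>I. u (x j))"
    by (subst sum.inter_restrict[OF J, symmetric]) simp
  also have "\<dots> = 1" using u(2) unfolding I(3) by (simp add: sum.reindex[OF I(2)])
  finally have 1: "(\<Sum>j\<in>J. ?p j) = 1" .
  have "(\<Sum>j\<in>J. ?p j *\<^sub>R x j) = (\<Sum>j\<in>J. if j \<in> I then u (x j) *\<^sub>R x j else 0)"
    by (intro sum.cong) auto
  also have "\<dots> = (\<Sum>j\<in>I. u (x j) *\<^sub>R x j)"
    by (subst sum.inter_restrict[OF J, symmetric]) simp
  also have "\<dots> = y" using u(3) unfolding I(3) by (simp add: sum.reindex[OF I(2)])
  finally have "(\<Sum>j\<in>J. ?p j *\<^sub>R x j) = y" .
  moreover have "\<forall>j\<in>J. ?p j \<ge> 0" using u(1) by auto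
  ultimately show "\<exists>p. (\<forall>j\<in>J. p j \<ge> 0) \<and> (\<Sum>j\<in>J. p j) = 1 \<and> (\<Sum>j\<in>J. p j *\<^sub>R x j) = y"
    using 1 by (intro exI[of _ ?p] conjI)
next
  assume "\<exists>p. (\<forall>j\<in>J. p j \<ge> 0) \<and> (\<Sum>j\<in>J. p j) = 1 \<and> (\<Sum>j\<in>J. p j *\<^sub>R x j) = y"
  then obtain p where p: "\<forall>j\<in>J. p j \<ge> 0" "(\<Sum>j\<in>J. p j) = 1" "(\<Sum>j\<in>J. p j *\<^sub>R x j) = y" by blast
  have "(\<Sum>j\<in>J. p j *\<^sub>R x j) \<in> convex hull (x ` J)"
    by (rule convex_sum[OF J convex_convex_hull p(2)]) (use p(1) in \<open>auto intro: hull_inc\<close>)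
  then show "y \<in> convex hull (x ` J)" using p(3) by simp
qed

lemma dep_affine_dependent:
  fixes x :: "nat \<Rightarrow> vec"
  assumes I: "finite I"
  shows "\<not> dep I UNIV x \<longleftrightarrow> inj_on x I \<and> \<not> affine_dependent (x ` I)"
proof
  assume nd: "\<not> dep I UNIV x"
  have inj: "inj_on x I"
  proof (rule inj_onI, rule ccontr)
    fix i j assume ij: "i \<in> I" "j \<in> I" "x i = x j" "i \<noteq> j"
    let ?p = "\<lambda>k. if k = i then 1 else if k = j then - 1 else 0 :: real"
    have e: "(\<Sum>k\<in>I. if k = i then f k else if k = j then g k else 0) = f i + g j" for f g :: "nat \<Rightarrow> 'z :: real_vector"
    proof -
      have "(\<Sum>k\<in>I. if k = i then f k else if k = j then g k else 0) =
          (\<Sum>k\<in>I. (if k = i then f k else 0) + (if k = j then g k else 0))"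
        using ij(4) by (intro sum.cong) auto
      then show ?thesis using I ij by (simp add: sum.distrib)
    qed
    have "(\<Sum>k\<in>I. ?p k) = 0" using e[of "\<lambda>_. 1" "\<lambda>_. - 1"] by simp
    moreover have "(\<Sum>k\<in>I. ?p k *\<^sub>R x k) = (\<Sum>k\<in>I. if k = i then x k else if k = j then - x k else 0)"
      by (intro sum.cong) auto
    then have "(\<Sum>k\<in>I. ?p k *\<^sub>R x k) = 0" using e[of x "\<lambda>k. - x k"] ij(3) by simp
    moreover have "\<exists>k\<in>I. ?p k \<noteq> 0" using ij(1) by (intro bexI[of _ i]) simp_all
    ultimately have "dep I UNIV x" unfolding dep_UNIV by (intro exI[of _ ?p] conjI)
    then show False using nd by simp
  qed
  moreover have "\<not> affine_dependent (x ` I)"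
  proof
    assume "affine_dependent (x ` I)"
    then obtain u where "(\<Sum>v\<in>x ` I. u v) = 0" "\<exists>v\<in>x ` I. u v \<noteq> 0" "(\<Sum>v\<in>x ` I. u v *\<^sub>R v) = 0"
      using I by (auto simp: affine_dependent_explicit_finite)
    then have "dep I UNIV x" unfolding dep_UNIV
      by (intro exI[of _ "\<lambda>i. u (x i)"]) (auto simp: sum.reindex[OF inj])
    then show False using nd by simp
  qed
  ultimately show "inj_on x I \<and> \<not> affine_dependent (x ` I)" ..
next
  assume "inj_on x I \<and> \<not> affine_dependent (x ` I)"
  then have inj: "inj_on x I" and na: "\<not> affine_dependent (x ` I)" by auto
  show "\<not> dep I UNIV x"
  proof
    assume "dep I UNIV x"
    then obtain p where p: "\<exists>i\<in>I. p i \<noteq> 0" "(\<Sum>i\<in>I. p i) = 0" "(\<Sum>i\<in>I. p i *\<^sub>R x i) = 0"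
      by (auto simp: dep_UNIV)
    let ?u = "\<lambda>v. p (the_inv_into I x v)"
    have u: "?u (x i) = p i" if "i \<in> I" for i using that inj by (simp add: the_inv_into_f_f)
    have "(\<Sum>v\<in>x ` I. ?u v) = 0" "(\<Sum>v\<in>x ` I. ?u v *\<^sub>R v) = 0"
      using p(2,3) by (simp_all add: sum.reindex[OF inj] u cong: sum.cong)
    moreover have "\<exists>v\<in>x ` I. ?u v \<noteq> 0" using p(1) u by auto
    ultimately show False using na I by (auto simp: affine_dependent_explicit_finite)
  qed
qed

text \<open>Affine independence of \<open>v\<close> is linear independence of \<open>(v, 1)\<close>.\<close>

lemma affine_independent_card_le:
  fixes A B :: "'a :: real_vector set"
  assumes A: "finite A" "\<not> affine_dependent A" and B: "finite B" and sub: "A \<subseteq> affine hull B"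
  shows "card A \<le> card B"
proof -
  let ?f = "\<lambda>v :: 'a. (v, 1 :: real)"
  have inj: "inj_on ?f X" for X by (auto simp: inj_on_def)
  have "independent (?f ` A)"
  proof
    assume "dependent (?f ` A)"
    then obtain u v where u: "v \<in> ?f ` A" "u v \<noteq> 0" "(\<Sum>v\<in>?f ` A. u v *\<^sub>R v) = 0"
      using A(1) by (auto simp: dependent_finite)
    have "(\<Sum>v\<in>A. u (v, 1) *\<^sub>R (v, 1 :: real)) = 0" using u(3) by (simp add: sum.reindex[OF inj])
    then have "(\<Sum>v\<in>A. (u (v, 1) *\<^sub>R v, u (v, 1))) = (0, 0)" by (simp add: zero_prod_def)
    then have "(\<Sum>v\<in>A. u (v, 1) *\<^sub>R v) = 0" "(\<Sum>v\<in>A. u (v, 1)) = 0"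
      by (simp_all add: sum_prod prod_eq_iff)
    moreover have "\<exists>v\<in>A. u (v, 1) \<noteq> 0" using u by auto
    ultimately have "affine_dependent A" using A(1) by (auto simp: affine_dependent_explicit_finite)
    then show False using A(2) by simp
  qed
  moreover have "?f ` A \<subseteq> span (?f ` B)"
  proof
    fix w assume "w \<in> ?f ` A"
    then obtain y where y: "y \<in> affine hull B" "w = (y, 1)" using sub by auto
    then obtain u where u: "(\<Sum>v\<in>B. u v) = 1" "(\<Sum>v\<in>B. u v *\<^sub>R v) = y"
      using B by (auto simp: affine_hull_finite)
    have "w = (\<Sum>v\<in>B. u v *\<^sub>R ?f v)" using u y(2) by (simp add: sum_prod prod_eq_iff fst_sum snd_sum)
    also have "\<dots> \<in> span (?f ` B)" by (intro span_sum span_scale span_base) auto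
    finally show "w \<in> span (?f ` B)" .
  qed
  ultimately have "card (?f ` A) \<le> card (?f ` B)"
    using independent_span_bound[of "?f ` B" "?f ` A"] B by simp
  then show ?thesis by (simp add: card_image[OF inj])
qed

text \<open>An index version of \<open>has_aff_dim\<close> for the points of \<open>J\<close>: the
  set \<open>I\<close> gives an affine basis among them. For finite \<open>J\<close> this is a
  finite Boolean combination of the closed conditions \<open>dep\<close>, hence Borel in
  \<open>x\<close>.\<close>

definition adim :: "nat \<Rightarrow> (nat \<Rightarrow> vec) \<Rightarrow> nat set \<Rightarrow> bool"
  where "adim d x J \<longleftrightarrow> (\<exists>I. I \<subseteq> J \<and> card I = d \<and> \<not> dep I UNIV x \<and> (\<forall>j\<in>J - I. dep (insert j I) UNIV x))"

lemma dep_insert_affine_hull: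
  fixes x :: "nat \<Rightarrow> vec"
  assumes I: "finite I" "j \<notin> I" and nd: "\<not> dep I UNIV x"
  shows "dep (insert j I) UNIV x \<longleftrightarrow> x j \<in> affine hull (x ` I)"
proof
  assume "dep (insert j I) UNIV x"
  then obtain p where p: "\<exists>i\<in>insert j I. p i \<noteq> 0" "p j + (\<Sum>i\<in>I. p i) = 0" "p j *\<^sub>R x j + (\<Sum>i\<in>I. p i *\<^sub>R x i) = 0"
    using I by (auto simp: dep_UNIV)
  have pj: "p j \<noteq> 0"
  proof
    assume "p j = 0"
    then have "dep I UNIV x" using p unfolding dep_UNIV by (intro exI[of _ p]) auto
    then show False using nd by simp
  qed
  let ?q = "\<lambda>i. - (1 / p j) * p i"
  have "(\<Sum>i\<in>I. ?q i) = - (1 / p j) * (\<Sum>i\<in>I. p i)" by (simp only: sum_distrib_left)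
  also have "(\<Sum>i\<in>I. p i) = - p j" using p(2) by linarith
  finally have 1: "(\<Sum>i\<in>I. ?q i) = 1" using pj by simp
  have "(\<Sum>i\<in>I. ?q i *\<^sub>R x i) = (- (1 / p j)) *\<^sub>R (\<Sum>i\<in>I. p i *\<^sub>R x i)"
    by (simp only: scaleR_sum_right scaleR_scaleR)
  also have "(\<Sum>i\<in>I. p i *\<^sub>R x i) = - (p j *\<^sub>R x j)"
    using p(3) by (simp only: add_eq_0_iff)
  also have "(- (1 / p j)) *\<^sub>R (- (p j *\<^sub>R x j)) = x j"
    using pj by (simp only: scaleR_minus_left scaleR_minus_right minus_minus scaleR_scaleR) simp
  finally have "(\<Sum>i\<in>I. ?q i *\<^sub>R x i) = x j" .
  with 1 show "x j \<in> affine hull (x ` I)" unfolding affine_hull_image[OF I(1)] by blast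
next
  assume "x j \<in> affine hull (x ` I)"
  then obtain q where q: "(\<Sum>i\<in>I. q i) = 1" "(\<Sum>i\<in>I. q i *\<^sub>R x i) = x j"
    unfolding affine_hull_image[OF I(1)] by blast
  let ?p = "q(j := - 1)"
  have "(\<Sum>i\<in>I. ?p i) = 1" "(\<Sum>i\<in>I. ?p i *\<^sub>R x i) = x j"
  proof -
    have "?p i = q i" if "i \<in> I" for i using that I(2) by auto
    then show "(\<Sum>i\<in>I. ?p i) = 1" "(\<Sum>i\<in>I. ?p i *\<^sub>R x i) = x j"
      using q by (simp_all cong: sum.cong)
  qed
  then have "(\<Sum>i\<in>insert j I. ?p i) = 0" "(\<Sum>i\<in>insert j I. ?p i *\<^sub>R x i) = 0"
    using I by simp_all
  then show "dep (insert j I) UNIV x" unfolding dep_UNIV by (intro exI[of _ ?p]) auto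
qed

text \<open>The witness \<open>B\<close> of \<open>has_aff_dim\<close> may consist of arbitrary
  points of the affine hull. A basis chosen among the given points has as many elements, since each
  of the two sets lies in the affine hull of the other.\<close>

lemma adim_has_aff_dim:
  fixes x :: "nat \<Rightarrow> vec"
  assumes J: "finite J" and d: "d \<ge> 1"
  shows "has_aff_dim (x ` J) (int d - 1) \<longleftrightarrow> adim d x J"
proof
  assume "has_aff_dim (x ` J) (int d - 1)"
  then obtain B where B: "affine hull B = affine hull (x ` J)" "\<not> affine_dependent B" "card B = d"
    by (auto simp: has_aff_dim_def)
  have fB: "finite B" using B(3) d by (metis card.infinite not_one_le_zero)
  obtain B' where B': "B' \<subseteq> x ` J" "\<not> affine_dependent B'" "affine hull (x ` J) = affine hull B'"
    using affine_basis_exists[of "x ` J"] by auto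
  have fB': "finite B'" using B'(1) J by (auto intro: finite_subset)
  have "card B \<le> card B'"
    by (rule affine_independent_card_le[OF fB B(2) fB']) (use B(1) B'(3) hull_subset[of B affine] in auto)
  moreover have "card B' \<le> card B"
    by (rule affine_independent_card_le[OF fB' B'(2) fB]) (use B(1) B'(3) hull_subset[of B' affine] in auto)
  ultimately have cB': "card B' = d" using B(3) by simp
  obtain I where I: "I \<subseteq> J" "inj_on x I" "B' = x ` I"
    using B'(1) by (auto simp: subset_image_inj)
  have fI: "finite I" using I(1) J by (rule finite_subset)
  have nd: "\<not> dep I UNIV x" using dep_affine_dependent[OF fI, of x] I B'(2) by simp
  have "dep (insert j I) UNIV x" if "j \<in> J - I" for j
  proof -
    have "x j \<in> affine hull (x ` J)" using that by (auto intro: hull_inc)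
    then show ?thesis using dep_insert_affine_hull[OF fI _ nd, of j] that B'(3) I(3) by simp
  qed
  then show "adim d x J" unfolding adim_def using I cB' nd by (intro exI[of _ I]) (auto simp: card_image)
next
  assume "adim d x J"
  then obtain I where I: "I \<subseteq> J" "card I = d" "\<not> dep I UNIV x" "\<And>j. j \<in> J - I \<Longrightarrow> dep (insert j I) UNIV x"
    by (auto simp: adim_def)
  have fI: "finite I" using I(1) J by (rule finite_subset)
  have na: "inj_on x I" "\<not> affine_dependent (x ` I)" using I(3) dep_affine_dependent[OF fI] by auto
  have "x j \<in> affine hull (x ` I)" if "j \<in> J" for j
    using that I(4)[of j] dep_insert_affine_hull[OF fI _ I(3), of j] by (cases "j \<in> I") (auto intro: hull_inc)
  then have "affine hull (x ` J) \<subseteq> affine hull (x ` I)" by (intro hull_minimal) auto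
  moreover have "affine hull (x ` I) \<subseteq> affine hull (x ` J)" using I(1) by (intro hull_mono) auto
  ultimately show "has_aff_dim (x ` J) (int d - 1)"
    unfolding has_aff_dim_def using na I(2)
    by (intro exI[of _ "x ` I"]) (auto simp: card_image)
qed

lemma adim_affine_hull:
  fixes x :: "nat \<Rightarrow> vec"
  assumes J: "finite J" and "I \<subseteq> J" "\<not> dep I UNIV x" "\<And>j. j \<in> J - I \<Longrightarrow> dep (insert j I) UNIV x"
  shows "affine hull (x ` I) = affine hull (x ` J)"
proof
  have fI: "finite I" using assms(2) J by (rule finite_subset)
  have "x j \<in> affine hull (x ` I)" if "j \<in> J" for j
    using that assms(4)[of j] dep_insert_affine_hull[OF fI _ assms(3), of j]
    by (cases "j \<in> I") (auto intro: hull_inc)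
  then show "affine hull (x ` J) \<subseteq> affine hull (x ` I)" by (intro hull_minimal) auto
next
  show "affine hull (x ` I) \<subseteq> affine hull (x ` J)" using assms(2) by (intro hull_mono image_mono)
qed

text \<open>\<open>J\<close> is to be the set of all indices of points on one facet. Disjointness of
  the hulls expresses being a face (\<open>face_of_disjoint\<close>, \<open>index_set_face\<close>),
  and it also makes \<open>J\<close> complete, as no other point lies in its affine hull.\<close>

definition fcond :: "nat \<Rightarrow> (nat \<Rightarrow> vec) \<Rightarrow> nat set \<Rightarrow> nat set \<Rightarrow> bool"
  where "fcond d x A J \<longleftrightarrow> J \<subseteq> A \<and> affine hull (x ` J) \<inter> convex hull (x ` (A - J)) = {} \<and> adim d x J"

text \<open>If \<open>x i\<close> has weight strictly between 0 and 1, the combination lies in the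
  open segment from \<open>x i\<close> to the normalised rest \<open>w\<close>, and the definition
  of a face applies. Weight 1 and \<open>x i = w\<close> are degenerate cases in which the
  combination is \<open>x i\<close> itself.\<close>

lemma face_of_coeff_pos:
  fixes x :: "nat \<Rightarrow> vec"
  assumes A: "finite A" and F: "F face_of convex hull (x ` A)"
    and p: "\<And>j. j \<in> A \<Longrightarrow> p j \<ge> 0" "(\<Sum>j\<in>A. p j) = 1" "(\<Sum>j\<in>A. p j *\<^sub>R x j) \<in> F"
    and i: "i \<in> A" "p i > 0"
  shows "x i \<in> F"
proof -
  define q where "q = (\<Sum>j\<in>A - {i}. p j)"
  define y where "y = (\<Sum>j\<in>A. p j *\<^sub>R x j)"
  have pq: "p i + q = 1" using p(2) by (simp add: q_def sum.remove[OF A i(1)])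
  have y: "y = p i *\<^sub>R x i + (\<Sum>j\<in>A - {i}. p j *\<^sub>R x j)"
    unfolding y_def by (rule sum.remove[OF A i(1)])
  have q0: "q \<ge> 0" unfolding q_def using p(1) by (intro sum_nonneg) auto
  show ?thesis
  proof (cases "q = 0")
    case True
    then have "p j = 0" if "j \<in> A - {i}" for j
      using that p(1) A unfolding q_def by (subst (asm) sum_nonneg_eq_0_iff) auto
    then have "(\<Sum>j\<in>A - {i}. p j *\<^sub>R x j) = 0" by (intro sum.neutral) auto
    then have "y = x i" using y pq True by simp
    then show ?thesis using p(3) y_def by simp
  next
    case False
    then have q: "q > 0" using q0 by simp
    define w where "w = (\<Sum>j\<in>A - {i}. (p j / q) *\<^sub>R x j)"
    have "(\<Sum>j\<in>A - {i}. p j / q) = 1" using q by (simp add: sum_divide_distrib[symmetric] q_def)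
    then have w: "w \<in> convex hull (x ` A)"
      unfolding w_def using p(1) q A by (intro convex_sum) (auto intro: hull_inc)
    have "q *\<^sub>R w = (\<Sum>j\<in>A - {i}. p j *\<^sub>R x j)"
      unfolding w_def scaleR_sum_right using q by (intro sum.cong) auto
    then have yw: "y = (1 - q) *\<^sub>R x i + q *\<^sub>R w" using y pq by (simp add: eq_diff_eq[symmetric])
    have xi: "x i \<in> convex hull (x ` A)" using i(1) by (auto intro: hull_inc)
    show ?thesis
    proof (cases "x i = w")
      case True
      then have "y = ((1 - q) + q) *\<^sub>R x i" unfolding yw by (simp only: scaleR_left_distrib)
      then show ?thesis using p(3) y_def by simp
    next
      case False
      have "y \<in> open_segment (x i) w"
        unfolding in_segment using False q pq i(2) yw by (intro conjI exI[of _ q]) auto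
      then show ?thesis using F xi w p(3) unfolding face_of_def y_def[symmetric] by blast
    qed
  qed
qed

lemma face_of_index_set:
  fixes x :: "nat \<Rightarrow> vec"
  assumes A: "finite A" and F: "F face_of convex hull (x ` A)"
  shows "F = convex hull (x ` {j \<in> A. x j \<in> F})"
proof
  let ?J = "{j \<in> A. x j \<in> F}"
  have "convex F" "F \<subseteq> convex hull (x ` A)" using F by (auto simp: face_of_def)
  then show "convex hull (x ` ?J) \<subseteq> F" by (intro hull_minimal) auto
  show "F \<subseteq> convex hull (x ` ?J)"
  proof
    fix y assume y: "y \<in> F"
    then have "y \<in> convex hull (x ` A)" using \<open>F \<subseteq> _\<close> by auto
    then obtain p where p: "\<forall>j\<in>A. p j \<ge> 0" "(\<Sum>j\<in>A. p j) = 1" "(\<Sum>j\<in>A. p j *\<^sub>R x j) = y"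
      unfolding convex_hull_image[OF A] by blast
    have z: "p j = 0" if "j \<in> A - ?J" for j
      using face_of_coeff_pos[OF A F _ p(2), of j] p(1,3) y that by force
    have "(\<Sum>j\<in>?J. p j) = (\<Sum>j\<in>A. p j)" "(\<Sum>j\<in>?J. p j *\<^sub>R x j) = (\<Sum>j\<in>A. p j *\<^sub>R x j)"
      using A z by (intro sum.mono_neutral_left; auto)+
    then show "y \<in> convex hull (x ` ?J)"
      using p A by (subst convex_hull_image) (auto intro!: exI[of _ p])
  qed
qed

text \<open>Suppose that \<open>z\<close> lies in both hulls. The barycentre of \<open>J\<close> is
  moved slightly away from \<open>z\<close> inside the affine hull of \<open>J\<close> and moved
  back using the points outside \<open>J\<close>. This writes it as a convex combination with
  positive weight on some outside point, which then belongs to \<open>F\<close> by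
  \<open>face_of_coeff_pos\<close>.\<close>

lemma face_of_disjoint:
  fixes x :: "nat \<Rightarrow> vec"
  assumes A: "finite A" and F: "F face_of convex hull (x ` A)" and ne: "F \<noteq> {}"
  defines "J \<equiv> {j \<in> A. x j \<in> F}"
  shows "affine hull (x ` J) \<inter> convex hull (x ` (A - J)) = {}"
proof (rule ccontr)
  assume "affine hull (x ` J) \<inter> convex hull (x ` (A - J)) \<noteq> {}"
  then obtain z where z: "z \<in> affine hull (x ` J)" "z \<in> convex hull (x ` (A - J))" by blast
  have J: "finite J" "J \<subseteq> A" "finite (A - J)" using A by (auto simp: J_def)
  have FJ: "F = convex hull (x ` J)" unfolding J_def by (rule face_of_index_set[OF A F])
  then have Jne: "J \<noteq> {}" using ne by auto
  obtain l where l: "(\<Sum>j\<in>J. l j) = 1" "(\<Sum>j\<in>J. l j *\<^sub>R x j) = z"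
    using z(1) unfolding affine_hull_image[OF J(1)] by blast
  obtain m where m: "\<forall>j\<in>A - J. m j \<ge> 0" "(\<Sum>j\<in>A - J. m j) = 1" "(\<Sum>j\<in>A - J. m j *\<^sub>R x j) = z"
    using z(2) unfolding convex_hull_image[OF J(3)] by blast
  define c where "c = 1 / real (card J)"
  have c: "c > 0" "(\<Sum>j\<in>J. c) = 1" using J Jne by (auto simp: c_def card_gt_0_iff)
  define M where "M = (\<Sum>j\<in>J. \<bar>l j\<bar>)"
  have M: "\<bar>l j\<bar> \<le> M" if "j \<in> J" for j unfolding M_def using that J(1) by (intro member_le_sum) auto
  have M0: "M \<ge> 0" unfolding M_def by (intro sum_nonneg) auto
  \<comment> \<open>So small that \<open>e * l j \<le> c\<close>: the barycentre keeps nonnegative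
    coefficients when \<open>e\<close> times the representation of \<open>z\<close> is
    subtracted.\<close>
  define e where "e = c / (M + 1)"
  have e: "e > 0" using c M0 by (simp add: e_def)
  have el: "e * l j \<le> c" if "j \<in> J" for j
  proof -
    have "e * l j \<le> e * (M + 1)" using M[OF that] e by (intro mult_left_mono) auto
    also have "\<dots> = c" using M0 by (simp add: e_def)
    finally show ?thesis .
  qed
  define k where "k = 1 / (1 + e)"
  have k: "k > 0" "k * (1 + e) = 1" using e by (auto simp: k_def)
  \<comment> \<open>The coefficients of \<open>k * ((1 + e) * b - e * z) + k * e * z\<close>, where
    \<open>b\<close> is the barycentre of \<open>J\<close>. By \<open>k * (1 + e) = 1\<close> this
    equals \<open>b\<close>.\<close>
  define p where "p j = (if j \<in> J then k * ((1 + e) * c - e * l j) else k * (e * m j))" for j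
  have split: "(\<Sum>j\<in>A. f j) = (\<Sum>j\<in>J. f j) + (\<Sum>j\<in>A - J. f j)" for f :: "nat \<Rightarrow> 'z :: comm_monoid_add"
    using sum.subset_diff[OF J(2) A, of f] by (simp add: add.commute)
  have pJ: "(\<Sum>j\<in>J. p j) = k" and pJ': "(\<Sum>j\<in>A - J. p j) = k * e"
  proof -
    have "(\<Sum>j\<in>J. p j) = (\<Sum>j\<in>J. k * (1 + e) * c - k * e * l j)"
      by (intro sum.cong) (auto simp: p_def algebra_simps)
    also have "\<dots> = k * (1 + e) * (\<Sum>j\<in>J. c) - k * e * (\<Sum>j\<in>J. l j)"
      by (simp only: sum_subtractf sum_distrib_left)
    also have "\<dots> = k" unfolding c(2) l(1) by (simp add: algebra_simps)
    finally show "(\<Sum>j\<in>J. p j) = k" .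
    have "(\<Sum>j\<in>A - J. p j) = (\<Sum>j\<in>A - J. k * e * m j)" by (intro sum.cong) (auto simp: p_def)
    also have "\<dots> = k * e" unfolding sum_distrib_left[symmetric] m(2) by simp
    finally show "(\<Sum>j\<in>A - J. p j) = k * e" .
  qed
  have "(\<Sum>j\<in>A. p j) = 1" unfolding split[of p] pJ pJ' using k(2) by (simp add: algebra_simps)
  moreover have "p j \<ge> 0" if "j \<in> A" for j
  proof (cases "j \<in> J")
    case True
    have "c \<le> (1 + e) * c" using e c by (simp add: algebra_simps)
    then show ?thesis using el[OF True] k True by (simp add: p_def)
  qed (use that k e m(1) in \<open>simp add: p_def\<close>)
  moreover have "(\<Sum>j\<in>A. p j *\<^sub>R x j) = (\<Sum>j\<in>J. c *\<^sub>R x j)"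
  proof -
    have "(\<Sum>j\<in>J. p j *\<^sub>R x j) = (\<Sum>j\<in>J. (k * (1 + e)) *\<^sub>R (c *\<^sub>R x j) - (k * e) *\<^sub>R (l j *\<^sub>R x j))"
      by (intro sum.cong) (auto simp: p_def scaleR_diff_left[symmetric] algebra_simps)
    also have "\<dots> = (\<Sum>j\<in>J. c *\<^sub>R x j) - (k * e) *\<^sub>R z"
      unfolding k(2) by (simp only: sum_subtractf scaleR_sum_right[symmetric] l(2) scaleR_one)
    finally have 1: "(\<Sum>j\<in>J. p j *\<^sub>R x j) = (\<Sum>j\<in>J. c *\<^sub>R x j) - (k * e) *\<^sub>R z" .
    have "(\<Sum>j\<in>A - J. p j *\<^sub>R x j) = (\<Sum>j\<in>A - J. (k * e) *\<^sub>R (m j *\<^sub>R x j))"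
      by (intro sum.cong) (auto simp: p_def)
    also have "\<dots> = (k * e) *\<^sub>R z" by (simp only: scaleR_sum_right[symmetric] m(3))
    finally show ?thesis unfolding split[of "\<lambda>j. p j *\<^sub>R x j"] 1 by (simp only: diff_add_cancel)
  qed
  moreover have "(\<Sum>j\<in>J. c *\<^sub>R x j) \<in> F"
    unfolding FJ using c by (intro convex_sum[OF J(1) convex_convex_hull c(2)]) (auto intro: hull_inc)
  ultimately have coeff: "x j \<in> F" if "j \<in> A" "p j > 0" for j
    using face_of_coeff_pos[OF A F, of p j] that by simp
  have "\<exists>j\<in>A - J. m j \<noteq> 0" using m(2) by (metis sum.neutral zero_neq_one)
  then obtain j where j: "j \<in> A - J" "m j > 0" using m(1) by force
  then have "p j > 0" using k e by (simp add: p_def)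
  then have "x j \<in> F" using coeff j by blast
  then show False using j by (simp add: J_def)
qed

text \<open>Let \<open>y\<close> in the hull of \<open>J\<close> lie between \<open>a\<close> and
  \<open>b\<close>. If their combined weight \<open>m\<close> outside \<open>J\<close> were
  positive, solving for the normalised outside part would exhibit it as an affine combination of
  \<open>J\<close>, against disjointness. So the weights of \<open>a\<close> and \<open>b\<close>
  outside \<open>J\<close> vanish.\<close>

lemma index_set_face:
  fixes x :: "nat \<Rightarrow> vec"
  assumes A: "finite A" and J: "J \<subseteq> A"
    and dis: "affine hull (x ` J) \<inter> convex hull (x ` (A - J)) = {}"
  shows "convex hull (x ` J) face_of convex hull (x ` A)"
  unfolding face_of_def
proof (intro conjI ballI impI)
  have fJ: "finite J" "finite (A - J)" using A J by (auto intro: finite_subset)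
  have split: "(\<Sum>j\<in>A. f j) = (\<Sum>j\<in>J. f j) + (\<Sum>j\<in>A - J. f j)" for f :: "nat \<Rightarrow> 'z :: comm_monoid_add"
    using sum.subset_diff[OF J A, of f] by (simp add: add.commute)
  show "convex hull (x ` J) \<subseteq> convex hull (x ` A)" using J by (intro hull_mono image_mono)
  show "convex (convex hull (x ` J))" by simp
  fix a b y
  assume a: "a \<in> convex hull (x ` A)" and b: "b \<in> convex hull (x ` A)"
    and y: "y \<in> convex hull (x ` J)" "y \<in> open_segment a b"
  obtain s where s: "0 < s" "s < 1" "y = (1 - s) *\<^sub>R a + s *\<^sub>R b"
    using y(2) unfolding in_segment by blast
  obtain p where p: "\<forall>j\<in>A. p j \<ge> 0" "(\<Sum>j\<in>A. p j) = 1" "(\<Sum>j\<in>A. p j *\<^sub>R x j) = a"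
    using a unfolding convex_hull_image[OF A] by blast
  obtain q where q: "\<forall>j\<in>A. q j \<ge> 0" "(\<Sum>j\<in>A. q j) = 1" "(\<Sum>j\<in>A. q j *\<^sub>R x j) = b"
    using b unfolding convex_hull_image[OF A] by blast
  obtain r where r: "(\<Sum>j\<in>J. r j) = 1" "(\<Sum>j\<in>J. r j *\<^sub>R x j) = y"
    using y(1) unfolding convex_hull_image[OF fJ(1)] by blast
  define v where "v j = (1 - s) * p j + s * q j" for j
  have v0: "v j \<ge> 0" if "j \<in> A" for j using that p q s by (simp add: v_def)
  have "(\<Sum>j\<in>A. v j) = (1 - s) * (\<Sum>j\<in>A. p j) + s * (\<Sum>j\<in>A. q j)"
    by (simp only: v_def sum.distrib sum_distrib_left)
  then have v1: "(\<Sum>j\<in>A. v j) = 1" using p q by simp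
  have vy: "(\<Sum>j\<in>A. v j *\<^sub>R x j) = y"
    unfolding s(3) p(3)[symmetric] q(3)[symmetric] v_def
    by (simp only: scaleR_left_distrib sum.distrib scaleR_sum_right scaleR_scaleR)
  define m where "m = (\<Sum>j\<in>A - J. v j)"
  have m0: "m \<ge> 0" unfolding m_def using v0 by (intro sum_nonneg) auto
  have "m = 0"
  proof (rule ccontr)
    assume "m \<noteq> 0"
    then have m: "m > 0" using m0 by simp
    define z where "z = (\<Sum>j\<in>A - J. (v j / m) *\<^sub>R x j)"
    have "z \<in> convex hull (x ` (A - J))"
      unfolding z_def using v0 m fJ
      by (intro convex_sum) (auto simp: sum_divide_distrib[symmetric] m_def[symmetric] intro: hull_inc)
    moreover have "z \<in> affine hull (x ` J)"
    proof -
      have "(\<Sum>j\<in>J. v j) = 1 - m" using v1 unfolding split[of v] m_def by simp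
      then have 1: "(\<Sum>j\<in>J. (r j - v j) / m) = 1"
        using m r(1) by (simp add: sum_divide_distrib[symmetric] sum_subtractf)
      have "m *\<^sub>R z = (\<Sum>j\<in>A - J. v j *\<^sub>R x j)"
        unfolding z_def scaleR_sum_right using m by (intro sum.cong) auto
      also have "\<dots> = y - (\<Sum>j\<in>J. v j *\<^sub>R x j)"
        using vy unfolding split[of "\<lambda>j. v j *\<^sub>R x j"] by (metis add_diff_cancel_left')
      also have "\<dots> = (\<Sum>j\<in>J. (r j - v j) *\<^sub>R x j)"
        unfolding r(2)[symmetric] by (simp only: scaleR_diff_left sum_subtractf)
      finally have mz: "m *\<^sub>R z = (\<Sum>j\<in>J. (r j - v j) *\<^sub>R x j)" .
      have "z = (1 / m) *\<^sub>R (m *\<^sub>R z)" using m by simp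
      also have "\<dots> = (\<Sum>j\<in>J. ((r j - v j) / m) *\<^sub>R x j)"
        unfolding mz scaleR_sum_right by simp
      finally show ?thesis unfolding affine_hull_image[OF fJ(1)] using 1 by metis
    qed
    ultimately show False using dis by blast
  qed
  then have vz: "v j = 0" if "j \<in> A - J" for j
    using that fJ v0 unfolding m_def by (subst (asm) sum_nonneg_eq_0_iff) auto
  have pz: "p j = 0" "q j = 0" if "j \<in> A - J" for j
  proof -
    have "(1 - s) * p j \<ge> 0" "s * q j \<ge> 0" using that p q s by auto
    then have "(1 - s) * p j = 0" "s * q j = 0" using vz[OF that] unfolding v_def by linarith+
    then show "p j = 0" "q j = 0" using s by auto
  qed
  have hull: "w \<in> convex hull (x ` J)"
    if "\<forall>j\<in>A. u j \<ge> 0" "(\<Sum>j\<in>A. u j) = 1" "(\<Sum>j\<in>A. u j *\<^sub>R x j) = w" "\<And>j. j \<in> A - J \<Longrightarrow> u j = 0" for u w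
  proof -
    have "(\<Sum>j\<in>J. u j) = (\<Sum>j\<in>A. u j)" "(\<Sum>j\<in>J. u j *\<^sub>R x j) = (\<Sum>j\<in>A. u j *\<^sub>R x j)"
      using A J that(4) by (intro sum.mono_neutral_left; auto)+
    then show ?thesis unfolding convex_hull_image[OF fJ(1)] using that J by (intro exI[of _ u]) auto
  qed
  show "a \<in> convex hull (x ` J)" by (rule hull[OF p pz(1)])
  show "b \<in> convex hull (x ` J)" by (rule hull[OF q pz(2)])
qed

text \<open>The map from index sets to hulls is inverted by sending \<open>F\<close> to
  \<open>{j \<in> A. x j \<in> F}\<close>. Counting index sets instead of faces makes the count a
  finite sum of indicators of Borel conditions.\<close>

lemma card_facets:
  fixes x :: "nat \<Rightarrow> vec"
  assumes A: "finite A" and d: "d \<ge> 1"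
  shows "card (facets d (convex hull (x ` A))) = card {J. fcond d x A J}"
proof -
  have hd: "has_aff_dim (convex hull (x ` J)) (int d - 1) \<longleftrightarrow> adim d x J" if "J \<subseteq> A" for J
    using adim_has_aff_dim[OF finite_subset[OF that A] d, of x] by (simp add: has_aff_dim_def)
  have idx: "{j \<in> A. x j \<in> convex hull (x ` J)} = J" if "fcond d x A J" for J
  proof -
    have J: "J \<subseteq> A" "affine hull (x ` J) \<inter> convex hull (x ` (A - J)) = {}" using that by (auto simp: fcond_def)
    have "x j \<notin> convex hull (x ` J)" if "j \<in> A - J" for j
    proof -
      have "x j \<in> convex hull (x ` (A - J))" using that by (auto intro: hull_inc)
      then have "x j \<notin> affine hull (x ` J)" using J(2) by blast
      then show ?thesis using convex_hull_subset_affine_hull[of "x ` J"] by blast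
    qed
    moreover have "x j \<in> convex hull (x ` J)" if "j \<in> J" for j using that by (auto intro: hull_inc)
    ultimately show ?thesis using J(1) by blast
  qed
  have "bij_betw (\<lambda>J. convex hull (x ` J)) {J. fcond d x A J} (facets d (convex hull (x ` A)))"
    unfolding bij_betw_def
  proof
    show "inj_on (\<lambda>J. convex hull (x ` J)) {J. fcond d x A J}"
      by (rule inj_on_inverseI[where g = "\<lambda>F. {j \<in> A. x j \<in> F}"]) (use idx in auto)
    show "(\<lambda>J. convex hull (x ` J)) ` {J. fcond d x A J} = facets d (convex hull (x ` A))"
    proof (intro equalityI subsetI)
      fix F assume "F \<in> (\<lambda>J. convex hull (x ` J)) ` {J. fcond d x A J}"
      then obtain J where J: "fcond d x A J" "F = convex hull (x ` J)" by blast
      then show "F \<in> facets d (convex hull (x ` A))"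
        using index_set_face[OF A, of J x] hd[of J] by (simp add: facets_def fcond_def)
    next
      fix F assume "F \<in> facets d (convex hull (x ` A))"
      then have F: "F face_of convex hull (x ` A)" "has_aff_dim F (int d - 1)" by (auto simp: facets_def)
      let ?J = "{j \<in> A. x j \<in> F}"
      have FJ: "F = convex hull (x ` ?J)" by (rule face_of_index_set[OF A F(1)])
      \<comment> \<open>The empty face has affine dimension -1, which \<open>d \<ge> 1\<close>
        excludes.\<close>
      have "F \<noteq> {}"
      proof
        assume "F = {}"
        then obtain B where "affine hull B = {}" "int (card B) = int d" using F(2) by (auto simp: has_aff_dim_def)
        then show False using d by simp
      qed
      then have "affine hull (x ` ?J) \<inter> convex hull (x ` (A - ?J)) = {}"
        by (rule face_of_disjoint[OF A F(1)])
      moreover have "adim d x ?J" using hd[of ?J] F(2) FJ by simp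
      ultimately have "fcond d x A ?J" by (simp add: fcond_def)
      then show "F \<in> (\<lambda>J. convex hull (x ` J)) ` {J. fcond d x A J}" using FJ by blast
    qed
  qed
  then show ?thesis by (rule bij_betw_same_card[symmetric])
qed

subsection \<open>Supporting hyperplanes\<close>

text \<open>The origin and the \<open>m\<close> unit vectors affinely span \<open>Rn m\<close>, so
  independent families there have at most \<open>m + 1\<close> members.\<close>

lemma dep_card:
  fixes x :: "nat \<Rightarrow> vec"
  assumes K: "finite K" "card K \<ge> m + 2" and x: "\<And>k. k \<in> K \<Longrightarrow> x k \<in> Rn m"
  shows "dep K UNIV x"
proof (rule ccontr)
  assume "\<not> dep K UNIV x"
  then have inj: "inj_on x K" and na: "\<not> affine_dependent (x ` K)" using dep_affine_dependent[OF K(1)] by auto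
  define f :: "nat \<Rightarrow> vec" where "f k = (if k < m then (\<lambda>i. if i = k then 1 else 0) else 0)" for k
  have "y \<in> affine hull (f ` {..m})" if "y \<in> Rn m" for y
  proof -
    let ?p = "\<lambda>k. if k < m then y k else 1 - (\<Sum>k<m. y k)"
    have 1: "(\<Sum>k\<le>m. ?p k) = 1" by (simp add: lessThan_Suc_atMost[symmetric])
    have "(\<Sum>k\<le>m. ?p k *\<^sub>R f k) i = y i" for i
    proof -
      have "(\<Sum>k\<le>m. ?p k *\<^sub>R f k) i = (\<Sum>k<m. ?p k * f k i) + ?p m * f m i"
        by (simp add: sum_fun_apply scaleR_fun_def lessThan_Suc_atMost[symmetric])
      also have "\<dots> = (\<Sum>k<m. if k = i then y k else 0)"
      proof -
        have "?p m * f m i = 0" by (simp add: f_def)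
        moreover have "(\<Sum>k<m. ?p k * f k i) = (\<Sum>k<m. if k = i then y k else 0)"
          by (intro sum.cong) (auto simp: f_def)
        ultimately show ?thesis by (simp only: add_0_right)
      qed
      also have "\<dots> = y i" using that by (auto simp: Rn_def sum.delta)
      finally show ?thesis .
    qed
    then have "(\<Sum>k\<le>m. ?p k *\<^sub>R f k) = y" by (rule ext)
    with 1 show ?thesis by (subst affine_hull_image) (simp, blast)
  qed
  then have "card (x ` K) \<le> card (f ` {..m})"
    using x K(1) na by (intro affine_independent_card_le) auto
  also have "\<dots> \<le> m + 1" using card_image_le[of "{..m}" f] by simp
  finally show False using K(2) by (simp add: card_image[OF inj])
qed

text \<open>The origin is added as a further point. Its coefficient absorbs the condition that the
  coefficients sum to 0, so an affine dependence becomes a linear one.\<close>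

lemma linear_system:
  fixes w :: "nat \<Rightarrow> vec"
  assumes K: "finite K" "card K \<ge> m + 1" and w: "\<And>k. k \<in> K \<Longrightarrow> w k \<in> Rn m"
  shows "\<exists>c. (\<exists>k\<in>K. c k \<noteq> 0) \<and> (\<forall>i. (\<Sum>k\<in>K. c k * w k i) = 0)"
proof -
  obtain a where a: "a \<notin> K" using K(1) infinite_UNIV_nat ex_new_if_finite by blast
  let ?w = "w(a := 0)"
  have "dep (insert a K) UNIV ?w"
    by (rule dep_card[of _ m]) (use K w a in \<open>auto simp: Rn_def\<close>)
  then obtain p where p: "\<exists>k\<in>insert a K. p k \<noteq> 0" "p a + (\<Sum>k\<in>K. p k) = 0"
    "\<And>i. p a * ?w a i + (\<Sum>k\<in>K. p k * ?w k i) = 0"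
    using K(1) a by (auto simp: dep_def)
  have "(\<Sum>k\<in>K. p k * w k i) = 0" for i
  proof -
    have "(\<Sum>k\<in>K. p k * ?w k i) = (\<Sum>k\<in>K. p k * w k i)" using a by (intro sum.cong) auto
    then show ?thesis using p(3)[of i] by simp
  qed
  moreover have "\<exists>k\<in>K. p k \<noteq> 0"
  proof (rule ccontr)
    assume n: "\<not> (\<exists>k\<in>K. p k \<noteq> 0)"
    then have "(\<Sum>k\<in>K. p k) = 0" by simp
    then have "p a = 0" using p(2) by simp
    with n p(1) show False by blast
  qed
  ultimately show ?thesis by blast
qed

lemma ip_sum: "ip d u (\<Sum>i\<in>X. p i *\<^sub>R w i) = (\<Sum>i\<in>X. p i * ip d u (w i))"
proof -
  have "ip d u (\<Sum>i\<in>X. p i *\<^sub>R w i) = (\<Sum>k<d. \<Sum>i\<in>X. p i * (u k * w i k))"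
    unfolding ip_def sum_fun_apply scaleR_fun_def sum_distrib_left
    by (intro sum.cong refl) simp
  also have "\<dots> = (\<Sum>i\<in>X. \<Sum>k<d. p i * (u k * w i k))" by (rule sum.swap)
  finally show ?thesis by (simp only: ip_def sum_distrib_left)
qed

text \<open>The \<open>d\<close> incidences are homogeneous linear equations in \<open>d + 1\<close>
  unknowns, namely a normal and the negated offset \<open>c d\<close>. Were the normal zero, any one
  of the equations would make the offset zero too.\<close>

lemma hyperplane_exists:
  fixes x :: "nat \<Rightarrow> vec"
  assumes I: "finite I" "card I = d" and d: "d \<ge> 1"
  shows "\<exists>u t. ip d u u = 1 \<and> (\<forall>i\<in>I. ip d u (x i) = t)"
proof -
  obtain \<sigma> where \<sigma>: "bij_betw \<sigma> {..<d} I"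
    using ex_bij_betw_nat_finite[OF I(1)] I(2) by (auto simp: atLeast0LessThan)
  define w :: "nat \<Rightarrow> vec" where "w k j = (if j < d then (if k < d then x (\<sigma> j) k else 1) else 0)" for k j
  have "\<exists>c. (\<exists>k\<in>{..d}. c k \<noteq> 0) \<and> (\<forall>i. (\<Sum>k\<in>{..d}. c k * w k i) = 0)"
    by (rule linear_system[of _ d]) (auto simp: Rn_def w_def)
  then obtain c where c: "\<exists>k\<in>{..d}. c k \<noteq> 0" "\<And>i. (\<Sum>k\<in>{..d}. c k * w k i) = 0" by blast
  have 1: "ip d c (x (\<sigma> j)) = - c d" if "j < d" for j
    using c(2)[of j] that unfolding lessThan_Suc_atMost[symmetric] by (simp add: w_def ip_def)
  have "\<exists>k<d. c k \<noteq> 0"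
  proof (rule ccontr)
    assume "\<not> (\<exists>k<d. c k \<noteq> 0)"
    then have z: "c k = 0" if "k < d" for k using that by blast
    then have "ip d c (x (\<sigma> 0)) = 0" by (simp add: ip_def)
    then have "c d = 0" using 1[of 0] d by simp
    then have "c k = 0" if "k \<le> d" for k using z that by (cases "k = d") auto
    with c(1) show False by auto
  qed
  then obtain k where k: "k < d" "c k \<noteq> 0" by blast
  have "0 < c k * c k" using k(2) by (simp add: zero_less_mult_iff) linarith
  also have "\<dots> \<le> ip d c c" unfolding ip_def using k(1) by (intro member_le_sum) auto
  finally have pos: "ip d c c > 0" .
  define r where "r = 1 / sqrt (ip d c c)"
  have "ip d (r *\<^sub>R c) (r *\<^sub>R c) = 1" using pos by (simp add: ip_simps r_def)
  moreover have "ip d (r *\<^sub>R c) (x i) = - (r * c d)" if "i \<in> I" for i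
  proof -
    obtain j where "j < d" "i = \<sigma> j" using \<sigma> \<open>i \<in> I\<close> by (auto simp: bij_betw_def)
    then show ?thesis using 1[of j] by (simp add: ip_simps)
  qed
  ultimately show ?thesis by blast
qed

text \<open>Together with \<open>y\<close> and \<open>y + v\<close>, where \<open>v\<close> is the
  unit normal, there are \<open>d + 2\<close> points in \<open>Rn d\<close>, hence a dependence.
  Applying \<open>ip d u\<close> shows that the coefficient of \<open>y + v\<close> is 0, so
  \<open>y\<close> depends on the points of \<open>I\<close>.\<close>

lemma hyperplane_subset_affine_hull:
  fixes x :: "nat \<Rightarrow> vec"
  assumes I: "finite I" "card I = d" "\<not> dep I UNIV x" and x: "\<And>i. i \<in> I \<Longrightarrow> x i \<in> Rn d"
    and u: "ip d u u = 1" "\<And>i. i \<in> I \<Longrightarrow> ip d u (x i) = t" and y: "y \<in> Rn d" "ip d u y = t"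
  shows "y \<in> affine hull (x ` I)"
proof -
  define v where "v = (\<lambda>i. if i < d then u i else 0)"
  have v: "v \<in> Rn d" "ip d u v = 1" using u(1) by (simp_all add: v_def Rn_def ip_def)
  obtain a where a: "a \<notin> I" using I(1) infinite_UNIV_nat ex_new_if_finite by blast
  obtain b where b: "b \<notin> insert a I" using I(1) infinite_UNIV_nat ex_new_if_finite[of "insert a I"] by blast
  define w where "w = x(a := y, b := y + v)"
  have wI: "w i = x i" if "i \<in> I" for i using that a b by (auto simp: w_def)
  have wa: "w a = y" "w b = y + v" using b by (auto simp: w_def)
  have "dep (insert b (insert a I)) UNIV w"
    by (rule dep_card[of _ d]) (use I a b x y v wI wa in \<open>auto simp: Rn_simps\<close>)
  then obtain p where p: "\<exists>i\<in>insert b (insert a I). p i \<noteq> 0" "p b + (p a + (\<Sum>i\<in>I. p i)) = 0"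
    "p b *\<^sub>R w b + (p a *\<^sub>R w a + (\<Sum>i\<in>I. p i *\<^sub>R w i)) = 0"
    using I(1) a b by (auto simp: dep_UNIV)
  have ips: "ip d u (\<Sum>i\<in>I. p i *\<^sub>R w i) = (\<Sum>i\<in>I. p i * t)"
    unfolding ip_sum using u(2) wI by (simp cong: sum.cong)
  have "ip d u (p b *\<^sub>R w b + (p a *\<^sub>R w a + (\<Sum>i\<in>I. p i *\<^sub>R w i))) = 0" unfolding p(3) by (simp add: ip_simps)
  then have "p b * (t + 1) + (p a * t + (\<Sum>i\<in>I. p i) * t) = 0"
    by (simp only: ip_simps ips wa v y sum_distrib_right)
  then have "p b + t * (p b + (p a + (\<Sum>i\<in>I. p i))) = 0" by (simp add: algebra_simps)
  then have pb: "p b = 0" unfolding p(2) by simp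
  have "dep (insert a I) UNIV w"
    unfolding dep_UNIV using p pb I(1) a by (intro exI[of _ p]) auto
  moreover have "\<not> dep I UNIV w"
  proof -
    have "dep I UNIV w \<longleftrightarrow> dep I UNIV x" unfolding dep_UNIV using wI by (simp cong: sum.cong)
    then show ?thesis using I(3) by simp
  qed
  ultimately have "w a \<in> affine hull (w ` I)" using dep_insert_affine_hull[OF I(1) a] by blast
  moreover have "w ` I = x ` I" using wI by (intro image_cong) auto
  ultimately show ?thesis by (simp only: wa)
qed

definition supported :: "nat \<Rightarrow> (nat \<Rightarrow> vec) \<Rightarrow> nat set \<Rightarrow> nat set \<Rightarrow> bool"
  where "supported d x A I \<longleftrightarrow> (\<exists>u t. ip d u u = 1 \<and> (\<forall>i\<in>I. ip d u (x i) = t) \<and> (\<forall>l\<in>A - I. ip d u (x l) \<le> t))"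

lemma ip_affine_hull:
  fixes x :: "nat \<Rightarrow> vec"
  assumes "finite I" "\<And>i. i \<in> I \<Longrightarrow> ip d u (x i) = t" "y \<in> affine hull (x ` I)"
  shows "ip d u y = t"
proof -
  obtain p where p: "(\<Sum>j\<in>I. p j) = 1" "(\<Sum>j\<in>I. p j *\<^sub>R x j) = y"
    using assms(3) unfolding affine_hull_image[OF assms(1)] by blast
  have "ip d u y = (\<Sum>i\<in>I. p i * ip d u (x i))" unfolding p(2)[symmetric] by (rule ip_sum)
  also have "\<dots> = (\<Sum>i\<in>I. p i * t)" using assms(2) by (simp cong: sum.cong)
  finally have "ip d u y = (\<Sum>i\<in>I. p i * t)" .
  then show ?thesis using p(1) by (simp add: sum_distrib_right[symmetric])
qed

text \<open>\<open>I\<close> gives an affine basis of the points of \<open>J\<close>. If two points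
  lay strictly on opposite sides of the hyperplane through it, the segment between them would cross
  the affine hull of \<open>J\<close>. The last conjunct recovers \<open>J\<close> from
  \<open>I\<close>, for the count in \<open>card_fcond_le\<close>.\<close>

lemma fcond_supported:
  fixes x :: "nat \<Rightarrow> vec"
  assumes A: "finite A" and d: "d \<ge> 1" and x: "\<And>i. i \<in> A \<Longrightarrow> x i \<in> Rn d" and J: "fcond d x A J"
  shows "\<exists>I. I \<subseteq> A \<and> card I = d \<and> supported d x A I \<and> J = {j \<in> A. x j \<in> affine hull (x ` I)}"
proof -
  have JA: "J \<subseteq> A" and dis: "affine hull (x ` J) \<inter> convex hull (x ` (A - J)) = {}" and ad: "adim d x J"
    using J by (auto simp: fcond_def)
  have fJ: "finite J" using JA A by (rule finite_subset)
  obtain I where I: "I \<subseteq> J" "card I = d" "\<not> dep I UNIV x" "\<And>j. j \<in> J - I \<Longrightarrow> dep (insert j I) UNIV x"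
    using ad by (auto simp: adim_def)
  have fI: "finite I" using I(1) fJ by (rule finite_subset)
  have aff: "affine hull (x ` I) = affine hull (x ` J)" by (rule adim_affine_hull[OF fJ I(1,3,4)])
  have xI: "x i \<in> Rn d" if "i \<in> I" for i using that I(1) JA x by blast
  obtain u t where u: "ip d u u = 1" "\<And>i. i \<in> I \<Longrightarrow> ip d u (x i) = t"
    using hyperplane_exists[OF fI I(2) d, of x] by blast
  have "x j \<notin> affine hull (x ` J)" if "j \<in> A - J" for j
    using that dis hull_inc[of "x j" "x ` (A - J)" convex] by blast
  moreover have "x j \<in> affine hull (x ` J)" if "j \<in> J" for j using that by (auto intro: hull_inc)
  ultimately have Jeq: "J = {j \<in> A. x j \<in> affine hull (x ` I)}" using JA unfolding aff by blast
  have onJ: "ip d u (x j) = t" if "j \<in> J" for j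
  proof -
    have xj: "x j \<in> affine hull (x ` I)" using that Jeq by blast
    show ?thesis by (rule ip_affine_hull[where x = x, OF fI _ xj]) (rule u(2))
  qed
  have side: "\<not> (ip d u (x j) < t \<and> t < ip d u (x k))" if jk: "j \<in> A" "k \<in> A" for j k
  proof
    assume s: "ip d u (x j) < t \<and> t < ip d u (x k)"
    have jk': "j \<in> A - J" "k \<in> A - J" using s onJ jk by auto
    define a b where "a = t - ip d u (x j)" and "b = ip d u (x k) - t"
    have ab: "a > 0" "b > 0" using s by (auto simp: a_def b_def)
    \<comment> \<open>The crossing point of the segment with the hyperplane: each endpoint is
      weighted with the distance of the other one.\<close>
    define y where "y = (b / (a + b)) *\<^sub>R x j + (a / (a + b)) *\<^sub>R x k"
    have sum1: "b / (a + b) + a / (a + b) = 1" using ab by (simp add: add_divide_distrib[symmetric] add.commute)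
    have "y \<in> convex hull (x ` (A - J))"
      unfolding y_def using jk' ab sum1 by (intro convexD[OF convex_convex_hull]) (auto intro: hull_inc)
    moreover have "y \<in> affine hull (x ` I)"
    proof (rule hyperplane_subset_affine_hull[where u = u and t = t, OF fI I(2,3) _ u(1)])
      show "y \<in> Rn d" unfolding y_def using x jk by (intro Rn_simps) auto
      have "ip d u y = (b * ip d u (x j) + a * ip d u (x k)) / (a + b)"
        unfolding y_def ip_simps by (simp add: add_divide_distrib)
      also have "b * ip d u (x j) + a * ip d u (x k) = (a + b) * t" unfolding a_def b_def by (simp add: algebra_simps)
      finally show "ip d u y = t" using ab by simp
    qed (use xI u(2) in auto)
    ultimately show False using dis aff by blast
  qed
  have "supported d x A I"
  proof (cases "\<exists>k\<in>A. t < ip d u (x k)")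
    case False
    then show ?thesis unfolding supported_def using u by (intro exI[of _ u] exI[of _ t]) force
  next
    case True
    then have "\<forall>j\<in>A. t \<le> ip d u (x j)" using side by force
    then show ?thesis unfolding supported_def using u
      by (intro exI[of _ "- u"] exI[of _ "- t"]) (auto simp: ip_simps)
  qed
  then show ?thesis using I JA Jeq by blast
qed

text \<open>A facet with more than \<open>d\<close> points can arise from several \<open>I\<close>.
  One is selected, and the choice is injective because \<open>J\<close> is determined by the affine
  hull of \<open>I\<close>.\<close>

lemma card_fcond_le:
  fixes x :: "nat \<Rightarrow> vec"
  assumes A: "finite A" and d: "d \<ge> 1" and x: "\<And>i. i \<in> A \<Longrightarrow> x i \<in> Rn d"
  shows "card {J. fcond d x A J} \<le> card {I. I \<subseteq> A \<and> card I = d \<and> supported d x A I}"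
proof -
  define f where "f J = (SOME I. I \<subseteq> A \<and> card I = d \<and> supported d x A I \<and> J = {j \<in> A. x j \<in> affine hull (x ` I)})" for J
  have f0: "f J \<subseteq> A \<and> card (f J) = d \<and> supported d x A (f J) \<and> J = {j \<in> A. x j \<in> affine hull (x ` f J)}"
    if "fcond d x A J" for J
    unfolding f_def by (rule someI_ex, rule fcond_supported[OF A d x that])
  have f: "\<And>J. fcond d x A J \<Longrightarrow> f J \<in> {I. I \<subseteq> A \<and> card I = d \<and> supported d x A I}"
    "\<And>J. fcond d x A J \<Longrightarrow> {j \<in> A. x j \<in> affine hull (x ` f J)} = J"
    using f0 by blast+
  show ?thesis
  proof (rule card_inj_on_le[where f = f])
    show "inj_on f {J. fcond d x A J}"
      by (rule inj_on_inverseI[where g = "\<lambda>I. {j \<in> A. x j \<in> affine hull (x ` I)}"]) (rule f(2), simp)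
    show "finite {I. I \<subseteq> A \<and> card I = d \<and> supported d x A I}"
      by (rule finite_subset[of _ "Pow A"]) (use A in auto)
  qed (use f(1) in blast)
qed

lemma fcond_lower:
  fixes x :: "nat \<Rightarrow> vec"
  assumes A: "finite A" and I: "I \<subseteq> A" "card I = d" "\<not> dep I UNIV x"
    and u: "\<And>i. i \<in> I \<Longrightarrow> ip d u (x i) = t" "\<And>l. l \<in> A - I \<Longrightarrow> ip d u (x l) < t"
  shows "fcond d x A I"
proof -
  have fI: "finite I" "finite (A - I)" using A I(1) by (auto intro: finite_subset)
  have "ip d u y < t" if y: "y \<in> convex hull (x ` (A - I))" for y
  proof -
    obtain p where p: "\<forall>j\<in>A - I. p j \<ge> 0" "(\<Sum>j\<in>A - I. p j) = 1" "(\<Sum>j\<in>A - I. p j *\<^sub>R x j) = y"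
      using y unfolding convex_hull_image[OF fI(2)] by blast
    have e: "ip d u y = (\<Sum>i\<in>A - I. p i * ip d u (x i))" unfolding p(3)[symmetric] by (rule ip_sum)
    have "\<exists>j\<in>A - I. p j \<noteq> 0" using p(2) by (metis sum.neutral zero_neq_one)
    then obtain j where j: "j \<in> A - I" "p j > 0" using p(1) by force
    have "(\<Sum>i\<in>A - I. p i * ip d u (x i)) < (\<Sum>i\<in>A - I. p i * t)"
    proof (rule sum_strict_mono_ex1[OF fI(2)])
      show "\<forall>i\<in>A - I. p i * ip d u (x i) \<le> p i * t"
      proof
        fix i assume i: "i \<in> A - I"
        show "p i * ip d u (x i) \<le> p i * t"
          by (rule mult_left_mono[OF less_imp_le[OF u(2)[OF i]]]) (use p(1) i in blast)
      qed
      have "p j * ip d u (x j) < p j * t" using u(2) j by (intro mult_strict_left_mono)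
      then show "\<exists>i\<in>A - I. p i * ip d u (x i) < p i * t" using j(1) by blast
    qed
    also have "\<dots> = t" using p(2) by (simp add: sum_distrib_right[symmetric])
    finally show ?thesis using e by simp
  qed
  then have "affine hull (x ` I) \<inter> convex hull (x ` (A - I)) = {}"
    using ip_affine_hull[where x = x and u = u and t = t, OF fI(1)] u(1) by force
  moreover have "adim d x I" using I unfolding adim_def by (intro exI[of _ I]) auto
  ultimately show ?thesis using I by (simp add: fcond_def)
qed

subsection \<open>Measurability of the number of facets\<close>

text \<open>For disjoint \<open>J\<close> and \<open>K\<close> a single vector \<open>p\<close>
  holds the coefficients of both combinations. Those of the affine one are unbounded, so
  \<open>meet_iff\<close> exhausts them by cubes and yields a countable union of closed
  sets.\<close>

definition meet :: "nat set \<Rightarrow> nat set \<Rightarrow> (nat \<Rightarrow> vec) \<Rightarrow> vec \<Rightarrow> bool"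
  where "meet J K x p \<longleftrightarrow> (\<Sum>j\<in>J. p j) = 1 \<and> (\<forall>k\<in>K. 0 \<le> p k) \<and> (\<Sum>k\<in>K. p k) = 1 \<and>
    (\<forall>i. (\<Sum>j\<in>J. p j * x j i) = (\<Sum>k\<in>K. p k * x k i))"

lemma meet_iff:
  assumes JK: "finite J" "finite K" "J \<inter> K = {}"
  shows "affine hull (x ` J) \<inter> convex hull (x ` K) \<noteq> {} \<longleftrightarrow> (\<exists>N. \<exists>p\<in>pbox (real N). meet J K x p)"
proof
  assume "affine hull (x ` J) \<inter> convex hull (x ` K) \<noteq> {}"
  then obtain z where z: "z \<in> affine hull (x ` J)" "z \<in> convex hull (x ` K)" by blast
  obtain l where l: "(\<Sum>j\<in>J. l j) = 1" "(\<Sum>j\<in>J. l j *\<^sub>R x j) = z"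
    using z(1) unfolding affine_hull_image[OF JK(1)] by blast
  obtain m where m: "\<forall>j\<in>K. m j \<ge> 0" "(\<Sum>j\<in>K. m j) = 1" "(\<Sum>j\<in>K. m j *\<^sub>R x j) = z"
    using z(2) unfolding convex_hull_image[OF JK(2)] by blast
  define p where "p j = (if j \<in> J then l j else if j \<in> K then m j else 0)" for j
  have pJ: "(\<Sum>j\<in>J. f (p j) j) = (\<Sum>j\<in>J. f (l j) j)" for f :: "real \<Rightarrow> nat \<Rightarrow> real"
    by (intro sum.cong) (auto simp: p_def)
  have pK: "(\<Sum>j\<in>K. f (p j) j) = (\<Sum>j\<in>K. f (m j) j)" for f :: "real \<Rightarrow> nat \<Rightarrow> real"
    using JK(3) by (intro sum.cong) (auto simp: p_def)
  have zi: "(\<Sum>j\<in>J. l j * x j i) = z i" "(\<Sum>j\<in>K. m j * x j i) = z i" for i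
    using fun_cong[OF l(2), of i] fun_cong[OF m(3), of i] by (simp_all add: sum_fun_apply scaleR_fun_def)
  have "meet J K x p"
    unfolding meet_def
  proof (intro conjI ballI allI)
    show "(\<Sum>j\<in>J. p j) = 1" "(\<Sum>k\<in>K. p k) = 1" using pJ[of "\<lambda>a _. a"] pK[of "\<lambda>a _. a"] l(1) m(2) by auto
    show "0 \<le> p k" if "k \<in> K" for k using that m(1) JK(3) by (auto simp: p_def)
    show "(\<Sum>j\<in>J. p j * x j i) = (\<Sum>k\<in>K. p k * x k i)" for i
      using pJ[of "\<lambda>a j. a * x j i"] pK[of "\<lambda>a j. a * x j i"] zi by simp
  qed
  moreover have "\<exists>N. p \<in> pbox (real N)"
  proof -
    have le: "\<bar>p j\<bar> \<le> (\<Sum>j\<in>J \<union> K. \<bar>p j\<bar>)" for j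
    proof (cases "j \<in> J \<union> K")
      case True then show ?thesis using JK by (intro member_le_sum) auto
    next
      case False then show ?thesis by (simp add: p_def sum_nonneg)
    qed
    obtain N where "(\<Sum>j\<in>J \<union> K. \<bar>p j\<bar>) \<le> real N" using real_arch_simple by blast
    then show ?thesis using le by (intro exI[of _ N]) (auto simp: pbox_def intro: order_trans)
  qed
  ultimately show "\<exists>N. \<exists>p\<in>pbox (real N). meet J K x p" by blast
next
  assume "\<exists>N. \<exists>p\<in>pbox (real N). meet J K x p"
  then obtain p where p: "meet J K x p" by blast
  define z where "z = (\<Sum>j\<in>J. p j *\<^sub>R x j)"
  have "z = (\<Sum>j\<in>K. p j *\<^sub>R x j)"
    unfolding z_def using p by (intro ext) (simp add: sum_fun_apply scaleR_fun_def meet_def)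
  then have "z \<in> affine hull (x ` J)" "z \<in> convex hull (x ` K)"
    using p z_def unfolding affine_hull_image[OF JK(1)] convex_hull_image[OF JK(2)] meet_def
    by (auto intro!: exI[of _ p])
  then show "affine hull (x ` J) \<inter> convex hull (x ` K) \<noteq> {}" by blast
qed

lemma sets_meet:
  assumes JK: "finite J" "finite K" "J \<inter> K = {}"
  shows "{x. affine hull (x ` J) \<inter> convex hull (x ` K) = {}} \<in> sets (borel :: (nat \<Rightarrow> vec) measure)"
proof -
  have c: "closed {x. \<exists>p\<in>pbox (real N). meet J K x p}" for N
    unfolding meet_def
    by (rule closed_ex_pbox) (intro closed_Collect_conj closed_ball_Collect closed_Collect_all closed_Collect_eq
        closed_Collect_le continuous_intros)
  have "{x. affine hull (x ` J) \<inter> convex hull (x ` K) = {}} = UNIV - (\<Union>N. {x. \<exists>p\<in>pbox (real N). meet J K x p})"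
    using meet_iff[OF JK] by auto
  moreover have "(\<Union>N. {x. \<exists>p\<in>pbox (real N). meet J K x p}) \<in> sets borel"
    by (rule sets.countable_nat_UN) (blast intro: borel_closed c)
  ultimately show ?thesis by auto
qed

lemma sets_fcond:
  assumes A: "finite A"
  shows "{x. fcond d x A J} \<in> sets (borel :: (nat \<Rightarrow> vec) measure)"
proof (cases "J \<subseteq> A")
  case True
  then have J: "finite J" "finite (A - J)" using A by (auto intro: finite_subset)
  have "{x. adim d x J} = (\<Union>I\<in>{I. I \<subseteq> J \<and> card I = d}. {x. \<not> dep I UNIV x} \<inter> (\<Inter>j\<in>J - I. {x. dep (insert j I) UNIV x}) )"
    by (auto simp: adim_def)
  also have "\<dots> \<in> sets borel"
  proof (rule sets.finite_UN)
    show "finite {I. I \<subseteq> J \<and> card I = d}" by (rule finite_subset[of _ "Pow J"]) (use J in auto)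
    fix I assume I: "I \<in> {I. I \<subseteq> J \<and> card I = d}"
    then have fI: "finite I" using J by (auto intro: finite_subset)
    have "{x. \<not> dep I UNIV x} = UNIV - {x. dep I UNIV x}" by auto
    then have 1: "{x. \<not> dep I UNIV x} \<in> sets borel" using sets_dep[OF fI] by auto
    have "closed (\<Inter>j\<in>J - I. {x. dep (insert j I) UNIV x})" using closed_dep fI by auto
    then show "{x. \<not> dep I UNIV x} \<inter> (\<Inter>j\<in>J - I. {x. dep (insert j I) UNIV x}) \<in> sets borel"
      by (rule sets.Int[OF 1 borel_closed])
  qed
  finally have "{x. adim d x J} \<in> sets borel" .
  moreover have "{x. fcond d x A J} = {x. affine hull (x ` J) \<inter> convex hull (x ` (A - J)) = {}} \<inter> {x. adim d x J}"
    using True by (auto simp: fcond_def)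
  ultimately show ?thesis using sets_meet[OF J, of] by auto
qed (simp add: fcond_def)

subsection \<open>Bounds for the expected number of facets\<close>

lemma upper_event_supported:
  fixes x :: "nat \<Rightarrow> vec"
  assumes \<sigma>: "bij_betw \<sigma> {..<n} A" "\<sigma> ` {..<d} = I" and d: "1 \<le> d" "d \<le> n" and s: "supported d x A I"
  shows "upper_event {d..<n} d (\<lambda>i. if i < n then x (\<sigma> i) else 0) = 1"
proof -
  obtain u t where u: "ip d u u = 1" "\<forall>i\<in>I. ip d u (x i) = t" "\<forall>l\<in>A - I. ip d u (x l) \<le> t"
    using s by (auto simp: supported_def)
  have inj: "inj_on \<sigma> {..<n}" and im: "\<sigma> ` {..<n} = A" using \<sigma>(1) by (auto simp: bij_betw_def)
  have 1: "ip d u (x (\<sigma> i)) = t" if "i < d" for i using u(2) \<sigma>(2) that by blast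
  have 2: "ip d u (x (\<sigma> l)) \<le> t" if "l \<in> {d..<n}" for l
  proof -
    have "\<sigma> l \<notin> \<sigma> ` {..<d}"
    proof
      assume "\<sigma> l \<in> \<sigma> ` {..<d}"
      then obtain i where "i < d" "\<sigma> l = \<sigma> i" by auto
      then have "l = i" using inj_onD[OF inj, of l i] that d by auto
      then show False using \<open>i < d\<close> that by simp
    qed
    then show ?thesis using u(3) \<sigma>(2) im that by auto
  qed
  have "supp d {d..<n} 0 (\<lambda>i. if i < n then x (\<sigma> i) else 0)"
    unfolding supp_def
  proof (intro exI[of _ u] conjI ballI)
    show "ip d u u = 1" by (rule u(1))
    fix i assume "i \<in> {..<d}"
    then show "ip d u (if i < n then x (\<sigma> i) else 0) = ip d u (if 0 < n then x (\<sigma> 0) else 0)"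
      using 1[of i] 1[of 0] d by simp
  next
    fix l assume "l \<in> {d..<n}"
    then show "ip d u (if l < n then x (\<sigma> l) else 0) \<le> ip d u (if 0 < n then x (\<sigma> 0) else 0) - 0"
      using 2[of l] 1[of 0] d by simp
  qed
  then show ?thesis by (simp add: upper_event_def)
qed

lemma lower_event_fcond:
  fixes x :: "nat \<Rightarrow> vec"
  assumes \<sigma>: "bij_betw \<sigma> {..<n} A" "\<sigma> ` {..<d} = I" and d: "1 \<le> d" "d \<le> n"
    and e: "lower_event {d..<n} d (\<lambda>i. if i < n then x (\<sigma> i) else 0) \<noteq> 0"
  shows "fcond d x A I"
proof -
  let ?z = "\<lambda>i. if i < n then x (\<sigma> i) else 0"
  have inj: "inj_on \<sigma> {..<n}" and im: "\<sigma> ` {..<n} = A" using \<sigma>(1) by (auto simp: bij_betw_def)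
  have injd: "inj_on \<sigma> {..<d}" using inj by (rule inj_on_subset) (use d in auto)
  have nd: "\<not> dep {..<d} {..<d} ?z" and "ssupp d {d..<n} ?z"
    using e by (auto simp: lower_event_def indicator_def split: if_splits)
  then obtain u where u: "\<forall>i\<in>{..<d}. ip d u (?z i) = ip d u (?z 0)" "\<forall>l\<in>{d..<n}. ip d u (?z l) < ip d u (?z 0)"
    by (auto simp only: ssupp_def)
  let ?t = "ip d u (?z 0)"
  show ?thesis
  proof (rule fcond_lower[where u = u and t = ?t])
    show "finite A" using im by auto
    show "I \<subseteq> A" using \<sigma>(2) im d by auto
    show "card I = d" using \<sigma>(2) card_image[OF injd] by simp
    show "\<not> dep I UNIV x"
    proof
      assume "dep I UNIV x"
      then obtain p where p: "\<exists>i\<in>I. p i \<noteq> 0" "(\<Sum>i\<in>I. p i) = 0" "\<And>k. (\<Sum>i\<in>I. p i * x i k) = 0"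
        by (auto simp: dep_def)
      have "(\<Sum>i<d. p (\<sigma> i)) = 0" using p(2) unfolding \<sigma>(2)[symmetric] by (simp add: sum.reindex[OF injd])
      moreover have "(\<Sum>i<d. p (\<sigma> i) * ?z i k) = 0" for k
      proof -
        have "(\<Sum>i<d. p (\<sigma> i) * ?z i k) = (\<Sum>i<d. p (\<sigma> i) * x (\<sigma> i) k)"
          using d by (intro sum.cong) auto
        then show ?thesis using p(3)[of k] unfolding \<sigma>(2)[symmetric] by (simp add: sum.reindex[OF injd])
      qed
      moreover have "\<exists>i\<in>{..<d}. p (\<sigma> i) \<noteq> 0" using p(1) unfolding \<sigma>(2)[symmetric] by blast
      ultimately have "dep {..<d} {..<d} ?z" unfolding dep_def by (intro exI[of _ "\<lambda>i. p (\<sigma> i)"] conjI ballI)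
      then show False using nd by simp
    qed
    fix i assume "i \<in> I"
    then obtain j where "j < d" "i = \<sigma> j" using \<sigma>(2) by auto
    then show "ip d u (x i) = ?t" using bspec[OF u(1), of j] d by simp
  next
    fix l assume l: "l \<in> A - I"
    then obtain j where j: "j < n" "l = \<sigma> j" using im by auto
    then have "\<not> j < d" using l \<sigma>(2) by auto
    then show "ip d u (x l) < ?t" using bspec[OF u(2), of j] j by simp
  qed
qed

lemma (in prob_space) distr_pm:
  fixes X :: "nat \<Rightarrow> 'a \<Rightarrow> vec"
  assumes ind: "indep_vars (\<lambda>_. borel) X A" and N: "\<And>i. i \<in> A \<Longrightarrow> distr M borel (X i) = N"
    and \<sigma>: "bij_betw \<sigma> {..<n} A" and n: "n > 0"
  shows "distr M borel (\<lambda>\<omega> i. if i < n then X (\<sigma> i) \<omega> else 0) = power_measure {..<n} N"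
    and "(\<lambda>\<omega> i. if i < n then X (\<sigma> i) \<omega> else 0) \<in> borel_measurable M"
proof -
  have inj: "inj_on \<sigma> {..<n}" and im: "\<sigma> ` {..<n} = A" using \<sigma> by (auto simp: bij_betw_def)
  have rv: "random_variable borel (X i)" if "i \<in> A" for i using ind that by (auto simp: indep_vars_def)
  have s\<sigma>: "\<sigma> i \<in> A" if "i < n" for i using im that by auto
  have rv': "random_variable borel (X (\<sigma> i))" if "i \<in> {..<n}" for i using rv s\<sigma> that by auto
  have sN: "sets N = sets borel" using N[OF s\<sigma>[OF n]] by (metis sets_distr)
  have pN: "prob_space N" using N[OF s\<sigma>[OF n]] prob_space_distr[OF rv[OF s\<sigma>[OF n]]] by simp
  have ne: "A \<noteq> {}" using s\<sigma>[OF n] by auto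
  let ?B = "borel :: vec measure"
  have mA: "(\<lambda>\<omega>. \<lambda>i\<in>A. X i \<omega>) \<in> measurable M (\<Pi>\<^sub>M i\<in>A. ?B)"
    by (rule measurable_restrict) (use rv in auto)
  have "distr M (\<Pi>\<^sub>M i\<in>A. ?B) (\<lambda>\<omega>. \<lambda>i\<in>A. X i \<omega>) = (\<Pi>\<^sub>M i\<in>A. distr M borel (X i))"
    using indep_vars_iff_distr_eq_PiM'[OF ne, where M' = "\<lambda>_. borel" and X = X] ind rv by auto
  also have "\<dots> = (\<Pi>\<^sub>M i\<in>A. N)" using N by (intro PiM_cong) auto
  finally have dA: "distr M (\<Pi>\<^sub>M i\<in>A. ?B) (\<lambda>\<omega>. \<lambda>i\<in>A. X i \<omega>) = (\<Pi>\<^sub>M i\<in>A. N)" .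
  have mr: "(\<lambda>\<omega>. \<lambda>k\<in>{..<n}. \<omega> (\<sigma> k)) \<in> measurable (\<Pi>\<^sub>M i\<in>A. ?B) (\<Pi>\<^sub>M i\<in>{..<n}. ?B)"
    by (rule measurable_restrict, rule measurable_component_singleton) (use s\<sigma> in auto)
  have seq: "sets (\<Pi>\<^sub>M i\<in>{..<n}. N) = sets (\<Pi>\<^sub>M i\<in>{..<n}. ?B)"
    by (intro sets_PiM_cong) (simp_all add: sN)
  have "(\<Pi>\<^sub>M i\<in>{..<n}. N) = distr (\<Pi>\<^sub>M i\<in>A. N) (\<Pi>\<^sub>M i\<in>{..<n}. N) (\<lambda>\<omega>. \<lambda>k\<in>{..<n}. \<omega> (\<sigma> k))"
    by (rule distr_PiM_reindex[symmetric]) (use inj s\<sigma> pN in auto)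
  also have "\<dots> = distr (\<Pi>\<^sub>M i\<in>A. N) (\<Pi>\<^sub>M i\<in>{..<n}. ?B) (\<lambda>\<omega>. \<lambda>k\<in>{..<n}. \<omega> (\<sigma> k))"
    by (rule distr_cong) (simp_all add: seq)
  also have "\<dots> = distr M (\<Pi>\<^sub>M i\<in>{..<n}. ?B) ((\<lambda>\<omega>. \<lambda>k\<in>{..<n}. \<omega> (\<sigma> k)) \<circ> (\<lambda>\<omega>. \<lambda>i\<in>A. X i \<omega>))"
    unfolding dA[symmetric] by (rule distr_distr[OF mr mA])
  also have "(\<lambda>\<omega>. \<lambda>k\<in>{..<n}. \<omega> (\<sigma> k)) \<circ> (\<lambda>\<omega>. \<lambda>i\<in>A. X i \<omega>) = (\<lambda>\<omega>. \<lambda>i\<in>{..<n}. X (\<sigma> i) \<omega>)"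
    using s\<sigma> by (auto simp: fun_eq_iff)
  finally have d2: "distr M (\<Pi>\<^sub>M i\<in>{..<n}. borel) (\<lambda>\<omega>. \<lambda>i\<in>{..<n}. X (\<sigma> i) \<omega>) = (\<Pi>\<^sub>M i\<in>{..<n}. N)" by (rule sym)
  have m1: "(\<lambda>\<omega>. \<lambda>i\<in>{..<n}. X (\<sigma> i) \<omega>) \<in> measurable M (\<Pi>\<^sub>M i\<in>{..<n}. borel)"
    by (rule measurable_restrict) (use rv' in auto)
  have m2: "(\<lambda>x i. if i \<in> {..<n} then x i else 0) \<in> borel_measurable (\<Pi>\<^sub>M i\<in>{..<n}. (borel :: vec measure))"
    by (rule measurable_zext) simp
  have comp: "(\<lambda>x i. if i \<in> {..<n} then x i else 0) \<circ> (\<lambda>\<omega>. \<lambda>i\<in>{..<n}. X (\<sigma> i) \<omega>) = (\<lambda>\<omega> i. if i < n then X (\<sigma> i) \<omega> else 0)"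
    by (auto simp: fun_eq_iff)
  show "distr M borel (\<lambda>\<omega> i. if i < n then X (\<sigma> i) \<omega> else 0) = power_measure {..<n} N"
    unfolding comp[symmetric] power_measure_def d2[symmetric] by (rule distr_distr[OF m2 m1, symmetric])
  show "(\<lambda>\<omega> i. if i < n then X (\<sigma> i) \<omega> else 0) \<in> borel_measurable M"
    unfolding comp[symmetric] by (rule Sigma_Algebra.measurable_comp[OF m1 m2])
qed

lemma bij_extend:
  assumes "finite A" "card A = n" "I \<subseteq> A" "card I = d"
  obtains \<sigma> where "bij_betw \<sigma> {..<n} A" "\<sigma> ` {..<d} = I"
proof -
  have fI: "finite I" using assms finite_subset by auto
  have dn: "d \<le> n" using assms card_mono by blast
  obtain f where f: "bij_betw f {..<d} I" using ex_bij_betw_nat_finite[OF fI] assms(4) by (auto simp: atLeast0LessThan)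
  have "card (A - I) = card {d..<n}" using assms fI by (simp add: card_Diff_subset)
  then obtain g where g: "bij_betw g {d..<n} (A - I)"
    using assms(1) by (metis finite_Diff finite_atLeastLessThan finite_same_card_bij)
  let ?h = "\<lambda>i. if i \<in> {..<d} then f i else g i"
  have "bij_betw ?h ({..<d} \<union> {d..<n}) (I \<union> (A - I))"
    by (rule bij_betw_disjoint_Un[OF f g]) auto
  moreover have "{..<d} \<union> {d..<n} = {..<n}" "I \<union> (A - I) = A" using dn assms(3) by auto
  moreover have "?h ` {..<d} = I" using f by (auto simp: bij_betw_def)
  ultimately show thesis using that[of ?h] by simp
qed

text \<open>For each \<open>d\<close>-subset \<open>I\<close> the points are reordered so that
  \<open>I\<close> comes first. All reorderings have the same law, so each of the
  \<open>n choose d\<close> terms has the same mean. Each \<open>I\<close> with the lower event is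
  itself the index set of a facet, and almost surely each facet arises from some \<open>I\<close>
  with the upper event.\<close>

theorem expected_facets_bounds:
  fixes X :: "nat \<Rightarrow> 'w \<Rightarrow> vec"
  assumes M: "prob_space M" and d: "3 \<le> d" "d \<le> n"
    and ind: "prob_space.indep_vars M (\<lambda>_. borel) X {1..n}"
    and N: "\<And>i. i \<in> {1..n} \<Longrightarrow> distr M borel (X i) = uniform_sphere d"
  shows "of_nat (n choose d) * facet_int d (n - d) \<le> ennreal (expected_facets n d M X)"
    and "ennreal (expected_facets n d M X) \<le> of_nat (n choose d) * (2 * facet_int d (n - d))"
proof -
  interpret prob_space M by fact
  let ?A = "{1..n}"
  have d1: "1 \<le> d" "n > 0" using d by auto
  define x where "x \<omega> = (\<lambda>i. X i \<omega>)" for \<omega>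
  \<comment> \<open>Outside \<open>{1..n}\<close> nothing is known about the measurability of
    \<open>X i\<close>; padding by 0 makes the whole configuration measurable.\<close>
  define xz where "xz \<omega> = (\<lambda>i. if i \<in> ?A then X i \<omega> else 0)" for \<omega>
  have rv: "random_variable borel (X i)" if "i \<in> ?A" for i using ind that by (auto simp: indep_vars_def)
  have mxz: "xz \<in> borel_measurable M"
  proof (rule measurable_coords)
    fix i show "(\<lambda>\<omega>. xz \<omega> i) \<in> borel_measurable M"
    proof (cases "i \<in> ?A")
      case True
      then show ?thesis using rv[OF True] by (simp add: xz_def)
    next
      case False
      then have "(\<lambda>\<omega>. xz \<omega> i) = (\<lambda>_. 0)" by (auto simp: xz_def fun_eq_iff)
      then show ?thesis by simp
    qed
  qed
  define FS where "FS \<omega> = {J. fcond d (xz \<omega>) ?A J}" for \<omega>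
  have FS: "FS \<omega> \<subseteq> Pow ?A" for \<omega> by (auto simp: FS_def fcond_def)
  have cf: "card (facets d (convex hull ((\<lambda>i. X i \<omega>) ` ?A))) = card (FS \<omega>)" for \<omega>
  proof -
    have "(\<lambda>i. X i \<omega>) ` ?A = xz \<omega> ` ?A" by (intro image_cong) (auto simp: xz_def)
    then show ?thesis unfolding FS_def using card_facets[of ?A d "xz \<omega>"] d1 by simp
  qed
  have cs: "real (card (FS \<omega>)) = (\<Sum>J\<in>Pow ?A. indicator {\<omega>. fcond d (xz \<omega>) ?A J} \<omega>)" for \<omega>
  proof -
    have "(\<Sum>J\<in>Pow ?A. indicator {\<omega>. fcond d (xz \<omega>) ?A J} \<omega>) = (\<Sum>J\<in>Pow ?A. if J \<in> FS \<omega> then 1 else 0 :: real)"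
      by (intro sum.cong) (auto simp: FS_def indicator_def)
    also have "\<dots> = real (card (Pow ?A \<inter> {J. J \<in> FS \<omega>}))" by (subst sum.If_cases) simp_all
    also have "Pow ?A \<inter> {J. J \<in> FS \<omega>} = FS \<omega>" using FS by blast
    finally show ?thesis ..
  qed
  have mJ: "{\<omega> \<in> space M. fcond d (xz \<omega>) ?A J} \<in> sets M" for J
    using measurable_sets[OF mxz sets_fcond[of ?A d J]] by (simp add: vimage_def Int_def conj_commute)
  have mI: "(\<lambda>\<omega>. indicator {\<omega>. fcond d (xz \<omega>) ?A J} \<omega> :: real) \<in> borel_measurable M" for J
  proof -
    have "(\<lambda>\<omega>. indicator {\<omega> \<in> space M. fcond d (xz \<omega>) ?A J} \<omega> :: real) \<in> borel_measurable M"
      using mJ[of J] by (rule borel_measurable_indicator)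
    then show ?thesis by (rule measurable_cong[THEN iffD1, rotated]) (simp add: indicator_def)
  qed
  have mc: "(\<lambda>\<omega>. real (card (FS \<omega>))) \<in> borel_measurable M"
    unfolding cs using mI by (intro borel_measurable_sum) auto
  have bound: "real (card (FS \<omega>)) \<le> 2 ^ n" for \<omega>
  proof -
    have "card (FS \<omega>) \<le> card (Pow ?A)" by (rule card_mono[OF _ FS]) simp
    then have "card (FS \<omega>) \<le> 2 ^ n" by (simp add: card_Pow)
    then show ?thesis by (metis of_nat_le_iff of_nat_numeral of_nat_power)
  qed
  \<comment> \<open>Without integrability the Bochner integral in \<open>expected_facets\<close>
    would be 0 by convention.\<close>
  have int: "integrable M (\<lambda>\<omega>. real (card (FS \<omega>)))"
    by (rule integrable_const_bound[of _ "2 ^ n"]) (use bound mc in auto)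
  have E: "ennreal (expected_facets n d M X) = (\<integral>\<^sup>+\<omega>. ennreal (real (card (FS \<omega>))) \<partial>M)"
    unfolding expected_facets_def cf by (rule nn_integral_eq_integral[OF int, symmetric]) auto
  have card_sub: "card {I. I \<subseteq> ?A \<and> card I = d} = n choose d" using n_subsets[of ?A d] by simp
  have finI: "finite {I. I \<subseteq> ?A \<and> card I = d}" by (rule finite_subset[of _ "Pow ?A"]) auto
  let ?Is = "{I. I \<subseteq> ?A \<and> card I = d}"
  define \<sigma> where "\<sigma> I = (SOME \<sigma>. bij_betw \<sigma> {..<n} ?A \<and> \<sigma> ` {..<d} = I)" for I
  have \<sigma>: "bij_betw (\<sigma> I) {..<n} ?A \<and> \<sigma> I ` {..<d} = I" if "I \<in> ?Is" for I
  proof -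
    have "\<exists>\<sigma>. bij_betw \<sigma> {..<n} ?A \<and> \<sigma> ` {..<d} = I"
      using bij_extend[of ?A n I d] that by (metis (mono_tags, lifting) card_atLeastAtMost diff_Suc_1 finite_atLeastAtMost mem_Collect_eq One_nat_def)
    then show ?thesis unfolding \<sigma>_def by (rule someI_ex)
  qed
  define Z where "Z I \<omega> = (\<lambda>i. if i < n then X (\<sigma> I i) \<omega> else 0)" for I \<omega>
  have Zx: "Z I \<omega> = (\<lambda>i. if i < n then xz \<omega> (\<sigma> I i) else 0)" if "I \<in> ?Is" for I \<omega>
  proof
    fix i
    have "\<sigma> I i \<in> ?A" if "i < n" using \<sigma>[OF \<open>I \<in> ?Is\<close>] that by (auto simp: bij_betw_def)
    then show "Z I \<omega> i = (if i < n then xz \<omega> (\<sigma> I i) else 0)" by (simp add: Z_def xz_def)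
  qed
  have Zd: "distr M borel (Z I) = power_measure {..<n} (uniform_sphere d)" "Z I \<in> borel_measurable M" if "I \<in> ?Is" for I
    unfolding Z_def using distr_pm[OF ind N _ d1(2), of "\<sigma> I"] \<sigma>[OF that] by auto
  have Zint: "(\<integral>\<^sup>+\<omega>. f (Z I \<omega>) \<partial>M) = (\<integral>\<^sup>+z. f z \<partial>power_measure {..<n} (uniform_sphere d))"
    if "I \<in> ?Is" "f \<in> borel_measurable borel" for I f
    unfolding Zd(1)[OF that(1), symmetric] by (rule nn_integral_distr[OF Zd(2)[OF that(1)], symmetric]) (use that in simp)
  have Lc: "finite {d..<n}" "{d..<n} \<inter> {..<d} = {}" by auto
  have mU: "upper_event {d..<n} d \<in> borel_measurable borel" and mL: "lower_event {d..<n} d \<in> borel_measurable borel"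
    using upper_family[OF Lc] lower_family[OF Lc] d1 by (auto simp: cfg_family_def cfg_inv_def)
  have "(\<Sum>I\<in>?Is. (\<integral>\<^sup>+\<omega>. lower_event {d..<n} d (Z I \<omega>) \<partial>M)) =
      (\<integral>\<^sup>+\<omega>. (\<Sum>I\<in>?Is. lower_event {d..<n} d (Z I \<omega>)) \<partial>M)"
    by (rule nn_integral_sum[symmetric]) (use measurable_compose[OF Zd(2) mL] in auto)
  also have "\<dots> \<le> (\<integral>\<^sup>+\<omega>. ennreal (real (card (FS \<omega>))) \<partial>M)"
  proof (rule nn_integral_mono)
    fix \<omega>
    have "(\<Sum>I\<in>?Is. lower_event {d..<n} d (Z I \<omega>)) \<le> (\<Sum>I\<in>?Is. indicator (FS \<omega>) I)"
    proof (rule sum_mono)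
      fix I assume I: "I \<in> ?Is"
      show "lower_event {d..<n} d (Z I \<omega>) \<le> indicator (FS \<omega>) I"
      proof (cases "lower_event {d..<n} d (Z I \<omega>) = 0")
        case False
        then have "fcond d (xz \<omega>) ?A I"
          unfolding Zx[OF I] using \<sigma>[OF I] d1 d by (intro lower_event_fcond) auto
        then show ?thesis by (simp add: FS_def lower_event_def indicator_def)
      qed simp
    qed
    also have "\<dots> = of_nat (card (?Is \<inter> FS \<omega>))"
      unfolding indicator_def of_bool_def by (subst sum.If_cases[OF finI]) simp
    also have "\<dots> \<le> of_nat (card (FS \<omega>))"
      using FS finite_subset[OF FS] by (intro of_nat_mono card_mono) auto
    finally show "(\<Sum>I\<in>?Is. lower_event {d..<n} d (Z I \<omega>)) \<le> ennreal (real (card (FS \<omega>)))"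
      by (simp add: ennreal_of_nat_eq_real_of_nat)
  qed
  finally have lo: "(\<Sum>I\<in>?Is. (\<integral>\<^sup>+\<omega>. lower_event {d..<n} d (Z I \<omega>) \<partial>M)) \<le> ennreal (expected_facets n d M X)"
    unfolding E .
  have "of_nat (n choose d) * facet_int d (n - d) \<le>
      of_nat (n choose d) * (\<integral>\<^sup>+z. lower_event {d..<n} d z \<partial>power_measure {..<n} (uniform_sphere d))"
    using event_bounds(2)[OF d] by (intro mult_left_mono) auto
  also have "\<dots> = (\<Sum>I\<in>?Is. (\<integral>\<^sup>+\<omega>. lower_event {d..<n} d (Z I \<omega>) \<partial>M))"
    using Zint[OF _ mL] card_sub by simp
  finally show "of_nat (n choose d) * facet_int d (n - d) \<le> ennreal (expected_facets n d M X)"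
    using lo by (rule order_trans)
  \<comment> \<open>The points lie in \<open>Rn d\<close> almost surely only, and
    \<open>card_fcond_le\<close> asks for this, so the upper bound is integrated almost
    everywhere.\<close>
  have AEx: "AE \<omega> in M. \<forall>i\<in>?A. X i \<omega> \<in> Rn d"
  proof (rule AE_finite_allI)
    fix i assume i: "i \<in> ?A"
    have RnS: "{x \<in> space borel. x \<in> Rn d} \<in> sets (borel :: vec measure)"
    proof -
      have "{x \<in> space borel. \<forall>i. d \<le> i \<longrightarrow> x i = 0} \<in> sets (borel :: vec measure)" by measurable
      then show ?thesis by (simp add: Rn_def)
    qed
    have "AE x in distr M borel (X i). x \<in> Rn d"
      unfolding N[OF i] using AE_S[of d] d1 by auto
    then show "AE \<omega> in M. X i \<omega> \<in> Rn d"
      using AE_distr_iff[OF rv[OF i] RnS] by simp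
  qed simp
  have "ennreal (expected_facets n d M X) \<le> (\<integral>\<^sup>+\<omega>. (\<Sum>I\<in>?Is. upper_event {d..<n} d (Z I \<omega>)) \<partial>M)"
    unfolding E
  proof (rule nn_integral_mono_AE, use AEx in eventually_elim)
    case (elim \<omega>)
    have "card (FS \<omega>) \<le> card {I. I \<subseteq> ?A \<and> card I = d \<and> supported d (xz \<omega>) ?A I}"
      unfolding FS_def by (rule card_fcond_le) (use elim d1 in \<open>auto simp: xz_def\<close>)
    moreover have "{I. I \<subseteq> ?A \<and> card I = d \<and> supported d (xz \<omega>) ?A I} = ?Is \<inter> {I. supported d (xz \<omega>) ?A I}"
      by blast
    ultimately have "ennreal (real (card (FS \<omega>))) \<le> of_nat (card (?Is \<inter> {I. supported d (xz \<omega>) ?A I}))"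
      by (simp only: ennreal_of_nat_eq_real_of_nat ennreal_leI of_nat_mono)
    also have "\<dots> = (\<Sum>I\<in>?Is. indicator {I. supported d (xz \<omega>) ?A I} I)"
      unfolding indicator_def of_bool_def by (subst sum.If_cases[OF finI]) simp
    also have "\<dots> \<le> (\<Sum>I\<in>?Is. upper_event {d..<n} d (Z I \<omega>))"
    proof (rule sum_mono)
      fix I assume I: "I \<in> ?Is"
      have "upper_event {d..<n} d (Z I \<omega>) = 1" if "supported d (xz \<omega>) ?A I"
        unfolding Zx[OF I] using \<sigma>[OF I] d1 d that by (intro upper_event_supported) auto
      then show "indicator {I. supported d (xz \<omega>) ?A I} I \<le> upper_event {d..<n} d (Z I \<omega>)"
        by (auto simp: indicator_def)
    qed
    finally show ?case .
  qed
  also have "\<dots> = (\<Sum>I\<in>?Is. (\<integral>\<^sup>+\<omega>. upper_event {d..<n} d (Z I \<omega>) \<partial>M))"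
    by (rule nn_integral_sum) (use measurable_compose[OF Zd(2) mU] in auto)
  also have "\<dots> = of_nat (n choose d) * (\<integral>\<^sup>+z. upper_event {d..<n} d z \<partial>power_measure {..<n} (uniform_sphere d))"
    using Zint[OF _ mU] card_sub by simp
  also have "\<dots> \<le> of_nat (n choose d) * (2 * facet_int d (n - d))"
    using event_bounds(1)[OF d] by (intro mult_left_mono) auto
  finally show "ennreal (expected_facets n d M X) \<le> of_nat (n choose d) * (2 * facet_int d (n - d))" .
qed

subsection \<open>Estimates for caps\<close>

text \<open>The extra factor \<open>y\<close> gives an explicit antiderivative;
  \<open>lw_lower\<close> and \<open>lw_upper\<close> pay for it with \<open>y \<le> r\<close> and
  \<open>y \<ge> t\<close>. The interior form of the fundamental theorem of calculus is used because
  differentiating the power requires \<open>y\<^sup>2 < 1\<close>.\<close>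

lemma cap_integral:
  assumes a: "a \<ge> 0" and t: "0 \<le> t" "t \<le> r" "r \<le> 1"
  shows "(\<integral>\<^sup>+y. ennreal (y * (1 - y\<^sup>2) powr a) * indicator {t..r} y \<partial>lborel) =
    ennreal (((1 - t\<^sup>2) powr (a + 1) - (1 - r\<^sup>2) powr (a + 1)) / (2 * (a + 1)))"
proof -
  let ?F = "\<lambda>y. - ((1 - y\<^sup>2) powr (a + 1)) / (2 * (a + 1))"
  have sq: "y\<^sup>2 \<le> 1" if "y \<in> {t..r}" for y using that t by (simp add: abs_square_le_1)
  have "((\<lambda>y. y * (1 - y\<^sup>2) powr a) has_integral ?F r - ?F t) {t..r}"
  proof (rule fundamental_theorem_of_calculus_interior[OF t(2)])
    show "continuous_on {t..r} ?F"
      using a sq by (intro continuous_intros continuous_on_powr') auto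
    fix y assume y: "y \<in> {t<..<r}"
    then have "y\<^sup>2 < 1" using t by (simp add: abs_square_less_1)
    then have p: "1 - y\<^sup>2 > 0" by simp
    have "((\<lambda>y. 1 - y\<^sup>2) has_real_derivative - (2 * y)) (at y)"
      by (auto intro!: derivative_eq_intros)
    from DERIV_chain2[OF has_real_derivative_powr[OF p, of "a + 1"] this]
    have "((\<lambda>y. (1 - y\<^sup>2) powr (a + 1)) has_real_derivative (a + 1) * (1 - y\<^sup>2) powr a * - (2 * y)) (at y)"
      by simp
    from DERIV_cdivide[OF DERIV_minus[OF this], of "2 * (a + 1)"]
    have "(?F has_real_derivative - ((a + 1) * (1 - y\<^sup>2) powr a * - (2 * y)) / (2 * (a + 1))) (at y)" .
    moreover have "- ((a + 1) * (1 - y\<^sup>2) powr a * - (2 * y)) / (2 * (a + 1)) = y * (1 - y\<^sup>2) powr a"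
      using a by (simp add: field_simps)
    ultimately have "(?F has_real_derivative y * (1 - y\<^sup>2) powr a) (at y)" by (simp only:)
    then show "(?F has_vector_derivative y * (1 - y\<^sup>2) powr a) (at y)"
      by (simp add: has_real_derivative_iff_has_vector_derivative)
  qed
  then have "(\<integral>\<^sup>+y. ennreal (y * (1 - y\<^sup>2) powr a) * indicator {t..r} y \<partial>lborel) = ennreal (?F r - ?F t)"
    by (rule nn_integral_has_integral_lebesgue'[rotated]) (use t in auto)
  also have "?F r - ?F t = ((1 - t\<^sup>2) powr (a + 1) - (1 - r\<^sup>2) powr (a + 1)) / (2 * (a + 1))"
    by (simp add: diff_divide_distrib)
  finally show ?thesis .
qed

lemma lw_lower:
  assumes a: "a \<ge> 0" and t: "0 \<le> t" "t < r" "r < 1"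
  shows "ennreal (((1 - t\<^sup>2) powr (a + 1) - (1 - r\<^sup>2) powr (a + 1)) / (2 * (a + 1) * r)) \<le> beta_below a (- t)"
proof -
  have r: "r > 0" using t by simp
  have "ennreal (((1 - t\<^sup>2) powr (a + 1) - (1 - r\<^sup>2) powr (a + 1)) / (2 * (a + 1) * r)) =
      ennreal (1 / r) * (\<integral>\<^sup>+y. ennreal (y * (1 - y\<^sup>2) powr a) * indicator {t..r} y \<partial>lborel)"
    using t r a by (subst cap_integral) (auto simp: ennreal_mult'[symmetric] field_simps)
  also have "\<dots> = (\<integral>\<^sup>+y. ennreal (1 / r) * (ennreal (y * (1 - y\<^sup>2) powr a) * indicator {t..r} y) \<partial>lborel)"
    by (rule nn_integral_cmult[symmetric]) (intro borel_measurable_times_ennreal, simp_all)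
  also have "\<dots> \<le> (\<integral>\<^sup>+y. ennreal (beta_weight a (y\<^sup>2)) * indicator {t..} y \<partial>lborel)"
  proof (rule nn_integral_mono)
    fix y :: real
    have "1 / r * (y * (1 - y\<^sup>2) powr a) \<le> beta_weight a (y\<^sup>2)" if y: "y \<in> {t..r}"
    proof -
      have "y\<^sup>2 < 1" using y t by (simp add: abs_square_less_1)
      moreover have "y / r * (1 - y\<^sup>2) powr a \<le> 1 * (1 - y\<^sup>2) powr a"
        using y r by (intro mult_right_mono) auto
      ultimately show ?thesis by (simp add: beta_weight_def)
    qed
    then show "ennreal (1 / r) * (ennreal (y * (1 - y\<^sup>2) powr a) * indicator {t..r} y) \<le>
      ennreal (beta_weight a (y\<^sup>2)) * indicator {t..} y"
      using r t by (auto simp: indicator_def ennreal_mult'[symmetric] intro!: ennreal_leI)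
  qed
  also have "\<dots> = beta_below a (- t)" by (rule lw_ge)
  finally show ?thesis .
qed

lemma lw_upper:
  assumes a: "a \<ge> 0" and t: "0 < t" "t < 1"
  shows "beta_below a (- t) \<le> ennreal ((1 - t\<^sup>2) powr (a + 1) / (2 * (a + 1) * t))"
proof -
  have "beta_below a (- t) = (\<integral>\<^sup>+y. ennreal (beta_weight a (y\<^sup>2)) * indicator {t..} y \<partial>lborel)" by (rule lw_ge[symmetric])
  also have "\<dots> \<le> (\<integral>\<^sup>+y. ennreal (1 / t) * (ennreal (y * (1 - y\<^sup>2) powr a) * indicator {t..1} y) \<partial>lborel)"
  proof (rule nn_integral_mono)
    fix y :: real
    have "beta_weight a (y\<^sup>2) \<le> 1 / t * (y * (1 - y\<^sup>2) powr a)" if y: "t \<le> y" "y \<le> 1"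
    proof -
      have "1 * (1 - y\<^sup>2) powr a \<le> y / t * (1 - y\<^sup>2) powr a"
        using y t by (intro mult_right_mono) auto
      then show ?thesis using y t by (auto simp: beta_weight_def)
    qed
    moreover have "beta_weight a (y\<^sup>2) = 0" if "y > 1" using that bw_sq_0[of y a] by auto
    ultimately show "ennreal (beta_weight a (y\<^sup>2)) * indicator {t..} y \<le>
      ennreal (1 / t) * (ennreal (y * (1 - y\<^sup>2) powr a) * indicator {t..1} y)"
      using t by (auto simp: indicator_def ennreal_mult'[symmetric] not_le intro!: ennreal_leI)
  qed
  also have "\<dots> = ennreal (1 / t) * (\<integral>\<^sup>+y. ennreal (y * (1 - y\<^sup>2) powr a) * indicator {t..1} y \<partial>lborel)"
    by (rule nn_integral_cmult) (intro borel_measurable_times_ennreal, simp_all)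
  also have "\<dots> = ennreal ((1 - t\<^sup>2) powr (a + 1) / (2 * (a + 1) * t))"
    using t a by (subst cap_integral) (auto simp: ennreal_mult'[symmetric] field_simps)
  finally show ?thesis .
qed

text \<open>Log-convexity of the Gamma function at the midpoint of \<open>x\<close> and
  \<open>x + 1\<close>.\<close>

lemma Gamma_half_step:
  assumes x: "x > (0 :: real)"
  shows "Gamma (x + 1 / 2) \<le> sqrt x * Gamma x"
proof -
  have G: "Gamma x > 0" "Gamma (x + 1) > 0" "Gamma (x + 1 / 2) > 0" using x by (auto intro: Gamma_real_pos)
  have "(ln \<circ> Gamma) ((1 - 1 / 2) *\<^sub>R x + (1 / 2) *\<^sub>R (x + 1)) \<le> (1 - 1 / 2) * (ln \<circ> Gamma) x + 1 / 2 * (ln \<circ> Gamma) (x + 1)"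
    by (rule convex_onD[OF log_convex_Gamma_real]) (use x in auto)
  moreover have "(1 - 1 / 2) *\<^sub>R x + (1 / 2) *\<^sub>R (x + 1) = x + 1 / 2" by (simp add: field_simps)
  ultimately have "ln (Gamma (x + 1 / 2)) \<le> (ln (Gamma x) + ln (Gamma (x + 1))) / 2"
    by (simp add: add_divide_distrib)
  moreover have "Gamma (x + 1) = x * Gamma x" by (rule Gamma_plus1) (use x in \<open>auto elim!: nonpos_Ints_cases\<close>)
  ultimately have "ln (Gamma (x + 1 / 2)) \<le> ln (Gamma x) + ln x / 2"
    using x G by (simp add: ln_mult)
  also have "\<dots> = ln (sqrt x * Gamma x)" using x G by (subst ln_mult_pos) (auto simp: ln_sqrt)
  finally show ?thesis using x G by (subst (asm) ln_le_cancel_iff) auto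
qed

lemma Bt_Beta:
  assumes "d \<ge> 3"
  shows "beta_mass ((real d - 3) / 2) = ennreal (sqrt pi * Gamma ((real d - 1) / 2) / Gamma (real d / 2))"
proof -
  have "beta_mass ((real d - 3) / 2) = (\<integral>\<^sup>+x. indicator {-1..1} x * sqrt (1 - x\<^sup>2) ^ (d - 3) \<partial>lborel)"
    unfolding beta_mass_def
  proof (rule nn_integral_cong_AE, use AE_lborel_singleton[of 1] AE_lborel_singleton[of "-1"] in eventually_elim)
    case (elim x)
    show ?case
    proof (cases "x \<in> {-1<..<1}")
      case True
      then have "x\<^sup>2 < 1" by (simp add: abs_square_less_1 abs_less_iff)
      then show ?thesis using True assms
        by (simp add: beta_weight_def powr_half_sqrt[symmetric] powr_realpow[symmetric] powr_powr of_nat_diff)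
    next
      case False
      then have "x \<notin> {-1..1}" using elim by auto
      then show ?thesis using bw_sq_0[OF False] by simp
    qed
  qed
  also have "\<dots> = ennreal (Beta (1 / 2) (real (d - 3) / 2 + 1))" by (rule emeasure_cball_aux_integral)
  also have "real (d - 3) / 2 + 1 = (real d - 1) / 2" using assms by (simp add: of_nat_diff field_simps)
  also have "Beta (1 / 2) ((real d - 1) / 2) = sqrt pi * Gamma ((real d - 1) / 2) / Gamma (real d / 2)"
  proof -
    have "1 / 2 + (real d - 1) / 2 = real d / 2" by (simp add: field_simps)
    then show ?thesis unfolding Beta_def by (simp only: Gamma_one_half_real)
  qed
  finally show ?thesis .
qed

text \<open>\<open>Gamma_half_step\<close> at \<open>(d - 1) / 2\<close> gives the lower bound and
  at \<open>(d - 2) / 2\<close> the upper one. Both are \<open>sqrt (2 * pi / d)\<close> to leading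
  order.\<close>

lemma Bt_bounds:
  assumes "d \<ge> 3"
  defines "b \<equiv> enn2real (beta_mass ((real d - 3) / 2))"
  shows "sqrt (2 * pi / (real d - 1)) \<le> b" "b \<le> sqrt (2 * pi / (real d - 2))" "beta_mass ((real d - 3) / 2) = ennreal b" "b > 0"
proof -
  let ?x = "(real d - 1) / 2" and ?y = "(real d - 2) / 2"
  have x: "?x > 0" "?y > 0" using assms by auto
  have e: "?x + 1 / 2 = real d / 2" "?y + 1 / 2 = ?x" "?y + 1 = real d / 2" by (simp_all add: field_simps)
  have G: "Gamma ?x > 0" "Gamma (real d / 2) > 0" "Gamma ?y > 0" using assms by (auto intro!: Gamma_real_pos)
  have b: "b = sqrt pi * Gamma ?x / Gamma (real d / 2)"
    unfolding b_def Bt_Beta[OF assms(1)] using G by simp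
  show "b > 0" unfolding b using G by simp
  show "beta_mass ((real d - 3) / 2) = ennreal b" unfolding b by (rule Bt_Beta[OF assms(1)])
  have 1: "Gamma (real d / 2) \<le> sqrt ?x * Gamma ?x" using Gamma_half_step[OF x(1)] unfolding e .
  have "sqrt (2 * pi / (real d - 1)) = sqrt pi / sqrt ?x" by (simp add: real_sqrt_divide[symmetric])
  also have "\<dots> \<le> b"
  proof -
    have "sqrt pi * Gamma (real d / 2) \<le> sqrt pi * (sqrt ?x * Gamma ?x)" using 1 by (intro mult_left_mono) auto
    then show ?thesis unfolding b using G x by (simp add: divide_le_eq le_divide_eq mult_ac)
  qed
  finally show "sqrt (2 * pi / (real d - 1)) \<le> b" .
  have "Gamma (?y + 1) = ?y * Gamma ?y" by (rule Gamma_plus1) (use x(2) in \<open>auto elim!: nonpos_Ints_cases\<close>)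
  then have g: "Gamma (real d / 2) = ?y * Gamma ?y" unfolding e .
  have 2: "Gamma ?x \<le> sqrt ?y * Gamma ?y" using Gamma_half_step[OF x(2)] unfolding e .
  have "b \<le> sqrt pi * (sqrt ?y * Gamma ?y) / Gamma (real d / 2)"
    unfolding b using 2 G by (intro divide_right_mono mult_left_mono) auto
  also have "\<dots> = sqrt pi * (sqrt ?y / ?y)" unfolding g using G by simp
  also have "sqrt ?y / ?y = 1 / sqrt ?y" using sqrt_divide_self_eq[of ?y] x by (simp only: inverse_eq_divide)
  also have "sqrt pi * (1 / sqrt ?y) = sqrt (2 * pi / (real d - 2))" by (simp add: real_sqrt_divide[symmetric])
  finally show "b \<le> sqrt (2 * pi / (real d - 2))" .
qed

lemma cap_eq:
  assumes "d \<ge> 3"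
  shows "beta_below ((real d - 3) / 2) (- t) = ennreal (cap ((real d - 3) / 2) t * enn2real (beta_mass ((real d - 3) / 2)))"
  using lw_cap(4)[of "(real d - 3) / 2" t] lw_cap(2)[of "(real d - 3) / 2" t] Bt_bounds(3,4)[OF assms] assms
  by (simp add: ennreal_mult)

text \<open>Only the mass between \<open>t\<close> and \<open>r\<close> is kept and divided by the
  upper bound for the total mass. For \<open>r\<close> near \<open>t\<close> with negligible tail
  this is close to the bound in \<open>cap_upper\<close>, with denominator about
  \<open>t * sqrt (2 * pi * d)\<close>. At \<open>t\<^sup>2 = 2 * ln (n / d) / d\<close> that is
  \<open>sqrt (4 * pi * ln (n / d))\<close>, whence the constant \<open>4 * pi\<close> of the
  theorem.\<close>

lemma cap_lower:
  assumes d: "d \<ge> 3" and t: "0 \<le> t" "t < r" "r < 1"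
  shows "((1 - t\<^sup>2) powr ((real d - 1) / 2) - (1 - r\<^sup>2) powr ((real d - 1) / 2)) /
    ((real d - 1) * r * sqrt (2 * pi / (real d - 2))) \<le> cap ((real d - 3) / 2) t"
proof -
  let ?a = "(real d - 3) / 2" and ?X = "(1 - t\<^sup>2) powr ((real d - 1) / 2) - (1 - r\<^sup>2) powr ((real d - 1) / 2)"
  note B = Bt_bounds[OF d]
  let ?b = "enn2real (beta_mass ?a)"
  have a: "?a \<ge> 0" "?a + 1 = (real d - 1) / 2" "2 * ((real d - 1) / 2) = real d - 1"
    using d by (auto simp: field_simps)
  have "t\<^sup>2 \<le> r\<^sup>2" "r\<^sup>2 < 1" using t by (auto intro: power_mono simp: abs_square_less_1)
  then have X: "?X \<ge> 0" using d by (auto intro!: powr_mono2)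
  have "ennreal (?X / ((real d - 1) * r)) \<le> ennreal (cap ?a t * ?b)"
    using lw_lower[OF a(1) t] unfolding a(2) a(3) cap_eq[OF d] .
  then have "?X / ((real d - 1) * r) \<le> cap ?a t * ?b"
    using lw_cap(2)[OF a(1)] B(4) by (subst (asm) ennreal_le_iff) auto
  then have "?X / ((real d - 1) * r) / ?b \<le> cap ?a t" by (simp only: pos_divide_le_eq[OF B(4)])
  moreover have "?X / ((real d - 1) * r) / sqrt (2 * pi / (real d - 2)) \<le> ?X / ((real d - 1) * r) / ?b"
    using B(2,4) X t d by (intro divide_left_mono mult_pos_pos) auto
  ultimately show ?thesis by (simp only: divide_divide_eq_left)
qed

lemma cap_upper:
  assumes d: "d \<ge> 3" and t: "0 < t" "t < 1"
  shows "cap ((real d - 3) / 2) t \<le> (1 - t\<^sup>2) powr ((real d - 1) / 2) / (t * sqrt (2 * pi * (real d - 1)))"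
proof -
  let ?a = "(real d - 3) / 2" and ?X = "(1 - t\<^sup>2) powr ((real d - 1) / 2)"
  note B = Bt_bounds[OF d]
  let ?b = "enn2real (beta_mass ?a)"
  have a: "?a \<ge> 0" "?a + 1 = (real d - 1) / 2" "2 * ((real d - 1) / 2) = real d - 1"
    using d by (auto simp: field_simps)
  have "ennreal (cap ?a t * ?b) \<le> ennreal (?X / ((real d - 1) * t))"
    using lw_upper[OF a(1) t] unfolding a(2) a(3) cap_eq[OF d] .
  then have "cap ?a t * ?b \<le> ?X / ((real d - 1) * t)"
    using t d by (subst (asm) ennreal_le_iff) auto
  then have "cap ?a t \<le> ?X / ((real d - 1) * t) / ?b" by (simp only: pos_le_divide_eq[OF B(4)])
  also have "\<dots> \<le> ?X / ((real d - 1) * t) / sqrt (2 * pi / (real d - 1))"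
    using B(1,4) t d by (intro divide_left_mono mult_pos_pos) auto
  also have "\<dots> = ?X / (t * ((real d - 1) * sqrt (2 * pi / (real d - 1))))"
    by (simp only: divide_divide_eq_left mult_ac)
  also have "(real d - 1) * sqrt (2 * pi / (real d - 1)) = sqrt ((real d - 1)\<^sup>2 * (2 * pi / (real d - 1)))"
    using d by (simp only: real_sqrt_mult) simp
  also have "(real d - 1)\<^sup>2 * (2 * pi / (real d - 1)) = 2 * pi * (real d - 1)"
    using d by (simp add: power2_eq_square)
  finally show ?thesis .
qed

lemma cap_antimono:
  assumes d: "d \<ge> 3" and "s \<le> t"
  shows "cap ((real d - 3) / 2) t \<le> cap ((real d - 3) / 2) s"
proof -
  let ?a = "(real d - 3) / 2"
  have a: "?a \<ge> 0" using d by simp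
  have "beta_below ?a (- t) \<le> beta_below ?a (- s)" unfolding beta_below_def using assms(2)
    by (intro nn_integral_mono mult_left_mono) (auto simp: indicator_def)
  then have "cap ?a t * enn2real (beta_mass ?a) \<le> cap ?a s * enn2real (beta_mass ?a)"
    unfolding cap_eq[OF d] using lw_cap(2)[OF a] Bt_bounds(4)[OF d] by (subst (asm) ennreal_le_iff) auto
  then show ?thesis using Bt_bounds(4)[OF d] by simp
qed

lemma power_ge_half:
  assumes "0 \<le> \<alpha>" "\<alpha> \<le> real k" "real k * x \<le> 1 / 2" "0 \<le> x" "x < 1"
  shows "1 / 2 \<le> (1 - x) powr \<alpha>"
proof -
  have "1 - real k * x \<le> (1 - x) ^ k"
    using Bernoulli_inequality[of "- x" k] assms by simp
  also have "\<dots> = (1 - x) powr real k" using assms by (simp add: powr_realpow)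
  also have "\<dots> \<le> (1 - x) powr \<alpha>" using assms by (intro powr_mono') auto
  finally show ?thesis using assms(3) by linarith
qed

text \<open>A bound for the integrand times the length 2 of the interval, divided by the mass. The
  weight is at least 1/2 for heights up to \<open>1 / (2 * d)\<close>, so the mass is at least
  \<open>1 / (4 * d)\<close>.\<close>

lemma facet_int_upper:
  assumes d: "d \<ge> 3" and s: "s \<ge> 0"
    and le: "\<And>t. \<lbrakk>-1 < t; t < 1\<rbrakk> \<Longrightarrow> (1 - t\<^sup>2) powr ((real d - 1)\<^sup>2 / 2 - 1) * (1 - cap ((real d - 3) / 2) t) ^ N \<le> s"
  shows "facet_int d N \<le> ennreal (8 * real d * s)"
proof -
  let ?\<alpha> = "(real d - 1)\<^sup>2 / 2 - 1"
  have "(real d - 1)\<^sup>2 \<ge> 2\<^sup>2" using d by (intro power_mono) auto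
  then have \<alpha>: "?\<alpha> \<ge> 0" by simp
  have rd: "real d \<ge> 3" using d by simp
  have "?\<alpha> \<le> real (d\<^sup>2)" using rd by (simp add: power2_eq_square algebra_simps)
  moreover have "real (d\<^sup>2) * ((1 / (2 * real d))\<^sup>2) \<le> 1 / 2" using rd by (simp add: power2_eq_square)
  moreover have "(1 / (2 * real d))\<^sup>2 < 1" using rd by (simp add: abs_square_less_1)
  ultimately have h: "1 / 2 \<le> (1 - (1 / (2 * real d))\<^sup>2) powr ?\<alpha>"
    using \<alpha> by (intro power_ge_half[where k = "d\<^sup>2"]) auto
  have "ennreal (1 / (2 * real d) * (1 / 2)) \<le> ennreal (1 / (2 * real d) * (1 - (1 / (2 * real d))\<^sup>2) powr ?\<alpha>)"
    using h by (intro ennreal_leI mult_left_mono) auto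
  also have "\<dots> \<le> beta_mass ?\<alpha>" by (rule Bt_ge[OF \<alpha>]) (use rd in auto)
  finally have B: "ennreal (1 / (4 * real d)) \<le> beta_mass ?\<alpha>" by simp
  have "(\<integral>\<^sup>+t. beta_weight ?\<alpha> (t\<^sup>2) * ennreal ((1 - cap ((real d - 3) / 2) t) ^ N) \<partial>lborel) \<le>
    (\<integral>\<^sup>+t. ennreal s * indicator {-1..1 :: real} t \<partial>lborel)"
  proof (rule nn_integral_mono)
    fix t :: real
    show "ennreal (beta_weight ?\<alpha> (t\<^sup>2)) * ennreal ((1 - cap ((real d - 3) / 2) t) ^ N) \<le> ennreal s * indicator {-1..1} t"
    proof (cases "t \<in> {-1<..<1}")
      case True
      then have "t\<^sup>2 < 1" by (simp add: abs_square_less_1 abs_less_iff)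
      then have "beta_weight ?\<alpha> (t\<^sup>2) * (1 - cap ((real d - 3) / 2) t) ^ N \<le> s" using le[of t] True by (simp add: beta_weight_def)
      moreover have "t \<in> {-1..1}" using True by auto
      ultimately show ?thesis by (simp add: ennreal_mult'[symmetric] ennreal_leI)
    next
      case False
      then show ?thesis by (simp add: bw_sq_0)
    qed
  qed
  also have "\<dots> = ennreal (2 * s)"
    using s by (subst nn_integral_cmult_indicator) (auto simp: ennreal_mult mult.commute)
  finally have J: "(\<integral>\<^sup>+t. beta_weight ?\<alpha> (t\<^sup>2) * ennreal ((1 - cap ((real d - 3) / 2) t) ^ N) \<partial>lborel) \<le> ennreal (2 * s)" .
  have "ennreal (2 * s) = ennreal (1 / (4 * real d)) * ennreal (8 * real d * s)"
    using s rd by (simp add: ennreal_mult[symmetric])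
  also have "\<dots> \<le> beta_mass ?\<alpha> * ennreal (8 * real d * s)" by (rule mult_right_mono[OF B]) simp
  finally have "(\<integral>\<^sup>+t. beta_weight ?\<alpha> (t\<^sup>2) * ennreal ((1 - cap ((real d - 3) / 2) t) ^ N) \<partial>lborel) \<le>
    beta_mass ?\<alpha> * ennreal (8 * real d * s)" using J by (rule order_trans[rotated])
  then show ?thesis unfolding facet_int_def by (rule divide_le_posI_ennreal[OF Bt_finite_pos(1)[OF \<alpha>]])
qed

text \<open>On the window from \<open>t0\<close> to \<open>t1\<close> the weight is smallest at
  \<open>t1\<close> and the cap largest at \<open>t0\<close>; the normalising mass is at most
  2.\<close>

lemma facet_int_lower:
  assumes d: "d \<ge> 3" and t: "0 \<le> t0" "t0 < t1" "t1 < 1"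
  shows "ennreal ((t1 - t0) * ((1 - t1\<^sup>2) powr ((real d - 1)\<^sup>2 / 2 - 1) * (1 - cap ((real d - 3) / 2) t0) ^ N) / 2) \<le> facet_int d N"
proof -
  let ?\<alpha> = "(real d - 1)\<^sup>2 / 2 - 1" and ?a = "(real d - 3) / 2"
  have "(real d - 1)\<^sup>2 \<ge> 2\<^sup>2" using d by (intro power_mono) auto
  then have \<alpha>: "?\<alpha> \<ge> 0" by simp
  have a: "?a \<ge> 0" using d by simp
  define v where "v = (1 - t1\<^sup>2) powr ?\<alpha> * (1 - cap ?a t0) ^ N"
  have v: "v \<ge> 0" unfolding v_def using lw_cap(3)[OF a, of t0] by simp
  have "ennreal ((t1 - t0) * v) = (\<integral>\<^sup>+t. ennreal v * indicator {t0..t1} t \<partial>lborel)"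
    using t v by (subst nn_integral_cmult_indicator) (auto simp: ennreal_mult[symmetric] mult.commute)
  also have "\<dots> \<le> (\<integral>\<^sup>+t. beta_weight ?\<alpha> (t\<^sup>2) * ennreal ((1 - cap ?a t) ^ N) \<partial>lborel)"
  proof (rule nn_integral_mono)
    fix t :: real
    have "v \<le> beta_weight ?\<alpha> (t\<^sup>2) * (1 - cap ?a t) ^ N" if tt: "t \<in> {t0..t1}"
    proof -
      have "t\<^sup>2 \<le> t1\<^sup>2" "t1\<^sup>2 < 1" using tt t by (auto intro: power_mono simp: abs_square_less_1)
      then have "(1 - t1\<^sup>2) powr ?\<alpha> \<le> beta_weight ?\<alpha> (t\<^sup>2)" using \<alpha> by (auto simp: beta_weight_def intro!: powr_mono2)
      moreover have "(1 - cap ?a t0) ^ N \<le> (1 - cap ?a t) ^ N"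
        using cap_antimono[OF d, of t0 t] tt lw_cap(3)[OF a] by (intro power_mono) auto
      ultimately show ?thesis unfolding v_def using lw_cap(3)[OF a] by (intro mult_mono) auto
    qed
    then show "ennreal v * indicator {t0..t1} t \<le> ennreal (beta_weight ?\<alpha> (t\<^sup>2)) * ennreal ((1 - cap ?a t) ^ N)"
      by (auto simp: indicator_def ennreal_mult'[symmetric] intro!: ennreal_leI)
  qed
  finally have J: "ennreal ((t1 - t0) * v) \<le> (\<integral>\<^sup>+t. beta_weight ?\<alpha> (t\<^sup>2) * ennreal ((1 - cap ?a t) ^ N) \<partial>lborel)" .
  define b where "b = enn2real (beta_mass ?\<alpha>)"
  have bB: "beta_mass ?\<alpha> = ennreal b" using Bt_finite_pos[OF \<alpha>] by (simp add: b_def ennreal_enn2real_if less_top)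
  have b: "0 < b" "b \<le> 2"
    using Bt_finite_pos(1)[OF \<alpha>] Bt_le[OF \<alpha>] unfolding bB by (auto simp flip: ennreal_numeral)
  have "(t1 - t0) * v / 2 \<le> (t1 - t0) * v / b"
    using b t v by (intro divide_left_mono mult_nonneg_nonneg) auto
  then have "ennreal ((t1 - t0) * v / 2) \<le> ennreal ((t1 - t0) * v / b)" by (rule ennreal_leI)
  also have "\<dots> = ennreal ((t1 - t0) * v) / beta_mass ?\<alpha>"
    unfolding bB using b t v by (subst divide_ennreal) auto
  also have "\<dots> \<le> facet_int d N" unfolding facet_int_def by (rule divide_right_mono_ennreal[OF J])
  finally show ?thesis unfolding v_def .
qed

section \<open>Factorials and binomial coefficients up to polynomial factors\<close>

lemma fact_upper: "d \<ge> 1 \<Longrightarrow> fact d * exp (real d - 1) \<le> real d ^ (d + 1)"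
proof (induction d rule: dec_induct)
  case (step d)
  have d: "real d \<ge> 1" using step.hyps by simp
  have "1 - real d / (real d + 1) \<ge> 0" "1 / (real d + 1) \<le> ln (1 + 1 / real d)"
  proof -
    show "1 - real d / (real d + 1) \<ge> 0" using d by simp
    have "ln (real d / (real d + 1)) \<le> real d / (real d + 1) - 1" using d by (intro ln_le_minus_one) auto
    also have "\<dots> = - (1 / (real d + 1))" using d by (simp add: field_simps)
    finally have "1 / (real d + 1) \<le> - ln (real d / (real d + 1))" by simp
    also have "\<dots> = ln ((real d + 1) / real d)" using d by (simp add: ln_div)
    also have "(real d + 1) / real d = 1 + 1 / real d" using d by (simp add: field_simps)
    finally show "1 / (real d + 1) \<le> ln (1 + 1 / real d)" .
  qed
  then have "1 \<le> real (d + 1) * ln (1 + 1 / real d)" using d by (simp add: field_simps)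
  then have "exp 1 \<le> exp (real (d + 1) * ln (1 + 1 / real d))" by (simp only: exp_le_cancel_iff)
  also have "\<dots> = (1 + 1 / real d) ^ (d + 1)" using d by (simp only: exp_of_nat_mult) (simp add: add_pos_pos)
  finally have e: "exp 1 \<le> (1 + 1 / real d) ^ (d + 1)" .
  have "fact (Suc d) * exp (real (Suc d) - 1) = (real d + 1) * exp 1 * (fact d * exp (real d - 1))"
  proof -
    have "exp (real (Suc d) - 1) = exp 1 * exp (real d - 1)" by (simp flip: exp_add)
    then show ?thesis by (simp only: fact_Suc of_nat_Suc of_nat_mult mult_ac add.commute)
  qed
  also have "\<dots> \<le> (real d + 1) * (1 + 1 / real d) ^ (d + 1) * real d ^ (d + 1)"
    using e step.IH d by (intro mult_mono) auto
  also have "\<dots> = (real d + 1) * ((1 + 1 / real d) * real d) ^ (d + 1)" by (simp only: power_mult_distrib mult.assoc)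
  also have "(1 + 1 / real d) * real d = real (Suc d)" using d by (simp add: field_simps)
  finally show ?case by (simp add: add.commute)
qed simp

lemma fact_lower: "real d ^ d \<le> fact d * exp (real d)"
proof (induction d)
  case (Suc d)
  show ?case
  proof (cases "d = 0")
    case False
    then have d: "real d \<ge> 1" by simp
    have "(1 + 1 / real d) ^ d \<le> exp (1 / real d) ^ d" using d by (intro power_mono) auto
    also have "\<dots> = exp 1" using d by (simp add: exp_of_nat_mult[symmetric])
    finally have e: "(1 + 1 / real d) ^ d \<le> exp 1" .
    have "real (Suc d) ^ Suc d = real (Suc d) * ((1 + 1 / real d) * real d) ^ d"
    proof -
      have "(1 + 1 / real d) * real d = real (Suc d)" using d by (simp add: field_simps)
      then show ?thesis by (simp only: power_Suc)
    qed
    also have "\<dots> = real (Suc d) * ((1 + 1 / real d) ^ d * real d ^ d)" by (simp only: power_mult_distrib)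
    also have "\<dots> \<le> real (Suc d) * (exp 1 * (fact d * exp (real d)))"
      using e Suc by (intro mult_left_mono mult_mono) auto
    finally show ?thesis by (simp add: exp_add mult_ac)
  qed simp
qed simp

lemma choose_upper:
  assumes "d \<ge> 1"
  shows "real (n choose d) \<le> (exp 1 * real n / real d) ^ d"
proof -
  have "real ((n choose d) * fact d) \<le> real (n ^ d)" using binomial_fact_pow by (intro of_nat_mono)
  then have "real (n choose d) \<le> real n ^ d / fact d" by (simp add: le_divide_eq)
  also have "\<dots> \<le> real n ^ d * (exp (real d) / real d ^ d)"
  proof -
    have "1 / fact d \<le> exp (real d) / real d ^ d"
      using fact_lower[of d] assms by (simp add: divide_le_eq le_divide_eq mult.commute)
    from mult_left_mono[OF this, of "real n ^ d"] show ?thesis by simp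
  qed
  also have "\<dots> = (exp 1 * real n / real d) ^ d"
    using exp_of_nat_mult[of d "1 :: real"] by (simp only: power_mult_distrib power_divide mult_1_right) simp
  finally show ?thesis .
qed

lemma choose_lower:
  assumes "1 \<le> d" "d \<le> n"
  shows "(real n - real d) ^ d * exp (real d - 1) / real d ^ (d + 1) \<le> real (n choose d)"
proof -
  have "(real n - real d) ^ d = (\<Prod>i = 0..<d. real n - real d)" by simp
  also have "\<dots> \<le> (\<Prod>i = 0..<d. real (n - i))" using assms by (intro prod_mono) (auto simp: of_nat_diff)
  also have "\<dots> = real (n choose d) * fact d"
  proof -
    have "real (n choose d) = (\<Prod>i = 0..<d. real (n - i) / real (d - i))"
      using assms by (intro binomial_altdef_of_nat)
    also have "\<dots> = (\<Prod>i = 0..<d. real (n - i)) / (\<Prod>i = 0..<d. real (d - i))" by (rule prod_dividef)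
    also have "(\<Prod>i = 0..<d. real (d - i)) = fact d" by (simp add: fact_prod_rev)
    finally show ?thesis by simp
  qed
  finally have 1: "(real n - real d) ^ d \<le> real (n choose d) * fact d" .
  have "(real n - real d) ^ d * exp (real d - 1) \<le> real (n choose d) * (fact d * exp (real d - 1))"
    using mult_right_mono[OF 1, of "exp (real d - 1)"] by (simp add: mult.assoc)
  also have "\<dots> \<le> real (n choose d) * real d ^ (d + 1)" using fact_upper[OF assms(1)] by (intro mult_left_mono) auto
  finally show ?thesis using assms by (simp add: divide_le_eq)
qed

text \<open>The maximum is attained at \<open>x = m\<close>; use \<open>1 + u \<le> exp u\<close>
  with \<open>u = x / m - 1\<close>.\<close>

lemma power_exp_le:
  assumes "x \<ge> (0 :: real)" "m \<ge> 1"
  shows "x ^ m * exp (- x) \<le> (real m / exp 1) ^ m"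
proof -
  have m: "real m > 0" using assms by simp
  have "1 + (x / real m - 1) \<le> exp (x / real m - 1)" by (rule exp_ge_add_one_self)
  then have "(x / real m) ^ m \<le> exp (x / real m - 1) ^ m" using assms by (intro power_mono) auto
  also have "\<dots> = exp (x - real m)" using m by (simp add: exp_of_nat_mult[symmetric] algebra_simps)
  finally have "x ^ m \<le> real m ^ m * exp (x - real m)" using m by (simp add: power_divide divide_le_eq mult.commute)
  then have "x ^ m * exp (- x) \<le> real m ^ m * exp (x - real m) * exp (- x)" by (intro mult_right_mono) auto
  also have "\<dots> = real m ^ m * exp (- (real m * 1))" by (simp add: mult.assoc exp_add[symmetric])
  also have "\<dots> = (real m / exp 1) ^ m"
    using exp_of_nat_mult[of m "1 :: real"] by (simp only: power_divide exp_minus divide_inverse mult_1_right power_mult_distrib power_inverse)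
  finally show ?thesis .
qed

subsection \<open>Bounds for a fixed number of points\<close>

lemma powr_one_minus_le: "x < 1 \<Longrightarrow> 0 \<le> a \<Longrightarrow> (1 - x) powr a \<le> exp (- (a * x))" for x :: real
proof -
  assume x: "x < 1" and a: "0 \<le> a"
  have "(1 - x) powr a \<le> exp (- x) powr a"
    using x a exp_ge_add_one_self[of "- x"] by (intro powr_mono2) auto
  also have "\<dots> = exp (- (a * x))" by (simp add: exp_powr_real mult.commute)
  finally show ?thesis .
qed

text \<open>Far out, the weight alone decays faster than \<open>n choose d\<close> grows. The
  hypothesis \<open>h\<close> replaces the exponent by \<open>d\<^sup>2 / 2\<close> at the cost of
  half of \<delta>.\<close>

lemma integrand_far:
  assumes d: "d \<ge> 3" and \<delta>: "0 < \<delta>" and L: "0 < L"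
    and h: "((real d - 1)\<^sup>2 / 2 - 1) * (1 + \<delta>) \<ge> (real d)\<^sup>2 / 2 * (1 + \<delta> / 2)"
    and t: "t\<^sup>2 \<ge> 2 * (1 + \<delta>) * L / real d" "t\<^sup>2 < 1"
  shows "(1 - t\<^sup>2) powr ((real d - 1)\<^sup>2 / 2 - 1) * (1 - cap ((real d - 3) / 2) t) ^ N \<le> exp (- ((1 + \<delta> / 2) * L * real d))"
proof -
  let ?\<alpha> = "(real d - 1)\<^sup>2 / 2 - 1"
  have "(real d - 1)\<^sup>2 \<ge> 2\<^sup>2" using d by (intro power_mono) auto
  then have \<alpha>: "?\<alpha> \<ge> 0" by simp
  have c: "0 \<le> 1 - cap ((real d - 3) / 2) t" "1 - cap ((real d - 3) / 2) t \<le> 1"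
    using lw_cap(2,3)[of "(real d - 3) / 2" t] d by auto
  have "(1 + \<delta> / 2) * L * real d = (real d)\<^sup>2 / 2 * (1 + \<delta> / 2) * (2 * L / real d)"
    using d by (simp add: power2_eq_square field_simps)
  also have "\<dots> \<le> ?\<alpha> * (1 + \<delta>) * (2 * L / real d)" using h L by (intro mult_right_mono) auto
  also have "\<dots> = ?\<alpha> * (2 * (1 + \<delta>) * L / real d)" by simp
  also have "\<dots> \<le> ?\<alpha> * t\<^sup>2" using t(1) \<alpha> by (rule mult_left_mono)
  finally have e: "exp (- (?\<alpha> * t\<^sup>2)) \<le> exp (- ((1 + \<delta> / 2) * L * real d))" by simp
  have "(1 - t\<^sup>2) powr ?\<alpha> * (1 - cap ((real d - 3) / 2) t) ^ N \<le> (1 - t\<^sup>2) powr ?\<alpha> * 1"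
    using c by (intro mult_left_mono power_le_one) auto
  also have "\<dots> \<le> exp (- (?\<alpha> * t\<^sup>2))" using powr_one_minus_le[OF t(2) \<alpha>] by simp
  finally show ?thesis using e by (rule order_trans)
qed

text \<open>\<open>cap_lower\<close> with \<open>r\<close> beyond the threshold for
  \<open>t\<close>: the gap between the squares is large enough that the tail beyond
  \<open>r\<close> is at most the fraction \<delta> of the tail beyond \<open>t\<close>, while
  \<open>r\<close> exceeds the threshold by little. The denominator contains \<open>r\<close> and
  not \<open>t\<close>, which makes the bound uniform in \<open>t\<close>.\<close>

lemma cap_lower_near:
  assumes d: "d \<ge> 3" and \<delta>: "0 < \<delta>" "\<delta> < 1" and L: "0 < L"
    and h3: "2 * (1 + 2 * \<delta>) * L / real d \<le> 1 / 2" and h4: "exp (- (\<delta> * L / 2)) \<le> \<delta>"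
    and h5: "(real d - 1)\<^sup>2 \<le> (1 + \<delta>) * (real d * (real d - 2))"
    and t: "t\<^sup>2 < 2 * (1 + \<delta>) * L / real d"
  shows "(1 - t\<^sup>2) powr ((real d - 1) / 2) / sqrt (4 * pi * ((1 + 2 * \<delta>) * (1 + \<delta>) / (1 - \<delta>)\<^sup>2) * L)
    \<le> cap ((real d - 3) / 2) t"
proof -
  let ?a = "(real d - 3) / 2"
  define r where "r = sqrt (2 * (1 + 2 * \<delta>) * L / real d)"
  define Q R where "Q = (1 - t\<^sup>2) powr ((real d - 1) / 2)" and "R = (1 - r\<^sup>2) powr ((real d - 1) / 2)"
  define K where "K = 4 * pi * ((1 + 2 * \<delta>) * (1 + \<delta>) / (1 - \<delta>)\<^sup>2) * L"
  have rd: "real d \<ge> 3" using d by simp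
  have r2: "r\<^sup>2 = 2 * (1 + 2 * \<delta>) * L / real d" unfolding r_def using rd L \<delta> by simp
  have r0: "r > 0" unfolding r_def using rd L \<delta> by simp
  define g h where "g = 2 * (1 + \<delta>) * L / real d" and "h = 2 * \<delta> * L / real d"
  have t_g: "t\<^sup>2 < g" using t unfolding g_def .
  have gap: "r\<^sup>2 - g = h" unfolding g_def h_def r2 by (simp only: diff_divide_distrib[symmetric]) (simp add: algebra_simps)
  have gap0: "h > 0" unfolding h_def using rd L \<delta> by simp
  have t_r: "t\<^sup>2 < r\<^sup>2" using t_g gap gap0 by linarith
  then have tr: "\<bar>t\<bar> < r" using r0 power2_less_imp_less[of "\<bar>t\<bar>" r] by simp
  have r_half: "r\<^sup>2 \<le> 1 / 2" using h3 r2 by simp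
  then have r1: "r < 1" using power2_less_imp_less[of r 1] r0 by simp
  \<comment> \<open>Splitting off \<open>1 - t\<^sup>2\<close> compares \<open>R\<close> with
    \<open>Q\<close>, leaving a factor that depends on the difference of the squares alone.\<close>
  have "1 - r\<^sup>2 \<le> (1 - (r\<^sup>2 - t\<^sup>2)) * (1 - t\<^sup>2)"
  proof -
    have "(1 - (r\<^sup>2 - t\<^sup>2)) * (1 - t\<^sup>2) = 1 - r\<^sup>2 + (r\<^sup>2 - t\<^sup>2) * t\<^sup>2" by (simp add: algebra_simps)
    then show ?thesis using t_r by simp
  qed
  then have "R \<le> ((1 - (r\<^sup>2 - t\<^sup>2)) * (1 - t\<^sup>2)) powr ((real d - 1) / 2)"
    unfolding R_def using r_half rd by (intro powr_mono2) auto
  then have R1: "R \<le> (1 - (r\<^sup>2 - t\<^sup>2)) powr ((real d - 1) / 2) * Q"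
    unfolding Q_def powr_mult .
  have Q: "Q \<ge> 0" unfolding Q_def by simp
  have "(1 - (r\<^sup>2 - t\<^sup>2)) powr ((real d - 1) / 2) \<le> exp (- ((real d - 1) / 2 * (r\<^sup>2 - t\<^sup>2)))"
    using r_half rd zero_le_power2[of t] by (intro powr_one_minus_le) (linarith, simp)
  also have "\<dots> \<le> exp (- (\<delta> * L / 2))"
  proof -
    have "\<delta> * L / 2 \<le> (real d - 1) / 2 * h"
    proof -
      have "1 / 2 \<le> (real d - 1) / real d" using rd by (simp add: field_simps)
      then have "1 / 2 * (\<delta> * L) \<le> (real d - 1) / real d * (\<delta> * L)" using \<delta> L by (intro mult_right_mono) auto
      moreover have "(real d - 1) / real d * (\<delta> * L) = (real d - 1) / 2 * h" unfolding h_def by simp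
      ultimately show ?thesis by simp
    qed
    also have "\<dots> \<le> (real d - 1) / 2 * (r\<^sup>2 - t\<^sup>2)"
      using t_g gap rd by (intro mult_left_mono) auto
    finally show ?thesis by simp
  qed
  also note h4
  finally have "(1 - (r\<^sup>2 - t\<^sup>2)) powr ((real d - 1) / 2) * Q \<le> \<delta> * Q" using Q by (rule mult_right_mono)
  then have RQ: "R \<le> \<delta> * Q" using R1 by linarith
  have den: "(real d - 1) * r * sqrt (2 * pi / (real d - 2)) \<le> (1 - \<delta>) * sqrt K"
  proof (rule power2_le_imp_le)
    have "((real d - 1) * r * sqrt (2 * pi / (real d - 2)))\<^sup>2 = (real d - 1)\<^sup>2 * r\<^sup>2 * (2 * pi / (real d - 2))"
      using rd by (simp only: power_mult_distrib) simp
    also have "\<dots> = (real d - 1)\<^sup>2 / (real d * (real d - 2)) * (4 * pi * (1 + 2 * \<delta>) * L)"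
      unfolding r2 by simp
    also have "\<dots> \<le> (1 + \<delta>) * (4 * pi * (1 + 2 * \<delta>) * L)"
      using h5 rd \<delta> L by (intro mult_right_mono) (auto simp: pos_divide_le_eq)
    also have "\<dots> = (1 - \<delta>)\<^sup>2 * K" unfolding K_def using \<delta> by simp
    also have "\<dots> = ((1 - \<delta>) * sqrt K)\<^sup>2" using \<delta> L by (simp add: power_mult_distrib K_def)
    finally show "((real d - 1) * r * sqrt (2 * pi / (real d - 2)))\<^sup>2 \<le> ((1 - \<delta>) * sqrt K)\<^sup>2" .
    show "0 \<le> (1 - \<delta>) * sqrt K" using \<delta> L by (simp add: K_def)
  qed
  have den0: "0 < (real d - 1) * r * sqrt (2 * pi / (real d - 2))" using rd r0 by simp
  have "Q / sqrt K = (Q - \<delta> * Q) / ((1 - \<delta>) * sqrt K)"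
  proof -
    have "Q - \<delta> * Q = (1 - \<delta>) * Q" by (simp add: algebra_simps)
    then show ?thesis using \<delta> by simp
  qed
  also have "\<dots> \<le> (Q - \<delta> * Q) / ((real d - 1) * r * sqrt (2 * pi / (real d - 2)))"
  proof -
    have "0 \<le> Q - \<delta> * Q" using Q \<delta> mult_right_mono[of \<delta> 1 Q] by simp
    then show ?thesis using den den0 by (intro divide_left_mono) (auto intro: mult_pos_pos less_le_trans)
  qed
  also have "\<dots> \<le> (Q - R) / ((real d - 1) * r * sqrt (2 * pi / (real d - 2)))"
    using RQ den0 by (intro divide_right_mono) linarith+
  \<comment> \<open>\<open>cap_lower\<close> asks for a nonnegative height; for negative
    \<open>t\<close> the cap is only larger.\<close>
  also have "\<dots> \<le> cap ?a \<bar>t\<bar>"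
    using cap_lower[OF d _ tr r1] unfolding Q_def R_def by simp
  also have "\<dots> \<le> cap ?a t" by (rule cap_antimono[OF d]) simp
  finally show ?thesis unfolding Q_def K_def .
qed

text \<open>In terms of \<open>Q\<close> the weight is \<open>Q ^ (d - 1) / (1 - t\<^sup>2)\<close>
  with denominator at least 1/2, and the power of one minus the cap is at most
  \<open>exp (- (N * A * Q))\<close>. Maximising over \<open>Q\<close> by
  \<open>power_exp_le\<close> removes the dependence on \<open>t\<close>.\<close>

lemma integrand_near:
  assumes d: "d \<ge> 3" and t: "t\<^sup>2 \<le> 1 / 2" and A: "0 < A" and N: "0 < N"
    and c: "(1 - t\<^sup>2) powr ((real d - 1) / 2) * A \<le> cap ((real d - 3) / 2) t"
  shows "(1 - t\<^sup>2) powr ((real d - 1)\<^sup>2 / 2 - 1) * (1 - cap ((real d - 3) / 2) t) ^ N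
    \<le> 2 * (real (d - 1) / (exp 1 * real N * A)) ^ (d - 1)"
proof -
  define Q where "Q = (1 - t\<^sup>2) powr ((real d - 1) / 2)"
  let ?c = "cap ((real d - 3) / 2) t" and ?x = "real N * A * Q"
  have Q: "Q \<ge> 0" unfolding Q_def by simp
  have c': "0 \<le> 1 - ?c" using lw_cap(3)[of "(real d - 3) / 2" t] d by auto
  have "Q ^ (d - 1) = (1 - t\<^sup>2) powr ((real d - 1)\<^sup>2 / 2)"
    unfolding Q_def using t d
    by (subst powr_realpow[symmetric]) (auto simp: powr_powr power2_eq_square of_nat_diff)
  then have "(1 - t\<^sup>2) powr ((real d - 1)\<^sup>2 / 2 - 1) = Q ^ (d - 1) / (1 - t\<^sup>2)"
    using t by (simp add: powr_diff)
  also have "\<dots> \<le> Q ^ (d - 1) / (1 / 2)" using t Q by (intro divide_left_mono) auto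
  finally have 1: "(1 - t\<^sup>2) powr ((real d - 1)\<^sup>2 / 2 - 1) \<le> 2 * Q ^ (d - 1)" by simp
  have "(1 - ?c) ^ N \<le> exp (- (Q * A)) ^ N"
  proof (rule power_mono[OF _ c'])
    have "1 - ?c \<le> 1 + - (Q * A)" using c unfolding Q_def by simp
    also have "\<dots> \<le> exp (- (Q * A))" by (rule exp_ge_add_one_self)
    finally show "1 - ?c \<le> exp (- (Q * A))" .
  qed
  also have "\<dots> = exp (- ?x)" by (simp add: exp_of_nat_mult[symmetric] mult_ac)
  finally have 2: "(1 - ?c) ^ N \<le> exp (- ?x)" .
  have NA: "real N * A > 0" using N A by simp
  have "(real N * A) ^ (d - 1) * (Q ^ (d - 1) * exp (- ?x)) = ?x ^ (d - 1) * exp (- ?x)"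
    by (simp only: power_mult_distrib mult.assoc)
  also have "\<dots> \<le> (real (d - 1) / exp 1) ^ (d - 1)" using Q NA d by (intro power_exp_le) auto
  finally have "Q ^ (d - 1) * exp (- ?x) \<le> (real (d - 1) / exp 1) ^ (d - 1) / (real N * A) ^ (d - 1)"
    using NA by (simp only: pos_le_divide_eq zero_less_power mult.commute)
  also have "\<dots> = (real (d - 1) / (exp 1 * real N * A)) ^ (d - 1)"
    by (simp only: power_divide[symmetric] divide_divide_eq_left mult.assoc)
  finally have 3: "Q ^ (d - 1) * exp (- ?x) \<le> (real (d - 1) / (exp 1 * real N * A)) ^ (d - 1)" .
  have "(1 - t\<^sup>2) powr ((real d - 1)\<^sup>2 / 2 - 1) * (1 - ?c) ^ N \<le> 2 * Q ^ (d - 1) * exp (- ?x)"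
    using 1 2 Q c' by (intro mult_mono) auto
  then show ?thesis using 3 by linarith
qed

text \<open>The hypotheses \<open>h1\<close> to \<open>h7\<close> hold eventually for fixed
  \<delta>. Of the factor \<open>(1 + \<delta>) ^ 3\<close>, two powers come from replacing
  \<open>n - d\<close> by \<open>n\<close> inside a square, and one absorbs the factors polynomial
  in \<open>n\<close>.\<close>

lemma facets_upper_fixed:
  assumes d: "3 \<le> d" "d < n" and \<delta>: "0 < \<delta>" "\<delta> < 1"
  defines "L \<equiv> ln (real n / real d)" and "\<kappa> \<equiv> (1 + 2 * \<delta>) * (1 + \<delta>) / (1 - \<delta>)\<^sup>2"
  assumes h1: "\<delta> * L \<ge> 2"
    and h2: "((real d - 1)\<^sup>2 / 2 - 1) * (1 + \<delta>) \<ge> (real d)\<^sup>2 / 2 * (1 + \<delta> / 2)"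
    and h3: "2 * (1 + 2 * \<delta>) * L / real d \<le> 1 / 2" and h4: "exp (- (\<delta> * L / 2)) \<le> \<delta>"
    and h5: "(real d - 1)\<^sup>2 \<le> (1 + \<delta>) * (real d * (real d - 2))"
    and h6: "real n \<le> (1 + \<delta>) * (real n - real d)"
    and h7: "112 * real n \<le> (1 + \<delta>) powr ((real d - 1) / 2)"
  shows "of_nat (n choose d) * (2 * facet_int d (n - d)) \<le>
    ennreal ((4 * pi * (\<kappa> * (1 + \<delta>) ^ 3) * L) powr ((real d - 1) / 2))"
proof -
  define K where "K = 4 * pi * \<kappa> * L"
  define A where "A = 1 / sqrt K"
  define m where "m = d - 1"
  have rm: "real m = real d - 1" "d = Suc m" unfolding m_def using d by auto
  have rd: "real d \<ge> 3" "real n > real d" using d by auto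
  have L2: "L \<ge> 2"
  proof -
    have "0 < \<delta> * L" using h1 by linarith
    then have "L > 0" using \<delta> by (simp add: zero_less_mult_iff)
    then have "\<delta> * L \<le> 1 * L" using \<delta> by (intro mult_right_mono) auto
    then show ?thesis using h1 by simp
  qed
  have \<kappa>: "\<kappa> \<ge> 1"
  proof -
    have "(1 - \<delta>)\<^sup>2 \<le> 1" using \<delta> by (intro power_le_one) auto
    also have "1 \<le> (1 + 2 * \<delta>) * (1 + \<delta>)" using \<delta> by (simp add: algebra_simps)
    finally show ?thesis unfolding \<kappa>_def using \<delta> by simp
  qed
  have K1: "K \<ge> 1"
  proof -
    have "1 * 1 * 1 \<le> (4 * pi) * \<kappa> * L" using \<kappa> L2 pi_ge_two by (intro mult_mono) auto
    then show ?thesis unfolding K_def by simp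
  qed
  have A: "A > 0" unfolding A_def using K1 by simp
  have N: "n - d > 0" "real (n - d) = real n - real d" using d by auto
  \<comment> \<open>The far and the near bound are added, so that \<open>s\<close> dominates the
    integrand at every height.\<close>
  define s where "s = exp (- ((1 + \<delta> / 2) * L * real d)) + 2 * (real m / (exp 1 * real (n - d) * A)) ^ m"
  have s0: "2 * (real m / (exp 1 * real (n - d) * A)) ^ m \<ge> 0" using A N by simp
  have fi: "facet_int d (n - d) \<le> ennreal (8 * real d * s)"
  proof (rule facet_int_upper[OF d(1)])
    show "s \<ge> 0" unfolding s_def using s0 by (intro add_nonneg_nonneg) auto
    fix t :: real assume t: "-1 < t" "t < 1"
    then have t2: "t\<^sup>2 < 1" by (simp add: abs_square_less_1 abs_less_iff)
    show "(1 - t\<^sup>2) powr ((real d - 1)\<^sup>2 / 2 - 1) * (1 - cap ((real d - 3) / 2) t) ^ (n - d) \<le> s"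
    proof (cases "t\<^sup>2 \<ge> 2 * (1 + \<delta>) * L / real d")
      case True
      have "(1 - t\<^sup>2) powr ((real d - 1)\<^sup>2 / 2 - 1) * (1 - cap ((real d - 3) / 2) t) ^ (n - d) \<le>
        exp (- ((1 + \<delta> / 2) * L * real d))"
        by (rule integrand_far[OF d(1) \<delta>(1) _ h2 True t2]) (use L2 in simp)
      then show ?thesis unfolding s_def using s0 by linarith
    next
      case False
      then have lt: "t\<^sup>2 < 2 * (1 + \<delta>) * L / real d" by simp
      have "2 * (1 + \<delta>) * L / real d \<le> 2 * (1 + 2 * \<delta>) * L / real d"
        using \<delta> L2 rd by (intro divide_right_mono mult_right_mono) auto
      then have th: "t\<^sup>2 \<le> 1 / 2" using lt h3 by linarith
      have "(1 - t\<^sup>2) powr ((real d - 1) / 2) * A \<le> cap ((real d - 3) / 2) t"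
        using cap_lower_near[OF d(1) \<delta> _ h3 h4 h5 lt] L2 unfolding A_def K_def \<kappa>_def by simp
      from integrand_near[OF d(1) th A N(1) this]
      have "(1 - t\<^sup>2) powr ((real d - 1)\<^sup>2 / 2 - 1) * (1 - cap ((real d - 3) / 2) t) ^ (n - d) \<le>
        2 * (real m / (exp 1 * real (n - d) * A)) ^ m" unfolding m_def .
      then show ?thesis unfolding s_def by (smt (verit) exp_gt_zero)
    qed
  qed
  have C: "real (n choose d) \<le> (exp 1 * real n / real d) ^ d" using choose_upper[of d n] d by simp
  have CL: "(exp 1 * real n / real d) ^ d = exp (real d * (1 + L))"
  proof -
    have "exp 1 * real n / real d = exp (1 + L)" unfolding L_def using rd by (simp add: exp_add)
    then show ?thesis by (simp only: exp_of_nat_mult)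
  qed
  \<comment> \<open>The far part: \<open>exp (d * (1 + L))\<close> from the binomial coefficient
    leaves \<open>exp (d * (1 - \<delta> * L / 2))\<close>, which is at most 1 by
    \<open>h1\<close>.\<close>
  have T1: "real d * (real (n choose d) * exp (- ((1 + \<delta> / 2) * L * real d))) \<le> real n"
  proof -
    have "real (n choose d) * exp (- ((1 + \<delta> / 2) * L * real d)) \<le>
      exp (real d * (1 + L)) * exp (- ((1 + \<delta> / 2) * L * real d))"
      using C unfolding CL by (intro mult_right_mono) auto
    also have "\<dots> = exp (real d * (1 - \<delta> * L / 2))" by (simp add: exp_add[symmetric] algebra_simps)
    also have "\<dots> \<le> 1" using h1 by (simp add: mult_nonneg_nonpos)
    finally have "real d * (real (n choose d) * exp (- ((1 + \<delta> / 2) * L * real d))) \<le> real d * 1"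
      by (intro mult_left_mono) auto
    then show ?thesis using rd by linarith
  qed
  define Y where "Y = (1 + \<delta>) ^ m * sqrt K ^ m"
  have Y1: "Y \<ge> 1"
  proof -
    have "1 * 1 \<le> (1 + \<delta>) ^ m * sqrt K ^ m" using \<delta> K1 by (intro mult_mono one_le_power) auto
    then show ?thesis unfolding Y_def by simp
  qed
  \<comment> \<open>The near part: the binomial bound has power \<open>d\<close>, the integrand
    power \<open>m = d - 1\<close>. One factor \<open>exp 1 * n / d\<close> is left over; its
    denominator cancels the leading \<open>d\<close>, and \<open>exp 1 \<le> 3\<close>.\<close>
  have T2: "real d * (real (n choose d) * (real m / (exp 1 * real (n - d) * A)) ^ m) \<le> 3 * real n * Y"
  proof -
    have "(real m / (exp 1 * real (n - d) * A)) ^ m \<le> (real d / (exp 1 * real (n - d) * A)) ^ m"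
      using rm(1) A N by (intro power_mono divide_right_mono) auto
    then have "real (n choose d) * (real m / (exp 1 * real (n - d) * A)) ^ m \<le>
      (exp 1 * real n / real d) ^ d * (real d / (exp 1 * real (n - d) * A)) ^ m"
      using C A N by (intro mult_mono) auto
    also have "\<dots> = exp 1 * real n / real d * ((exp 1 * real n / real d) * (real d / (exp 1 * real (n - d) * A))) ^ m"
      unfolding rm(2) power_Suc by (simp only: power_mult_distrib mult.assoc)
    also have "\<dots> \<le> exp 1 * real n / real d * Y"
    proof (intro mult_left_mono)
      have "(exp 1 * real n / real d) * (real d / (exp 1 * real (n - d) * A)) = real n / real (n - d) * sqrt K"
        using rd N A unfolding A_def by simp
      moreover have "real n / real (n - d) \<le> 1 + \<delta>" using h6 rd unfolding N(2) by (simp add: pos_divide_le_eq)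
      ultimately have "((exp 1 * real n / real d) * (real d / (exp 1 * real (n - d) * A))) ^ m \<le> ((1 + \<delta>) * sqrt K) ^ m"
        using K1 by (simp only:) (intro power_mono mult_right_mono; simp)
      then show "((exp 1 * real n / real d) * (real d / (exp 1 * real (n - d) * A))) ^ m \<le> Y"
        unfolding Y_def power_mult_distrib[of "1 + \<delta>"] .
    qed (use rd in auto)
    finally have "real d * (real (n choose d) * (real m / (exp 1 * real (n - d) * A)) ^ m) \<le>
      real d * (exp 1 * real n / real d * Y)" by (rule mult_left_mono) auto
    also have "\<dots> = exp 1 * (real n * Y)" using rd by simp
    also have "\<dots> \<le> 3 * (real n * Y)" using exp_le Y1 by (intro mult_right_mono) auto
    finally show ?thesis by simp
  qed
  have "real (n choose d) * (2 * (8 * real d * s)) =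
      16 * (real d * (real (n choose d) * exp (- ((1 + \<delta> / 2) * L * real d)))) +
      32 * (real d * (real (n choose d) * (real m / (exp 1 * real (n - d) * A)) ^ m))"
    unfolding s_def by (simp add: algebra_simps)
  also have "\<dots> \<le> 16 * (real n * Y) + 32 * (3 * real n * Y)"
  proof (intro add_mono mult_left_mono T2)
    have "real n * 1 \<le> real n * Y" using Y1 by (intro mult_left_mono) auto
    then show "real d * (real (n choose d) * exp (- ((1 + \<delta> / 2) * L * real d))) \<le> real n * Y"
      using T1 by linarith
  qed auto
  \<comment> \<open>The origin of the constant in \<open>h7\<close>: 112 is 16 + 32 * 3.\<close>
  also have "\<dots> = 112 * real n * Y" by simp
  also have "\<dots> \<le> (1 + \<delta>) powr ((real d - 1) / 2) * Y" using h7 Y1 by (intro mult_right_mono) auto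
  also have "Y = ((1 + \<delta>)\<^sup>2 * K) powr ((real d - 1) / 2)"
  proof -
    have "Y = ((1 + \<delta>) * sqrt K) powr real m"
      unfolding Y_def using \<delta> K1 by (subst powr_realpow) (auto simp: power_mult_distrib)
    also have "(1 + \<delta>) * sqrt K = ((1 + \<delta>)\<^sup>2 * K) powr (1 / 2)"
      using \<delta> K1 by (simp add: powr_half_sqrt real_sqrt_mult)
    finally show ?thesis by (simp only: powr_powr rm(1)) simp
  qed
  also have "(1 + \<delta>) powr ((real d - 1) / 2) * ((1 + \<delta>)\<^sup>2 * K) powr ((real d - 1) / 2) =
      ((1 + \<delta>) * ((1 + \<delta>)\<^sup>2 * K)) powr ((real d - 1) / 2)"
    by (rule powr_mult[symmetric])
  also have "(1 + \<delta>) * ((1 + \<delta>)\<^sup>2 * K) = 4 * pi * (\<kappa> * (1 + \<delta>) ^ 3) * L"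
    unfolding K_def by (simp add: power3_eq_cube power2_eq_square)
  finally have fin: "real (n choose d) * (2 * (8 * real d * s)) \<le>
    (4 * pi * (\<kappa> * (1 + \<delta>) ^ 3) * L) powr ((real d - 1) / 2)" .
  have "of_nat (n choose d) * (2 * facet_int d (n - d)) \<le> of_nat (n choose d) * (2 * ennreal (8 * real d * s))"
    using fi by (intro mult_left_mono) auto
  also have "\<dots> = ennreal (real (n choose d) * (2 * (8 * real d * s)))"
  proof -
    have "of_nat k * (2 * ennreal u) = ennreal (real k * (2 * u))" for k :: nat and u :: real
      by (simp add: ennreal_mult' ennreal_of_nat_eq_real_of_nat)
    then show ?thesis .
  qed
  also have "\<dots> \<le> ennreal ((4 * pi * (\<kappa> * (1 + \<delta>) ^ 3) * L) powr ((real d - 1) / 2))"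
    using fin by (rule ennreal_leI)
  finally show ?thesis .
qed

text \<open>The height \<open>t0\<close> is chosen with cap at most \<open>d / n\<close>, so that
  the other points all stay below with probability at least \<open>exp (- d)\<close>; this cancels
  the exponential in the binomial coefficient. The weight near \<open>t0\<close> is at least half of
  \<open>(d / n * w) ^ (d - 1)\<close>, and the power of \<open>w\<close> gives the claim.\<close>

lemma facets_lower_fixed:
  assumes d: "3 \<le> d" "d < n" and \<delta>: "0 < \<delta>" "\<delta> < 1"
  defines "L \<equiv> ln (real n / real d)"
  defines "w \<equiv> sqrt (4 * pi * (1 - \<delta>) * L)"
  assumes l1: "w \<ge> 1" and l2: "ln w \<le> \<delta> / 4 * L" and l3: "2 * L / (real d - 1) \<le> \<delta> / 2"
    and l4: "real n \<le> (1 + \<delta>) * (real n - real d)"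
    and l5: "64 * exp 1 * real d ^ 4 \<le> exp (\<delta> * (real d - 1))"
  shows "ennreal ((4 * pi * ((1 - \<delta>) * exp (- 4 * \<delta>)) * L) powr ((real d - 1) / 2)) \<le>
    of_nat (n choose d) * facet_int d (n - d)"
proof -
  let ?a = "(real d - 3) / 2" and ?\<alpha> = "(real d - 1)\<^sup>2 / 2 - 1"
  define m where "m = d - 1"
  have rm: "real m = real d - 1" "d = Suc m" unfolding m_def using d by auto
  have rd: "real d \<ge> 3" "real n > real d" using d by auto
  have N: "n - d > 0" "real (n - d) = real n - real d" using d by auto
  have L0: "L > 0" unfolding L_def using rd by simp
  have w2: "w\<^sup>2 = 4 * pi * (1 - \<delta>) * L" unfolding w_def using \<delta> L0 by simp
  \<comment> \<open>Solves \<open>exp (- (y * (m / 2))) = d / n * w\<close>, where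
    \<open>exp (- y)\<close> will be \<open>1 - t0\<^sup>2\<close>.\<close>
  define y where "y = 2 * (L - ln w) / real m"
  have m0: "real m > 0" using rm(1) rd by simp
  have lnw: "ln w \<ge> 0" using l1 by simp
  have y_le: "y \<le> \<delta> / 2"
  proof -
    have "y \<le> 2 * L / real m" unfolding y_def using lnw m0 by (intro divide_right_mono) auto
    then show ?thesis using l3 unfolding rm(1) by linarith
  qed
  have y_ge: "2 * (1 - \<delta> / 4) * L / real m \<le> y"
    unfolding y_def using l2 m0 by (intro divide_right_mono) (auto simp: algebra_simps)
  have y0: "y > 0"
  proof -
    have "2 * (1 - \<delta> / 4) * L / real m > 0" using \<delta> L0 m0 by simp
    then show ?thesis using y_ge by linarith
  qed
  define t0 where "t0 = sqrt (1 - exp (- y))"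
  have t02: "t0\<^sup>2 = 1 - exp (- y)" unfolding t0_def using y0 by simp
  have t0: "0 < t0" "t0 < 1" unfolding t0_def using y0 by auto
  have ey: "exp (- y) \<ge> 1 / 2"
    using exp_ge_add_one_self[of "- y"] y_le \<delta> by linarith
  have Q0: "(1 - t0\<^sup>2) powr (real m / 2) = real d / real n * w"
  proof -
    have "(1 - t0\<^sup>2) powr (real m / 2) = exp (- (y * (real m / 2)))" unfolding t02 by (simp add: exp_powr_real)
    also have "y * (real m / 2) = L - ln w" unfolding y_def using m0 by simp
    also have "exp (- (L - ln w)) = exp (ln w) / exp L" by (simp add: exp_diff[symmetric])
    also have "\<dots> = real d / real n * w" unfolding L_def using rd l1 by simp
    finally show ?thesis .
  qed
  \<comment> \<open>\<open>w\<close> was chosen as a lower bound for the denominator in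
    \<open>cap_upper\<close>: the square of \<open>t0\<close> is at least
    \<open>(1 - \<delta>) * (2 * L / m)\<close>.\<close>
  have w_le: "w \<le> t0 * sqrt (2 * pi * real m)"
  proof (rule power2_le_imp_le)
    have "exp (- y) \<le> 1 / (1 + y)"
      using exp_ge_add_one_self[of y] y0 by (simp add: exp_minus inverse_eq_divide frac_le)
    then have "y / (1 + y) \<le> t0\<^sup>2" unfolding t02 using y0 by (simp add: field_simps)
    moreover have "(1 - \<delta>) * (2 * L / real m) \<le> y / (1 + y)"
    proof -
      have "(1 - \<delta>) * (1 + y) \<le> (1 - \<delta>) * (1 + \<delta> / 2)" using y_le \<delta> by (intro mult_left_mono) auto
      also have "\<dots> \<le> 1 - \<delta> / 4" using \<delta> by (simp add: algebra_simps)
      finally have "(1 - \<delta>) * (1 + y) * (2 * L / real m) \<le> (1 - \<delta> / 4) * (2 * L / real m)"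
        using L0 m0 by (intro mult_right_mono) auto
      also have "\<dots> \<le> y" using y_ge by (simp add: mult_ac)
      finally have "(1 - \<delta>) * (2 * L / real m) * (1 + y) \<le> y" by (simp only: mult_ac)
      moreover have "1 + y > 0" using y0 by simp
      ultimately show ?thesis by (simp only: pos_le_divide_eq)
    qed
    ultimately have "(1 - \<delta>) * (2 * L / real m) \<le> t0\<^sup>2" by linarith
    then have "(1 - \<delta>) * (2 * L / real m) * (2 * pi * real m) \<le> t0\<^sup>2 * (2 * pi * real m)"
      using m0 by (intro mult_right_mono) auto
    then show "w\<^sup>2 \<le> (t0 * sqrt (2 * pi * real m))\<^sup>2"
      unfolding w2 power_mult_distrib using m0 by (simp add: mult_ac)
    show "0 \<le> t0 * sqrt (2 * pi * real m)" using t0 m0 by simp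
  qed
  have cap: "cap ?a t0 \<le> real d / real n"
  proof -
    have "cap ?a t0 \<le> real d / real n * w / (t0 * sqrt (2 * pi * real m))"
      using cap_upper[OF d(1) t0] unfolding rm(1)[symmetric] Q0 .
    also have "\<dots> \<le> real d / real n * w / w"
      using w_le l1 t0 m0 by (intro divide_left_mono) auto
    finally show ?thesis using l1 by simp
  qed
  have p1: "exp (- real d) \<le> (1 - cap ?a t0) ^ (n - d)"
  proof -
    have "real n / real (n - d) = 1 + real d / real (n - d)" using N by (simp add: field_simps)
    also have "\<dots> \<le> exp (real d / real (n - d))" by (rule exp_ge_add_one_self)
    finally have "exp (- (real d / real (n - d))) \<le> real (n - d) / real n"
      using N rd by (simp add: exp_minus field_simps)
    also have "\<dots> = 1 - real d / real n" using N rd by (simp add: field_simps)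
    also have "\<dots> \<le> 1 - cap ?a t0" using cap by simp
    finally have "exp (- (real d / real (n - d))) ^ (n - d) \<le> (1 - cap ?a t0) ^ (n - d)"
      by (intro power_mono) auto
    moreover have "exp (- (real d / real (n - d))) ^ (n - d) = exp (- real d)"
      using N by (simp add: exp_of_nat_mult[symmetric])
    ultimately show ?thesis by simp
  qed
  \<comment> \<open>The width of the window. It changes \<open>1 - t\<^sup>2\<close> by a relative
    amount \<open>x\<close> with \<open>d\<^sup>2 * x \<le> 1 / 2\<close>, so the weight, whose
    exponent is at most \<open>d\<^sup>2\<close>, loses at most a factor two by
    \<open>power_ge_half\<close>.\<close>
  define h where "h = 1 / (16 * (real d)\<^sup>2)"
  define t1 where "t1 = t0 + h"
  define x where "x = (t1\<^sup>2 - t0\<^sup>2) / exp (- y)"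
  have d2: "(real d)\<^sup>2 \<ge> 1" using rd by (intro one_le_power) auto
  then have "16 * (real d)\<^sup>2 \<ge> 1" by linarith
  then have h: "0 < h" "h \<le> 1" unfolding h_def
    by (auto simp only: divide_le_eq_1_pos zero_less_divide_1_iff)
  have xx: "t1\<^sup>2 - t0\<^sup>2 = h * (2 * t0 + h)" unfolding t1_def by (simp add: power2_eq_square algebra_simps)
  have x0: "x \<ge> 0" unfolding x_def xx using h t0 by simp
  have x_le: "real (d\<^sup>2) * x \<le> 1 / 2"
  proof -
    have "x \<le> h * (2 * t0 + h) / (1 / 2)" unfolding x_def xx using ey h t0 by (intro divide_left_mono) auto
    also have "\<dots> \<le> h * 3 / (1 / 2)" using h t0 by (intro divide_right_mono mult_left_mono) auto
    finally have "real (d\<^sup>2) * x \<le> real (d\<^sup>2) * (h * 6)" by (intro mult_left_mono) auto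
    also have "\<dots> \<le> 1 / 2" unfolding h_def using rd by simp
    finally show ?thesis .
  qed
  have x1: "x < 1"
  proof -
    have "1 * x \<le> real (d\<^sup>2) * x" using d2 x0 by (intro mult_right_mono) auto
    then show ?thesis using x_le by linarith
  qed
  have fac: "1 - t1\<^sup>2 = exp (- y) * (1 - x)" unfolding x_def using t02 by (simp add: field_simps)
  have t1: "t1 < 1"
  proof -
    have "1 - t1\<^sup>2 > 0" unfolding fac using x1 by simp
    then have "t1\<^sup>2 < 1\<^sup>2" by simp
    then show ?thesis by (rule power2_less_imp_less) simp
  qed
  have "(real d - 1)\<^sup>2 \<ge> 2\<^sup>2" using rd by (intro power_mono) auto
  then have \<alpha>: "?\<alpha> \<ge> 0" by simp
  have p2: "(real d / real n * w) ^ m / 2 \<le> (1 - t1\<^sup>2) powr ?\<alpha>"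
  proof -
    have "?\<alpha> \<le> real (d\<^sup>2)" using rd by (simp add: power2_eq_square algebra_simps)
    then have "1 / 2 \<le> (1 - x) powr ?\<alpha>" using power_ge_half[OF \<alpha> _ x_le x0 x1] by simp
    moreover have "(real d / real n * w) ^ m \<le> exp (- y) powr ?\<alpha>"
    proof -
      have "(real d / real n * w) ^ m = exp (- y * (real m / 2)) ^ m"
        unfolding Q0[symmetric] t02 by (simp add: exp_powr_real)
      also have "\<dots> = exp (- y * (real m ^ 2 / 2))"
        by (simp add: exp_of_nat_mult[symmetric] power2_eq_square mult_ac)
      also have "\<dots> \<le> exp (- y * ?\<alpha>)" using y0 unfolding rm(1) by (simp add: mult_left_mono)
      also have "\<dots> = exp (- y) powr ?\<alpha>" by (simp add: exp_powr_real)
      finally show ?thesis .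
    qed
    ultimately have "(real d / real n * w) ^ m * (1 / 2) \<le> exp (- y) powr ?\<alpha> * (1 - x) powr ?\<alpha>"
      by (intro mult_mono) auto
    also have "\<dots> = (1 - t1\<^sup>2) powr ?\<alpha>" unfolding fac by (rule powr_mult[symmetric])
    finally show ?thesis by simp
  qed
  define v where "v = h * ((real d / real n * w) ^ m / 2 * exp (- real d)) / 2"
  have le: "v \<le> h * ((1 - t1\<^sup>2) powr ?\<alpha> * (1 - cap ?a t0) ^ (n - d)) / 2"
    unfolding v_def using p1 p2 h l1 by (intro divide_right_mono mult_left_mono mult_mono) auto
  have th: "0 \<le> t0" "t0 < t1" "t1 - t0 = h" unfolding t1_def using t0 h by auto
  have fi: "ennreal v \<le> facet_int d (n - d)"
    using ennreal_leI[OF le] facet_int_lower[OF d(1) th(1,2) t1, of "n - d"] unfolding th(3) by (rule order_trans)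
  define c where "c = (real n - real d) ^ d * exp (real d - 1) / real d ^ (d + 1)"
  have c: "0 \<le> c" "c \<le> real (n choose d)" unfolding c_def using choose_lower[of d n] d rd by auto
  \<comment> \<open>In the denominator, \<open>16 * d\<^sup>2\<close> stems from the window, 4 from
    the two halvings in \<open>v\<close>, and another \<open>d\<^sup>2\<close> from
    \<open>choose_lower\<close> after \<open>d ^ m\<close> has cancelled.\<close>
  have cv: "c * v = ((real n - real d) / real n) ^ m * w ^ m * (real n - real d) / (64 * exp 1 * real d ^ 4)"
  proof -
    have "exp (real d - 1) * exp (- real d) = 1 / exp 1" by (simp add: exp_diff exp_minus field_simps)
    moreover have "c * v = (real n - real d) ^ m * (real n - real d) * (exp (real d - 1) * exp (- real d)) *
        (real d ^ m * w ^ m / real n ^ m) / (real d ^ m * (real d)\<^sup>2 * (64 * (real d)\<^sup>2))"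
      unfolding c_def v_def h_def rm(2) power_mult_distrib power_divide
      by (simp add: power2_eq_square mult_ac)
    ultimately show ?thesis
      using rd by (simp add: power_divide power4_eq_xxxx power2_eq_square mult_ac)
  qed
  have "exp (- \<delta>) ^ m * w ^ m * 1 / exp (\<delta> * real m) \<le> c * v"
    unfolding cv
  proof (intro frac_le mult_mono)
    show "64 * exp 1 * real d ^ 4 \<le> exp (\<delta> * real m)" using l5 unfolding rm(1) .
    have "exp (- \<delta>) \<le> (real n - real d) / real n"
    proof -
      have "real n \<le> exp \<delta> * (real n - real d)"
        using l4 rd exp_ge_add_one_self[of \<delta>] by (intro order_trans[OF l4] mult_right_mono) auto
      then show ?thesis using rd by (simp add: exp_minus field_simps)
    qed
    then show "exp (- \<delta>) ^ m \<le> ((real n - real d) / real n) ^ m" by (intro power_mono) auto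
    show "1 \<le> real n - real d" using N by linarith
  qed (use l1 rd in auto)
  \<comment> \<open>One factor \<open>exp (- \<delta>)\<close> per dimension pays for
    \<open>n - d\<close> in place of \<open>n\<close>, the other for the polynomial in
    \<open>d\<close>. Moved under the square root, they become
    \<open>exp (- 4 * \<delta>)\<close>.\<close>
  moreover have "exp (- \<delta>) ^ m * w ^ m * 1 / exp (\<delta> * real m) = (exp (- 2 * \<delta>) * w) ^ m"
    by (simp add: power_mult_distrib exp_of_nat_mult[symmetric] exp_diff[symmetric] exp_minus[symmetric] divide_inverse mult_ac exp_add[symmetric])
  moreover have "(exp (- 2 * \<delta>) * w) ^ m = (4 * pi * ((1 - \<delta>) * exp (- 4 * \<delta>)) * L) powr ((real d - 1) / 2)"
  proof -
    have "exp (- 2 * \<delta>) * w = sqrt (4 * pi * ((1 - \<delta>) * exp (- 4 * \<delta>)) * L)"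
    proof (rule real_sqrt_unique[symmetric])
      have "exp (- 2 * \<delta>) ^ 2 = exp (- 4 * \<delta>)" by (simp add: power2_eq_square exp_add[symmetric])
      then show "(exp (- 2 * \<delta>) * w)\<^sup>2 = 4 * pi * ((1 - \<delta>) * exp (- 4 * \<delta>)) * L"
        unfolding power_mult_distrib w2 by simp
      show "0 \<le> exp (- 2 * \<delta>) * w" using l1 by simp
    qed
    also have "\<dots> = (4 * pi * ((1 - \<delta>) * exp (- 4 * \<delta>)) * L) powr (1 / 2)"
      using \<delta> L0 by (subst powr_half_sqrt) auto
    finally have "(exp (- 2 * \<delta>) * w) ^ m = ((4 * pi * ((1 - \<delta>) * exp (- 4 * \<delta>)) * L) powr (1 / 2)) ^ m" by simp
    also have "\<dots> = ((4 * pi * ((1 - \<delta>) * exp (- 4 * \<delta>)) * L) powr (1 / 2)) powr real m"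
      using \<delta> L0 by (subst powr_realpow) auto
    also have "\<dots> = (4 * pi * ((1 - \<delta>) * exp (- 4 * \<delta>)) * L) powr ((real d - 1) / 2)"
      by (simp only: powr_powr rm(1)) simp
    finally show ?thesis .
  qed
  ultimately have "(4 * pi * ((1 - \<delta>) * exp (- 4 * \<delta>)) * L) powr ((real d - 1) / 2) \<le> c * v" by simp
  then have "ennreal ((4 * pi * ((1 - \<delta>) * exp (- 4 * \<delta>)) * L) powr ((real d - 1) / 2)) \<le> ennreal (c * v)"
    by (rule ennreal_leI)
  also have "\<dots> = ennreal c * ennreal v" using c by (intro ennreal_mult') auto
  also have "\<dots> \<le> of_nat (n choose d) * facet_int d (n - d)"
    using c fi by (intro mult_mono) (auto simp: ennreal_of_nat_eq_real_of_nat intro: ennreal_leI)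
  finally show ?thesis .
qed

subsection \<open>The asymptotics\<close>

theorem theorem11:
  fixes d :: "nat \<Rightarrow> nat"
    and M :: "nat \<Rightarrow> 'w measure"
    and X :: "nat \<Rightarrow> nat \<Rightarrow> 'w \<Rightarrow> (nat \<Rightarrow> real)"
  assumes "\<forall>\<^sub>F n in sequentially. d n \<in> {2..n - 1}"
    and "(\<exists>c. \<forall>\<^sub>F n in sequentially. d n = c) \<or> filterlim d at_top sequentially"
    and "\<And>n. prob_space (M n)"
    and "\<And>n. prob_space.indep_vars (M n) (\<lambda>_. borel) (X n) {1..n}"
    and "\<And>n i. i \<in> {1..n} \<Longrightarrow> distr (M n) borel (X n i) = uniform_sphere (d n)"
    and "(\<lambda>n. ln (real n) / real (d n)) \<longlonglongrightarrow> 0"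
    and "(\<lambda>n. real (d n) / real n) \<longlonglongrightarrow> 0"
  shows "\<exists>\<epsilon> :: nat \<Rightarrow> real. \<epsilon> \<longlonglongrightarrow> 0 \<and>
    (\<forall>\<^sub>F n in sequentially.
      expected_facets n (d n) (M n) (X n) =
        ((4 * pi + \<epsilon> n) * ln (real n / real (d n))) powr ((real (d n) - 1) / 2))"
proof -
  define D where "D n = real (d n)" for n
  define L where "L n = ln (real n / D n)" for n
  define E where "E n = expected_facets n (d n) (M n) (X n)" for n
  have E0: "E n \<ge> 0" for n unfolding E_def expected_facets_def by (rule integral_nonneg_AE) simp
  have ev2: "\<forall>\<^sub>F n in sequentially. 2 \<le> d n \<and> d n < n"
    using assms(1) eventually_gt_at_top[of 0] by eventually_elim auto
  have growth: "\<forall>\<^sub>F n in sequentially. K * ln (real n) \<le> D n" if K: "K > 0" for K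
  proof -
    have "\<forall>\<^sub>F n in sequentially. ln (real n) / D n < 1 / K"
      using assms(6) K unfolding D_def by (intro order_tendstoD(2)) auto
    with ev2 show ?thesis
    proof eventually_elim
      case (elim n)
      then have "D n > 0" unfolding D_def by simp
      then show ?case using elim K by (simp add: field_simps)
    qed
  qed
  \<comment> \<open>Eventually \<open>ln n\<close> is at most the dimension, so the dimension tends
    to infinity.\<close>
  have D_top: "filterlim D at_top sequentially"
  proof (rule filterlim_at_top_mono[OF _ growth[of 1]])
    show "filterlim (\<lambda>n. 1 * ln (real n)) at_top sequentially" by real_asymp
  qed simp
  have L_top: "filterlim L at_top sequentially"
  proof -
    have "\<forall>\<^sub>F n in sequentially. 0 < D n / real n" using ev2 by eventually_elim (auto simp: D_def)
    then have "filterlim (\<lambda>n. inverse (D n / real n)) at_top sequentially"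
      using assms(7) unfolding D_def by (intro filterlim_inverse_at_top)
    then have "filterlim (\<lambda>n. real n / D n) at_top sequentially" by simp
    then show ?thesis unfolding L_def by (rule filterlim_compose[OF ln_at_top])
  qed
  have LD: "(\<lambda>n. L n / D n) \<longlonglongrightarrow> 0"
  proof (rule tendsto_sandwich[OF _ _ tendsto_const])
    show "(\<lambda>n. ln (real n) / D n) \<longlonglongrightarrow> 0" using assms(6) unfolding D_def .
    show "\<forall>\<^sub>F n in sequentially. 0 \<le> L n / D n"
      using ev2 by eventually_elim (auto simp: L_def D_def)
    show "\<forall>\<^sub>F n in sequentially. L n / D n \<le> ln (real n) / D n"
      using ev2 by eventually_elim (auto simp: L_def D_def ln_div divide_right_mono)
  qed
  have D3: "\<forall>\<^sub>F n in sequentially. 3 \<le> D n" using D_top by (simp add: filterlim_at_top)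
  have base: "\<forall>\<^sub>F n in sequentially. 3 \<le> d n \<and> d n < n" using ev2 D3 by eventually_elim (simp add: D_def)
  have ratio: "\<forall>\<^sub>F n in sequentially. real n \<le> (1 + \<delta>) * (real n - D n)" if \<delta>: "\<delta> > 0" for \<delta>
  proof -
    have "\<forall>\<^sub>F n in sequentially. D n / real n < \<delta> / (1 + \<delta>)"
      using assms(7) \<delta> unfolding D_def by (intro order_tendstoD(2)) auto
    with base show ?thesis
      by eventually_elim (use \<delta> in \<open>simp add: field_simps\<close>)
  qed
  note evD = eventually_compose_filterlim[OF _ D_top] and evL = eventually_compose_filterlim[OF _ L_top]
  have upper: "\<forall>\<^sub>F n in sequentially. E n \<le> (4 * pi * ((1 + 2 * \<delta>) * (1 + \<delta>) / (1 - \<delta>)\<^sup>2 * (1 + \<delta>) ^ 3) * L n) powr ((D n - 1) / 2)"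
    if \<delta>: "0 < \<delta>" "\<delta> < 1" for \<delta>
  proof -
    have h1: "\<forall>\<^sub>F n in sequentially. \<delta> * L n \<ge> 2" by (rule evL) (use \<delta> in real_asymp)
    have h4: "\<forall>\<^sub>F n in sequentially. exp (- (\<delta> * L n / 2)) \<le> \<delta>" by (rule evL) (use \<delta> in real_asymp)
    have h2: "\<forall>\<^sub>F n in sequentially. ((D n - 1)\<^sup>2 / 2 - 1) * (1 + \<delta>) \<ge> (D n)\<^sup>2 / 2 * (1 + \<delta> / 2)"
      by (rule evD) (use \<delta> in real_asymp)
    have h5: "\<forall>\<^sub>F n in sequentially. (D n - 1)\<^sup>2 \<le> (1 + \<delta>) * (D n * (D n - 2))"
      by (rule evD) (use \<delta> in real_asymp)
    have "(\<lambda>n. 2 * (1 + 2 * \<delta>) * (L n / D n)) \<longlonglongrightarrow> 2 * (1 + 2 * \<delta>) * 0" by (intro tendsto_intros LD)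
    then have h3: "\<forall>\<^sub>F n in sequentially. 2 * (1 + 2 * \<delta>) * (L n / D n) < 1 / 2" by (rule order_tendstoD(2)) simp
    have l\<delta>: "ln (1 + \<delta>) > 0" using \<delta> by simp
    \<comment> \<open>The constant 8 makes \<open>(1 + \<delta>) powr ((D n - 1) / 2)\<close> at
      least \<open>n\<^sup>2\<close>, which is at least \<open>112 * n\<close> for
      \<open>n \<ge> 112\<close>.\<close>
    then have g: "\<forall>\<^sub>F n in sequentially. 8 / ln (1 + \<delta>) * ln (real n) \<le> D n" by (intro growth) simp
    have h7: "\<forall>\<^sub>F n in sequentially. 112 * real n \<le> (1 + \<delta>) powr ((D n - 1) / 2)"
      using base g eventually_ge_at_top[of 112]
    proof eventually_elim
      case (elim n)
      have "8 * ln (real n) \<le> D n * ln (1 + \<delta>)" using elim l\<delta> by (simp add: field_simps)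
      also have "\<dots> \<le> (2 * (D n - 1)) * ln (1 + \<delta>)"
        using elim l\<delta> unfolding D_def by (intro mult_right_mono) auto
      also have "\<dots> = 4 * ((D n - 1) / 2 * ln (1 + \<delta>))" by simp
      finally have "2 * ln (real n) \<le> (D n - 1) / 2 * ln (1 + \<delta>)" by linarith
      then have "exp (2 * ln (real n)) \<le> exp ((D n - 1) / 2 * ln (1 + \<delta>))" by (simp only: exp_le_cancel_iff)
      also have "\<dots> = (1 + \<delta>) powr ((D n - 1) / 2)" using \<delta> by (simp add: powr_def)
      also have "exp (2 * ln (real n)) = real n * real n" using elim unfolding mult_2 exp_add by simp
      finally have "real n * real n \<le> (1 + \<delta>) powr ((D n - 1) / 2)" .
      moreover have "112 * real n \<le> real n * real n" using elim by (intro mult_right_mono) auto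
      ultimately show ?case by linarith
    qed
    show ?thesis using base h1 h2 h3 h4 h5 h7 ratio[OF \<delta>(1)]
    proof eventually_elim
      case (elim n)
      have "ennreal (E n) \<le> of_nat (n choose d n) * (2 * facet_int (d n) (n - d n))"
        unfolding E_def using elim by (intro expected_facets_bounds(2) assms(3-5)) auto
      also have "\<dots> \<le> ennreal ((4 * pi * ((1 + 2 * \<delta>) * (1 + \<delta>) / (1 - \<delta>)\<^sup>2 * (1 + \<delta>) ^ 3) * L n) powr ((D n - 1) / 2))"
        unfolding L_def D_def using elim \<delta> unfolding L_def D_def by (intro facets_upper_fixed) auto
      finally show ?case by (subst (asm) ennreal_le_iff) auto
    qed
  qed
  have lower: "\<forall>\<^sub>F n in sequentially. (4 * pi * ((1 - \<delta>) * exp (- 4 * \<delta>)) * L n) powr ((D n - 1) / 2) \<le> E n"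
    if \<delta>: "0 < \<delta>" "\<delta> < 1" for \<delta>
  proof -
    have l1: "\<forall>\<^sub>F n in sequentially. sqrt (4 * pi * (1 - \<delta>) * L n) \<ge> 1" by (rule evL) (use \<delta> in real_asymp)
    have l2: "\<forall>\<^sub>F n in sequentially. ln (sqrt (4 * pi * (1 - \<delta>) * L n)) \<le> \<delta> / 4 * L n"
      by (rule evL) (use \<delta> in real_asymp)
    have l5: "\<forall>\<^sub>F n in sequentially. 64 * exp 1 * D n ^ 4 \<le> exp (\<delta> * (D n - 1))"
      by (rule evD) (use \<delta> in real_asymp)
    have "\<forall>\<^sub>F n in sequentially. L n / D n < \<delta> / 8" using LD \<delta> by (intro order_tendstoD(2)) auto
    with base have l3: "\<forall>\<^sub>F n in sequentially. 2 * L n / (D n - 1) \<le> \<delta> / 2"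
    proof eventually_elim
      case (elim n)
      have D: "D n \<ge> 3" using elim by (simp add: D_def)
      then have "L n \<le> \<delta> / 8 * D n" using elim by (simp add: pos_divide_less_eq less_imp_le)
      also have "\<dots> \<le> \<delta> / 8 * (2 * (D n - 1))" using D \<delta> by (intro mult_left_mono) auto
      also have "\<dots> = \<delta> / 2 * (D n - 1) / 2" by simp
      finally have "2 * L n \<le> \<delta> / 2 * (D n - 1)" by linarith
      moreover have "D n - 1 > 0" using D by simp
      ultimately show ?case by (simp only: pos_divide_le_eq)
    qed
    show ?thesis using base l1 l2 l3 l5 ratio[OF \<delta>(1)]
    proof eventually_elim
      case (elim n)
      have "ennreal ((4 * pi * ((1 - \<delta>) * exp (- 4 * \<delta>)) * L n) powr ((D n - 1) / 2)) \<le>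
          of_nat (n choose d n) * facet_int (d n) (n - d n)"
        unfolding L_def D_def using elim \<delta> unfolding L_def D_def by (intro facets_lower_fixed) auto
      also have "\<dots> \<le> ennreal (E n)"
        unfolding E_def using elim by (intro expected_facets_bounds(1) assms(3-5)) auto
      finally show ?case using E0 by (subst (asm) ennreal_le_iff) auto
    qed
  qed
  \<comment> \<open>The claimed equation solved for the error term, so that the convergence to 0 is
    the main thing to show.\<close>
  define \<epsilon> where "\<epsilon> n = E n powr (2 / (D n - 1)) / L n - 4 * pi" for n
  have L1: "\<forall>\<^sub>F n in sequentially. 1 \<le> L n" using L_top by (simp add: filterlim_at_top)
  have "\<epsilon> \<longlonglongrightarrow> 0"
  proof (rule tendstoI)
    fix e :: real assume e: "e > 0"
    define e' where "e' = e / (4 * pi)"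
    have e': "e' > 0" unfolding e'_def using e by simp
    \<comment> \<open>Both correction factors tend to 1 with \<delta> tending to 0, so a single
      \<delta> brings them within the relative error \<open>e'\<close>.\<close>
    have "((\<lambda>\<delta>. (1 + 2 * \<delta>) * (1 + \<delta>) / (1 - \<delta>)\<^sup>2 * (1 + \<delta>) ^ 3) \<longlongrightarrow> (1 :: real)) (at_right 0)" by real_asymp
    then have k1: "\<forall>\<^sub>F \<delta> in at_right 0. (1 + 2 * \<delta>) * (1 + \<delta>) / (1 - \<delta>)\<^sup>2 * (1 + \<delta>) ^ 3 < 1 + e'"
      by (rule order_tendstoD(2)) (use e' in simp)
    have "((\<lambda>\<delta>. (1 - \<delta>) * exp (- 4 * \<delta>)) \<longlongrightarrow> (1 :: real)) (at_right 0)" by real_asymp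
    then have k2: "\<forall>\<^sub>F \<delta> in at_right 0. 1 - e' < (1 - \<delta>) * exp (- 4 * \<delta>)"
      by (rule order_tendstoD(1)) (use e' in simp)
    have "\<forall>\<^sub>F \<delta> :: real in at_right 0. 0 < \<delta> \<and> \<delta> < 1" using eventually_at_right_real[of 0 1] by simp
    with k1 k2 have "\<forall>\<^sub>F \<delta> in at_right 0. (1 + 2 * \<delta>) * (1 + \<delta>) / (1 - \<delta>)\<^sup>2 * (1 + \<delta>) ^ 3 < 1 + e' \<and>
      1 - e' < (1 - \<delta>) * exp (- 4 * \<delta>) \<and> 0 < \<delta> \<and> \<delta> < 1" by eventually_elim simp
    then obtain \<delta> where \<delta>: "(1 + 2 * \<delta>) * (1 + \<delta>) / (1 - \<delta>)\<^sup>2 * (1 + \<delta>) ^ 3 < 1 + e'"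
      "1 - e' < (1 - \<delta>) * exp (- 4 * \<delta>)" "0 < \<delta>" "\<delta> < 1"
      using eventually_happens'[OF trivial_limit_at_right_real] by blast
    show "\<forall>\<^sub>F n in sequentially. dist (\<epsilon> n) 0 < e"
      using upper[OF \<delta>(3,4)] lower[OF \<delta>(3,4)] base L1
    proof eventually_elim
      case (elim n)
      let ?c = "(1 + 2 * \<delta>) * (1 + \<delta>) / (1 - \<delta>)\<^sup>2 * (1 + \<delta>) ^ 3" and ?b = "(1 - \<delta>) * exp (- 4 * \<delta>)"
      have D: "D n \<ge> 3" using elim by (simp add: D_def)
      have inv: "(u powr ((D n - 1) / 2)) powr (2 / (D n - 1)) = u" if "u \<ge> 0" for u
      proof -
        have "(D n - 1) / 2 * (2 / (D n - 1)) = 1" using D by simp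
        then show ?thesis using that by (simp only: powr_powr powr_one)
      qed
      have "E n powr (2 / (D n - 1)) \<le> ((4 * pi * ?c * L n) powr ((D n - 1) / 2)) powr (2 / (D n - 1))"
        using elim(1) E0 D by (intro powr_mono2) auto
      also have "\<dots> = 4 * pi * ?c * L n" using elim \<delta> by (intro inv) auto
      finally have u: "E n powr (2 / (D n - 1)) / L n \<le> 4 * pi * ?c" using elim by (simp add: pos_divide_le_eq)
      have "4 * pi * ?b * L n = ((4 * pi * ?b * L n) powr ((D n - 1) / 2)) powr (2 / (D n - 1))"
        using elim \<delta> by (intro inv[symmetric]) auto
      also have "\<dots> \<le> E n powr (2 / (D n - 1))"
        using elim(2) D by (intro powr_mono2) auto
      finally have l: "4 * pi * ?b \<le> E n powr (2 / (D n - 1)) / L n" using elim by (simp add: pos_le_divide_eq)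
      have e4: "4 * pi * (1 + e') = 4 * pi + e" "4 * pi * (1 - e') = 4 * pi - e"
        unfolding e'_def by (simp_all add: field_simps)
      have "4 * pi * ?c < 4 * pi + e" unfolding e4(1)[symmetric]
        by (rule mult_strict_left_mono[OF \<delta>(1)]) simp
      with u have u': "E n powr (2 / (D n - 1)) / L n < 4 * pi + e" by (rule le_less_trans)
      have "4 * pi - e < 4 * pi * ?b" unfolding e4(2)[symmetric]
        by (rule mult_strict_left_mono[OF \<delta>(2)]) simp
      then have "4 * pi - e < E n powr (2 / (D n - 1)) / L n" using l by (rule less_le_trans)
      with u' have "\<bar>\<epsilon> n\<bar> < e" unfolding \<epsilon>_def by (simp add: abs_less_iff)
      then show ?case by simp
    qed
  qed
  \<comment> \<open>The power is inverted exactly, which includes the case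
    \<open>E n = 0\<close>.\<close>
  moreover have "\<forall>\<^sub>F n in sequentially. E n = ((4 * pi + \<epsilon> n) * L n) powr ((D n - 1) / 2)"
    using base L1
  proof eventually_elim
    case (elim n)
    have "D n \<ge> 3" using elim by (simp add: D_def)
    moreover have "(4 * pi + \<epsilon> n) * L n = E n powr (2 / (D n - 1))" unfolding \<epsilon>_def using elim by simp
    moreover have "2 / (D n - 1) * ((D n - 1) / 2) = 1" using \<open>D n \<ge> 3\<close> by simp
    ultimately show ?case using E0[of n] by (simp only: powr_powr powr_one)
  qed
  ultimately show ?thesis unfolding E_def L_def D_def by blast
qed

end
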